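(* Let $1<k\le n/2$, $B=B_{k,n}$ and $v=\mathrm{lcm}(n,k)/k$. Every module in the stable category $\underline{\mathrm{CM}}(B)$ is $\tau$-periodic with period a factor of $2v$, where $\tau$ is the Auslander--Reiten translation of $\underline{\mathrm{CM}}(B)$.
   Context: The algebra $B=B_{k,n}$: take the quiver with vertex set $\mathbb{Z}_n$ and, for each $i\in\mathbb{Z}_n$, arrows $x_i\colon i-1\to i$ and $y_i\colon i\to i-1$. $B$ is the completed path algebra over $\mathbb{C}$ (completion with respect to the ideal generated by arrows) modulo the closure of the ideal generated by the relations $xy=yx$ and $x^k=y^{n-k}$ at every vertex (subscripts determined by the starting vertex). Its center is $Z=\mathbb{C}[[t]]$, $t=\sum_i x_iy_i$. $\mathrm{CM}(B)$ is the category of (left) $B$-modules that are finitely generated free over $Z$. It is a Frobenius category whose projective-injective objects are the projective $B$-modules, and $\underline{\mathrm{CM}}(B)$ is its stable category, triangulated with suspension the inverse of the syzygy functor $\Omega$. It is 2-Calabi--Yau, and $\tau^{-1}=\Omega$ on $\underline{\mathrm{CM}}(B)$. A module $M$ is $\tau$-periodic of period $d$ if $\tau^dM\cong M$ in $\underline{\mathrm{CM}}(B)$ with $d\geq 1$ minimal. *)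

theory Defs
  imports Complex_Main "HOL-Algebra.QuotRing" "HOL-Algebra.Module"
begin

section \<open>Left modules over a (not necessarily commutative) ring\<close>

text \<open>The locale \<^locale>\<open>module\<close> of HOL-Algebra requires a commutative ring of scalars. We reuse its
  record type only; the fields \<open>mult\<close> and \<open>one\<close> of a module record are never used.\<close>

locale left_module = R?: ring R + M?: abelian_group M
  for R :: "'r ring" (structure) and M :: "('r, 'm) module" (structure) +
  assumes smult_closed:
      "\<lbrakk>a \<in> carrier R; x \<in> carrier M\<rbrakk> \<Longrightarrow> a \<odot>\<^bsub>M\<^esub> x \<in> carrier M"
    and smult_l_distr:
      "\<lbrakk>a \<in> carrier R; b \<in> carrier R; x \<in> carrier M\<rbrakk> \<Longrightarrow>
        (a \<oplus>\<^bsub>R\<^esub> b) \<odot>\<^bsub>M\<^esub> x = a \<odot>\<^bsub>M\<^esub> x \<oplus>\<^bsub>M\<^esub> b \<odot>\<^bsub>M\<^esub> x"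
    and smult_r_distr:
      "\<lbrakk>a \<in> carrier R; x \<in> carrier M; y \<in> carrier M\<rbrakk> \<Longrightarrow>
        a \<odot>\<^bsub>M\<^esub> (x \<oplus>\<^bsub>M\<^esub> y) = a \<odot>\<^bsub>M\<^esub> x \<oplus>\<^bsub>M\<^esub> a \<odot>\<^bsub>M\<^esub> y"
    and smult_assoc:
      "\<lbrakk>a \<in> carrier R; b \<in> carrier R; x \<in> carrier M\<rbrakk> \<Longrightarrow>
        (a \<otimes>\<^bsub>R\<^esub> b) \<odot>\<^bsub>M\<^esub> x = a \<odot>\<^bsub>M\<^esub> (b \<odot>\<^bsub>M\<^esub> x)"
    and smult_one: "x \<in> carrier M \<Longrightarrow> \<one>\<^bsub>R\<^esub> \<odot>\<^bsub>M\<^esub> x = x"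

text \<open>Homomorphisms are extensional (\<^term>\<open>undefined\<close> off the carrier), so that equality of
  homomorphisms is equality in HOL.\<close>

definition Hom :: "'r ring \<Rightarrow> ('r, 'm) module \<Rightarrow> ('r, 'n) module \<Rightarrow> ('m \<Rightarrow> 'n) set" where
  "Hom R M N = {f \<in> carrier M \<rightarrow>\<^sub>E carrier N.
     (\<forall>x\<in>carrier M. \<forall>y\<in>carrier M. f (x \<oplus>\<^bsub>M\<^esub> y) = f x \<oplus>\<^bsub>N\<^esub> f y) \<and>
     (\<forall>r\<in>carrier R. \<forall>x\<in>carrier M. f (r \<odot>\<^bsub>M\<^esub> x) = r \<odot>\<^bsub>N\<^esub> f x)}"

definition hom_id :: "('r, 'm) module \<Rightarrow> 'm \<Rightarrow> 'm" where
  "hom_id M = (\<lambda>x\<in>carrier M. x)"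

definition hom_add :: "('r, 'm) module \<Rightarrow> ('r, 'n) module \<Rightarrow> ('m \<Rightarrow> 'n) \<Rightarrow> ('m \<Rightarrow> 'n) \<Rightarrow> 'm \<Rightarrow> 'n" where
  "hom_add M N f g = (\<lambda>x\<in>carrier M. f x \<oplus>\<^bsub>N\<^esub> g x)"

definition hom_diff :: "('r, 'm) module \<Rightarrow> ('r, 'n) module \<Rightarrow> ('m \<Rightarrow> 'n) \<Rightarrow> ('m \<Rightarrow> 'n) \<Rightarrow> 'm \<Rightarrow> 'n" where
  "hom_diff M N f g = (\<lambda>x\<in>carrier M. f x \<ominus>\<^bsub>N\<^esub> g x)"

definition hom_scale :: "('r, 'm) module \<Rightarrow> ('r, 'n) module \<Rightarrow> 'r \<Rightarrow> ('m \<Rightarrow> 'n) \<Rightarrow> 'm \<Rightarrow> 'n" where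
  "hom_scale M N r f = (\<lambda>x\<in>carrier M. r \<odot>\<^bsub>N\<^esub> f x)"

text \<open>HOL cannot quantify over the modules on all carrier types at once. Wherever a definition
  quantifies over modules, they are taken with carrier in the type \<open>nat \<Rightarrow> 'r\<close>. Up to isomorphism these
  include all finitely generated modules: \<open>R\<^sup>m\<close> lives on the functions supported on \<open>{..<m}\<close>, and a
  quotient of \<open>R\<^sup>m\<close> on a set of representatives.\<close>

type_synonym 'r fmodule = "('r, nat \<Rightarrow> 'r) module"

text \<open>The lifting property. For finitely generated \<open>P\<close> it is enough to test it on
  modules as above, since one may lift the identity of \<open>P\<close> along a surjection \<open>R\<^sup>m \<rightarrow> P\<close>.\<close>

definition projective :: "'r ring \<Rightarrow> ('r, 'p) module \<Rightarrow> bool" where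
  "projective R P \<longleftrightarrow> left_module R P \<and>
     (\<forall>(X :: 'r fmodule) (Y :: 'r fmodule). \<forall>g\<in>Hom R X Y. \<forall>h\<in>Hom R P Y.
        left_module R X \<longrightarrow> left_module R Y \<longrightarrow> g ` carrier X = carrier Y \<longrightarrow>
        (\<exists>l\<in>Hom R P X. compose (carrier P) g l = h))"


section \<open>The Frobenius category CM(R) and its stable category\<close>

definition ring_center :: "'r ring \<Rightarrow> 'r set" where
  "ring_center R = {z \<in> carrier R. \<forall>r\<in>carrier R. z \<otimes>\<^bsub>R\<^esub> r = r \<otimes>\<^bsub>R\<^esub> z}"

text \<open>\<open>M\<close> has a finite basis \<open>e 0, \<dots>, e (m - 1)\<close> over the center.\<close>

definition free_over_center :: "'r ring \<Rightarrow> ('r, 'm) module \<Rightarrow> bool" where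
  "free_over_center R M \<longleftrightarrow> (\<exists>(m::nat) e. e \<in> {..<m} \<rightarrow> carrier M \<and>
     (\<forall>x\<in>carrier M. \<exists>!a. a \<in> {..<m} \<rightarrow>\<^sub>E ring_center R \<and>
        x = (\<Oplus>\<^bsub>M\<^esub>i\<in>{..<m}. a i \<odot>\<^bsub>M\<^esub> e i)))"

definition CM :: "'r ring \<Rightarrow> ('r, 'm) module set" where
  "CM R = {M. left_module R M \<and> free_over_center R M}"

text \<open>The morphisms that become zero in the stable category: those factoring through a
  projective-injective object of CM, i.e. through a projective module in CM.\<close>

definition stably_zero :: "'r ring \<Rightarrow> ('r, 'm) module \<Rightarrow> ('r, 'n) module \<Rightarrow> ('m \<Rightarrow> 'n) set" where
  "stably_zero R M N = {f. \<exists>P :: 'r fmodule. P \<in> CM R \<and> projective R P \<and>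
     (\<exists>g\<in>Hom R M P. \<exists>h\<in>Hom R P N. f = compose (carrier M) h g)}"

definition stably_iso :: "'r ring \<Rightarrow> ('r, 'm) module \<Rightarrow> ('r, 'n) module \<Rightarrow> bool" where
  "stably_iso R M N \<longleftrightarrow> (\<exists>f\<in>Hom R M N. \<exists>g\<in>Hom R N M.
     hom_diff M M (compose (carrier M) g f) (hom_id M) \<in> stably_zero R M M \<and>
     hom_diff N N (compose (carrier N) f g) (hom_id N) \<in> stably_zero R N N)"

text \<open>\<open>K \<cong> \<Omega>M\<close>: there is an exact sequence \<open>0 \<rightarrow> K \<rightarrow> P \<rightarrow> M \<rightarrow> 0\<close> in CM with \<open>P\<close> projective.\<close>

definition is_syzygy :: "'r ring \<Rightarrow> ('r, 'm) module \<Rightarrow> 'r fmodule \<Rightarrow> bool" where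
  "is_syzygy R M K \<longleftrightarrow> K \<in> CM R \<and>
     (\<exists>P :: 'r fmodule. P \<in> CM R \<and> projective R P \<and>
       (\<exists>f\<in>Hom R K P. \<exists>g\<in>Hom R P M.
          inj_on f (carrier K) \<and> g ` carrier P = carrier M \<and>
          f ` carrier K = {p \<in> carrier P. g p = \<zero>\<^bsub>M\<^esub>}))"


section \<open>Serre functor and Auslander--Reiten translation\<close>

text \<open>In this section \<open>R\<close> is a \<open>\<complex>\<close>-algebra with structure map \<open>\<iota> :: complex \<Rightarrow> 'r\<close>.\<close>

text \<open>The \<open>\<complex>\<close>-dual of the stable morphism space from \<open>M\<close> to \<open>N\<close>, as the space of linear forms on
  \<open>Hom R M N\<close> that vanish on \<open>stably_zero R M N\<close>.\<close>

definition stable_dual ::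
  "'r ring \<Rightarrow> (complex \<Rightarrow> 'r) \<Rightarrow> ('r, 'm) module \<Rightarrow> ('r, 'n) module \<Rightarrow> (('m \<Rightarrow> 'n) \<Rightarrow> complex) set" where
  "stable_dual R \<iota> M N = {\<phi>.
     (\<forall>f\<in>Hom R M N. \<forall>g\<in>Hom R M N. \<phi> (hom_add M N f g) = \<phi> f + \<phi> g) \<and>
     (\<forall>c. \<forall>f\<in>Hom R M N. \<phi> (hom_scale M N (\<iota> c) f) = c * \<phi> f) \<and>
     (\<forall>f\<in>stably_zero R M N. \<phi> f = 0)}"

text \<open>\<open>S \<cong> \<S>M\<close> for a Serre functor \<open>\<S>\<close> of the stable category: there are \<open>\<complex>\<close>-linear isomorphisms
  \<open>\<eta> Y\<close>, natural in \<open>Y\<close>, from the stable morphisms \<open>Y \<rightarrow> S\<close> to the dual of the stable morphisms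
  \<open>M \<rightarrow> Y\<close>. By the Yoneda lemma this determines \<open>S\<close> up to stable isomorphism.\<close>

definition is_serre ::
  "'r ring \<Rightarrow> (complex \<Rightarrow> 'r) \<Rightarrow> ('r, 'm) module \<Rightarrow> 'r fmodule \<Rightarrow> bool" where
  "is_serre R \<iota> M S \<longleftrightarrow> S \<in> CM R \<and>
     (\<exists>\<eta> :: 'r fmodule \<Rightarrow> ((nat \<Rightarrow> 'r) \<Rightarrow> (nat \<Rightarrow> 'r)) \<Rightarrow> ('m \<Rightarrow> (nat \<Rightarrow> 'r)) \<Rightarrow> complex.
        (\<forall>Y\<in>CM R.
           (\<forall>g\<in>Hom R Y S. \<eta> Y g \<in> stable_dual R \<iota> M Y) \<and>
           (\<forall>g\<in>Hom R Y S. \<forall>g'\<in>Hom R Y S. \<forall>f\<in>Hom R M Y.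
              \<eta> Y (hom_add Y S g g') f = \<eta> Y g f + \<eta> Y g' f) \<and>
           (\<forall>c. \<forall>g\<in>Hom R Y S. \<forall>f\<in>Hom R M Y.
              \<eta> Y (hom_scale Y S (\<iota> c) g) f = c * \<eta> Y g f) \<and>
           (\<forall>g\<in>Hom R Y S. (\<forall>f\<in>Hom R M Y. \<eta> Y g f = 0) \<longleftrightarrow> g \<in> stably_zero R Y S) \<and>
           (\<forall>\<phi>\<in>stable_dual R \<iota> M Y. \<exists>g\<in>Hom R Y S. \<forall>f\<in>Hom R M Y. \<eta> Y g f = \<phi> f)) \<and>
        (\<forall>Y\<in>CM R. \<forall>Y'\<in>CM R. \<forall>h\<in>Hom R Y Y'. \<forall>g\<in>Hom R Y' S. \<forall>f\<in>Hom R M Y.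
           \<eta> Y (compose (carrier Y) g h) f = \<eta> Y' g (compose (carrier M) h f)))"

text \<open>\<open>N \<cong> \<tau>M\<close>, where \<open>\<tau> = \<S> \<circ> \<Sigma>\<^sup>-\<^sup>1\<close> is the Auslander--Reiten translation of the triangulated stable
  category, whose suspension \<open>\<Sigma>\<close> is inverse to \<open>\<Omega>\<close>.\<close>

definition is_tau ::
  "'r ring \<Rightarrow> (complex \<Rightarrow> 'r) \<Rightarrow> ('r, 'm) module \<Rightarrow> 'r fmodule \<Rightarrow> bool" where
  "is_tau R \<iota> M N \<longleftrightarrow> (\<exists>K. is_syzygy R M K \<and> is_serre R \<iota> K N)"

text \<open>\<open>N \<cong> \<tau>\<^sup>dM\<close>. The step \<open>d = 0\<close> allows \<open>M\<close> to have an arbitrary carrier type.\<close>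

primrec is_tau_pow ::
  "'r ring \<Rightarrow> (complex \<Rightarrow> 'r) \<Rightarrow> ('r, 'm) module \<Rightarrow> nat \<Rightarrow> 'r fmodule \<Rightarrow> bool" where
  "is_tau_pow R \<iota> M 0 N \<longleftrightarrow> N \<in> CM R \<and> stably_iso R M N"
| "is_tau_pow R \<iota> M (Suc d) N \<longleftrightarrow> (\<exists>L. is_tau_pow R \<iota> M d L \<and> is_tau R \<iota> L N)"

definition tau_pow_fixes ::
  "'r ring \<Rightarrow> (complex \<Rightarrow> 'r) \<Rightarrow> ('r, 'm) module \<Rightarrow> nat \<Rightarrow> bool" where
  "tau_pow_fixes R \<iota> M d \<longleftrightarrow> (\<exists>N. is_tau_pow R \<iota> M d N \<and> stably_iso R N M)"

definition tau_periodic ::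
  "'r ring \<Rightarrow> (complex \<Rightarrow> 'r) \<Rightarrow> ('r, 'm) module \<Rightarrow> nat \<Rightarrow> bool" where
  "tau_periodic R \<iota> M d \<longleftrightarrow>
     1 \<le> d \<and> tau_pow_fixes R \<iota> M d \<and> (\<forall>d'. 1 \<le> d' \<and> d' < d \<longrightarrow> \<not> tau_pow_fixes R \<iota> M d')"


section \<open>The algebra \<open>B\<^sub>k\<^sub>,\<^sub>n\<close>\<close>

text \<open>Vertices are the residues \<open>0, \<dots>, n - 1\<close>; \<open>XArr i\<close> is \<open>x\<^sub>i : i - 1 \<rightarrow> i\<close> and \<open>YArr i\<close> is
  \<open>y\<^sub>i : i \<rightarrow> i - 1\<close>.\<close>

datatype arrow = XArr int | YArr int

definition vertices :: "nat \<Rightarrow> int set" where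
  "vertices n = {0..<int n}"

definition arrows :: "nat \<Rightarrow> arrow set" where
  "arrows n = XArr ` vertices n \<union> YArr ` vertices n"

fun arrow_source :: "nat \<Rightarrow> arrow \<Rightarrow> int" where
  "arrow_source n (XArr i) = (i - 1) mod int n"
| "arrow_source n (YArr i) = i"

fun arrow_target :: "nat \<Rightarrow> arrow \<Rightarrow> int" where
  "arrow_target n (XArr i) = i"
| "arrow_target n (YArr i) = (i - 1) mod int n"

text \<open>A path is its starting vertex with the list of its arrows in the order of traversal.\<close>

type_synonym path = "int \<times> arrow list"

fun is_walk :: "nat \<Rightarrow> int \<Rightarrow> arrow list \<Rightarrow> bool" where
  "is_walk n s [] \<longleftrightarrow> s \<in> vertices n"
| "is_walk n s (a # as) \<longleftrightarrow> a \<in> arrows n \<and> arrow_source n a = s \<and> is_walk n (arrow_target n a) as"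

fun walk_end :: "nat \<Rightarrow> int \<Rightarrow> arrow list \<Rightarrow> int" where
  "walk_end n s [] = s"
| "walk_end n s (a # as) = walk_end n (arrow_target n a) as"

text \<open>The path algebra completed at the arrow ideal: since there are finitely many paths of each
  length, its elements are all the formal infinite linear combinations of paths. The product
  \<open>p q\<close> of paths is \<open>q\<close> followed by \<open>p\<close>, so that left modules are representations of the quiver.\<close>

definition completed_path_algebra :: "nat \<Rightarrow> (path \<Rightarrow> complex) ring" where
  "completed_path_algebra n = \<lparr>
     carrier = {f. \<forall>s as. \<not> is_walk n s as \<longrightarrow> f (s, as) = 0},
     mult = (\<lambda>f g (s, as). \<Sum>j\<le>length as. f (walk_end n s (take j as), drop j as) * g (s, take j as)),
     one = (\<lambda>(s, as). if s \<in> vertices n \<and> as = [] then 1 else 0),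
     zero = (\<lambda>_. 0),
     add = (\<lambda>f g p. f p + g p)\<rparr>"

definition vertex_idem :: "int \<Rightarrow> path \<Rightarrow> complex" where
  "vertex_idem i = (\<lambda>p. if p = (i, []) then 1 else 0)"

text \<open>\<open>x = \<Sum>\<^sub>i x\<^sub>i\<close> and \<open>y = \<Sum>\<^sub>i y\<^sub>i\<close>.\<close>

definition x_elt :: "nat \<Rightarrow> path \<Rightarrow> complex" where
  "x_elt n = (\<lambda>p. if \<exists>i\<in>vertices n. p = (arrow_source n (XArr i), [XArr i]) then 1 else 0)"

definition y_elt :: "nat \<Rightarrow> path \<Rightarrow> complex" where
  "y_elt n = (\<lambda>p. if \<exists>i\<in>vertices n. p = (arrow_source n (YArr i), [YArr i]) then 1 else 0)"

text \<open>The relations \<open>xy = yx\<close> and \<open>x\<^sup>k = y\<^sup>n\<^sup>-\<^sup>k\<close> at every vertex; multiplication by the idempotent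
  \<open>e\<^sub>i\<close> on the right selects the paths that start at \<open>i\<close>.\<close>

definition B_relations :: "nat \<Rightarrow> nat \<Rightarrow> (path \<Rightarrow> complex) set" where
  "B_relations k n =
    (let A = completed_path_algebra n; x = x_elt n; y = y_elt n in
      (\<Union>i\<in>vertices n.
        {(x \<otimes>\<^bsub>A\<^esub> y \<ominus>\<^bsub>A\<^esub> y \<otimes>\<^bsub>A\<^esub> x) \<otimes>\<^bsub>A\<^esub> vertex_idem i,
         (x [^]\<^bsub>A\<^esub> k \<ominus>\<^bsub>A\<^esub> y [^]\<^bsub>A\<^esub> (n - k)) \<otimes>\<^bsub>A\<^esub> vertex_idem i}))"

text \<open>Closure in the topology of the completion, whose basic neighbourhoods of \<open>0\<close> consist of the
  combinations of paths of length at least \<open>N\<close>.\<close>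

definition adic_closure :: "nat \<Rightarrow> (path \<Rightarrow> complex) set \<Rightarrow> (path \<Rightarrow> complex) set" where
  "adic_closure n I = {f \<in> carrier (completed_path_algebra n).
     \<forall>N. \<exists>g\<in>I. \<forall>s as. length as < N \<longrightarrow> f (s, as) = g (s, as)}"

definition B_ideal :: "nat \<Rightarrow> nat \<Rightarrow> (path \<Rightarrow> complex) set" where
  "B_ideal k n = adic_closure n (Idl\<^bsub>completed_path_algebra n\<^esub> (B_relations k n))"

definition B_algebra :: "nat \<Rightarrow> nat \<Rightarrow> (path \<Rightarrow> complex) set ring" where
  "B_algebra k n = completed_path_algebra n Quot B_ideal k n"

text \<open>The structure map \<open>c \<mapsto> c \<cdot> 1\<close> of the \<open>\<complex>\<close>-algebra.\<close>

definition B_scalar :: "nat \<Rightarrow> nat \<Rightarrow> complex \<Rightarrow> (path \<Rightarrow> complex) set" where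
  "B_scalar k n c =
     B_ideal k n +>\<^bsub>completed_path_algebra n\<^esub> (\<lambda>p. c * \<one>\<^bsub>completed_path_algebra n\<^esub> p)"

end

theory Submission
  imports Defs "HOL-Computational_Algebra.Formal_Power_Series"
begin

text \<open>\<open>B\<close> is the order of all \<open>n \<times> n\<close> matrices over \<open>\<complex>[[t]]\<close> whose entry at \<open>(i, j)\<close> is divisible by
  \<open>t\<^sup>m\<close>, \<open>m\<close> the least cost of a walk from \<open>j\<close> to \<open>i\<close>. Conjugation by \<open>x\<close> gives an automorphism \<open>\<sigma>\<close> of
  \<open>B\<close> that moves every vertex by one step, hence \<open>\<sigma>\<^sup>n = 1\<close>. Write \<open>M(a)\<close> for \<open>M\<close> with the action
  twisted by \<open>\<sigma>\<^sup>a\<close>. Two facts about the twists give the theorem. First, \<open>M(k)\<close> represents the dual of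
  stable morphisms out of \<open>M\<close>: the walk \<open>x\<^sup>k = y\<^sup>n\<^sup>-\<^sup>k\<close> out of \<open>j\<close> passes, in one of its two forms,
  through every vertex, so that taking a coefficient of a trace is a perfect pairing. Secondly, over the subalgebra \<open>A\<close>
  generated by \<open>y\<close> and the idempotents every module is projective, \<open>B = A[x] / (x\<^sup>k - y\<^sup>n\<^sup>-\<^sup>k)\<close>, and the
  factorisation of \<open>X\<^sup>k - x\<^sup>k\<close> by \<open>X - x\<close> resolves \<open>M\<close> through \<open>B \<otimes>\<^sub>A M\<close> and identifies
  \<open>\<Omega>\<^sup>2 M\<close> with \<open>M(-k)\<close>. Together \<open>\<tau>\<^sup>2 M\<close> is \<open>M(k)\<close>, and \<open>n\<close> divides
  \<open>v k = lcm(n, k)\<close>.\<close>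

text \<open>Give \<open>x\<close> the weight \<open>n - k\<close> and \<open>y\<close> the weight
  \<open>k\<close>: both relations become homogeneous, and \<open>x y\<close> has weight
  \<open>n\<close>, the weight of \<open>t\<close>. Costs are weights divided by \<open>n\<close>,
  made integral by the coboundary of a potential; so a path is determined modulo the relations by
  its ends and its cost. The unit costs are placed so that vertex 0 is reached for free from
  everywhere.

  Syzygies and Serre duals are relations that fix their values only up to stable isomorphism. Both
  must be shown to respect stable isomorphism before the exponents \<open>d\<close> with
  \<open>\<tau>^d M\<close> isomorphic to \<open>M\<close> are closed under subtraction, so that the
  least one divides \<open>2 v\<close>. As \<open>\<tau>\<close> is a syzygy followed by the twist
  by \<open>k\<close>, \<open>\<tau>^2 M\<close> is \<open>\<Omega>^2 M\<close> twisted by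
  \<open>2 k\<close>; the resolution takes one \<open>k\<close> away.

  No limits are formed in modules: approximation happens in the coefficients of power series, and a
  map commuting with the generators commutes with all power series because its target contains no
  nonzero element divisible by all powers of \<open>t\<close>.\<close>

abbreviation (input) smult_in ("(_ \<odot>\<^sub>_ _)" [70, 1000, 71] 70) where "r \<odot>\<^sub>M m \<equiv> module.smult M r m"
abbreviation (input) add_in ("(_ \<oplus>\<^sub>_ _)" [65, 1000, 66] 65) where "a \<oplus>\<^sub>M b \<equiv> ring.add M a b"
abbreviation (input) zero_in ("\<zero>\<^sub>_" [1000] 1000) where "\<zero>\<^sub>M \<equiv> ring.zero M"

section \<open>Walks and their costs\<close>

text \<open>A walk is encoded by a word, \<open>True\<close> for \<open>x\<close> and \<open>False\<close> for \<open>y\<close>. Its cost is the power of \<open>t\<close> by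
  which it acts when every vertex space is embedded in one \<open>\<complex>[[t]]\<close>-module.\<close>

definition stp :: "nat \<Rightarrow> bool \<Rightarrow> nat \<Rightarrow> nat" where
  "stp n b j = (if b then (j + 1) mod n else (j + (n - 1)) mod n)"

text \<open>\<open>x\<close> costs 1 on the \<open>n - k\<close> arrows leaving
  \<open>0, ..., n - k - 1\<close>, and \<open>y\<close> costs 1 exactly on the reverses of the free
  arrows \<open>x\<close>. With this placement every vertex reaches 0 at cost 0
  (\<open>C_0\<close>).\<close>

definition scost :: "nat \<Rightarrow> nat \<Rightarrow> bool \<Rightarrow> nat \<Rightarrow> nat" where
  "scost n k b j = (if b then (if j < n - k then 1 else 0) else (if 1 \<le> j \<and> j \<le> n - k then 0 else 1))"

primrec wend :: "nat \<Rightarrow> bool list \<Rightarrow> nat \<Rightarrow> nat" where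
  "wend n [] j = j"
| "wend n (b # w) j = wend n w (stp n b j)"

primrec wcost :: "nat \<Rightarrow> nat \<Rightarrow> bool list \<Rightarrow> nat \<Rightarrow> nat" where
  "wcost n k [] j = 0"
| "wcost n k (b # w) j = scost n k b j + wcost n k w (stp n b j)"

text \<open>The potential whose coboundary turns the weights \<open>n - k\<close> of
  \<open>x\<close> and \<open>k\<close> of \<open>y\<close> into \<open>n\<close> times the costs:
  it rises by \<open>k\<close> where \<open>x\<close> costs 1 and falls by \<open>n - k\<close>
  where \<open>x\<close> is free.\<close>

definition pot :: "nat \<Rightarrow> nat \<Rightarrow> nat \<Rightarrow> nat" where
  "pot n k j = (if j \<le> n - k then k * j else (n - k) * (n - j))"

lemma wend_append [simp]: "wend n (v @ w) j = wend n w (wend n v j)"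
  by (induction v arbitrary: j) auto

lemma wcost_append [simp]: "wcost n k (v @ w) j = wcost n k v j + wcost n k w (wend n v j)"
  by (induction v arbitrary: j) auto

lemma stp_less: "0 < n ==> stp n b j < n"
  by (simp add: stp_def)

lemma wend_less: "j < n ==> wend n w j < n"
  by (induction w arbitrary: j) (auto simp: stp_less)

lemma stp_stp: "j < n ==> stp n b (stp n (\<not> b) j) = j"
  by (cases "j = 0"; cases "j + 1 = n") (auto simp: stp_def mod_if)

lemma stp_True: "j < n ==> stp n True j = (if j + 1 = n then 0 else j + 1)"
  by (auto simp: stp_def)

lemma stp_False: "j < n ==> stp n False j = (if j = 0 then n - 1 else j - 1)"
  by (auto simp: stp_def mod_if)

lemma scost_pot:
  assumes "j < n" "1 < k" "2 * k \<le> n"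
  shows "n * scost n k b j + pot n k j = (if b then n - k else k) + pot n k (stp n b j)"
proof -
  obtain m where m: "n = k + m" "k \<le> m" using assms by (metis add_leD1 le_add_diff_inverse mult_2 nat_add_left_cancel_le)
  have nk: "n - k = m" using m by simp
  have p1: "pot n k i = k * i" if "i \<le> m" for i using that nk by (simp add: pot_def)
  have p2: "pot n k i = m * (n - i)" if "m \<le> i" "i \<le> n" for i
    using that m nk by (cases "i = m") (simp_all add: pot_def)
  have nn: "n * c = k * c + m * c" for c by (simp add: m(1) algebra_simps)
  \<comment> \<open>The two linear pieces of \<open>pot\<close>, which meet at
    \<open>m = n - k\<close>, and the passage between \<open>n - 1\<close> and 0 have to be
    separated.\<close>
  consider "b" "j < m" | "b" "m \<le> j" "j + 1 < n" | "b" "j + 1 = n"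
    | "\<not> b" "j = 0" | "\<not> b" "1 \<le> j" "j \<le> m" | "\<not> b" "m < j" using assms(1) by linarith
  then show ?thesis
  proof cases
    case 1
    have "scost n k b j = 1" "stp n b j = j + 1" using 1 nk m assms by (simp_all add: scost_def stp_True)
    then show ?thesis using 1 p1[of j] p1[of "j + 1"] nk nn[of 1] by simp
  next
    case 2
    obtain d where d: "n = j + 1 + d" using 2(3) by (metis less_imp_add_positive)
    have "scost n k b j = 0" "stp n b j = j + 1" using 2 nk m assms by (simp_all add: scost_def stp_True)
    moreover have "pot n k j = m * (d + 1)" "pot n k (j + 1) = m * d" using 2 p2[of j] p2[of "j + 1"] d by simp_all
    ultimately show ?thesis using 2 nk by simp
  next
    case 3
    have "m \<le> j" using 3 m assms by linarith
    then have "scost n k b j = 0" "stp n b j = 0" using 3 nk m assms by (simp_all add: scost_def stp_True)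
    moreover have "n - j = 1" using 3 by linarith
    ultimately show ?thesis using 3 p2[of j] p1[of 0] nk \<open>m \<le> j\<close> by simp
  next
    case 4
    have "scost n k b j = 1" "stp n b j = n - 1" using 4 nk m assms by (simp_all add: scost_def stp_False)
    moreover have "n - (n - 1) = 1" "m \<le> n - 1" using m assms by linarith+
    ultimately show ?thesis using 4 p1[of 0] p2[of "n - 1"] nk nn[of 1] by simp
  next
    case 5
    then obtain i where i: "j = Suc i" by (metis Suc_le_D One_nat_def)
    have "scost n k b j = 0" "stp n b j = i" using 5 nk m assms i by (simp_all add: scost_def stp_False)
    then show ?thesis using 5 i p1[of j] p1[of i] nk by simp
  next
    case 6
    then obtain i where i: "j = Suc i" "m \<le> i" by (cases j) auto
    have "scost n k b j = 1" "stp n b j = i" using 6 nk m assms i by (simp_all add: scost_def stp_False)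
    moreover have "n - i = (n - j) + 1" using i assms by linarith
    ultimately show ?thesis using 6 i assms p2[of j] p2[of i] nk nn[of 1] by simp
  qed
qed

text \<open>Telescoping of \<open>scost_pot\<close>: up to the potentials at the two ends, the cost
  depends only on the numbers of letters \<open>x\<close> and \<open>y\<close>.\<close>

lemma wcost_pot:
  assumes "j < n" "1 < k" "2 * k \<le> n"
  shows "n * wcost n k w j + pot n k j =
    (n - k) * count_list w True + k * count_list w False + pot n k (wend n w j)"
  using assms(1)
proof (induction w arbitrary: j)
  case (Cons b w)
  have "stp n b j < n" using stp_less Cons.prems by auto
  from Cons.IH[OF this] scost_pot[OF Cons.prems assms(2,3), of b]
  show ?case by (cases b) (auto simp: algebra_simps)
qed auto

lemma wend_count:
  assumes "j < n"
  shows "int (wend n w j) = (int j + int (count_list w True) - int (count_list w False)) mod int n"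
  using assms
proof (induction w arbitrary: j)
  case (Cons b w)
  have s: "stp n b j < n" using stp_less Cons.prems by auto
  show ?case
  proof (cases b)
    case True
    have "int (stp n b j) = (int j + 1) mod int n" using True
      by (simp add: stp_def zmod_int add.commute)
    then show ?thesis using Cons.IH[OF s] True
      by (simp add: mod_simps algebra_simps) (metis (no_types, opaque_lifting) add.assoc add.commute mod_add_left_eq mod_diff_left_eq)
  next
    case False
    have "int (stp n b j) = (int j + (int n - 1)) mod int n" using False Cons.prems
      by (simp add: stp_def zmod_int of_nat_diff add_diff_eq)
    also have "... = (int j - 1) mod int n" using mod_add_self1[of "int n" "int j - 1"]
      by (simp add: algebra_simps)
    finally have "int (stp n b j) = (int j - 1) mod int n" .
    then show ?thesis using Cons.IH[OF s] False
      by (simp add: algebra_simps) (metis (no_types, opaque_lifting) add.assoc add.commute add_diff_eq diff_diff_eq mod_add_left_eq mod_diff_left_eq diff_add_eq)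
  qed
qed simp

lemma length_counts: "length w = count_list w True + count_list w False"
  by (induction w) auto

text \<open>Every letter has weight at least 1. Hence only finitely many walks from a vertex have a
  given cost, and the coefficients of matrix entries will be finite sums.\<close>

lemma length_le_wcost:
  assumes "j < n" "1 < k" "2 * k \<le> n"
  shows "length w \<le> n * wcost n k w j + pot n k j"
proof -
  have "length w \<le> (n - k) * count_list w True + k * count_list w False"
    using assms(2,3) by (auto simp: length_counts intro!: add_mono)
  then show ?thesis using wcost_pot[OF assms, of w] by linarith
qed

lemma finite_words_length: "finite {w :: bool list. length w \<le> N}"
  using finite_lists_length_le[of "UNIV :: bool set" N] by simp

definition wset :: "nat \<Rightarrow> nat \<Rightarrow> nat \<Rightarrow> nat \<Rightarrow> nat \<Rightarrow> bool list set" where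
  "wset n k i j m = {w. wend n w j = i \<and> wcost n k w j = m}"

lemma finite_wset: "j < n ==> 1 < k ==> 2 * k \<le> n ==> finite (wset n k i j m)"
  by (rule finite_subset[OF _ finite_words_length[of "n * m + pot n k j"]])
     (auto simp: wset_def intro: length_le_wcost)

text \<open>\<open>q\<close> counts the exchanges of \<open>x\<^sup>k\<close> and \<open>y\<^sup>n\<^sup>-\<^sup>k\<close>.\<close>

lemma wend_wcost_eq_iff:
  assumes "j < n" "1 < k" "2 * k \<le> n"
  shows "wend n w j = wend n w' j \<and> wcost n k w j = wcost n k w' j \<longleftrightarrow>
    (\<exists>q. int (count_list w True) = int (count_list w' True) + int k * q \<and>
         int (count_list w' False) = int (count_list w False) + int (n - k) * q)"
proof -
  define a b a' b' where abs: "a = int (count_list w True)" "b = int (count_list w False)"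
    "a' = int (count_list w' True)" "b' = int (count_list w' False)"
  have n0: "int n > 0" "int (n - k) = int n - int k" using assms by auto
  have e: "int (wend n w j) = (int j + a - b) mod int n" "int (wend n w' j) = (int j + a' - b') mod int n"
    using wend_count[OF assms(1)] by (auto simp: abs)
  have cw: "int n * int (wcost n k w j) + int (pot n k j) = (int n - int k) * a + int k * b + int (pot n k (wend n w j))"
    "int n * int (wcost n k w' j) + int (pot n k j) = (int n - int k) * a' + int k * b' + int (pot n k (wend n w' j))"
    using arg_cong[OF wcost_pot[OF assms, of w], of int] arg_cong[OF wcost_pot[OF assms, of w'], of int] n0 abs
    by simp_all
  show ?thesis
  proof
    assume *: "wend n w j = wend n w' j \<and> wcost n k w j = wcost n k w' j"
    then have "(int j + a - b) mod int n = (int j + a' - b') mod int n" using e by simp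
    then have "int n dvd (int j + a - b) - (int j + a' - b')" by (simp add: mod_eq_dvd_iff)
    \<comment> \<open>Equal ends give \<open>a - b\<close> only modulo \<open>n\<close>. The
      quotient \<open>q\<close> is the number of exchanges, and the equation between the weights
      then determines \<open>a\<close> itself.\<close>
    then obtain q where q: "a - b = a' - b' + int n * q"
      by (auto simp: dvd_def algebra_simps)
    have "(int n - int k) * a + int k * b = (int n - int k) * a' + int k * b'" using * cw by simp
    then have "int n * a - int k * (a - b) = int n * a' - int k * (a' - b')" by (simp add: algebra_simps)
    then have "int n * a = int n * (a' + int k * q)" unfolding q by (simp add: algebra_simps)
    then have a: "a = a' + int k * q" using n0 by simp
    then have "b' = b + (int n - int k) * q" using q by (simp add: algebra_simps)
    then show "\<exists>q. int (count_list w True) = int (count_list w' True) + int k * q \<and>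
         int (count_list w' False) = int (count_list w False) + int (n - k) * q"
      using a n0 abs by auto
  next
    assume "\<exists>q. int (count_list w True) = int (count_list w' True) + int k * q \<and>
         int (count_list w' False) = int (count_list w False) + int (n - k) * q"
    then obtain q where q: "a = a' + int k * q" "b' = b + (int n - int k) * q" using n0 abs by auto
    have "int j + a - b = int j + a' - b' + q * int n" using q by (simp add: algebra_simps)
    then have we: "wend n w j = wend n w' j" using e
      by (metis mod_mult_self1 of_nat_eq_iff)
    have "(int n - int k) * a + int k * b = (int n - int k) * a' + int k * b'"
      unfolding q by (simp add: algebra_simps)
    then have "int n * int (wcost n k w j) = int n * int (wcost n k w' j)"
      using cw unfolding we by linarith
    then show "wend n w j = wend n w' j \<and> wcost n k w j = wcost n k w' j" using n0 we by simp
  qed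
qed

text \<open>The words \<open>True # w\<close> and \<open>w @ [True]\<close> have the same letter
  counts, so \<open>q = 0\<close> works in the criterion. This is commutation of \<open>x\<close>
  with all walks on the level of costs, and the reason why conjugation by \<open>x\<close> preserves
  the order.\<close>

lemma wcost_shift:
  assumes "j < n" "1 < k" "2 * k \<le> n"
  shows "wend n w (stp n True j) = stp n True (wend n w j)"
    and "wcost n k w (stp n True j) + scost n k True j = wcost n k w j + scost n k True (wend n w j)"
proof -
  have "wend n (True # w) j = wend n (w @ [True]) j \<and> wcost n k (True # w) j = wcost n k (w @ [True]) j"
    by (subst wend_wcost_eq_iff[OF assms]) (auto intro!: exI[of _ 0])
  then show "wend n w (stp n True j) = stp n True (wend n w j)"
    and "wcost n k w (stp n True j) + scost n k True j = wcost n k w j + scost n k True (wend n w j)"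
    by auto
qed

section \<open>The path algebra as a matrix algebra\<close>

text \<open>\<open>x\<close> is indexed by its target and \<open>y\<close> by its source, hence the
  shift of the index in the first case only.\<close>

definition arr :: "nat \<Rightarrow> bool \<Rightarrow> nat \<Rightarrow> arrow" where
  "arr n b j = (if b then XArr (int ((j + 1) mod n)) else YArr (int j))"

primrec warr :: "nat \<Rightarrow> bool list \<Rightarrow> nat \<Rightarrow> arrow list" where
  "warr n [] j = []"
| "warr n (b # w) j = arr n b j # warr n w (stp n b j)"

lemma warr_append: "warr n (v @ w) j = warr n v j @ warr n w (wend n v j)"
  by (induction v arbitrary: j) auto

lemma length_warr [simp]: "length (warr n w j) = length w"
  by (induction w arbitrary: j) auto

lemma warr_inj: "warr n v j = warr n w j \<longleftrightarrow> v = w"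
proof (induction v arbitrary: j w)
  case Nil then show ?case by (cases w) auto
next
  case (Cons b v) then show ?case by (cases w) (auto simp: arr_def split: if_splits)
qed

lemma arr_facts:
  assumes "j < n"
  shows "arr n b j \<in> arrows n" "arrow_source n (arr n b j) = int j"
    "arrow_target n (arr n b j) = int (stp n b j)"
proof -
  have "(int j + int n - 1) mod int n = (int j - 1) mod int n"
    by (metis add.commute add_diff_eq mod_add_self1)
  then show "arr n b j \<in> arrows n" "arrow_source n (arr n b j) = int j"
    "arrow_target n (arr n b j) = int (stp n b j)"
    using assms by (auto simp: arr_def arrows_def vertices_def stp_def zmod_int of_nat_diff mod_simps
      algebra_simps intro!: imageI)
qed

lemma warr_walk:
  assumes "j < n"
  shows "is_walk n (int j) (warr n w j)" "walk_end n (int j) (warr n w j) = int (wend n w j)"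
  using assms
  by (induction w arbitrary: j) (auto simp: vertices_def arr_facts stp_less)

text \<open>Exactly one arrow of each kind leaves every vertex, so the walks from \<open>j\<close>
  correspond to the words.\<close>

lemma walk_warr:
  assumes "is_walk n s as"
  obtains j w where "j < n" "s = int j" "as = warr n w j"
proof -
  have s: "s \<in> vertices n" if "is_walk n s as" for s as
    using that by (cases as; cases "hd as") (auto simp: arrows_def vertices_def)
  have "\<exists>w. as = warr n w j" if "is_walk n (int j) as" "j < n" for j
    using that
  proof (induction as arbitrary: j)
    case Nil then show ?case by (intro exI[of _ "[]"]) auto
  next
    case (Cons a as)
    then have a: "a \<in> arrows n" "arrow_source n a = int j" "is_walk n (arrow_target n a) as" by auto
    have "\<exists>b. a = arr n b j"
    proof (cases a)
      case (XArr i)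
      then obtain i' where i': "i = int i'" "i' < n" using a(1) 
        by (intro that[of "nat i"]) (auto simp: arrows_def vertices_def)
      have "int ((j + 1) mod n) = (arrow_source n a + 1) mod int n" using a(2) by (simp add: zmod_int add.commute)
      also have "... = i mod int n" using XArr by (simp add: mod_simps)
      finally have "a = arr n True j" using XArr i' by (simp add: arr_def)
      then show ?thesis by blast
    next
      case (YArr i)
      then have "a = arr n False j" using a(2) by (simp add: arr_def)
      then show ?thesis by blast
    qed
    then obtain b where b: "a = arr n b j" by blast
    have "stp n b j < n" using Cons.prems stp_less by auto
    moreover have "is_walk n (int (stp n b j)) as" using a(3) b arr_facts(3)[OF Cons.prems(2)] by simp
    ultimately obtain w where "as = warr n w (stp n b j)" using Cons.IH by blast
    then show ?case using b by (intro exI[of _ "b # w"]) auto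
  qed
  moreover obtain j where "s = int j" "j < n" using s[OF assms]
    by (intro that[of "nat s"]) (auto simp: vertices_def)
  ultimately show ?thesis using assms that by blast
qed

section \<open>The completed path algebra is a ring\<close>

abbreviation (input) PA :: "nat \<Rightarrow> (path \<Rightarrow> complex) ring" where
  "PA n \<equiv> completed_path_algebra n"

lemma PA_mult: "(f \<otimes>\<^bsub>PA n\<^esub> g) (s, as) =
    (\<Sum>p\<le>length as. f (walk_end n s (take p as), drop p as) * g (s, take p as))"
  by (simp add: completed_path_algebra_def)

lemma PA_add: "(f \<oplus>\<^bsub>PA n\<^esub> g) p = f p + g p"
  by (simp add: completed_path_algebra_def)

lemma PA_zero: "\<zero>\<^bsub>PA n\<^esub> = (\<lambda>_. 0)"
  by (simp add: completed_path_algebra_def)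

lemma PA_one: "\<one>\<^bsub>PA n\<^esub> (s, as) = (if s \<in> vertices n \<and> as = [] then 1 else 0)"
  by (simp add: completed_path_algebra_def)

lemma PA_carrier: "f \<in> carrier (PA n) \<longleftrightarrow> (\<forall>s as. \<not> is_walk n s as \<longrightarrow> f (s, as) = 0)"
  by (simp add: completed_path_algebra_def)

lemma walk_end_append: "walk_end n s (as @ bs) = walk_end n (walk_end n s as) bs"
  by (induction as arbitrary: s) auto

lemma is_walk_append:
  "is_walk n s as ==> is_walk n (walk_end n s as) bs ==> is_walk n s (as @ bs)"
  by (induction as arbitrary: s) auto

lemma is_walk_source: "is_walk n s as ==> s \<in> vertices n"
  by (metis walk_warr vertices_def atLeastLessThan_iff of_nat_0_le_iff of_nat_less_iff)

lemma is_walk_end: "is_walk n s as ==> walk_end n s as \<in> vertices n"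
  by (induction as arbitrary: s) auto

text \<open>Both sides sum over the ways of cutting a path in three. The left one cuts off
  \<open>q\<close> arrows and then \<open>r\<close> more, the right one cuts at
  \<open>p = q + r\<close> first, so the identity is the reindexing of a triangle.\<close>

lemma PA_mult_assoc: "(f \<otimes>\<^bsub>PA n\<^esub> g) \<otimes>\<^bsub>PA n\<^esub> h = f \<otimes>\<^bsub>PA n\<^esub> (g \<otimes>\<^bsub>PA n\<^esub> h)"
proof (intro ext, clarify)
  fix s :: int and as :: "arrow list"
  define L where "L = length as"
  define F where "F q r = f (walk_end n s (take (q + r) as), drop (q + r) as) *
    g (walk_end n s (take q as), take r (drop q as)) * h (s, take q as)" for q r
  have "((f \<otimes>\<^bsub>PA n\<^esub> g) \<otimes>\<^bsub>PA n\<^esub> h) (s, as) = (\<Sum>q\<le>L. \<Sum>r\<le>L - q. F q r)"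
    unfolding PA_mult L_def F_def sum_distrib_right
    by (intro sum.cong refl)
       (auto simp: take_add walk_end_append add.commute intro!: arg_cong2[of _ _ _ _ "(*)"])
  also have "... = (\<Sum>(q, r)\<in>(SIGMA q:{..L}. {..L - q}). F q r)"
    by (simp add: sum.Sigma)
  also have "(SIGMA q:{..L}. {..L - q}) = {(q, r). q + r \<le> L}" by auto
  also have "(\<Sum>(q, r)\<in>{(q, r). q + r \<le> L}. F q r) = (\<Sum>p\<le>L. \<Sum>q\<le>p. F q (p - q))"
    by (rule sum.triangle_reindex_eq)
  also have "... = (f \<otimes>\<^bsub>PA n\<^esub> (g \<otimes>\<^bsub>PA n\<^esub> h)) (s, as)"
    unfolding PA_mult L_def F_def sum_distrib_left
    by (intro sum.cong refl) (auto simp: min_absorb2 drop_take mult.assoc)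
  finally show "((f \<otimes>\<^bsub>PA n\<^esub> g) \<otimes>\<^bsub>PA n\<^esub> h) (s, as) = (f \<otimes>\<^bsub>PA n\<^esub> (g \<otimes>\<^bsub>PA n\<^esub> h)) (s, as)" .
qed

lemma PA_ring: "ring (PA n)"
proof (rule ringI)
  show "abelian_group (PA n)"
  proof (rule abelian_groupI)
    fix f assume f: "f \<in> carrier (PA n)"
    show "\<exists>g\<in>carrier (PA n). g \<oplus>\<^bsub>PA n\<^esub> f = \<zero>\<^bsub>PA n\<^esub>"
      using f by (intro bexI[of _ "\<lambda>p. - f p"]) (auto simp: PA_carrier PA_add PA_zero)
  qed (auto simp: PA_carrier PA_add PA_zero fun_eq_iff)
  show "Group.monoid (PA n)"
  proof (rule monoidI)
    fix f g assume fg: "f \<in> carrier (PA n)" "g \<in> carrier (PA n)"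
    show "f \<otimes>\<^bsub>PA n\<^esub> g \<in> carrier (PA n)"
      unfolding PA_carrier PA_mult
    proof (intro allI impI sum.neutral ballI)
      fix s as p assume "\<not> is_walk n s as" "p \<in> {..length as}"
      then have "\<not> (is_walk n s (take p as) \<and> is_walk n (walk_end n s (take p as)) (drop p as))"
        using is_walk_append by fastforce
      then show "f (walk_end n s (take p as), drop p as) * g (s, take p as) = 0"
        using fg by (auto simp: PA_carrier)
    qed
  next
    fix f assume f: "f \<in> carrier (PA n)"
    show "\<one>\<^bsub>PA n\<^esub> \<otimes>\<^bsub>PA n\<^esub> f = f"
    proof (intro ext, clarify)
      fix s :: int and as :: "arrow list"
      have "(\<one>\<^bsub>PA n\<^esub> \<otimes>\<^bsub>PA n\<^esub> f) (s, as) =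
          (\<Sum>p\<in>{..length as}. if p = length as then (if walk_end n s as \<in> vertices n then f (s, as) else 0) else 0)"
        unfolding PA_mult PA_one by (intro sum.cong refl) auto
      also have "... = f (s, as)" using f by (cases "is_walk n s as") (auto simp: PA_carrier dest: is_walk_end)
      finally show "(\<one>\<^bsub>PA n\<^esub> \<otimes>\<^bsub>PA n\<^esub> f) (s, as) = f (s, as)" .
    qed
    show "f \<otimes>\<^bsub>PA n\<^esub> \<one>\<^bsub>PA n\<^esub> = f"
    proof (intro ext, clarify)
      fix s :: int and as :: "arrow list"
      have "(f \<otimes>\<^bsub>PA n\<^esub> \<one>\<^bsub>PA n\<^esub>) (s, as) =
          (\<Sum>p\<in>{..length as}. if p = 0 then (if s \<in> vertices n then f (s, as) else 0) else 0)"
        unfolding PA_mult PA_one by (intro sum.cong refl) auto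
      also have "... = f (s, as)" using f by (cases "is_walk n s as") (auto simp: PA_carrier dest: is_walk_source)
      finally show "(f \<otimes>\<^bsub>PA n\<^esub> \<one>\<^bsub>PA n\<^esub>) (s, as) = f (s, as)" .
    qed
  qed (auto simp: PA_carrier PA_one PA_mult_assoc)
qed (auto simp: fun_eq_iff PA_mult PA_add algebra_simps sum.distrib)

lemma PA_minus: "f \<in> carrier (PA n) ==> g \<in> carrier (PA n) ==> f \<ominus>\<^bsub>PA n\<^esub> g = (\<lambda>p. f p - g p)"
proof -
  interpret ring "PA n" by (rule PA_ring)
  assume f: "f \<in> carrier (PA n)" and g: "g \<in> carrier (PA n)"
  have "\<ominus>\<^bsub>PA n\<^esub> g = (\<lambda>p. - g p)"
    by (rule minus_equality) (use g in \<open>auto simp: PA_carrier PA_add PA_zero\<close>)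
  then show ?thesis by (simp add: a_minus_def PA_add fun_eq_iff)
qed

text \<open>The representation that sends a path from \<open>j\<close> to \<open>i\<close> of cost
  \<open>m\<close> to \<open>t^m\<close> times the matrix unit \<open>(i, j)\<close>. For genuine
  vertices each coefficient is a finite sum by \<open>finite_wset\<close>.\<close>

definition pmat :: "nat \<Rightarrow> nat \<Rightarrow> (path \<Rightarrow> complex) \<Rightarrow> nat \<Rightarrow> nat \<Rightarrow> complex fps" where
  "pmat n k f i j = Abs_fps (\<lambda>m. \<Sum>w\<in>wset n k i j m. f (int j, warr n w j))"

lemma pmat_nth: "fps_nth (pmat n k f i j) m = (\<Sum>w\<in>wset n k i j m. f (int j, warr n w j))"
  by (simp add: pmat_def)

lemma pmat_add: "pmat n k (f \<oplus>\<^bsub>PA n\<^esub> g) i j = pmat n k f i j + pmat n k g i j"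
  by (rule fps_ext) (simp add: pmat_nth PA_add sum.distrib)

lemma PA_mult_word:
  assumes "j < n"
  shows "(f \<otimes>\<^bsub>PA n\<^esub> g) (int j, warr n w j) =
    (\<Sum>(v, u)\<in>{(v, u). v @ u = w}. f (int (wend n v j), warr n u (wend n v j)) * g (int j, warr n v j))"
proof -
  have tk: "take p (warr n w j) = warr n (take p w) j" "drop p (warr n w j) = warr n (drop p w) (wend n (take p w) j)"
    if "p \<le> length w" for p
  proof -
    have "warr n w j = warr n (take p w) j @ warr n (drop p w) (wend n (take p w) j)"
      by (metis append_take_drop_id warr_append)
    moreover have "length (warr n (take p w) j) = p" using that by simp
    ultimately show "take p (warr n w j) = warr n (take p w) j" "drop p (warr n w j) = warr n (drop p w) (wend n (take p w) j)"
      by (metis append_eq_conv_conj)+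
  qed
  show ?thesis unfolding PA_mult length_warr
    by (rule sum.reindex_bij_witness[where i = "\<lambda>(v, u). length v" and j = "\<lambda>p. (take p w, drop p w)"])
       (auto simp: tk warr_walk assms)
qed

lemma finite_splits: "finite {(v, u). v @ u = (w :: bool list)}"
  by (rule finite_subset[of _ "{v. length v \<le> length w} \<times> {u. length u \<le> length w}"])
     (auto simp: finite_words_length)

lemma pmat_mult:
  assumes n: "j < n" "1 < k" "2 * k \<le> n"
  shows "pmat n k (f \<otimes>\<^bsub>PA n\<^esub> g) i j = (\<Sum>l<n. pmat n k f i l * pmat n k g l j)"
proof (rule fps_ext)
  fix m
  define F where "F = (\<lambda>(v, u). f (int (wend n v j), warr n u (wend n v j)) * g (int j, warr n v j))"
  define P where "P = {(v, u). v @ u \<in> wset n k i j m}"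
  have Pu: "P = snd ` (SIGMA w:wset n k i j m. {(v, u). v @ u = w})"
    by (force simp: P_def)
  have finP: "finite P" unfolding Pu using finite_wset[OF n] finite_splits
    by (intro finite_imageI finite_SigmaI) auto
  have "fps_nth (pmat n k (f \<otimes>\<^bsub>PA n\<^esub> g) i j) m = (\<Sum>w\<in>wset n k i j m. \<Sum>z\<in>{(v, u). v @ u = w}. F z)"
    unfolding pmat_nth PA_mult_word[OF n(1)] F_def ..
  also have "... = (\<Sum>(w, z)\<in>(SIGMA w:wset n k i j m. {(v, u). v @ u = w}). F z)"
    using finite_wset[OF n] finite_splits by (subst sum.Sigma) auto
  also have "... = sum F P"
    by (rule sum.reindex_bij_witness[where i = "\<lambda>(v, u). (v @ u, (v, u))" and j = snd]) (auto simp: P_def)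
  \<comment> \<open>The splittings are sorted by the middle vertex \<open>l\<close> and the cost
    \<open>a\<close> of the second part. Each fibre is a product of two sets \<open>wset\<close>,
    which gives the matrix product with Cauchy products as entries.\<close>
  also have "... = (\<Sum>y\<in>{..<n} \<times> {..m}. \<Sum>z\<in>{z \<in> P. (\<lambda>(v, u). (wend n v j, wcost n k u (wend n v j))) z = y}. F z)"
    using finP n(1) by (intro sum.group[symmetric]) (auto simp: P_def wset_def wend_less)
  also have "... = (\<Sum>(l, a)\<in>{..<n} \<times> {..m}. fps_nth (pmat n k f i l) a * fps_nth (pmat n k g l j) (m - a))"
  proof (intro sum.cong refl, clarify)
    fix l a assume "l < n" "a \<le> m"
    have "{z \<in> P. (\<lambda>(v, u). (wend n v j, wcost n k u (wend n v j))) z = (l, a)} =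
        wset n k l j (m - a) \<times> wset n k i l a"
      using \<open>a \<le> m\<close> by (auto simp: P_def wset_def)
    then have "(\<Sum>z\<in>{z \<in> P. (\<lambda>(v, u). (wend n v j, wcost n k u (wend n v j))) z = (l, a)}. F z) =
        (\<Sum>v\<in>wset n k l j (m - a). \<Sum>u\<in>wset n k i l a. F (v, u))"
      by (simp add: sum.cartesian_product)
    also have "... = (\<Sum>v\<in>wset n k l j (m - a). \<Sum>u\<in>wset n k i l a. f (int l, warr n u l) * g (int j, warr n v j))"
      by (intro sum.cong refl) (auto simp: F_def wset_def)
    also have "... = fps_nth (pmat n k f i l) a * fps_nth (pmat n k g l j) (m - a)"
      unfolding pmat_nth by (subst sum.swap) (simp add: sum_product)
    finally show "(\<Sum>z\<in>{z \<in> P. (\<lambda>(v, u). (wend n v j, wcost n k u (wend n v j))) z = (l, a)}. F z) =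
      fps_nth (pmat n k f i l) a * fps_nth (pmat n k g l j) (m - a)" .
  qed
  also have "... = (\<Sum>l<n. \<Sum>a\<le>m. fps_nth (pmat n k f i l) a * fps_nth (pmat n k g l j) (m - a))"
    by (simp add: sum.cartesian_product)
  also have "... = fps_nth (\<Sum>l<n. pmat n k f i l * pmat n k g l j) m"
    by (simp add: fps_sum_nth fps_mult_nth atLeast0AtMost)
  finally show "fps_nth (pmat n k (f \<otimes>\<^bsub>PA n\<^esub> g) i j) m = fps_nth (\<Sum>l<n. pmat n k f i l * pmat n k g l j) m" .
qed

definition pth :: "nat \<Rightarrow> nat \<Rightarrow> bool list \<Rightarrow> path \<Rightarrow> complex" where
  "pth n j w = (\<lambda>p. if p = (int j, warr n w j) then 1 else 0)"

lemma pth_carrier: "j < n ==> pth n j w \<in> carrier (PA n)"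
  by (auto simp: PA_carrier pth_def warr_walk)

text \<open>Only the values of \<open>f\<close> on paths out of the end of \<open>w\<close> matter,
  and there \<open>f\<close> is the single path \<open>v\<close>. This form covers paths as well as
  the sums \<open>x_elt\<close> and \<open>y_elt\<close>.\<close>

lemma PA_mult_pth:
  assumes "j < n" "f \<in> carrier (PA n)"
    and "\<And>u. f (int (wend n w j), warr n u (wend n w j)) = (if P u then 1 else 0)"
    and "\<And>u. P u \<longleftrightarrow> u = v"
  shows "f \<otimes>\<^bsub>PA n\<^esub> pth n j w = pth n j (w @ v)"
proof (intro ext, clarify)
  fix s :: int and as :: "arrow list"
  interpret ring "PA n" by (rule PA_ring)
  have c: "f \<otimes>\<^bsub>PA n\<^esub> pth n j w \<in> carrier (PA n)" using assms pth_carrier by simp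
  show "(f \<otimes>\<^bsub>PA n\<^esub> pth n j w) (s, as) = pth n j (w @ v) (s, as)"
  proof (cases "is_walk n s as")
    case False
    then show ?thesis using c pth_carrier[OF assms(1), of "w @ v"] by (auto simp: PA_carrier)
  next
    case True
    then obtain j' x where jx: "j' < n" "s = int j'" "as = warr n x j'" by (rule walk_warr)
    have "(f \<otimes>\<^bsub>PA n\<^esub> pth n j w) (s, as) = (\<Sum>z\<in>{(v, u). v @ u = x}.
        if z = (w, v) then (if j' = j then 1 else 0) else 0)"
      unfolding jx(2,3) PA_mult_word[OF jx(1)]
      by (intro sum.cong refl) (auto simp: pth_def warr_inj assms(3,4) split: if_splits)
    also have "... = (if w @ v = x \<and> j' = j then 1 else 0)"
      using finite_splits[of x] by (simp add: sum.delta')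
    also have "... = pth n j (w @ v) (s, as)"
      using jx by (auto simp: pth_def warr_inj)
    finally show ?thesis .
  qed
qed

lemma pth_mult: 
  assumes "j < n"
  shows "pth n (wend n w j) v \<otimes>\<^bsub>PA n\<^esub> pth n j w = pth n j (w @ v)"
proof (rule PA_mult_pth[where P = "\<lambda>u. u = v"])
  show "pth n (wend n w j) v \<in> carrier (PA n)" using assms by (simp add: pth_carrier wend_less)
qed (use assms in \<open>auto simp: pth_def warr_inj\<close>)

lemma vertex_idem_pth: "vertex_idem (int j) = pth n j []"
  by (auto simp: vertex_idem_def pth_def)

lemma
  shows x_elt_carrier: "x_elt n \<in> carrier (PA n)" and y_elt_carrier: "y_elt n \<in> carrier (PA n)"
  by (auto simp: PA_carrier x_elt_def y_elt_def arrows_def vertices_def simp del: arrow_source.simps)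

lemma x_elt_word: "j < n ==> x_elt n (int j, warr n u j) = (if u = [True] then 1 else 0)"
proof -
  assume j: "j < n"
  have 1: "x_elt n (int j, warr n [True] j) = 1"
  proof -
    have "arrow_source n (XArr (int ((j + 1) mod n))) = int j" using arr_facts(2)[OF j, of True] by (simp add: arr_def)
    then show ?thesis using j by (auto simp: x_elt_def arr_def vertices_def intro!: bexI[of _ "int ((j + 1) mod n)"])
  qed
  have "u = [True]" if nz: "x_elt n (int j, warr n u j) \<noteq> 0"
  proof -
    obtain i where i: "warr n u j = [XArr i]" using nz by (auto simp: x_elt_def split: if_splits)
    then obtain b where b: "u = [b]" by (cases u; cases "tl u") auto
    show ?thesis using i unfolding b by (cases b) (auto simp: arr_def)
  qed
  then show ?thesis using 1 by metis
qed

lemma y_elt_word: "j < n ==> y_elt n (int j, warr n u j) = (if u = [False] then 1 else 0)"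
proof -
  assume j: "j < n"
  have 1: "y_elt n (int j, warr n [False] j) = 1"
    using j by (auto simp: y_elt_def arr_def vertices_def intro!: bexI[of _ "int j"])
  have "u = [False]" if nz: "y_elt n (int j, warr n u j) \<noteq> 0"
  proof -
    obtain i where i: "warr n u j = [YArr i]" using nz by (auto simp: y_elt_def split: if_splits)
    then obtain b where b: "u = [b]" by (cases u; cases "tl u") auto
    show ?thesis using i unfolding b by (cases b) (auto simp: arr_def)
  qed
  then show ?thesis using 1 by metis
qed

lemma x_elt_pth: "j < n ==> x_elt n \<otimes>\<^bsub>PA n\<^esub> pth n j w = pth n j (w @ [True])"
  by (rule PA_mult_pth[where P = "\<lambda>u. u = [True]"]) (auto simp: x_elt_word wend_less x_elt_carrier)

lemma y_elt_pth: "j < n ==> y_elt n \<otimes>\<^bsub>PA n\<^esub> pth n j w = pth n j (w @ [False])"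
  by (rule PA_mult_pth[where P = "\<lambda>u. u = [False]"]) (auto simp: y_elt_word wend_less y_elt_carrier)

lemma x_elt_pow_pth:
  assumes "j < n"
  shows "x_elt n [^]\<^bsub>PA n\<^esub> (a::nat) \<otimes>\<^bsub>PA n\<^esub> pth n j w = pth n j (w @ replicate a True)"
proof (induction a arbitrary: w)
  case 0
  interpret ring "PA n" by (rule PA_ring)
  show ?case using pth_carrier assms by simp
next
  case (Suc a)
  interpret ring "PA n" by (rule PA_ring)
  show ?case using Suc[of "w @ [True]"] x_elt_pth[OF assms, of w] pth_carrier[OF assms] x_elt_carrier
    by (simp add: m_assoc)
qed

lemma y_elt_pow_pth:
  assumes "j < n"
  shows "y_elt n [^]\<^bsub>PA n\<^esub> (a::nat) \<otimes>\<^bsub>PA n\<^esub> pth n j w = pth n j (w @ replicate a False)"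
proof (induction a arbitrary: w)
  case 0
  interpret ring "PA n" by (rule PA_ring)
  show ?case using pth_carrier assms by simp
next
  case (Suc a)
  interpret ring "PA n" by (rule PA_ring)
  show ?case using Suc[of "w @ [False]"] y_elt_pth[OF assms, of w] pth_carrier[OF assms] y_elt_carrier
    by (simp add: m_assoc)
qed

text \<open>A product traverses its right factor first, so \<open>x y\<close> is the word
  \<open>[False, True]\<close>.\<close>

lemma B_relations_eq:
  "B_relations k n = (\<Union>j<n. {pth n j [False, True] \<ominus>\<^bsub>PA n\<^esub> pth n j [True, False],
     pth n j (replicate k True) \<ominus>\<^bsub>PA n\<^esub> pth n j (replicate (n - k) False)})"
proof -
  interpret ring "PA n" by (rule PA_ring)
  have v: "vertices n = int ` {..<n}"
    by (auto simp: vertices_def image_iff intro!: bexI[of _ "nat _"])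
  have d: "(a \<ominus>\<^bsub>PA n\<^esub> b) \<otimes>\<^bsub>PA n\<^esub> c = a \<otimes>\<^bsub>PA n\<^esub> c \<ominus>\<^bsub>PA n\<^esub> b \<otimes>\<^bsub>PA n\<^esub> c"
    if "a \<in> carrier (PA n)" "b \<in> carrier (PA n)" "c \<in> carrier (PA n)" for a b c
    using that by (simp add: a_minus_def l_distr l_minus)
  note c = x_elt_carrier y_elt_carrier pth_carrier
  show ?thesis
    unfolding B_relations_def Let_def v UN_simps image_comp o_def
    by (intro SUP_cong refl)
       (simp add: vertex_idem_pth[of _ n] d c m_assoc x_elt_pth y_elt_pth x_elt_pow_pth y_elt_pow_pth)
qed

section \<open>The closed ideal of relations is the kernel of the matrix representation\<close>

definition pker :: "nat \<Rightarrow> nat \<Rightarrow> (path \<Rightarrow> complex) set" where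
  "pker n k = {f \<in> carrier (PA n). \<forall>i<n. \<forall>j<n. pmat n k f i j = 0}"

lemma pker_ideal:
  assumes "1 < k" "2 * k \<le> n"
  shows "ideal (pker n k) (PA n)"
proof (rule idealI)
  interpret ring "PA n" by (rule PA_ring)
  show "ring (PA n)" by (rule PA_ring)
  have z: "pmat n k \<zero>\<^bsub>PA n\<^esub> i j = 0" for i j by (rule fps_ext) (simp add: pmat_nth PA_zero)
  have m: "pmat n k (\<ominus>\<^bsub>PA n\<^esub> f) i j = - pmat n k f i j" if "f \<in> carrier (PA n)" for f i j
    using pmat_add[of n k "\<ominus>\<^bsub>PA n\<^esub> f" f i j] that z by (simp add: l_neg eq_neg_iff_add_eq_0)
  show "subgroup (pker n k) (add_monoid (PA n))"
    by (rule add.subgroupI) (auto simp: pker_def pmat_add m z a_inv_def[symmetric] intro!: exI[of _ "\<zero>\<^bsub>PA n\<^esub>"])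
qed (use assms in \<open>auto simp: pker_def pmat_mult ring.ring_simprules[OF PA_ring]\<close>)

definition rel_ideal :: "nat \<Rightarrow> nat \<Rightarrow> (path \<Rightarrow> complex) set" where
  "rel_ideal k n = Idl\<^bsub>PA n\<^esub> (B_relations k n)"

lemma B_relations_carrier: "B_relations k n \<subseteq> carrier (PA n)"
proof -
  interpret ring "PA n" by (rule PA_ring)
  show ?thesis unfolding B_relations_eq using pth_carrier by auto
qed

lemma rel_ideal_ideal: "ideal (rel_ideal k n) (PA n)"
  unfolding rel_ideal_def
  by (rule ring.genideal_ideal[OF PA_ring B_relations_carrier])

text \<open>Equality of the ends is part of the congruence so that congruent words can be continued
  by the same word.\<close>

definition cong_word :: "nat \<Rightarrow> nat \<Rightarrow> nat \<Rightarrow> bool list \<Rightarrow> bool list \<Rightarrow> bool" where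
  "cong_word n k j v w \<longleftrightarrow> wend n v j = wend n w j \<and>
     (\<lambda>p. pth n j v p - pth n j w p) \<in> rel_ideal k n"

lemma cong_word_iff:
  assumes "j < n"
  shows "cong_word n k j v w \<longleftrightarrow> wend n v j = wend n w j \<and> pth n j v \<ominus>\<^bsub>PA n\<^esub> pth n j w \<in> rel_ideal k n"
  using PA_minus[OF pth_carrier pth_carrier, OF assms assms] by (simp add: cong_word_def)

lemma cong_word_refl: "cong_word n k j v v"
proof -
  interpret ideal "rel_ideal k n" "PA n" by (rule rel_ideal_ideal)
  show ?thesis using zero_closed additive_subgroup.zero_closed[OF additive_subgroup_axioms]
    by (simp add: cong_word_def PA_zero)
qed

lemma cong_word_sym:
  assumes "j < n" "cong_word n k j v w"
  shows "cong_word n k j w v"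
proof -
  interpret ideal "rel_ideal k n" "PA n" by (rule rel_ideal_ideal)
  have "\<ominus>\<^bsub>PA n\<^esub> (pth n j v \<ominus>\<^bsub>PA n\<^esub> pth n j w) \<in> rel_ideal k n"
    using assms cong_word_iff by (simp add: a_inv_closed)
  moreover have "\<ominus>\<^bsub>PA n\<^esub> (pth n j v \<ominus>\<^bsub>PA n\<^esub> pth n j w) = pth n j w \<ominus>\<^bsub>PA n\<^esub> pth n j v"
    using pth_carrier[OF assms(1)] by (simp add: a_minus_def minus_add a_comm)
  ultimately show ?thesis using assms cong_word_iff by simp
qed

lemma cong_word_trans:
  assumes "j < n" "cong_word n k j u v" "cong_word n k j v w"
  shows "cong_word n k j u w"
proof -
  interpret ideal "rel_ideal k n" "PA n" by (rule rel_ideal_ideal)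
  have "(pth n j u \<ominus>\<^bsub>PA n\<^esub> pth n j v) \<oplus>\<^bsub>PA n\<^esub> (pth n j v \<ominus>\<^bsub>PA n\<^esub> pth n j w) \<in> rel_ideal k n"
    using assms cong_word_iff additive_subgroup.a_closed[OF additive_subgroup_axioms] by simp
  moreover have "(pth n j u \<ominus>\<^bsub>PA n\<^esub> pth n j v) \<oplus>\<^bsub>PA n\<^esub> (pth n j v \<ominus>\<^bsub>PA n\<^esub> pth n j w) =
      pth n j u \<ominus>\<^bsub>PA n\<^esub> pth n j w"
    using pth_carrier[OF assms(1)] PA_minus[OF pth_carrier pth_carrier, OF assms(1) assms(1)]
    by (auto simp: PA_add fun_eq_iff)
  ultimately show ?thesis using assms cong_word_iff by simp
qed

lemma cong_word_append:
  assumes "j < n" "cong_word n k j v w"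
  shows "cong_word n k j (v @ u) (w @ u)"
proof -
  interpret ideal "rel_ideal k n" "PA n" by (rule rel_ideal_ideal)
  have e: "wend n v j = wend n w j" using assms cong_word_def by auto
  have c: "pth n (wend n v j) u \<in> carrier (PA n)" by (rule pth_carrier) (simp add: wend_less assms)
  have "pth n (wend n v j) u \<otimes>\<^bsub>PA n\<^esub> (pth n j v \<ominus>\<^bsub>PA n\<^esub> pth n j w) \<in> rel_ideal k n"
    using assms cong_word_iff I_l_closed c by blast
  moreover have "pth n (wend n v j) u \<otimes>\<^bsub>PA n\<^esub> (pth n j v \<ominus>\<^bsub>PA n\<^esub> pth n j w) =
      pth n j (v @ u) \<ominus>\<^bsub>PA n\<^esub> pth n j (w @ u)"
    using c pth_carrier[OF assms(1)] pth_mult[OF assms(1), of v u] pth_mult[OF assms(1), of w u] e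
    by (simp add: a_minus_def r_distr r_minus)
  ultimately show ?thesis using assms cong_word_iff by auto
qed

lemma cong_word_prepend:
  assumes "j < n" "cong_word n k (wend n u j) v w"
  shows "cong_word n k j (u @ v) (u @ w)"
proof -
  interpret ideal "rel_ideal k n" "PA n" by (rule rel_ideal_ideal)
  have j': "wend n u j < n" using assms wend_less by auto
  have "(pth n (wend n u j) v \<ominus>\<^bsub>PA n\<^esub> pth n (wend n u j) w) \<otimes>\<^bsub>PA n\<^esub> pth n j u \<in> rel_ideal k n"
    using assms cong_word_iff[OF j'] I_r_closed pth_carrier by blast
  moreover have "(pth n (wend n u j) v \<ominus>\<^bsub>PA n\<^esub> pth n (wend n u j) w) \<otimes>\<^bsub>PA n\<^esub> pth n j u =
      pth n j (u @ v) \<ominus>\<^bsub>PA n\<^esub> pth n j (u @ w)"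
    using pth_carrier[OF assms(1)] pth_carrier[OF j'] pth_mult[OF assms(1), of u]
    by (simp add: a_minus_def l_distr l_minus)
  ultimately show ?thesis using assms cong_word_iff[OF j'] cong_word_iff[OF assms(1)] by auto
qed

lemma wend_count_eq:
  assumes "j < n" "1 < k" "2 * k \<le> n"
    "int (count_list v True) = int (count_list w True) + int k * q"
    "int (count_list w False) = int (count_list v False) + int (n - k) * q"
  shows "wend n v j = wend n w j"
  using wend_wcost_eq_iff[OF assms(1-3), of v w] assms(4,5) by blast

lemma count_list_replicate: "count_list (replicate m a) b = (if a = b then m else 0)"
  by (induction m) auto

lemma cong_word_basic:
  assumes "j < n" "1 < k" "2 * k \<le> n"
  shows "cong_word n k j [False, True] [True, False]"
    and "cong_word n k j (replicate k True) (replicate (n - k) False)"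
proof -
  have "B_relations k n \<subseteq> rel_ideal k n"
    unfolding rel_ideal_def by (rule ring.genideal_self[OF PA_ring B_relations_carrier])
  then have "pth n j [False, True] \<ominus>\<^bsub>PA n\<^esub> pth n j [True, False] \<in> rel_ideal k n"
     "pth n j (replicate k True) \<ominus>\<^bsub>PA n\<^esub> pth n j (replicate (n - k) False) \<in> rel_ideal k n"
    unfolding B_relations_eq using assms(1) by auto
  moreover have "wend n [False, True] j = wend n [True, False] j"
    by (rule wend_count_eq[OF assms, where q = 0]) auto
  moreover have "wend n (replicate k True) j = wend n (replicate (n - k) False) j"
    by (rule wend_count_eq[OF assms, where q = 1]) (auto simp: count_list_replicate)
  ultimately show "cong_word n k j [False, True] [True, False]"
    "cong_word n k j (replicate k True) (replicate (n - k) False)"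
    using cong_word_iff[OF assms(1)] by auto
qed

lemma cong_word_swap:
  assumes "j < n" "1 < k" "2 * k \<le> n"
  shows "cong_word n k j (False # replicate a True) (replicate a True @ [False])"
  using assms(1)
proof (induction a arbitrary: j)
  case 0 show ?case by (simp add: cong_word_refl)
next
  case (Suc a)
  have "cong_word n k j ([False, True] @ replicate a True) ([True, False] @ replicate a True)"
    using cong_word_append cong_word_basic(1) Suc.prems assms by blast
  moreover have "cong_word n k j ([True] @ (False # replicate a True)) ([True] @ (replicate a True @ [False]))"
    using Suc by (intro cong_word_prepend) (auto simp: stp_less)
  ultimately have "cong_word n k j ([False, True] @ replicate a True) ([True] @ (replicate a True @ [False]))"
    using cong_word_trans Suc.prems by (metis append_Cons append_Nil)
  then show ?case by simp
qed

text \<open>The commutation relation alone moves all letters \<open>x\<close> to the front; the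
  normal form remembers only the letter counts.\<close>

lemma cong_word_sort:
  assumes "j < n" "1 < k" "2 * k \<le> n"
  shows "cong_word n k j w (replicate (count_list w True) True @ replicate (count_list w False) False)"
  using assms(1)
proof (induction w arbitrary: j)
  case Nil show ?case by (simp add: cong_word_refl)
next
  case (Cons b w)
  let ?a = "replicate (count_list w True) True" and ?b = "replicate (count_list w False) False"
  have 1: "cong_word n k j ([b] @ w) ([b] @ (?a @ ?b))"
    using Cons by (intro cong_word_prepend) (auto simp: stp_less)
  show ?case
  proof (cases b)
    case True
    then show ?thesis using 1 by simp
  next
    case False
    have "cong_word n k j ((False # ?a) @ ?b) ((?a @ [False]) @ ?b)"
      by (intro cong_word_append cong_word_swap Cons.prems assms)
    then have "cong_word n k j ([b] @ w) ((?a @ [False]) @ ?b)"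
      using 1 cong_word_trans Cons.prems False by simp
    then show ?thesis using False by (simp add: replicate_append_same)
  qed
qed

lemma cong_word_counts:
  assumes "j < n" "1 < k" "2 * k \<le> n"
    and "count_list v True = count_list w True" "count_list v False = count_list w False"
  shows "cong_word n k j v w"
  using cong_word_sort[OF assms(1-3), of v] cong_word_sort[OF assms(1-3), of w] assms(4,5)
    cong_word_sym[OF assms(1)] cong_word_trans[OF assms(1)] by metis

text \<open>One exchange at a time: \<open>k\<close> letters \<open>x\<close> are brought to the
  front by sorting, replaced by \<open>n - k\<close> letters \<open>y\<close>, and the result is
  sorted again.\<close>

lemma cong_word_exchange:
  assumes "j < n" "1 < k" "2 * k \<le> n"
  shows "cong_word n k j (replicate (a + k * q) True @ replicate b False)
    (replicate a True @ replicate (b + (n - k) * q) False)"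
proof (induction q arbitrary: b)
  case 0 show ?case by (simp add: cong_word_refl)
next
  case (Suc q)
  let ?u = "replicate (a + k * q) True @ replicate b False"
  have "cong_word n k j (replicate (a + k * Suc q) True @ replicate b False) (replicate k True @ ?u)"
    by (rule cong_word_counts[OF assms]) (auto simp: count_list_replicate)
  moreover have "cong_word n k j (replicate k True @ ?u) (replicate (n - k) False @ ?u)"
    by (intro cong_word_append cong_word_basic assms)
  moreover have "cong_word n k j (replicate (n - k) False @ ?u)
      (replicate (a + k * q) True @ replicate (b + (n - k)) False)"
    by (rule cong_word_counts[OF assms]) (auto simp: count_list_replicate)
  moreover note Suc[of "b + (n - k)"]
  ultimately have "cong_word n k j (replicate (a + k * Suc q) True @ replicate b False)
    (replicate a True @ replicate (b + (n - k) + (n - k) * q) False)"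
    using cong_word_trans[OF assms(1)] by blast
  then show ?case by (simp add: add.assoc)
qed

text \<open>Equal end and cost yield the number \<open>q\<close> of exchanges between the sorted
  forms. They are carried out by \<open>cong_word_exchange\<close>, with the two words interchanged
  if \<open>q\<close> is negative.\<close>

lemma cong_wordI:
  assumes "j < n" "1 < k" "2 * k \<le> n"
    and "wend n v j = wend n w j" "wcost n k v j = wcost n k w j"
  shows "cong_word n k j v w"
proof -
  have *: "cong_word n k j v w"
    if q: "int (count_list v True) = int (count_list w True) + int k * q"
       "int (count_list w False) = int (count_list v False) + int (n - k) * q" "q \<ge> 0" for v w q
  proof -
    have "int (count_list v True) = int (count_list w True + k * nat q)"
      "int (count_list w False) = int (count_list v False + (n - k) * nat q)" using q by auto
    then have c: "count_list v True = count_list w True + k * nat q"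
      "count_list w False = count_list v False + (n - k) * nat q" unfolding of_nat_eq_iff by auto
    show ?thesis
      using cong_word_exchange[OF assms(1-3), of "count_list w True" "nat q" "count_list v False"]
        cong_word_sort[OF assms(1-3), of v] cong_word_sort[OF assms(1-3), of w]
        cong_word_sym[OF assms(1)] cong_word_trans[OF assms(1)] unfolding c by metis
  qed
  obtain q where q: "int (count_list v True) = int (count_list w True) + int k * q"
       "int (count_list w False) = int (count_list v False) + int (n - k) * q"
    using wend_wcost_eq_iff[OF assms(1-3), of v w] assms(4,5) by blast
  show ?thesis
  proof (cases "q \<ge> 0")
    case True then show ?thesis using * q by blast
  next
    case False
    have "cong_word n k j w v" by (rule *[where q = "- q"]) (use q False in \<open>auto simp: algebra_simps\<close>)
    then show ?thesis using cong_word_sym assms by blast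
  qed
qed

lemma pmat_pth:
  assumes "j < n" "1 < k" "2 * k \<le> n"
  shows "pmat n k (pth n j w) i l = (if l = j \<and> i = wend n w j then fps_X ^ wcost n k w j else 0)"
proof (rule fps_ext)
  fix m
  have "fps_nth (pmat n k (pth n j w) i l) m = (\<Sum>v\<in>wset n k i l m. if v = w then (if l = j then 1 else 0) else 0)"
    unfolding pmat_nth by (intro sum.cong refl) (auto simp: pth_def warr_inj)
  also have "... = (if w \<in> wset n k i l m \<and> l = j then 1 else 0)"
    using finite_wset[OF assms] by (cases "l = j") auto
  finally show "fps_nth (pmat n k (pth n j w) i l) m =
    fps_nth (if l = j \<and> i = wend n w j then fps_X ^ wcost n k w j else 0) m"
    by (auto simp: wset_def fps_X_power_iff)
qed

lemma rel_ideal_subset_pker: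
  assumes "1 < k" "2 * k \<le> n"
  shows "rel_ideal k n \<subseteq> pker n k"
  unfolding rel_ideal_def
proof (rule ring.genideal_minimal[OF PA_ring pker_ideal[OF assms]], rule subsetI)
  interpret ring "PA n" by (rule PA_ring)
  have mm: "pmat n k (f \<ominus>\<^bsub>PA n\<^esub> g) i l = pmat n k f i l - pmat n k g i l"
    if "f \<in> carrier (PA n)" "g \<in> carrier (PA n)" for f g i l
    by (rule fps_ext) (simp add: pmat_nth PA_minus[OF that] sum_subtractf)
  have *: "pth n j v \<ominus>\<^bsub>PA n\<^esub> pth n j w \<in> pker n k"
    if "j < n" "wend n v j = wend n w j \<and> wcost n k v j = wcost n k w j" for v w j
    using that by (simp add: pker_def mm pth_carrier pmat_pth[OF that(1) assms])
  fix f assume "f \<in> B_relations k n"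
  then obtain j where j: "j < n" "f = pth n j [False, True] \<ominus>\<^bsub>PA n\<^esub> pth n j [True, False] \<or>
      f = pth n j (replicate k True) \<ominus>\<^bsub>PA n\<^esub> pth n j (replicate (n - k) False)"
    unfolding B_relations_eq by auto
  have "wend n [False, True] j = wend n [True, False] j \<and> wcost n k [False, True] j = wcost n k [True, False] j"
    by (subst wend_wcost_eq_iff[OF j(1) assms]) (auto intro!: exI[of _ 0])
  moreover have "wend n (replicate k True) j = wend n (replicate (n - k) False) j \<and>
      wcost n k (replicate k True) j = wcost n k (replicate (n - k) False) j"
    by (subst wend_wcost_eq_iff[OF j(1) assms]) (auto simp: count_list_replicate intro!: exI[of _ 1])
  ultimately show "f \<in> pker n k" using * j by blast
qed

text \<open>A ring ideal is closed under complex scalars because the scalar times the identity is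
  itself a ring element, here \<open>d\<close>.\<close>

lemma rel_ideal_sum:
  assumes "finite S" "\<And>z. z \<in> S ==> h z \<in> rel_ideal k n"
  shows "(\<lambda>p. \<Sum>z\<in>S. c z * h z p) \<in> rel_ideal k n"
  using assms
proof (induction S rule: finite_induct)
  case empty
  interpret ideal "rel_ideal k n" "PA n" by (rule rel_ideal_ideal)
  show ?case using additive_subgroup.zero_closed[OF additive_subgroup_axioms] by (simp add: PA_zero)
next
  case (insert z S)
  interpret ideal "rel_ideal k n" "PA n" by (rule rel_ideal_ideal)
  define d :: "path \<Rightarrow> complex" where "d = (\<lambda>(s, as). if s \<in> vertices n \<and> as = [] then c z else 0 :: complex)"
  have d: "d \<in> carrier (PA n)" by (auto simp: PA_carrier d_def)
  have h: "h z \<in> carrier (PA n)" using insert.prems Icarr by auto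
  have "d \<otimes>\<^bsub>PA n\<^esub> h z = (\<lambda>p. c z * h z p)"
  proof (intro ext, clarify)
    fix s :: int and as :: "arrow list"
    have "(d \<otimes>\<^bsub>PA n\<^esub> h z) (s, as) =
        (\<Sum>p\<in>{..length as}. if p = length as then (if walk_end n s as \<in> vertices n then c z * h z (s, as) else 0) else 0)"
      unfolding PA_mult d_def by (intro sum.cong refl) auto
    also have "... = c z * h z (s, as)"
      using h by (cases "is_walk n s as") (auto simp: PA_carrier dest: is_walk_end)
    finally show "(d \<otimes>\<^bsub>PA n\<^esub> h z) (s, as) = c z * h z (s, as)" .
  qed
  moreover have "d \<otimes>\<^bsub>PA n\<^esub> h z \<in> rel_ideal k n" using I_l_closed insert.prems d by auto
  ultimately have "(\<lambda>p. c z * h z p) \<oplus>\<^bsub>PA n\<^esub> (\<lambda>p. \<Sum>z\<in>S. c z * h z p) \<in> rel_ideal k n"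
    using insert additive_subgroup.a_closed[OF additive_subgroup_axioms] by simp
  moreover have "(\<lambda>p. c z * h z p) \<oplus>\<^bsub>PA n\<^esub> (\<lambda>p. \<Sum>z\<in>S. c z * h z p) = (\<lambda>p. \<Sum>z\<in>insert z S. c z * h z p)"
    using insert.hyps by (auto simp: PA_add fun_eq_iff)
  ultimately show ?case by simp
qed

text \<open>To approximate \<open>f\<close> in the kernel up to length \<open>N\<close>, subtract from every shorter path a congruent
  path of length at least \<open>N\<close>; where there is none, the whole congruence class consists of shorter
  paths, and the coefficients of \<open>f\<close> on it sum up to an entry of the zero matrix.\<close>

lemma B_ideal_eq_pker:
  assumes nk: "1 < k" "2 * k \<le> n"
  shows "B_ideal k n = pker n k"
proof (intro equalityI subsetI)
  fix f assume "f \<in> B_ideal k n"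
  then have f: "f \<in> carrier (PA n)"
    and ap: "\<And>N. \<exists>g\<in>rel_ideal k n. \<forall>s as. length as < N \<longrightarrow> f (s, as) = g (s, as)"
    by (auto simp: B_ideal_def adic_closure_def rel_ideal_def)
  have "pmat n k f i j = 0" if ij: "i < n" "j < n" for i j
  proof (rule fps_ext)
    fix m
    \<comment> \<open>By \<open>length_le_wcost\<close> no walk from \<open>j\<close> of cost
      \<open>m\<close> is longer than \<open>n * m + pot n k j\<close>, so an approximation beyond
      this length determines the coefficient.\<close>
    obtain g where g: "g \<in> rel_ideal k n" "\<And>s as. length as < Suc (n * m + pot n k j) ==> f (s, as) = g (s, as)"
      using ap by blast
    have "fps_nth (pmat n k f i j) m = fps_nth (pmat n k g i j) m"
      unfolding pmat_nth
    proof (intro sum.cong refl g(2))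
      fix w assume "w \<in> wset n k i j m"
      then show "length (warr n w j) < Suc (n * m + pot n k j)"
        using length_le_wcost[OF ij(2) nk, of w] by (auto simp: wset_def)
    qed
    also have "... = 0" using g(1) rel_ideal_subset_pker[OF nk] ij by (auto simp: pker_def)
    finally show "fps_nth (pmat n k f i j) m = fps_nth 0 m" by simp
  qed
  then show "f \<in> pker n k" using f by (simp add: pker_def)
next
  fix f assume "f \<in> pker n k"
  then have f: "f \<in> carrier (PA n)" and f0: "\<And>i j. i < n ==> j < n ==> pmat n k f i j = 0"
    by (auto simp: pker_def)
  have "\<exists>g\<in>rel_ideal k n. \<forall>s as. length as < N \<longrightarrow> f (s, as) = g (s, as)" for N
  proof -
    define cls where "cls j w = (wend n w j, wcost n k w j)" for j w
    \<comment> \<open>A representative of each class of words with equal end and cost, of length at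
      least \<open>N\<close> whenever the class contains such a word. If it is short, then so is the
      whole class (\<open>rp_short\<close>).\<close>
    define rp where "rp j c = (if \<exists>v. cls j v = c \<and> N \<le> length v then SOME v. cls j v = c \<and> N \<le> length v
      else SOME v. cls j v = c)" for j c
    have rp_cls: "cls j (rp j (cls j w)) = cls j w" for j w
      unfolding rp_def
      by (cases "\<exists>v. cls j v = cls j w \<and> N \<le> length v") (auto intro: someI2_ex)
    have rp_short: "length w' < N" if "length (rp j (cls j w)) < N" "cls j w' = cls j w" for j w w'
    proof (rule ccontr)
      assume "\<not> length w' < N"
      then have ex: "\<exists>v. cls j v = cls j w \<and> N \<le> length v" using that(2) by auto
      then have "N \<le> length (rp j (cls j w))" unfolding rp_def by (auto intro: someI2_ex)
      then show False using that by simp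
    qed
    define S where "S = {..<n} \<times> {w :: bool list. length w < N}"
    have finS: "finite {w :: bool list. length w < N}"
      by (rule finite_subset[OF _ finite_words_length[of N]]) auto
    define g where "g = (\<lambda>p. \<Sum>(j, w)\<in>S. f (int j, warr n w j) * (pth n j w p - pth n j (rp j (cls j w)) p))"
    have g: "g = (\<lambda>p. \<Sum>z\<in>S. f (int (fst z), warr n (snd z) (fst z)) *
        (\<lambda>z p. pth n (fst z) (snd z) p - pth n (fst z) (rp (fst z) (cls (fst z) (snd z))) p) z p)"
      by (simp add: g_def case_prod_unfold)
    have "g \<in> rel_ideal k n"
      unfolding g
    proof (rule rel_ideal_sum)
      fix z assume "z \<in> S"
      then obtain j w where z: "z = (j, w)" "j < n" by (auto simp: S_def)
      have "cong_word n k j w (rp j (cls j w))"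
        using rp_cls[of j w] z by (intro cong_wordI nk) (auto simp: cls_def)
      then show "(\<lambda>p. pth n (fst z) (snd z) p - pth n (fst z) (rp (fst z) (cls (fst z) (snd z))) p) \<in> rel_ideal k n"
        using z by (simp add: cong_word_def)
    qed (simp add: S_def finS)
    moreover have "f (s, as) = g (s, as)" if len: "length as < N" for s as
    proof (cases "is_walk n s as")
      case False
      have "pth n j w (s, as) = 0" if "j < n" for j w
        using False pth_carrier[OF that, of w] by (auto simp: PA_carrier)
      then have "g (s, as) = 0" unfolding g_def by (intro sum.neutral) (auto simp: S_def)
      then show ?thesis using f False by (simp add: PA_carrier)
    next
      case True
      then obtain j w where w: "j < n" "s = int j" "as = warr n w j" by (rule walk_warr)
      have lw: "length w < N" using len w by simp
      have "g (s, as) = (\<Sum>(i, v)\<in>S. if i = j then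
          f (int i, warr n v i) * ((if v = w then 1 else 0) - (if rp i (cls i v) = w then 1 else 0)) else 0)"
        unfolding g_def by (intro sum.cong refl) (auto simp: pth_def w warr_inj)
      also have "... = (\<Sum>i<n. if i = j then (\<Sum>v\<in>{w. length w < N}.
          f (int i, warr n v i) * ((if v = w then 1 else 0) - (if rp i (cls i v) = w then 1 else 0))) else 0)"
        unfolding S_def sum.cartesian_product[symmetric] by (intro sum.cong refl) auto
      also have "... = (\<Sum>v\<in>{w. length w < N}.
          f (int j, warr n v j) * ((if v = w then 1 else 0) - (if rp j (cls j v) = w then 1 else 0)))"
        using w(1) by simp
      also have "... = (\<Sum>v\<in>{w. length w < N}. if v = w then f (int j, warr n v j) else 0) -
          (\<Sum>v\<in>{w. length w < N}. if rp j (cls j v) = w then f (int j, warr n v j) else 0)"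
        unfolding sum_subtractf[symmetric] by (intro sum.cong refl) auto
      also have "(\<Sum>v\<in>{w. length w < N}. if v = w then f (int j, warr n v j) else 0) = f (s, as)"
        using finS lw w by simp
      also have "(\<Sum>v\<in>{w. length w < N}. if rp j (cls j v) = w then f (int j, warr n v j) else 0) =
          (\<Sum>v\<in>{v. length v < N \<and> rp j (cls j v) = w}. f (int j, warr n v j))"
        using finS by (simp add: sum.If_cases Int_def)
      \<comment> \<open>If \<open>w\<close> represents a class of some short word, that class
        consists of short words only and is a full set \<open>wset\<close>, so this is a coefficient
        of a zero entry. Otherwise the sum is empty.\<close>
      also have "... = 0"
      proof (cases "\<exists>v. length v < N \<and> rp j (cls j v) = w")
        case True
        then obtain v where v: "rp j (cls j v) = w" by blast
        have cw: "cls j w = cls j v" using rp_cls[of j v] v by simp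
        have "{v. length v < N \<and> rp j (cls j v) = w} = wset n k (wend n w j) j (wcost n k w j)"
        proof (intro equalityI subsetI)
          fix u assume "u \<in> {v. length v < N \<and> rp j (cls j v) = w}"
          then have "cls j u = cls j w" using rp_cls[of j u] by auto
          then show "u \<in> wset n k (wend n w j) j (wcost n k w j)" by (simp add: cls_def wset_def)
        next
          fix u assume "u \<in> wset n k (wend n w j) j (wcost n k w j)"
          then have u: "cls j u = cls j w" by (simp add: cls_def wset_def)
          then have "length u < N" using rp_short[of j v u] v lw cw by simp
          then show "u \<in> {v. length v < N \<and> rp j (cls j v) = w}" using u cw v by simp
        qed
        then have "(\<Sum>v\<in>{v. length v < N \<and> rp j (cls j v) = w}. f (int j, warr n v j)) =
            fps_nth (pmat n k f (wend n w j) j) (wcost n k w j)" by (simp add: pmat_nth)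
        then show ?thesis using f0[OF wend_less[OF w(1)] w(1)] by simp
      qed (auto intro!: sum.neutral)
      finally show ?thesis by simp
    qed
    ultimately show ?thesis by blast
  qed
  then show "f \<in> B_ideal k n" using f by (simp add: B_ideal_def adic_closure_def rel_ideal_def)
qed

section \<open>The algebra as a tiled order\<close>

text \<open>All that is used of \<open>B\<close>: it is the ring of \<open>n \<times> n\<close> matrices over \<open>\<complex>[[t]]\<close> whose entry at \<open>(i, j)\<close>
  involves only those \<open>t\<^sup>m\<close> for which there is a walk of cost \<open>m\<close> from \<open>j\<close> to \<open>i\<close>. The map
  \<open>\<upsilon>\<close> substitutes \<open>y\<close> into a power series.\<close>

locale tiled =
  fixes R :: "'r ring" (structure) and n k :: nat
    and mat :: "'r \<Rightarrow> nat \<Rightarrow> nat \<Rightarrow> complex fps"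
    and \<iota> :: "complex \<Rightarrow> 'r" and \<upsilon> :: "complex fps \<Rightarrow> 'r"
  assumes R_ring: "ring R" and k1: "1 < k" and nk: "2 * k \<le> n"
    and mat_add: "[|a \<in> carrier R; b \<in> carrier R; i < n; j < n|] ==> mat (a \<oplus> b) i j = mat a i j + mat b i j"
    and mat_mult: "[|a \<in> carrier R; b \<in> carrier R; i < n; j < n|] ==>
      mat (a \<otimes> b) i j = (\<Sum>l<n. mat a i l * mat b l j)"
    and mat_one: "[|i < n; j < n|] ==> mat \<one> i j = (if i = j then 1 else 0)"
    and mat_inj: "[|a \<in> carrier R; b \<in> carrier R; \<And>i j. [|i < n; j < n|] ==> mat a i j = mat b i j|] ==> a = b"
    and mat_valid: "[|a \<in> carrier R; i < n; j < n; fps_nth (mat a i j) m \<noteq> 0|] ==> wset n k i j m \<noteq> {}"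
    and mat_surj: "(\<And>i j m. [|i < n; j < n; fps_nth (\<beta> i j) m \<noteq> 0|] ==> wset n k i j m \<noteq> {}) ==>
      \<exists>a\<in>carrier R. \<forall>i<n. \<forall>j<n. mat a i j = \<beta> i j"
    and iota_closed: "\<iota> c \<in> carrier R"
    and mat_iota: "[|i < n; j < n|] ==> mat (\<iota> c) i j = (if i = j then fps_const c else 0)"
    and ups_closed: "\<upsilon> p \<in> carrier R"
    and ups_add: "\<upsilon> (p + q) = \<upsilon> p \<oplus> \<upsilon> q"
    and ups_mult: "\<upsilon> (p * q) = \<upsilon> p \<otimes> \<upsilon> q"
    and mat_ups: "[|i < n; j < n|] ==> fps_nth (mat (\<upsilon> p) i j) m =
      (\<Sum>b | replicate b False \<in> wset n k i j m. fps_nth p b)"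

section \<open>The quotient algebra satisfies the axioms of the tiled order\<close>

definition bcoset :: "nat \<Rightarrow> nat \<Rightarrow> (path \<Rightarrow> complex) \<Rightarrow> (path \<Rightarrow> complex) set" where
  "bcoset k n f = B_ideal k n +>\<^bsub>PA n\<^esub> f"

text \<open>The choice of a representative is harmless, as the ideal is the kernel of
  \<open>pmat\<close>; see \<open>bmat_coset\<close>.\<close>

definition bmat :: "nat \<Rightarrow> nat \<Rightarrow> (path \<Rightarrow> complex) set \<Rightarrow> nat \<Rightarrow> nat \<Rightarrow> complex fps" where
  "bmat k n X = pmat n k (SOME f. f \<in> X)"

definition dec :: "arrow list \<Rightarrow> bool list" where
  "dec = map (\<lambda>a. case a of XArr i \<Rightarrow> True | YArr i \<Rightarrow> False)"

definition ypath :: "nat \<Rightarrow> complex fps \<Rightarrow> path \<Rightarrow> complex" where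
  "ypath n p = (\<lambda>(s, as). if is_walk n s as \<and> dec as = replicate (length as) False then fps_nth p (length as) else 0)"

lemma dec_warr: "dec (warr n w j) = w"
  by (induction w arbitrary: j) (auto simp: dec_def arr_def)

context
  fixes k n :: nat
  assumes k1: "1 < k" and nk: "2 * k \<le> n"
begin

lemma bideal: "ideal (B_ideal k n) (PA n)"
  using B_ideal_eq_pker[OF k1 nk] pker_ideal[OF k1 nk] by simp

lemma bmat_coset:
  assumes "f \<in> carrier (PA n)" "i < n" "j < n"
  shows "bmat k n (bcoset k n f) i j = pmat n k f i j"
proof -
  interpret ideal "B_ideal k n" "PA n" by (rule bideal)
  have "f \<in> bcoset k n f" unfolding bcoset_def using a_rcos_self[OF assms(1)] by simp
  then have "(SOME f'. f' \<in> bcoset k n f) \<in> bcoset k n f" unfolding some_in_eq by blast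
  then obtain h where h: "h \<in> B_ideal k n" "(SOME f'. f' \<in> bcoset k n f) = h \<oplus>\<^bsub>PA n\<^esub> f"
    unfolding bcoset_def a_r_coset_def' by auto
  have "pmat n k h i j = 0" using h(1) assms unfolding B_ideal_eq_pker[OF k1 nk] pker_def by blast
  then show ?thesis by (simp add: bmat_def h(2) pmat_add)
qed

lemma B_carrier: "carrier (B_algebra k n) = bcoset k n ` carrier (PA n)"
  unfolding B_algebra_def FactRing_def A_RCOSETS_def' bcoset_def by auto

lemma B_mult:
  assumes "f \<in> carrier (PA n)" "g \<in> carrier (PA n)"
  shows "bcoset k n f \<otimes>\<^bsub>B_algebra k n\<^esub> bcoset k n g = bcoset k n (f \<otimes>\<^bsub>PA n\<^esub> g)"
  using ideal.rcoset_mult_add[OF bideal assms] by (simp add: B_algebra_def FactRing_def bcoset_def)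

lemma B_add:
  assumes "f \<in> carrier (PA n)" "g \<in> carrier (PA n)"
  shows "bcoset k n f \<oplus>\<^bsub>B_algebra k n\<^esub> bcoset k n g = bcoset k n (f \<oplus>\<^bsub>PA n\<^esub> g)"
  using ideal.a_rcos_sum[OF bideal assms] by (simp add: B_algebra_def FactRing_def bcoset_def)

lemma B_one: "\<one>\<^bsub>B_algebra k n\<^esub> = bcoset k n \<one>\<^bsub>PA n\<^esub>"
  by (simp add: B_algebra_def FactRing_def bcoset_def)

lemma bcoset_eqI:
  assumes "f \<in> carrier (PA n)" "g \<in> carrier (PA n)" "\<And>i j. i < n ==> j < n ==> pmat n k f i j = pmat n k g i j"
  shows "bcoset k n f = bcoset k n g"
proof -
  interpret ideal "B_ideal k n" "PA n" by (rule bideal)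
  have "pmat n k (f \<ominus>\<^bsub>PA n\<^esub> g) i j = pmat n k f i j - pmat n k g i j" for i j
    by (rule fps_ext) (simp add: pmat_nth PA_minus[OF assms(1,2)] sum_subtractf)
  then have "f \<ominus>\<^bsub>PA n\<^esub> g \<in> B_ideal k n"
    unfolding B_ideal_eq_pker[OF k1 nk] pker_def using assms by simp
  then show ?thesis using quotient_eq_iff_same_a_r_cos[OF is_ideal assms(1,2)] by (simp add: bcoset_def)
qed

lemma PA_scalar: "(\<lambda>p. c * \<one>\<^bsub>PA n\<^esub> p) \<in> carrier (PA n)"
  by (auto simp: PA_carrier PA_one)

lemma pmat_scalar:
  assumes "i < n" "j < n"
  shows "pmat n k (\<lambda>p. c * \<one>\<^bsub>PA n\<^esub> p) i j = (if i = j then fps_const c else 0)"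
proof (rule fps_ext)
  fix m
  have "fps_nth (pmat n k (\<lambda>p. c * \<one>\<^bsub>PA n\<^esub> p) i j) m = (\<Sum>w\<in>wset n k i j m. if w = [] then c else 0)"
    unfolding pmat_nth using assms
    by (intro sum.cong refl) (auto simp: PA_one vertices_def warr_inj[where w = "[]", simplified])
  also have "... = (if [] \<in> wset n k i j m then c else 0)"
    using finite_wset[OF assms(2) k1 nk] by simp
  finally show "fps_nth (pmat n k (\<lambda>p. c * \<one>\<^bsub>PA n\<^esub> p) i j) m = fps_nth (if i = j then fps_const c else 0) m"
    by (auto simp: wset_def)
qed

lemma ypath_carrier: "ypath n p \<in> carrier (PA n)"
  by (auto simp: PA_carrier ypath_def)

lemma ypath_word:
  "j < n ==> ypath n p (int j, warr n w j) = (if w = replicate (length w) False then fps_nth p (length w) else 0)"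
  by (simp add: ypath_def warr_walk dec_warr)

text \<open>A power of \<open>y\<close> splits only into powers of \<open>y\<close>, which leaves
  the Cauchy product; any other word keeps a letter \<open>x\<close> in one of its two
  parts.\<close>

lemma ypath_mult: "ypath n (p * q) = ypath n p \<otimes>\<^bsub>PA n\<^esub> ypath n q"
proof (intro ext, clarify)
  fix s :: int and as :: "arrow list"
  interpret ring "PA n" by (rule PA_ring)
  show "ypath n (p * q) (s, as) = (ypath n p \<otimes>\<^bsub>PA n\<^esub> ypath n q) (s, as)"
  proof (cases "is_walk n s as")
    case False
    then show ?thesis using ypath_carrier m_closed[OF ypath_carrier ypath_carrier] by (auto simp: PA_carrier)
  next
    case True
    then obtain j w where w: "j < n" "s = int j" "as = warr n w j" by (rule walk_warr)
    have "(ypath n p \<otimes>\<^bsub>PA n\<^esub> ypath n q) (s, as) = (\<Sum>(v, u)\<in>{(v, u). v @ u = w}.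
        (if u = replicate (length u) False then fps_nth p (length u) else 0) *
        (if v = replicate (length v) False then fps_nth q (length v) else 0))"
      unfolding w(2,3) PA_mult_word[OF w(1)] by (intro sum.cong refl) (auto simp: ypath_word w wend_less)
    also have "... = (if w = replicate (length w) False then fps_nth (p * q) (length w) else 0)"
    proof (cases "w = replicate (length w) False")
      case True
      have "(\<Sum>(v, u)\<in>{(v, u). v @ u = w}.
        (if u = replicate (length u) False then fps_nth p (length u) else 0) *
        (if v = replicate (length v) False then fps_nth q (length v) else 0)) =
        (\<Sum>i\<in>{0..length w}. fps_nth p i * fps_nth q (length w - i))"
      proof (rule sum.reindex_bij_witness[where
            i = "\<lambda>i. (replicate (length w - i) False, replicate i False)" and j = "\<lambda>(v, u). length u"])
        fix i assume "i \<in> {0..length w}"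
        then show "(replicate (length w - i) False, replicate i False) \<in> {(v, u). v @ u = w}"
          using True by (simp add: replicate_add[symmetric])
      next
        fix a assume "a \<in> {(v, u). v @ u = w}"
        then obtain v u where a: "a = (v, u)" "v @ u = w" by auto
        then have "set v \<subseteq> {False}" "set u \<subseteq> {False}" using True by (metis set_append set_replicate_conv_if Un_subset_iff order_refl empty_subsetI)+
        then have vu: "v = replicate (length v) False" "u = replicate (length u) False"
          by (metis replicate_eqI subsetD singletonD)+
        show "(replicate (length w - (case a of (v, u) \<Rightarrow> length u)) False,
             replicate (case a of (v, u) \<Rightarrow> length u) False) = a" using a vu by auto
        show "(case a of (v, u) \<Rightarrow> length u) \<in> {0..length w}" using a by auto
        show "fps_nth p (case a of (v, u) \<Rightarrow> length u) * fps_nth q (length w - (case a of (v, u) \<Rightarrow> length u)) =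
          (case a of (v, u) \<Rightarrow> (if u = replicate (length u) False then fps_nth p (length u) else 0) *
            (if v = replicate (length v) False then fps_nth q (length v) else 0))" using a vu by auto
      qed auto
      then show ?thesis using True by (simp add: fps_mult_nth)
    next
      case False
      have "(\<Sum>(v, u)\<in>{(v, u). v @ u = w}.
        (if u = replicate (length u) False then fps_nth p (length u) else 0) *
        (if v = replicate (length v) False then fps_nth q (length v) else 0)) = 0"
      proof (intro sum.neutral ballI, clarify)
        fix v u assume w: "w = v @ u"
        show "(if u = replicate (length u) False then fps_nth p (length u) else 0) *
          (if v = replicate (length v) False then fps_nth q (length v) else 0) = 0"
          using False unfolding w by (metis length_append mult_zero_left mult_zero_right replicate_add)
      qed
      then show ?thesis using False by simp
    qed
    also have "... = ypath n (p * q) (s, as)" by (simp add: w ypath_word)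
    finally show ?thesis by simp
  qed
qed

lemma ypath_add: "ypath n (p + q) = ypath n p \<oplus>\<^bsub>PA n\<^esub> ypath n q"
  by (auto simp: ypath_def PA_add)

lemma pmat_ypath:
  assumes "i < n" "j < n"
  shows "fps_nth (pmat n k (ypath n p) i j) m = (\<Sum>b | replicate b False \<in> wset n k i j m. fps_nth p b)"
proof -
  have "fps_nth (pmat n k (ypath n p) i j) m =
      (\<Sum>w\<in>wset n k i j m. if w = replicate (length w) False then fps_nth p (length w) else 0)"
    unfolding pmat_nth by (intro sum.cong refl) (simp add: ypath_word assms)
  also have "... = (\<Sum>w\<in>{w \<in> wset n k i j m. w = replicate (length w) False}. fps_nth p (length w))"
    using finite_wset[OF assms(2) k1 nk] by (simp add: sum.inter_filter)
  also have "... = (\<Sum>b | replicate b False \<in> wset n k i j m. fps_nth p b)"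
    by (rule sum.reindex_bij_witness[where i = "\<lambda>b. replicate b False" and j = length]) auto
  finally show ?thesis .
qed

lemma tiled_B_algebra:
  "tiled (B_algebra k n) n k (bmat k n) (B_scalar k n) (\<lambda>p. bcoset k n (ypath n p))"
proof (rule tiled.intro)
  interpret A: ring "PA n" by (rule PA_ring)
  show "ring (B_algebra k n)" unfolding B_algebra_def by (rule ideal.quotient_is_ring[OF bideal])
  have B_sc: "B_scalar k n c = bcoset k n (\<lambda>p. c * \<one>\<^bsub>PA n\<^esub> p)" for c
    by (simp add: B_scalar_def bcoset_def)
  show "1 < k" "2 * k \<le> n" by (rule k1, rule nk)
  show "B_scalar k n c \<in> carrier (B_algebra k n)" for c
    unfolding B_sc B_carrier using PA_scalar by blast
  show "bmat k n (B_scalar k n c) i j = (if i = j then fps_const c else 0)" if "i < n" "j < n" for i j c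
    unfolding B_sc using that by (simp add: bmat_coset PA_scalar pmat_scalar)
  show "bcoset k n (ypath n p) \<in> carrier (B_algebra k n)" for p
    unfolding B_carrier using ypath_carrier by blast
  show "bcoset k n (ypath n (p + q)) = bcoset k n (ypath n p) \<oplus>\<^bsub>B_algebra k n\<^esub> bcoset k n (ypath n q)" for p q
    by (simp add: B_add ypath_carrier ypath_add)
  show "bcoset k n (ypath n (p * q)) = bcoset k n (ypath n p) \<otimes>\<^bsub>B_algebra k n\<^esub> bcoset k n (ypath n q)" for p q
    by (simp add: B_mult ypath_carrier ypath_mult)
  show "fps_nth (bmat k n (bcoset k n (ypath n p)) i j) m = (\<Sum>b | replicate b False \<in> wset n k i j m. fps_nth p b)"
    if "i < n" "j < n" for i j p m
    using that by (simp add: bmat_coset ypath_carrier pmat_ypath)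
  show "bmat k n (a \<oplus>\<^bsub>B_algebra k n\<^esub> b) i j = bmat k n a i j + bmat k n b i j"
    if "a \<in> carrier (B_algebra k n)" "b \<in> carrier (B_algebra k n)" "i < n" "j < n" for a b i j
    using that unfolding B_carrier by (auto simp: B_add bmat_coset pmat_add)
  show "bmat k n (a \<otimes>\<^bsub>B_algebra k n\<^esub> b) i j = (\<Sum>l<n. bmat k n a i l * bmat k n b l j)"
    if "a \<in> carrier (B_algebra k n)" "b \<in> carrier (B_algebra k n)" "i < n" "j < n" for a b i j
    using that k1 nk unfolding B_carrier by (auto simp: B_mult bmat_coset pmat_mult)
  show "bmat k n \<one>\<^bsub>B_algebra k n\<^esub> i j = (if i = j then 1 else 0)" if "i < n" "j < n" for i j
    using that pmat_scalar[OF that, of 1] by (simp add: B_one bmat_coset)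
  show "a = b" if ab: "a \<in> carrier (B_algebra k n)" "b \<in> carrier (B_algebra k n)"
    and eq: "\<And>i j. i < n ==> j < n ==> bmat k n a i j = bmat k n b i j" for a b
  proof -
    obtain f g where fg: "f \<in> carrier (PA n)" "g \<in> carrier (PA n)" "a = bcoset k n f" "b = bcoset k n g"
      using ab unfolding B_carrier by auto
    show ?thesis unfolding fg(3,4)
      by (rule bcoset_eqI[OF fg(1,2)]) (use eq in \<open>simp add: fg bmat_coset\<close>)
  qed
  show "wset n k i j m \<noteq> {}"
    if a: "a \<in> carrier (B_algebra k n)" and ij: "i < n" "j < n" and nz: "fps_nth (bmat k n a i j) m \<noteq> 0" for a i j m
  proof -
    obtain f where f: "f \<in> carrier (PA n)" "a = bcoset k n f" using a unfolding B_carrier by auto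
    show ?thesis using nz f ij by (auto simp: bmat_coset pmat_nth)
  qed
  show "\<exists>a\<in>carrier (B_algebra k n). \<forall>i<n. \<forall>j<n. bmat k n a i j = \<beta> i j"
    if \<beta>: "\<And>i j m. [|i < n; j < n; fps_nth (\<beta> i j) m \<noteq> 0|] ==> wset n k i j m \<noteq> {}" for \<beta>
  proof -
    \<comment> \<open>Each coefficient of \<open>\<beta>\<close> is placed on one chosen walk with
      the right end and cost. The resulting combination of paths may be infinite, which the
      completion permits.\<close>
    define sel where "sel i j m = (SOME w. w \<in> wset n k i j m)" for i j m
    define f where "f = (\<lambda>(s, as). let j = nat s; w = dec as in
      if is_walk n s as \<and> w = sel (wend n w j) j (wcost n k w j) then fps_nth (\<beta> (wend n w j) j) (wcost n k w j) else 0)"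
    have f: "f \<in> carrier (PA n)" by (auto simp: PA_carrier f_def Let_def)
    have "pmat n k f i j = \<beta> i j" if ij: "i < n" "j < n" for i j
    proof (rule fps_ext)
      fix m
      have "fps_nth (pmat n k f i j) m = (\<Sum>w\<in>wset n k i j m. if w = sel i j m then fps_nth (\<beta> i j) m else 0)"
        unfolding pmat_nth using ij
        by (intro sum.cong refl) (auto simp: f_def Let_def dec_warr warr_walk wset_def)
      also have "... = (if sel i j m \<in> wset n k i j m then fps_nth (\<beta> i j) m else 0)"
        using finite_wset[OF ij(2) k1 nk] by simp
      also have "... = fps_nth (\<beta> i j) m"
        using \<beta>[OF ij, of m] by (auto simp: sel_def some_in_eq)
      finally show "fps_nth (pmat n k f i j) m = fps_nth (\<beta> i j) m" .
    qed
    then show ?thesis using f unfolding B_carrier by (auto simp: bmat_coset)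
  qed
qed

end

section \<open>Modules and homomorphisms\<close>

lemma (in abelian_monoid) finsum_single:
  assumes "finite A" "a \<in> A" "f a \<in> carrier G" "\<And>i. i \<in> A ==> i \<noteq> a ==> f i = \<zero>"
  shows "(\<Oplus>i\<in>A. f i) = f a"
proof -
  have "(\<Oplus>i\<in>A. f i) = (\<Oplus>i\<in>A. if a = i then f i else \<zero>)"
  proof (rule finsum_cong'[OF refl])
    show "(\<lambda>i. if a = i then f i else \<zero>) \<in> A \<rightarrow> carrier G"
      using assms(3) by auto
    fix i assume "i \<in> A"
    then show "f i = (if a = i then f i else \<zero>)" using assms(4) by auto
  qed
  also have "... = (\<Oplus>i\<in>A. if a = i then f a else \<zero>)"
    using assms(3) by (intro finsum_cong') auto
  also have "... = f a" using assms by (intro finsum_singleton) auto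
  finally show ?thesis .
qed

lemma (in abelian_group) diff_eq_zero_iff:
  assumes "x \<in> carrier G" "y \<in> carrier G"
  shows "x \<ominus> y = \<zero> \<longleftrightarrow> x = y"
proof
  assume "x \<ominus> y = \<zero>"
  then have "x = \<ominus> (\<ominus> y)" using assms by (intro minus_equality[symmetric]) (auto simp: a_minus_def)
  then show "x = y" using assms by simp
qed (use assms in \<open>simp add: a_minus_def r_neg\<close>)

lemma
  assumes "left_module R M"
  shows lm_ring: "ring R" and lm_grp: "abelian_group M"
    and lm_closed: "[|a \<in> carrier R; x \<in> carrier M|] ==> a \<odot>\<^sub>M x \<in> carrier M"
    and lm_l_distr: "[|a \<in> carrier R; b \<in> carrier R; x \<in> carrier M|] ==> (a \<oplus>\<^sub>R b) \<odot>\<^sub>M x = a \<odot>\<^sub>M x \<oplus>\<^sub>M b \<odot>\<^sub>M x"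
    and lm_r_distr: "[|a \<in> carrier R; x \<in> carrier M; y \<in> carrier M|] ==> a \<odot>\<^sub>M (x \<oplus>\<^sub>M y) = a \<odot>\<^sub>M x \<oplus>\<^sub>M a \<odot>\<^sub>M y"
    and lm_assoc: "[|a \<in> carrier R; b \<in> carrier R; x \<in> carrier M|] ==> (a \<otimes>\<^bsub>R\<^esub> b) \<odot>\<^sub>M x = a \<odot>\<^sub>M (b \<odot>\<^sub>M x)"
    and lm_one: "x \<in> carrier M ==> \<one>\<^bsub>R\<^esub> \<odot>\<^sub>M x = x"
  by (fact left_module.axioms(1)[OF assms] left_module.axioms(2)[OF assms]
      left_module.smult_closed[OF assms] left_module.smult_l_distr[OF assms] left_module.smult_r_distr[OF assms]
      left_module.smult_assoc[OF assms] left_module.smult_one[OF assms])+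

lemma
  assumes M: "left_module R M"
  shows lm_zero_l: "x \<in> carrier M ==> \<zero>\<^sub>R \<odot>\<^sub>M x = \<zero>\<^sub>M"
    and lm_zero_r: "a \<in> carrier R ==> a \<odot>\<^sub>M \<zero>\<^sub>M = \<zero>\<^sub>M"
    and lm_minus_r: "[|a \<in> carrier R; x \<in> carrier M|] ==> a \<odot>\<^sub>M (\<ominus>\<^bsub>M\<^esub> x) = \<ominus>\<^bsub>M\<^esub> (a \<odot>\<^sub>M x)"
    and lm_minus_l: "[|a \<in> carrier R; x \<in> carrier M|] ==> (\<ominus>\<^bsub>R\<^esub> a) \<odot>\<^sub>M x = \<ominus>\<^bsub>M\<^esub> (a \<odot>\<^sub>M x)"
proof -
  interpret R: ring R by (rule lm_ring[OF M])
  interpret M: abelian_group M by (rule lm_grp[OF M])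
  note c = lm_closed[OF M]
  show z: "\<zero>\<^sub>R \<odot>\<^sub>M x = \<zero>\<^sub>M" if "x \<in> carrier M" for x
  proof -
    have "\<zero>\<^sub>R \<odot>\<^sub>M x \<oplus>\<^sub>M \<zero>\<^sub>R \<odot>\<^sub>M x = \<zero>\<^sub>R \<odot>\<^sub>M x" using lm_l_distr[OF M, of "\<zero>\<^sub>R" "\<zero>\<^sub>R" x] that by simp
    then show ?thesis using M.add.r_cancel_one c that by simp
  qed
  show z': "a \<odot>\<^sub>M \<zero>\<^sub>M = \<zero>\<^sub>M" if "a \<in> carrier R" for a
  proof -
    have "a \<odot>\<^sub>M \<zero>\<^sub>M \<oplus>\<^sub>M a \<odot>\<^sub>M \<zero>\<^sub>M = a \<odot>\<^sub>M \<zero>\<^sub>M" using lm_r_distr[OF M, of a "\<zero>\<^sub>M" "\<zero>\<^sub>M"] that by simp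
    then show ?thesis using M.add.r_cancel_one c that by simp
  qed
  show "a \<odot>\<^sub>M (\<ominus>\<^bsub>M\<^esub> x) = \<ominus>\<^bsub>M\<^esub> (a \<odot>\<^sub>M x)" if "a \<in> carrier R" "x \<in> carrier M" for a x
    using that lm_r_distr[OF M, of a "\<ominus>\<^bsub>M\<^esub> x" x] z' c by (intro M.minus_equality[symmetric]) (auto simp: M.l_neg)
  show "(\<ominus>\<^bsub>R\<^esub> a) \<odot>\<^sub>M x = \<ominus>\<^bsub>M\<^esub> (a \<odot>\<^sub>M x)" if "a \<in> carrier R" "x \<in> carrier M" for a x
    using that lm_l_distr[OF M, of "\<ominus>\<^bsub>R\<^esub> a" a x] z c by (intro M.minus_equality[symmetric]) (auto simp: R.l_neg)
qed

lemma lm_diff_r: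
  assumes M: "left_module R M" and "a \<in> carrier R" "x \<in> carrier M" "y \<in> carrier M"
  shows "a \<odot>\<^sub>M (x \<ominus>\<^bsub>M\<^esub> y) = a \<odot>\<^sub>M x \<ominus>\<^bsub>M\<^esub> a \<odot>\<^sub>M y"
proof -
  interpret M: abelian_group M by (rule lm_grp[OF M])
  show ?thesis using assms by (simp add: a_minus_def lm_r_distr[OF M] lm_minus_r[OF M])
qed

lemma lm_finsum_r:
  assumes M: "left_module R M" and "finite A" "a \<in> carrier R" "\<And>i. i \<in> A ==> f i \<in> carrier M"
  shows "a \<odot>\<^sub>M (\<Oplus>\<^bsub>M\<^esub> i\<in>A. f i) = (\<Oplus>\<^bsub>M\<^esub> i\<in>A. a \<odot>\<^sub>M f i)"
proof -
  interpret M: abelian_group M by (rule lm_grp[OF M])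
  show ?thesis using assms(2,4)
  proof (induction A rule: finite_induct)
    case empty then show ?case using lm_zero_r[OF M] assms by simp
  next
    case (insert i A)
    then show ?case using assms(3) lm_closed[OF M] by (simp add: M.finsum_insert Pi_def lm_r_distr[OF M] M.finsum_closed)
  qed
qed

lemma lm_finsum_l:
  assumes M: "left_module R M" and "finite A" "x \<in> carrier M" "\<And>i. i \<in> A ==> f i \<in> carrier R"
  shows "(\<Oplus>\<^bsub>R\<^esub> i\<in>A. f i) \<odot>\<^sub>M x = (\<Oplus>\<^bsub>M\<^esub> i\<in>A. f i \<odot>\<^sub>M x)"
proof -
  interpret R: ring R by (rule lm_ring[OF M])
  interpret M: abelian_group M by (rule lm_grp[OF M])
  show ?thesis using assms(2,4)
  proof (induction A rule: finite_induct)
    case empty then show ?case using lm_zero_l[OF M] assms by simp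
  next
    case (insert i A)
    then show ?case using assms(3) lm_closed[OF M]
      by (simp add: M.finsum_insert R.finsum_insert Pi_def lm_l_distr[OF M] R.finsum_closed)
  qed
qed

lemma left_moduleI:
  assumes "ring R" "abelian_group M"
    and "\<And>a x. [|a \<in> carrier R; x \<in> carrier M|] ==> a \<odot>\<^sub>M x \<in> carrier M"
    and "\<And>a b x. [|a \<in> carrier R; b \<in> carrier R; x \<in> carrier M|] ==> (a \<oplus>\<^sub>R b) \<odot>\<^sub>M x = a \<odot>\<^sub>M x \<oplus>\<^sub>M b \<odot>\<^sub>M x"
    and "\<And>a x y. [|a \<in> carrier R; x \<in> carrier M; y \<in> carrier M|] ==> a \<odot>\<^sub>M (x \<oplus>\<^sub>M y) = a \<odot>\<^sub>M x \<oplus>\<^sub>M a \<odot>\<^sub>M y"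
    and "\<And>a b x. [|a \<in> carrier R; b \<in> carrier R; x \<in> carrier M|] ==> (a \<otimes>\<^bsub>R\<^esub> b) \<odot>\<^sub>M x = a \<odot>\<^sub>M (b \<odot>\<^sub>M x)"
    and "\<And>x. x \<in> carrier M ==> \<one>\<^bsub>R\<^esub> \<odot>\<^sub>M x = x"
  shows "left_module R M"
  by (intro left_module.intro left_module_axioms.intro assms)

lemma HomI:
  assumes "\<And>x. x \<in> carrier M ==> f x \<in> carrier N" "\<And>x. x \<notin> carrier M ==> f x = undefined"
    and "\<And>x y. [|x \<in> carrier M; y \<in> carrier M|] ==> f (x \<oplus>\<^sub>M y) = f x \<oplus>\<^sub>N f y"
    and "\<And>r x. [|r \<in> carrier R; x \<in> carrier M|] ==> f (r \<odot>\<^sub>M x) = r \<odot>\<^sub>N f x"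
  shows "f \<in> Hom R M N"
  using assms by (auto simp: Hom_def PiE_iff extensional_def)

lemma
  assumes "f \<in> Hom R M N"
  shows Hom_closed: "x \<in> carrier M ==> f x \<in> carrier N"
    and Hom_undef: "x \<notin> carrier M ==> f x = undefined"
    and Hom_add: "[|x \<in> carrier M; y \<in> carrier M|] ==> f (x \<oplus>\<^sub>M y) = f x \<oplus>\<^sub>N f y"
    and Hom_smult: "[|r \<in> carrier R; x \<in> carrier M|] ==> f (r \<odot>\<^sub>M x) = r \<odot>\<^sub>N f x"
  using assms by (auto simp: Hom_def PiE_iff extensional_def)

lemma Hom_eqI:
  assumes "f \<in> Hom R M N" "g \<in> Hom R M N" "\<And>x. x \<in> carrier M ==> f x = g x"
  shows "f = g"
  using assms Hom_undef by (metis ext)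

context
  fixes R :: "'r ring" and M :: "('r, 'm) module" and N :: "('r, 'n) module" and f
  assumes M: "left_module R M" and N: "left_module R N" and f: "f \<in> Hom R M N"
begin

lemma Hom_zero: "f \<zero>\<^sub>M = \<zero>\<^sub>N"
proof -
  interpret M: abelian_group M by (rule lm_grp[OF M])
  interpret N: abelian_group N by (rule lm_grp[OF N])
  have "f \<zero>\<^sub>M \<oplus>\<^sub>N f \<zero>\<^sub>M = f \<zero>\<^sub>M" using Hom_add[OF f, of "\<zero>\<^sub>M" "\<zero>\<^sub>M"] by simp
  then show ?thesis using N.add.r_cancel_one Hom_closed[OF f] by simp
qed

lemma Hom_minus: "x \<in> carrier M ==> f (\<ominus>\<^bsub>M\<^esub> x) = \<ominus>\<^bsub>N\<^esub> f x"
proof -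
  interpret M: abelian_group M by (rule lm_grp[OF M])
  interpret N: abelian_group N by (rule lm_grp[OF N])
  assume x: "x \<in> carrier M"
  have "f (\<ominus>\<^bsub>M\<^esub> x) \<oplus>\<^sub>N f x = \<zero>\<^sub>N" using Hom_add[OF f, of "\<ominus>\<^bsub>M\<^esub> x" x] x Hom_zero by (simp add: M.l_neg)
  then show ?thesis using Hom_closed[OF f] x by (simp add: N.minus_equality[symmetric])
qed

lemma Hom_diff: "[|x \<in> carrier M; y \<in> carrier M|] ==> f (x \<ominus>\<^bsub>M\<^esub> y) = f x \<ominus>\<^bsub>N\<^esub> f y"
proof -
  interpret M: abelian_group M by (rule lm_grp[OF M])
  assume "x \<in> carrier M" "y \<in> carrier M"
  then show ?thesis by (simp add: a_minus_def Hom_add[OF f] Hom_minus)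
qed

lemma Hom_finsum:
  assumes "finite A" "\<And>i. i \<in> A ==> g i \<in> carrier M"
  shows "f (\<Oplus>\<^bsub>M\<^esub> i\<in>A. g i) = (\<Oplus>\<^bsub>N\<^esub> i\<in>A. f (g i))"
proof -
  interpret M: abelian_group M by (rule lm_grp[OF M])
  interpret N: abelian_group N by (rule lm_grp[OF N])
  show ?thesis using assms
  proof (induction A rule: finite_induct)
    case empty then show ?case using Hom_zero by simp
  next
    case (insert i A)
    then show ?case using Hom_closed[OF f] by (simp add: M.finsum_insert N.finsum_insert Pi_def Hom_add[OF f] M.finsum_closed)
  qed
qed

end

lemma Hom_compose:
  assumes M: "left_module R M" and "f \<in> Hom R M N" "g \<in> Hom R N L"
  shows "compose (carrier M) g f \<in> Hom R M L"
  using assms(2,3) lm_closed[OF M] abelian_monoid.a_closed[OF abelian_group.axioms(1)[OF lm_grp[OF M]]]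
  by (auto simp: Hom_def PiE_iff compose_def)

lemma Hom_id: "left_module R M ==> hom_id M \<in> Hom R M M"
  using lm_closed abelian_group.axioms lm_grp
  by (fastforce simp: Hom_def hom_id_def PiE_iff abelian_monoid.a_closed)

lemma compose_assoc':
  assumes "f \<in> Hom R M N"
  shows "compose (carrier M) h (compose (carrier M) g f) = compose (carrier M) (compose (carrier N) h g) f"
  using assms by (auto simp: Hom_def compose_def fun_eq_iff)

lemma compose_id:
  assumes "f \<in> Hom R M N"
  shows "compose (carrier M) (hom_id N) f = f" "compose (carrier M) f (hom_id M) = f"
  using assms by (auto simp: Hom_def compose_def hom_id_def fun_eq_iff PiE_iff extensional_def)

lemma hom_add_closed:
  assumes M: "left_module R M" and N: "left_module R N" and "f \<in> Hom R M N" "g \<in> Hom R M N"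
  shows "hom_add M N f g \<in> Hom R M N"
proof -
  interpret M: abelian_group M by (rule lm_grp[OF M])
  interpret N: abelian_group N by (rule lm_grp[OF N])
  show ?thesis
    using Hom_closed[OF assms(3)] Hom_closed[OF assms(4)]
    by (intro HomI) (auto simp: hom_add_def Hom_add[OF assms(3)] Hom_add[OF assms(4)] Hom_smult[OF assms(3)]
      Hom_smult[OF assms(4)] lm_closed[OF M] lm_r_distr[OF N] N.a_ac)
qed

lemma hom_diff_closed:
  assumes M: "left_module R M" and N: "left_module R N" and "f \<in> Hom R M N" "g \<in> Hom R M N"
  shows "hom_diff M N f g \<in> Hom R M N"
proof -
  interpret M: abelian_group M by (rule lm_grp[OF M])
  interpret N: abelian_group N by (rule lm_grp[OF N])
  show ?thesis
    using Hom_closed[OF assms(3)] Hom_closed[OF assms(4)]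
    by (intro HomI) (auto simp: hom_diff_def Hom_add[OF assms(3)] Hom_add[OF assms(4)] Hom_smult[OF assms(3)]
      Hom_smult[OF assms(4)] lm_closed[OF M] lm_diff_r[OF N], auto simp: N.a_ac N.minus_add a_minus_def)
qed

lemma hom_diff_self: "left_module R N ==> f \<in> Hom R M N ==> hom_diff M N f f = (\<lambda>x\<in>carrier M. \<zero>\<^sub>N)"
proof -
  assume N: "left_module R N" and f: "f \<in> Hom R M N"
  interpret N: abelian_group N by (rule lm_grp[OF N])
  show ?thesis using Hom_closed[OF f] by (auto simp: hom_diff_def fun_eq_iff N.diff_eq_zero_iff)
qed

definition lm_iso :: "'r ring \<Rightarrow> ('r, 'm) module \<Rightarrow> ('r, 'n) module \<Rightarrow> ('m \<Rightarrow> 'n) \<Rightarrow> ('n \<Rightarrow> 'm) \<Rightarrow> bool" where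
  "lm_iso R M N f g \<longleftrightarrow> f \<in> Hom R M N \<and> g \<in> Hom R N M \<and>
     (\<forall>x\<in>carrier M. g (f x) = x) \<and> (\<forall>y\<in>carrier N. f (g y) = y)"

lemma lm_iso_bij:
  assumes M: "left_module R M" and N: "left_module R N" and f: "f \<in> Hom R M N" and b: "bij_betw f (carrier M) (carrier N)"
  shows "lm_iso R M N f (\<lambda>y\<in>carrier N. the_inv_into (carrier M) f y)"
proof -
  interpret M: abelian_group M by (rule lm_grp[OF M])
  interpret N: abelian_group N by (rule lm_grp[OF N])
  let ?g = "the_inv_into (carrier M) f"
  have inj: "inj_on f (carrier M)" and im: "f ` carrier M = carrier N" using b by (auto simp: bij_betw_def)
  have g: "?g y \<in> carrier M" "f (?g y) = y" if "y \<in> carrier N" for y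
    using that im inj by (auto intro: the_inv_into_into f_the_inv_into_f)
  have gf: "?g (f x) = x" if "x \<in> carrier M" for x using that inj by (rule the_inv_into_f_f[rotated])
  have "(\<lambda>y\<in>carrier N. ?g y) \<in> Hom R N M"
  proof (rule HomI)
    fix x y assume "x \<in> carrier N" "y \<in> carrier N"
    then show "(\<lambda>y\<in>carrier N. ?g y) (x \<oplus>\<^sub>N y) = (\<lambda>y\<in>carrier N. ?g y) x \<oplus>\<^sub>M (\<lambda>y\<in>carrier N. ?g y) y"
      using Hom_add[OF f, of "?g x" "?g y"] g gf[of "?g x \<oplus>\<^sub>M ?g y"] by simp
  next
    fix r x assume "r \<in> carrier R" "x \<in> carrier N"
    then show "(\<lambda>y\<in>carrier N. ?g y) (r \<odot>\<^sub>N x) = r \<odot>\<^sub>M (\<lambda>y\<in>carrier N. ?g y) x"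
      using Hom_smult[OF f, of r "?g x"] g gf[of "r \<odot>\<^sub>M ?g x"] lm_closed[OF M] lm_closed[OF N] by simp
  qed (auto simp: g)
  then show ?thesis using f g gf Hom_closed[OF f] by (simp add: lm_iso_def)
qed

lemma free_over_center_iso:
  assumes M: "left_module R M" and N: "left_module R N" and iso: "lm_iso R M N f g" and "free_over_center R M"
  shows "free_over_center R N"
proof -
  have f: "f \<in> Hom R M N" and g: "g \<in> Hom R N M" and gf: "\<And>x. x \<in> carrier M ==> g (f x) = x"
    and fg: "\<And>y. y \<in> carrier N ==> f (g y) = y" using iso by (auto simp: lm_iso_def)
  obtain m e where e: "e \<in> {..<m::nat} \<rightarrow> carrier M"
    and ex: "\<forall>x\<in>carrier M. \<exists>!a. a \<in> {..<m} \<rightarrow>\<^sub>E ring_center R \<and> x = (\<Oplus>\<^bsub>M\<^esub> i\<in>{..<m}. a i \<odot>\<^sub>M e i)"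
    using assms(4) by (auto simp: free_over_center_def)
  have ec: "e i \<in> carrier M" if "i < m" for i using e that by auto
  have cen: "a i \<in> carrier R" if "a \<in> {..<m} \<rightarrow>\<^sub>E ring_center R" "i < m" for a i
    using that by (auto simp: ring_center_def PiE_iff)
  have eq: "f (\<Oplus>\<^bsub>M\<^esub> i\<in>{..<m}. a i \<odot>\<^sub>M e i) = (\<Oplus>\<^bsub>N\<^esub> i\<in>{..<m}. a i \<odot>\<^sub>N f (e i))"
    if a: "a \<in> {..<m} \<rightarrow>\<^sub>E ring_center R" for a
  proof -
    have "f (\<Oplus>\<^bsub>M\<^esub> i\<in>{..<m}. a i \<odot>\<^sub>M e i) = (\<Oplus>\<^bsub>N\<^esub> i\<in>{..<m}. f (a i \<odot>\<^sub>M e i))"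
      using e cen[OF a] by (intro Hom_finsum[OF M N f]) (auto intro!: lm_closed[OF M])
    also have "... = (\<Oplus>\<^bsub>N\<^esub> i\<in>{..<m}. a i \<odot>\<^sub>N f (e i))"
      using ec cen[OF a] Hom_closed[OF f] Hom_smult[OF f]
      by (intro abelian_monoid.finsum_cong' abelian_group.axioms lm_grp[OF N]) (auto intro!: lm_closed[OF N])
    finally show ?thesis .
  qed
  have "\<exists>!a. a \<in> {..<m} \<rightarrow>\<^sub>E ring_center R \<and> y = (\<Oplus>\<^bsub>N\<^esub> i\<in>{..<m}. a i \<odot>\<^sub>N f (e i))" if y: "y \<in> carrier N" for y
  proof -
    have cl: "(\<Oplus>\<^bsub>M\<^esub> i\<in>{..<m}. a i \<odot>\<^sub>M e i) \<in> carrier M" if "a \<in> {..<m} \<rightarrow>\<^sub>E ring_center R" for a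
      using e cen[OF that] by (intro abelian_monoid.finsum_closed abelian_group.axioms lm_grp[OF M]) (auto intro!: lm_closed[OF M])
    have "(y = (\<Oplus>\<^bsub>N\<^esub> i\<in>{..<m}. a i \<odot>\<^sub>N f (e i))) \<longleftrightarrow> g y = (\<Oplus>\<^bsub>M\<^esub> i\<in>{..<m}. a i \<odot>\<^sub>M e i)"
      if "a \<in> {..<m} \<rightarrow>\<^sub>E ring_center R" for a
      using eq[OF that] fg[OF y] gf[OF cl[OF that]] by metis
    then have "(a \<in> {..<m} \<rightarrow>\<^sub>E ring_center R \<and> y = (\<Oplus>\<^bsub>N\<^esub> i\<in>{..<m}. a i \<odot>\<^sub>N f (e i))) \<longleftrightarrow>
        (a \<in> {..<m} \<rightarrow>\<^sub>E ring_center R \<and> g y = (\<Oplus>\<^bsub>M\<^esub> i\<in>{..<m}. a i \<odot>\<^sub>M e i))" for a by blast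
    then show ?thesis using bspec[OF ex Hom_closed[OF g y]] by presburger
  qed
  moreover have "(\<lambda>i. f (e i)) \<in> {..<m} \<rightarrow> carrier N" using e Hom_closed[OF f] by auto
  ultimately show ?thesis unfolding free_over_center_def by (intro exI[of _ m] exI[of _ "\<lambda>i. f (e i)"]) auto
qed

lemma CM_iso:
  assumes "M \<in> CM R" "left_module R N" "lm_iso R M N f g"
  shows "N \<in> CM R"
  using assms free_over_center_iso by (auto simp: CM_def)

definition transp :: "('r, 'm) module \<Rightarrow> ('m \<Rightarrow> 'n) \<Rightarrow> ('r, 'n) module" where
  "transp M \<phi> = (let \<psi> = the_inv_into (carrier M) \<phi> in
     \<lparr>carrier = \<phi> ` carrier M, monoid.mult = undefined, one = undefined, zero = \<phi> \<zero>\<^sub>M,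
      add = (\<lambda>a b. \<phi> (\<psi> a \<oplus>\<^sub>M \<psi> b)), smult = (\<lambda>r a. \<phi> (r \<odot>\<^sub>M \<psi> a))\<rparr>)"

lemma transp_iso:
  assumes M: "left_module R M" and inj: "inj_on \<phi> (carrier M)"
  shows "left_module R (transp M \<phi>)" and "\<exists>f g. lm_iso R M (transp M \<phi>) f g"
proof -
  interpret M: abelian_group M by (rule lm_grp[OF M])
  define \<psi> where "\<psi> = the_inv_into (carrier M) \<phi>"
  have \<psi>: "\<psi> (\<phi> x) = x" if "x \<in> carrier M" for x unfolding \<psi>_def using inj that by (rule the_inv_into_f_f)
  have T: "carrier (transp M \<phi>) = \<phi> ` carrier M" "\<zero>\<^bsub>transp M \<phi>\<^esub> = \<phi> \<zero>\<^sub>M"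
    "add (transp M \<phi>) = (\<lambda>a b. \<phi> (\<psi> a \<oplus>\<^sub>M \<psi> b))" "smult (transp M \<phi>) = (\<lambda>r a. \<phi> (r \<odot>\<^sub>M \<psi> a))"
    by (simp_all add: transp_def Let_def \<psi>_def)
  show L: "left_module R (transp M \<phi>)"
  proof (rule left_moduleI)
    show "ring R" by (rule lm_ring[OF M])
    show "abelian_group (transp M \<phi>)"
    proof (rule abelian_groupI)
      fix x assume "x \<in> carrier (transp M \<phi>)"
      then obtain x' where "x' \<in> carrier M" "x = \<phi> x'" by (auto simp: T)
      then show "\<exists>y\<in>carrier (transp M \<phi>). y \<oplus>\<^bsub>transp M \<phi>\<^esub> x = \<zero>\<^bsub>transp M \<phi>\<^esub>"
        by (intro bexI[of _ "\<phi> (\<ominus>\<^bsub>M\<^esub> x')"]) (auto simp: T \<psi> M.l_neg)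
    qed (auto simp: T \<psi> M.a_ac)
  qed (auto simp: T \<psi> lm_closed[OF M] lm_l_distr[OF M] lm_r_distr[OF M] lm_assoc[OF M] lm_one[OF M])
  have "(\<lambda>x\<in>carrier M. \<phi> x) \<in> Hom R M (transp M \<phi>)"
    by (rule HomI) (auto simp: T \<psi> lm_closed[OF M])
  moreover have "bij_betw (\<lambda>x\<in>carrier M. \<phi> x) (carrier M) (carrier (transp M \<phi>))"
    using inj by (auto simp: bij_betw_def T inj_on_def)
  ultimately show "\<exists>f g. lm_iso R M (transp M \<phi>) f g" using lm_iso_bij[OF M L] by blast
qed

text \<open>The coordinates with respect to a basis over the center embed the carrier in
  \<open>nat \<Rightarrow> 'r\<close>, along which the structure is transported. This brings a
  module on an arbitrary type into the range of the quantifiers of the definitions.\<close>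

lemma fmodule_copy:
  assumes "M \<in> CM R"
  shows "\<exists>(N :: 'r fmodule) f g. N \<in> CM R \<and> lm_iso R M N f g"
proof -
  have M: "left_module R M" and "free_over_center R M" using assms by (auto simp: CM_def)
  then obtain m e where ex: "\<forall>x\<in>carrier M. \<exists>!a. a \<in> {..<m::nat} \<rightarrow>\<^sub>E ring_center R \<and> x = (\<Oplus>\<^bsub>M\<^esub> i\<in>{..<m}. a i \<odot>\<^sub>M e i)"
    by (auto simp: free_over_center_def)
  define \<phi> where "\<phi> x = (THE a. a \<in> {..<m::nat} \<rightarrow>\<^sub>E ring_center R \<and> x = (\<Oplus>\<^bsub>M\<^esub> i\<in>{..<m}. a i \<odot>\<^sub>M e i))" for x
  have "x = (\<Oplus>\<^bsub>M\<^esub> i\<in>{..<m}. \<phi> x i \<odot>\<^sub>M e i)" if "x \<in> carrier M" for x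
    using theI'[OF bspec[OF ex that]] by (simp add: \<phi>_def)
  then have "inj_on \<phi> (carrier M)" by (intro inj_onI) metis
  from transp_iso[OF M this] CM_iso[OF assms] show ?thesis by metis
qed

lemma submodule_left_module:
  assumes M: "left_module R M" and "S \<subseteq> carrier M" "\<zero>\<^sub>M \<in> S"
    and "\<And>x y. x \<in> S ==> y \<in> S ==> x \<oplus>\<^sub>M y \<in> S" "\<And>r x. r \<in> carrier R ==> x \<in> S ==> r \<odot>\<^sub>M x \<in> S"
  shows "left_module R (M\<lparr>carrier := S\<rparr>)"
proof -
  interpret R: ring R by (rule lm_ring[OF M])
  interpret M: abelian_group M by (rule lm_grp[OF M])
  show ?thesis
  proof (rule left_moduleI)
    show "abelian_group (M\<lparr>carrier := S\<rparr>)"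
    proof (rule abelian_groupI)
      fix x assume "x \<in> carrier (M\<lparr>carrier := S\<rparr>)"
      then have x: "x \<in> S" "x \<in> carrier M" using assms by auto
      have "(\<ominus>\<^bsub>R\<^esub> \<one>\<^bsub>R\<^esub>) \<odot>\<^sub>M x = \<ominus>\<^bsub>M\<^esub> x" using x by (simp add: lm_minus_l[OF M] lm_one[OF M])
      then have "\<ominus>\<^bsub>M\<^esub> x \<in> S" using assms(5)[OF _ x(1), of "\<ominus>\<^bsub>R\<^esub> \<one>\<^bsub>R\<^esub>"] by simp
      then show "\<exists>y\<in>carrier (M\<lparr>carrier := S\<rparr>). y \<oplus>\<^bsub>M\<lparr>carrier := S\<rparr>\<^esub> x = \<zero>\<^bsub>M\<lparr>carrier := S\<rparr>\<^esub>"
        using x by (intro bexI[of _ "\<ominus>\<^bsub>M\<^esub> x"]) (auto simp: M.l_neg)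
    qed (use assms in \<open>auto simp: subset_iff M.a_ac\<close>)
  qed (use assms in \<open>auto simp: subset_iff lm_l_distr[OF M] lm_r_distr[OF M] lm_assoc[OF M] lm_one[OF M] R.ring_axioms\<close>)
qed

section \<open>Free modules and the stable category\<close>

text \<open>The direct sum of the left ideals \<open>R u_s\<close>, \<open>s < N\<close>, as
  functions with support below \<open>N\<close>; free of rank \<open>N\<close> if all
  \<open>u s\<close> are 1.\<close>

definition fmod :: "'r ring \<Rightarrow> nat \<Rightarrow> (nat \<Rightarrow> 'r) \<Rightarrow> 'r fmodule" where
  "fmod R N u = \<lparr>carrier = {p. (\<forall>s<N. p s \<in> carrier R \<and> p s \<otimes>\<^bsub>R\<^esub> u s = p s) \<and> (\<forall>s\<ge>N. p s = \<zero>\<^sub>R)},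
     monoid.mult = undefined, one = undefined, zero = (\<lambda>_. \<zero>\<^sub>R), add = (\<lambda>p q s. p s \<oplus>\<^sub>R q s),
     smult = (\<lambda>r p s. r \<otimes>\<^bsub>R\<^esub> p s)\<rparr>"

definition fvec :: "'r ring \<Rightarrow> (nat \<Rightarrow> 'r) \<Rightarrow> nat \<Rightarrow> nat \<Rightarrow> 'r" where
  "fvec R u s = (\<lambda>i. if i = s then u s else \<zero>\<^sub>R)"

definition flin :: "'r ring \<Rightarrow> nat \<Rightarrow> (nat \<Rightarrow> 'r) \<Rightarrow> ('r, 'm) module \<Rightarrow> (nat \<Rightarrow> 'm) \<Rightarrow> (nat \<Rightarrow> 'r) \<Rightarrow> 'm" where
  "flin R N u L \<xi> = (\<lambda>p\<in>carrier (fmod R N u). \<Oplus>\<^bsub>L\<^esub> s\<in>{..<N}. p s \<odot>\<^sub>L \<xi> s)"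

context
  fixes R :: "'r ring" (structure) and N :: nat and u :: "nat \<Rightarrow> 'r"
  assumes R: "ring R" and u: "\<And>s. s < N ==> u s \<in> carrier R" "\<And>s. s < N ==> u s \<otimes> u s = u s"
begin

interpretation R: ring R by (rule R)

lemma fmod_carrier: "p \<in> carrier (fmod R N u) \<longleftrightarrow> (\<forall>s<N. p s \<in> carrier R \<and> p s \<otimes> u s = p s) \<and> (\<forall>s\<ge>N. p s = \<zero>)"
  and fmod_add: "p \<oplus>\<^bsub>fmod R N u\<^esub> q = (\<lambda>s. p s \<oplus> q s)"
  and fmod_zero: "\<zero>\<^bsub>fmod R N u\<^esub> = (\<lambda>_. \<zero>)"
  and fmod_smult: "r \<odot>\<^bsub>fmod R N u\<^esub> p = (\<lambda>s. r \<otimes> p s)"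
  by (simp_all add: fmod_def)

lemma fmod_closed: "p \<in> carrier (fmod R N u) ==> p s \<in> carrier R"
  by (cases "s < N") (auto simp: fmod_carrier)

lemma fmod_module: "left_module R (fmod R N u)"
proof (rule left_moduleI[OF R])
  show "abelian_group (fmod R N u)"
  proof (rule abelian_groupI)
    fix p assume p: "p \<in> carrier (fmod R N u)"
    then show "\<exists>q\<in>carrier (fmod R N u). q \<oplus>\<^bsub>fmod R N u\<^esub> p = \<zero>\<^bsub>fmod R N u\<^esub>"
      by (intro bexI[of _ "\<lambda>s. \<ominus> p s"])
         (auto simp: fmod_add fmod_zero fmod_carrier R.l_neg R.l_minus u fmod_closed fun_eq_iff)
  qed (auto simp: fmod_add fmod_zero fmod_carrier fun_eq_iff R.a_ac R.l_distr u fmod_closed)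
qed (auto simp: fmod_add fmod_zero fmod_smult fmod_carrier fun_eq_iff R.l_distr R.r_distr R.m_assoc u fmod_closed)

lemma fmod_finsum_apply:
  assumes "finite A" "\<And>i. i \<in> A ==> g i \<in> carrier (fmod R N u)"
  shows "(\<Oplus>\<^bsub>fmod R N u\<^esub> i\<in>A. g i) t = (\<Oplus> i\<in>A. g i t)"
proof -
  interpret F: abelian_group "fmod R N u" by (rule lm_grp[OF fmod_module])
  show ?thesis using assms
  proof (induction A rule: finite_induct)
    case empty then show ?case by (simp add: fmod_zero)
  next
    case (insert i A)
    then show ?case by (simp add: F.finsum_insert R.finsum_insert Pi_def fmod_add fmod_closed)
  qed
qed

lemma fvec_closed: "s < N ==> fvec R u s \<in> carrier (fmod R N u)"
  by (auto simp: fmod_carrier fvec_def u)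

lemma fmod_expand:
  assumes p: "p \<in> carrier (fmod R N u)"
  shows "p = (\<Oplus>\<^bsub>fmod R N u\<^esub> s\<in>{..<N}. p s \<odot>\<^bsub>fmod R N u\<^esub> fvec R u s)"
proof
  fix t
  have "(\<Oplus>\<^bsub>fmod R N u\<^esub> s\<in>{..<N}. p s \<odot>\<^bsub>fmod R N u\<^esub> fvec R u s) t =
      (\<Oplus> s\<in>{..<N}. (p s \<odot>\<^bsub>fmod R N u\<^esub> fvec R u s) t)"
    using p by (intro fmod_finsum_apply) (auto intro!: lm_closed[OF fmod_module] fvec_closed fmod_closed)
  also have "... = (\<Oplus> s\<in>{..<N}. if s = t then p t else \<zero>)"
    using p by (intro R.finsum_cong') (auto simp: fmod_smult fvec_def fmod_carrier)
  also have "... = p t"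
  proof (cases "t < N")
    case True
    then show ?thesis using p by (subst R.finsum_single[of _ t]) (auto simp: fmod_closed)
  next
    case False
    have "(\<Oplus> s\<in>{..<N}. if s = t then p t else \<zero>) = (\<Oplus> s\<in>{..<N}. \<zero>)"
      using False p by (intro R.finsum_cong') auto
    then show ?thesis using p False by (simp add: fmod_carrier)
  qed
  finally show "p t = (\<Oplus>\<^bsub>fmod R N u\<^esub> s\<in>{..<N}. p s \<odot>\<^bsub>fmod R N u\<^esub> fvec R u s) t" by simp
qed

lemma flin_Hom:
  assumes L: "left_module R L" and \<xi>: "\<And>s. s < N ==> \<xi> s \<in> carrier L"
  shows "flin R N u L \<xi> \<in> Hom R (fmod R N u) L"
proof -
  interpret L: abelian_group L by (rule lm_grp[OF L])
  interpret F: abelian_group "fmod R N u" by (rule lm_grp[OF fmod_module])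
  have t: "p s \<odot>\<^sub>L \<xi> s \<in> carrier L" if "p \<in> carrier (fmod R N u)" "s < N" for p s
    using that \<xi> by (intro lm_closed[OF L]) (auto simp: fmod_closed)
  show ?thesis
  proof (rule HomI)
    fix p q assume p: "p \<in> carrier (fmod R N u)" and q: "q \<in> carrier (fmod R N u)"
    have "(\<Oplus>\<^bsub>L\<^esub> s\<in>{..<N}. (p \<oplus>\<^bsub>fmod R N u\<^esub> q) s \<odot>\<^sub>L \<xi> s) = (\<Oplus>\<^bsub>L\<^esub> s\<in>{..<N}. p s \<odot>\<^sub>L \<xi> s \<oplus>\<^sub>L q s \<odot>\<^sub>L \<xi> s)"
      using p q t \<xi> by (intro L.finsum_cong') (auto simp: fmod_add lm_l_distr[OF L] fmod_closed)
    also have "... = (\<Oplus>\<^bsub>L\<^esub> s\<in>{..<N}. p s \<odot>\<^sub>L \<xi> s) \<oplus>\<^sub>L (\<Oplus>\<^bsub>L\<^esub> s\<in>{..<N}. q s \<odot>\<^sub>L \<xi> s)"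
      using t p q by (intro L.finsum_addf) auto
    finally show "flin R N u L \<xi> (p \<oplus>\<^bsub>fmod R N u\<^esub> q) = flin R N u L \<xi> p \<oplus>\<^sub>L flin R N u L \<xi> q"
      using p q by (simp add: flin_def)
  next
    fix r p assume r: "r \<in> carrier R" and p: "p \<in> carrier (fmod R N u)"
    have rp: "r \<odot>\<^bsub>fmod R N u\<^esub> p \<in> carrier (fmod R N u)" using r p by (rule lm_closed[OF fmod_module])
    have "(\<Oplus>\<^bsub>L\<^esub> s\<in>{..<N}. (r \<odot>\<^bsub>fmod R N u\<^esub> p) s \<odot>\<^sub>L \<xi> s) = (\<Oplus>\<^bsub>L\<^esub> s\<in>{..<N}. r \<odot>\<^sub>L (p s \<odot>\<^sub>L \<xi> s))"
      using p r t \<xi> by (intro L.finsum_cong') (auto simp: fmod_smult lm_assoc[OF L] fmod_closed lm_closed[OF L])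
    also have "... = r \<odot>\<^sub>L (\<Oplus>\<^bsub>L\<^esub> s\<in>{..<N}. p s \<odot>\<^sub>L \<xi> s)"
      using t p r by (intro lm_finsum_r[OF L, symmetric]) auto
    finally show "flin R N u L \<xi> (r \<odot>\<^bsub>fmod R N u\<^esub> p) = r \<odot>\<^sub>L flin R N u L \<xi> p"
      using p rp by (simp add: flin_def)
  next
    fix p assume "p \<in> carrier (fmod R N u)"
    then show "flin R N u L \<xi> p \<in> carrier L" using t by (auto simp: flin_def intro!: L.finsum_closed)
  qed (simp add: flin_def)
qed

lemma Hom_fmod:
  assumes L: "left_module R L" and h: "h \<in> Hom R (fmod R N u) L" and p: "p \<in> carrier (fmod R N u)"
  shows "h p = (\<Oplus>\<^bsub>L\<^esub> s\<in>{..<N}. p s \<odot>\<^sub>L h (fvec R u s))"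
proof -
  interpret L: abelian_group L by (rule lm_grp[OF L])
  have "h p = h (\<Oplus>\<^bsub>fmod R N u\<^esub> s\<in>{..<N}. p s \<odot>\<^bsub>fmod R N u\<^esub> fvec R u s)" using fmod_expand[OF p] by simp
  also have "... = (\<Oplus>\<^bsub>L\<^esub> s\<in>{..<N}. h (p s \<odot>\<^bsub>fmod R N u\<^esub> fvec R u s))"
    using p by (intro Hom_finsum[OF fmod_module L h]) (auto intro!: lm_closed[OF fmod_module] fmod_closed fvec_closed)
  also have "... = (\<Oplus>\<^bsub>L\<^esub> s\<in>{..<N}. p s \<odot>\<^sub>L h (fvec R u s))"
    using p Hom_closed[OF h]
    by (intro L.finsum_cong') (auto simp: Hom_smult[OF h] fmod_closed fvec_closed intro!: lm_closed[OF L])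
  finally show ?thesis .
qed

lemma fmod_projective: "projective R (fmod R N u)"
  unfolding projective_def
proof (intro conjI allI ballI impI)
  show "left_module R (fmod R N u)" by (rule fmod_module)
next
  fix X Y :: "'r fmodule" and g h
  assume g: "g \<in> Hom R X Y" and h: "h \<in> Hom R (fmod R N u) Y" and X: "left_module R X"
    and Y: "left_module R Y" and onto: "g ` carrier X = carrier Y"
  interpret Y: abelian_group Y by (rule lm_grp[OF Y])
  have "\<forall>s. \<exists>x. s < N \<longrightarrow> x \<in> carrier X \<and> g x = h (fvec R u s)"
    using onto Hom_closed[OF h fvec_closed] by (metis imageE)
  then obtain \<xi> where \<xi>: "\<And>s. s < N ==> \<xi> s \<in> carrier X" "\<And>s. s < N ==> g (\<xi> s) = h (fvec R u s)" by metis
  have l: "flin R N u X \<xi> \<in> Hom R (fmod R N u) X" using flin_Hom[OF X \<xi>(1)] .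
  moreover have "compose (carrier (fmod R N u)) g (flin R N u X \<xi>) = h"
  proof (rule Hom_eqI[OF Hom_compose[OF fmod_module l g] h])
    fix p assume p: "p \<in> carrier (fmod R N u)"
    have "g (\<Oplus>\<^bsub>X\<^esub> s\<in>{..<N}. p s \<odot>\<^sub>X \<xi> s) = (\<Oplus>\<^bsub>Y\<^esub> s\<in>{..<N}. g (p s \<odot>\<^sub>X \<xi> s))"
      using p \<xi> by (intro Hom_finsum[OF X Y g]) (auto intro!: lm_closed[OF X] fmod_closed)
    also have "... = (\<Oplus>\<^bsub>Y\<^esub> s\<in>{..<N}. p s \<odot>\<^sub>Y h (fvec R u s))"
      using p \<xi> Hom_closed[OF h] fvec_closed
      by (intro Y.finsum_cong') (auto simp: Hom_smult[OF g] fmod_closed intro!: lm_closed[OF Y])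
    finally show "compose (carrier (fmod R N u)) g (flin R N u X \<xi>) p = h p"
      using p Hom_fmod[OF Y h p] by (simp add: compose_def flin_def)
  qed
  ultimately show "\<exists>l\<in>Hom R (fmod R N u) X. compose (carrier (fmod R N u)) g l = h" by blast
qed

end

definition regm :: "'r ring \<Rightarrow> ('r, 'r) module" where
  "regm R = \<lparr>carrier = carrier R, monoid.mult = undefined, one = undefined, zero = \<zero>\<^sub>R, add = add R, smult = monoid.mult R\<rparr>"

lemma regm_simps: "carrier (regm R) = carrier R" "\<zero>\<^bsub>regm R\<^esub> = \<zero>\<^sub>R" "x \<oplus>\<^bsub>regm R\<^esub> y = x \<oplus>\<^sub>R y"
  "r \<odot>\<^bsub>regm R\<^esub> x = r \<otimes>\<^bsub>R\<^esub> x"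
  by (simp_all add: regm_def)

lemma regm_module: "ring R ==> left_module R (regm R)"
proof -
  assume R: "ring R"
  interpret R: ring R by (rule R)
  show ?thesis
  proof (rule left_moduleI[OF R])
    show "abelian_group (regm R)"
    proof (rule abelian_groupI)
      fix x assume "x \<in> carrier (regm R)"
      then show "\<exists>y\<in>carrier (regm R). y \<oplus>\<^bsub>regm R\<^esub> x = \<zero>\<^bsub>regm R\<^esub>"
        by (intro bexI[of _ "\<ominus>\<^bsub>R\<^esub> x"]) (auto simp: regm_simps R.l_neg)
    qed (auto simp: regm_simps R.a_ac)
  qed (auto simp: regm_simps R.l_distr R.r_distr R.m_assoc)
qed

lemma stably_zeroE:
  fixes R :: "'r ring"
  assumes "f \<in> stably_zero R M N"
  obtains P :: "'r fmodule" and g h where "P \<in> CM R" "projective R P" "g \<in> Hom R M P" "h \<in> Hom R P N"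
    "f = compose (carrier M) h g"
  using assms unfolding stably_zero_def by blast

lemma stably_zero_Hom: "left_module R M ==> f \<in> stably_zero R M N ==> f \<in> Hom R M N"
  by (elim stably_zeroE) (simp add: Hom_compose)

lemma stably_zero_compose_l:
  assumes M: "left_module R M" and "f \<in> stably_zero R M N" "h' \<in> Hom R N L"
  shows "compose (carrier M) h' f \<in> stably_zero R M L"
  using assms(2)
proof (rule stably_zeroE)
  fix P :: "'a fmodule" and g h
  assume P: "P \<in> CM R" "projective R P" "g \<in> Hom R M P" "h \<in> Hom R P N" "f = compose (carrier M) h g"
  have "left_module R P" using P by (simp add: CM_def)
  then have "compose (carrier P) h' h \<in> Hom R P L" using Hom_compose P assms by blast
  moreover have "compose (carrier M) h' f = compose (carrier M) (compose (carrier P) h' h) g"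
    using P compose_assoc' by blast
  ultimately show ?thesis using P unfolding stably_zero_def by blast
qed

lemma stably_zero_compose_r:
  assumes M: "left_module R M" and "f \<in> stably_zero R N L" "g' \<in> Hom R M N"
  shows "compose (carrier M) f g' \<in> stably_zero R M L"
  using assms(2)
proof (rule stably_zeroE)
  fix P :: "'a fmodule" and g h
  assume P: "P \<in> CM R" "projective R P" "g \<in> Hom R N P" "h \<in> Hom R P L" "f = compose (carrier N) h g"
  have "compose (carrier M) g g' \<in> Hom R M P" using Hom_compose[OF M] P assms by blast
  moreover have "compose (carrier M) f g' = compose (carrier M) h (compose (carrier M) g g')"
    using P compose_assoc'[OF assms(3)] by metis
  ultimately show ?thesis using P unfolding stably_zero_def by blast
qed

text \<open>A projective module in CM is a summand of a free module of finite rank, so a map through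
  it is a finite sum of a linear form times a vector. This replaces the unknown projective module by
  data that can be computed with.\<close>

lemma stably_zeroD:
  assumes M: "left_module R M" and N: "left_module R N" and "f \<in> stably_zero R M N"
  shows "\<exists>(m::nat) a l. (\<forall>s<m. a s \<in> Hom R M (regm R) \<and> l s \<in> carrier N) \<and>
    f = (\<lambda>x\<in>carrier M. \<Oplus>\<^bsub>N\<^esub> s\<in>{..<m}. a s x \<odot>\<^sub>N l s)"
proof -
  obtain P :: "'a fmodule" and g h where P: "P \<in> CM R" and prj: "projective R P"
    and g: "g \<in> Hom R M P" and h: "h \<in> Hom R P N" and f: "f = compose (carrier M) h g"
    using assms(3) by (rule stably_zeroE)
  have R: "ring R" by (rule lm_ring[OF M])
  interpret R: ring R by (rule R)
  have LP: "left_module R P" using P by (simp add: CM_def)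
  obtain m e where e: "e \<in> {..<m::nat} \<rightarrow> carrier P"
    and ex: "\<forall>x\<in>carrier P. \<exists>!a. a \<in> {..<m} \<rightarrow>\<^sub>E ring_center R \<and> x = (\<Oplus>\<^bsub>P\<^esub> i\<in>{..<m}. a i \<odot>\<^sub>P e i)"
    using P by (auto simp: CM_def free_over_center_def)
  have ec: "e i \<in> carrier P" if "i < m" for i using e that by auto
  let ?F = "fmod R m (\<lambda>_. \<one>\<^bsub>R\<^esub>)"
  have F: "left_module R ?F" by (rule fmod_module[OF R]) auto
  interpret P: abelian_group P by (rule lm_grp[OF LP])
  interpret N: abelian_group N by (rule lm_grp[OF N])
  have lin: "flin R m (\<lambda>_. \<one>\<^bsub>R\<^esub>) P e \<in> Hom R ?F P" using e by (intro flin_Hom[OF R]) (auto simp: LP)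
  have "flin R m (\<lambda>_. \<one>\<^bsub>R\<^esub>) P e ` carrier ?F = carrier P"
  proof (intro equalityI subsetI)
    fix y assume y: "y \<in> carrier P"
    then obtain a where a: "a \<in> {..<m} \<rightarrow>\<^sub>E ring_center R" "y = (\<Oplus>\<^bsub>P\<^esub> i\<in>{..<m}. a i \<odot>\<^sub>P e i)" using ex by blast
    define p where "p s = (if s < m then a s else \<zero>\<^sub>R)" for s
    have ac: "a i \<in> carrier R" if "i < m" for i using a(1) that by (auto simp: ring_center_def PiE_iff)
    have p: "p \<in> carrier ?F" using ac by (auto simp: fmod_carrier[OF R] p_def)
    have "flin R m (\<lambda>_. \<one>\<^bsub>R\<^esub>) P e p = y"
      unfolding a(2) flin_def using p ac e lm_closed[OF LP] by (auto simp: p_def intro!: P.finsum_cong')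
    then show "y \<in> flin R m (\<lambda>_. \<one>\<^bsub>R\<^esub>) P e ` carrier ?F" using p by blast
  qed (use Hom_closed[OF lin] in auto)
  \<comment> \<open>A section of the surjection from the free module onto \<open>P\<close>; its
    components are the coordinate forms of \<open>P\<close> with respect to the generators
    \<open>e s\<close>.\<close>
  then obtain l where l: "l \<in> Hom R P ?F" and ll: "compose (carrier P) (flin R m (\<lambda>_. \<one>\<^bsub>R\<^esub>) P e) l = hom_id P"
    using prj lin Hom_id[OF LP] F LP unfolding projective_def by blast
  have lc: "l y s \<in> carrier R" if "y \<in> carrier P" for y s
    using Hom_closed[OF l that] fmod_closed[OF R, of m "\<lambda>_. \<one>\<^bsub>R\<^esub>"] by auto
  define a where "a s = (\<lambda>x\<in>carrier M. l (g x) s)" for s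
  have "a s \<in> Hom R M (regm R)" for s
    using Hom_closed[OF g] lc
    by (intro HomI) (auto simp: a_def regm_simps Hom_add[OF g] Hom_smult[OF g] Hom_add[OF l] Hom_smult[OF l]
        fmod_add[OF R] fmod_smult[OF R] lm_closed[OF M]
        abelian_monoid.a_closed[OF abelian_group.axioms(1)[OF lm_grp[OF M]]])
  moreover have "f = (\<lambda>x\<in>carrier M. \<Oplus>\<^bsub>N\<^esub> s\<in>{..<m}. a s x \<odot>\<^sub>N h (e s))"
  proof
    fix x show "f x = (\<lambda>x\<in>carrier M. \<Oplus>\<^bsub>N\<^esub> s\<in>{..<m}. a s x \<odot>\<^sub>N h (e s)) x"
    proof (cases "x \<in> carrier M")
      case True
      have gx: "g x \<in> carrier P" using Hom_closed[OF g True] .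
      have "g x = flin R m (\<lambda>_. \<one>\<^bsub>R\<^esub>) P e (l (g x))"
        using fun_cong[OF ll, of "g x"] gx by (simp add: compose_def hom_id_def)
      then have "h (g x) = h (\<Oplus>\<^bsub>P\<^esub> s\<in>{..<m}. l (g x) s \<odot>\<^sub>P e s)"
        using Hom_closed[OF l gx] by (simp add: flin_def)
      also have "... = (\<Oplus>\<^bsub>N\<^esub> s\<in>{..<m}. h (l (g x) s \<odot>\<^sub>P e s))"
        using e lc[OF gx] by (intro Hom_finsum[OF LP N h]) (auto intro!: lm_closed[OF LP])
      also have "... = (\<Oplus>\<^bsub>N\<^esub> s\<in>{..<m}. a s x \<odot>\<^sub>N h (e s))"
        using ec lc[OF gx] True Hom_closed[OF h]
        by (intro N.finsum_cong') (auto simp: a_def Hom_smult[OF h] intro!: lm_closed[OF N])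
      finally show ?thesis using True by (simp add: f compose_def)
    qed (simp add: f compose_def)
  qed
  moreover have "h (e s) \<in> carrier N" if "s < m" for s using that e Hom_closed[OF h] by auto
  ultimately show ?thesis by (intro exI[of _ m] exI[of _ a] exI[of _ "\<lambda>s. h (e s)"]) auto
qed

text \<open>The input about the algebra that the formal theory of the stable category takes: free
  modules of finite rank lie in CM.\<close>

locale free_cm =
  fixes R :: "'r ring" (structure)
  assumes fR: "ring R" and fCM: "\<And>m. fmod R m (\<lambda>_. \<one>) \<in> CM R"
begin

lemma stably_zeroI:
  fixes m :: nat
  assumes M: "left_module R M" and N: "left_module R N"
    and a: "\<And>s. s < m ==> a s \<in> Hom R M (regm R)" and l: "\<And>s. s < m ==> l s \<in> carrier N"
  shows "(\<lambda>x\<in>carrier M. \<Oplus>\<^bsub>N\<^esub> s\<in>{..<m}. a s x \<odot>\<^sub>N l s) \<in> stably_zero R M N"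
proof -
  interpret R: ring R by (rule fR)
  interpret N: abelian_group N by (rule lm_grp[OF N])
  let ?F = "fmod R m (\<lambda>_. \<one>)"
  define g where "g = (\<lambda>x\<in>carrier M. \<lambda>s. if s < m then a s x else \<zero>)"
  have ac: "a s x \<in> carrier R" if "s < m" "x \<in> carrier M" for s x
    using Hom_closed[OF a[OF that(1)] that(2)] by (simp add: regm_simps)
  have g: "g \<in> Hom R M ?F"
    by (rule HomI) (auto simp: g_def fmod_carrier[OF fR] fmod_add[OF fR] fmod_smult[OF fR] fun_eq_iff ac
        Hom_add[OF a] Hom_smult[OF a] regm_simps lm_closed[OF M]
        abelian_monoid.a_closed[OF abelian_group.axioms(1)[OF lm_grp[OF M]]])
  have h: "flin R m (\<lambda>_. \<one>) N l \<in> Hom R ?F N" using l by (intro flin_Hom[OF fR]) (auto simp: N)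
  have "(\<lambda>x\<in>carrier M. \<Oplus>\<^bsub>N\<^esub> s\<in>{..<m}. a s x \<odot>\<^sub>N l s) = compose (carrier M) (flin R m (\<lambda>_. \<one>) N l) g"
  proof
    fix x
    show "(\<lambda>x\<in>carrier M. \<Oplus>\<^bsub>N\<^esub> s\<in>{..<m}. a s x \<odot>\<^sub>N l s) x = compose (carrier M) (flin R m (\<lambda>_. \<one>) N l) g x"
    proof (cases "x \<in> carrier M")
      case True
      have "flin R m (\<lambda>_. \<one>) N l (g x) = (\<Oplus>\<^bsub>N\<^esub> s\<in>{..<m}. g x s \<odot>\<^sub>N l s)"
        using Hom_closed[OF g True] by (simp add: flin_def)
      also have "... = (\<Oplus>\<^bsub>N\<^esub> s\<in>{..<m}. a s x \<odot>\<^sub>N l s)"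
        using True ac l lm_closed[OF N] by (intro N.finsum_cong') (auto simp: g_def)
      finally show ?thesis using True by (simp add: compose_def)
    qed (simp add: compose_def)
  qed
  moreover have "projective R ?F" by (rule fmod_projective[OF fR]) auto
  ultimately show ?thesis using fCM g h unfolding stably_zero_def by blast
qed

lemma stably_zero_zero:
  assumes M: "left_module R M" and N: "left_module R N"
  shows "(\<lambda>x\<in>carrier M. \<zero>\<^sub>N) \<in> stably_zero R M N"
proof -
  interpret N: abelian_group N by (rule lm_grp[OF N])
  show ?thesis using stably_zeroI[OF M N, of 0] by simp
qed

text \<open>The two families of linear forms and vectors are concatenated, the second one shifted by
  \<open>m\<close>; this is the factorisation through the direct sum.\<close>

lemma stably_zero_add:
  assumes M: "left_module R M" and N: "left_module R N"
    and "f \<in> stably_zero R M N" "g \<in> stably_zero R M N"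
  shows "hom_add M N f g \<in> stably_zero R M N"
proof -
  interpret R: ring R by (rule fR)
  interpret N: abelian_group N by (rule lm_grp[OF N])
  obtain m :: nat and a l where f: "\<forall>s<m. a s \<in> Hom R M (regm R) \<and> l s \<in> carrier N"
    "f = (\<lambda>x\<in>carrier M. \<Oplus>\<^bsub>N\<^esub> s\<in>{..<m}. a s x \<odot>\<^sub>N l s)" using stably_zeroD[OF M N assms(3)] by blast
  obtain m' :: nat and a' l' where g: "\<forall>s<m'. a' s \<in> Hom R M (regm R) \<and> l' s \<in> carrier N"
    "g = (\<lambda>x\<in>carrier M. \<Oplus>\<^bsub>N\<^esub> s\<in>{..<m'}. a' s x \<odot>\<^sub>N l' s)" using stably_zeroD[OF M N assms(4)] by blast
  define b where "b s = (if s < m then a s else a' (s - m))" for s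
  define q where "q s = (if s < m then l s else l' (s - m))" for s
  have alc: "a s x \<odot>\<^sub>N l s \<in> carrier N" if "s < m" "x \<in> carrier M" for s x
    using that f(1) Hom_closed[of "a s" R M "regm R" x] by (auto simp: regm_simps intro!: lm_closed[OF N])
  have bc: "b s x \<odot>\<^sub>N q s \<in> carrier N" if "s < m + m'" "x \<in> carrier M" for s x
    using that f(1) g(1) Hom_closed[of "a s" R M "regm R" x] Hom_closed[of "a' (s - m)" R M "regm R" x]
    by (auto simp: b_def q_def regm_simps intro!: lm_closed[OF N])
  have "hom_add M N f g = (\<lambda>x\<in>carrier M. \<Oplus>\<^bsub>N\<^esub> s\<in>{..<m + m'}. b s x \<odot>\<^sub>N q s)"
  proof
    fix x show "hom_add M N f g x = (\<lambda>x\<in>carrier M. \<Oplus>\<^bsub>N\<^esub> s\<in>{..<m + m'}. b s x \<odot>\<^sub>N q s) x"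
    proof (cases "x \<in> carrier M")
      case True
      have un: "{..<m + m'} = {..<m} \<union> (\<lambda>s. s + m) ` {..<m'}"
      proof (intro equalityI subsetI)
        fix s assume s: "s \<in> {..<m + m'}"
        show "s \<in> {..<m} \<union> (\<lambda>s. s + m) ` {..<m'}"
        proof (cases "s < m")
          case False
          then have "s = (s - m) + m" "s - m \<in> {..<m'}" using s by auto
          then show ?thesis by blast
        qed simp
      qed auto
      have "(\<Oplus>\<^bsub>N\<^esub> s\<in>{..<m + m'}. b s x \<odot>\<^sub>N q s) =
          (\<Oplus>\<^bsub>N\<^esub> s\<in>{..<m}. b s x \<odot>\<^sub>N q s) \<oplus>\<^sub>N (\<Oplus>\<^bsub>N\<^esub> s\<in>(\<lambda>s. s + m) ` {..<m'}. b s x \<odot>\<^sub>N q s)"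
        unfolding un using bc True by (intro N.finsum_Un_disjoint) auto
      also have "(\<Oplus>\<^bsub>N\<^esub> s\<in>(\<lambda>s. s + m) ` {..<m'}. b s x \<odot>\<^sub>N q s) = (\<Oplus>\<^bsub>N\<^esub> s\<in>{..<m'}. b (s + m) x \<odot>\<^sub>N q (s + m))"
        using bc True by (intro N.finsum_reindex) auto
      also have "(\<Oplus>\<^bsub>N\<^esub> s\<in>{..<m'}. b (s + m) x \<odot>\<^sub>N q (s + m)) = (\<Oplus>\<^bsub>N\<^esub> s\<in>{..<m'}. a' s x \<odot>\<^sub>N l' s)"
        by (simp add: b_def q_def)
      also have "(\<Oplus>\<^bsub>N\<^esub> s\<in>{..<m}. b s x \<odot>\<^sub>N q s) = (\<Oplus>\<^bsub>N\<^esub> s\<in>{..<m}. a s x \<odot>\<^sub>N l s)"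
        using alc True by (intro N.finsum_cong') (auto simp: b_def q_def)
      finally show ?thesis using True by (simp add: hom_add_def f(2) g(2))
    qed (simp add: hom_add_def)
  qed
  moreover have "(\<lambda>x\<in>carrier M. \<Oplus>\<^bsub>N\<^esub> s\<in>{..<m + m'}. b s x \<odot>\<^sub>N q s) \<in> stably_zero R M N"
    using f(1) g(1) by (intro stably_zeroI[OF M N]) (auto simp: b_def q_def)
  ultimately show ?thesis by simp
qed

lemma stably_iso_lm_iso:
  assumes M: "left_module R M" and N: "left_module R N" and "lm_iso R M N f g"
  shows "stably_iso R M N"
proof -
  have f: "f \<in> Hom R M N" and g: "g \<in> Hom R N M" using assms by (auto simp: lm_iso_def)
  have "compose (carrier M) g f = hom_id M" "compose (carrier N) f g = hom_id N"
    using assms by (auto simp: lm_iso_def compose_def hom_id_def)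
  then show ?thesis unfolding stably_iso_def
    using f g hom_diff_self[OF M Hom_id[OF M]] hom_diff_self[OF N Hom_id[OF N]] stably_zero_zero M N by metis
qed

lemma stably_iso_sym: "stably_iso R M N ==> stably_iso R N M"
  unfolding stably_iso_def by blast

lemma stably_iso_trans_half:
  assumes M: "left_module R M" and N: "left_module R N" and L: "left_module R L"
    and f: "f \<in> Hom R M N" and g: "g \<in> Hom R N M" and f': "f' \<in> Hom R N L" and g': "g' \<in> Hom R L N"
    and z: "hom_diff M M (compose (carrier M) g f) (hom_id M) \<in> stably_zero R M M"
    and z': "hom_diff N N (compose (carrier N) g' f') (hom_id N) \<in> stably_zero R N N"
  shows "hom_diff M M (compose (carrier M) (compose (carrier L) g g') (compose (carrier M) f' f)) (hom_id M)
    \<in> stably_zero R M M"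
proof -
  interpret M: abelian_group M by (rule lm_grp[OF M])
  interpret N: abelian_group N by (rule lm_grp[OF N])
  \<comment> \<open>The identity behind the claim is
    \<open>g g' f' f - 1 = g (g' f' - 1) f + (g f - 1)\<close>, where \<open>?d\<close> is the first
    summand.\<close>
  let ?d = "compose (carrier M) g (compose (carrier M) (hom_diff N N (compose (carrier N) g' f') (hom_id N)) f)"
  have "?d \<in> stably_zero R M M"
    using stably_zero_compose_l[OF M stably_zero_compose_r[OF M z' f] g] .
  then have "hom_add M M ?d (hom_diff M M (compose (carrier M) g f) (hom_id M)) \<in> stably_zero R M M"
    using stably_zero_add[OF M M] z by blast
  moreover have "hom_add M M ?d (hom_diff M M (compose (carrier M) g f) (hom_id M)) =
      hom_diff M M (compose (carrier M) (compose (carrier L) g g') (compose (carrier M) f' f)) (hom_id M)"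
  proof
    fix x
    show "hom_add M M ?d (hom_diff M M (compose (carrier M) g f) (hom_id M)) x =
      hom_diff M M (compose (carrier M) (compose (carrier L) g g') (compose (carrier M) f' f)) (hom_id M) x"
    proof (cases "x \<in> carrier M")
      case True
      have c: "f x \<in> carrier N" "f' (f x) \<in> carrier L" "g' (f' (f x)) \<in> carrier N"
        using True Hom_closed[OF f] Hom_closed[OF f'] Hom_closed[OF g'] by auto
      have c': "g (f x) \<in> carrier M" "g (g' (f' (f x))) \<in> carrier M" using c Hom_closed[OF g] by auto
      show ?thesis using True c c'
        by (simp add: hom_add_def hom_diff_def compose_def hom_id_def Hom_diff[OF N M g])
           (simp add: a_minus_def M.a_assoc M.r_neg1)
    qed (simp add: hom_add_def hom_diff_def)
  qed
  ultimately show ?thesis by simp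
qed

lemma stably_iso_trans:
  assumes M: "left_module R M" and N: "left_module R N" and L: "left_module R L"
    and "stably_iso R M N" "stably_iso R N L"
  shows "stably_iso R M L"
proof -
  obtain f g where f: "f \<in> Hom R M N" and g: "g \<in> Hom R N M"
    and z: "hom_diff M M (compose (carrier M) g f) (hom_id M) \<in> stably_zero R M M"
      "hom_diff N N (compose (carrier N) f g) (hom_id N) \<in> stably_zero R N N"
    using assms(4) unfolding stably_iso_def by blast
  obtain f' g' where f': "f' \<in> Hom R N L" and g': "g' \<in> Hom R L N"
    and z': "hom_diff N N (compose (carrier N) g' f') (hom_id N) \<in> stably_zero R N N"
      "hom_diff L L (compose (carrier L) f' g') (hom_id L) \<in> stably_zero R L L"
    using assms(5) unfolding stably_iso_def by blast
  show ?thesis unfolding stably_iso_def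
    using Hom_compose[OF M f f'] Hom_compose[OF L g' g]
      stably_iso_trans_half[OF M N L f g f' g' z(1) z'(1)] stably_iso_trans_half[OF L N M g' f' g f z'(2) z(2)]
    by blast
qed

end

section \<open>Syzygies and Serre duals are unique up to stable isomorphism\<close>

definition syz_seq :: "'r ring \<Rightarrow> ('r, 'm) module \<Rightarrow> 'r fmodule \<Rightarrow> 'r fmodule \<Rightarrow>
    ((nat \<Rightarrow> 'r) \<Rightarrow> (nat \<Rightarrow> 'r)) \<Rightarrow> ((nat \<Rightarrow> 'r) \<Rightarrow> 'm) \<Rightarrow> bool" where
  "syz_seq R M K P i p \<longleftrightarrow> K \<in> CM R \<and> P \<in> CM R \<and> projective R P \<and> i \<in> Hom R K P \<and> p \<in> Hom R P M \<and>
     inj_on i (carrier K) \<and> p ` carrier P = carrier M \<and> i ` carrier K = {x \<in> carrier P. p x = \<zero>\<^sub>M}"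

lemma is_syzygy_seq: "is_syzygy R M K \<longleftrightarrow> (\<exists>P i p. syz_seq R M K P i p)"
  unfolding is_syzygy_def syz_seq_def by blast

lemma kernel_lift:
  assumes Q: "left_module R Q" and s: "syz_seq R M K P i p" and G: "G \<in> Hom R Q P"
    and z: "\<And>x. x \<in> carrier Q ==> p (G x) = \<zero>\<^sub>M"
  shows "\<exists>\<phi>\<in>Hom R Q K. \<forall>x\<in>carrier Q. i (\<phi> x) = G x"
proof -
  have i: "i \<in> Hom R K P" and inj: "inj_on i (carrier K)" and im: "i ` carrier K = {x \<in> carrier P. p x = \<zero>\<^sub>M}"
    and K: "left_module R K" using s by (auto simp: syz_seq_def CM_def)
  interpret Q: abelian_group Q by (rule lm_grp[OF Q])
  interpret K: abelian_group K by (rule lm_grp[OF K])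
  define \<phi> where "\<phi> = (\<lambda>x\<in>carrier Q. the_inv_into (carrier K) i (G x))"
  have Gi: "G x \<in> i ` carrier K" if "x \<in> carrier Q" for x
    unfolding im using that z Hom_closed[OF G] by auto
  have \<phi>: "\<phi> x \<in> carrier K" "i (\<phi> x) = G x" if "x \<in> carrier Q" for x
    using Gi[OF that] inj that by (auto simp: \<phi>_def the_inv_into_f_f)
  have eqI: "a = b" if "a \<in> carrier K" "b \<in> carrier K" "i a = i b" for a b
    using inj that by (auto dest: inj_onD)
  have "\<phi> \<in> Hom R Q K"
  proof (rule HomI)
    show "\<phi> (x \<oplus>\<^sub>Q y) = \<phi> x \<oplus>\<^sub>K \<phi> y" if "x \<in> carrier Q" "y \<in> carrier Q" for x y
      using that \<phi> by - (rule eqI, auto simp: Hom_add[OF i] Hom_add[OF G])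
    show "\<phi> (r \<odot>\<^sub>Q x) = r \<odot>\<^sub>K \<phi> x" if "r \<in> carrier R" "x \<in> carrier Q" for r x
      using that \<phi> by - (rule eqI, auto simp: Hom_smult[OF i] Hom_smult[OF G] lm_closed[OF K] lm_closed[OF Q])
  qed (auto simp: \<phi>(1), simp add: \<phi>_def)
  then show ?thesis using \<phi> by blast
qed

lemma projective_lift:
  fixes X Y :: "'r fmodule"
  assumes "projective R P" "left_module R X" "left_module R Y" "p \<in> Hom R X Y" "p ` carrier X = carrier Y" "h \<in> Hom R P Y"
  shows "\<exists>l\<in>Hom R P X. \<forall>x\<in>carrier P. p (l x) = h x"
proof -
  obtain l where "l \<in> Hom R P X" "compose (carrier P) p l = h" using assms unfolding projective_def by blast
  then show ?thesis by (intro bexI[of _ l]) (auto simp: compose_def)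
qed

lemma syz_map:
  fixes M M' :: "'r fmodule"
  assumes M: "left_module R M" and M': "left_module R M'" and s: "syz_seq R M K P i p" and s': "syz_seq R M' K' P' i' p'"
    and f: "f \<in> Hom R M M'"
  shows "\<exists>F\<in>Hom R P P'. \<exists>\<phi>\<in>Hom R K K'. (\<forall>x\<in>carrier P. p' (F x) = f (p x)) \<and> (\<forall>x\<in>carrier K. i' (\<phi> x) = F (i x))"
proof -
  have P: "left_module R P" and P': "left_module R P'" and K: "left_module R K" and i: "i \<in> Hom R K P"
    and p: "p \<in> Hom R P M" and p': "p' \<in> Hom R P' M'"
    and im: "i ` carrier K = {x \<in> carrier P. p x = \<zero>\<^sub>M}"
    using s s' by (auto simp: syz_seq_def CM_def)
  obtain F where F: "F \<in> Hom R P P'" "\<And>x. x \<in> carrier P ==> p' (F x) = f (p x)"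
    using projective_lift[OF _ P' M' p' _ Hom_compose[OF P p f]] s s' by (auto simp: syz_seq_def compose_def)
  have "\<exists>\<phi>\<in>Hom R K K'. \<forall>x\<in>carrier K. i' (\<phi> x) = compose (carrier K) F i x"
  proof (rule kernel_lift[OF K s' Hom_compose[OF K i F(1)]])
    fix x assume x: "x \<in> carrier K"
    have "i x \<in> {x \<in> carrier P. p x = \<zero>\<^sub>M}" using x im by blast
    then show "p' (compose (carrier K) F i x) = \<zero>\<^sub>M'" using x F(2) Hom_zero[OF M M' f] by (simp add: compose_def)
  qed
  then show ?thesis using F by (auto simp: compose_def)
qed

text \<open>Let \<open>f = h g\<close> through \<open>Q\<close>, and let \<open>l\<close> lift
  \<open>h\<close> along \<open>p'\<close>. Then \<open>F - l g p\<close> maps into the kernel of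
  \<open>p'\<close>, and \<open>l g p\<close> vanishes on the image of \<open>K\<close>; hence
  \<open>\<phi>\<close> factors through \<open>i\<close> and the projective module
  \<open>P\<close>.\<close>

lemma syz_null:
  fixes M M' :: "'r fmodule"
  assumes M: "left_module R M" and M': "left_module R M'" and s: "syz_seq R M K P i p" and s': "syz_seq R M' K' P' i' p'"
    and f: "f \<in> stably_zero R M M'" and F: "F \<in> Hom R P P'" and \<phi>: "\<phi> \<in> Hom R K K'"
    and Ff: "\<And>x. x \<in> carrier P ==> p' (F x) = f (p x)" and \<phi>F: "\<And>x. x \<in> carrier K ==> i' (\<phi> x) = F (i x)"
  shows "\<phi> \<in> stably_zero R K K'"
  using f
proof (rule stably_zeroE)
  fix Q :: "'r fmodule" and g h
  assume Q: "Q \<in> CM R" "projective R Q" "g \<in> Hom R M Q" "h \<in> Hom R Q M'" "f = compose (carrier M) h g"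
  have P: "left_module R P" and P': "left_module R P'" and K: "left_module R K" and K': "left_module R K'"
    and i: "i \<in> Hom R K P" and i': "i' \<in> Hom R K' P'" and inj': "inj_on i' (carrier K')"
    and p: "p \<in> Hom R P M" and p': "p' \<in> Hom R P' M'"
    and im: "i ` carrier K = {x \<in> carrier P. p x = \<zero>\<^sub>M}" and pP: "P \<in> CM R" "projective R P"
    using s s' by (auto simp: syz_seq_def CM_def)
  have LQ: "left_module R Q" using Q by (simp add: CM_def)
  interpret P': abelian_group P' by (rule lm_grp[OF P'])
  interpret M': abelian_group M' by (rule lm_grp[OF M'])
  obtain l where l: "l \<in> Hom R Q P'" "\<And>x. x \<in> carrier Q ==> p' (l x) = h x"
    using projective_lift[OF Q(2) P' M' p' _ Q(4)] s' by (auto simp: syz_seq_def)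
  define S where "S = compose (carrier P) l (compose (carrier P) g p)"
  have S: "S \<in> Hom R P P'" unfolding S_def by (rule Hom_compose[OF P Hom_compose[OF P p Q(3)] l(1)])
  have Sx: "S x = l (g (p x))" if "x \<in> carrier P" for x using that by (simp add: S_def compose_def)
  have D: "hom_diff P P' F S \<in> Hom R P P'" by (rule hom_diff_closed[OF P P' F S])
  have "\<exists>\<psi>\<in>Hom R P K'. \<forall>x\<in>carrier P. i' (\<psi> x) = hom_diff P P' F S x"
  proof (rule kernel_lift[OF P s' D])
    fix x assume x: "x \<in> carrier P"
    have px: "p x \<in> carrier M" "g (p x) \<in> carrier Q" using x Hom_closed[OF p] Hom_closed[OF Q(3)] by auto
    have "p' (F x \<ominus>\<^bsub>P'\<^esub> S x) = p' (F x) \<ominus>\<^bsub>M'\<^esub> p' (S x)"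
      using x Hom_closed[OF F] Hom_closed[OF S] by (intro Hom_diff[OF P' M' p']) auto
    also have "... = \<zero>\<^sub>M'" using x px Ff l(2) Sx Q(5) Hom_closed[OF Q(4) px(2)]
      by (simp add: compose_def M'.diff_eq_zero_iff)
    finally show "p' (hom_diff P P' F S x) = \<zero>\<^sub>M'" using x by (simp add: hom_diff_def)
  qed
  then obtain \<psi> where \<psi>: "\<psi> \<in> Hom R P K'" "\<And>x. x \<in> carrier P ==> i' (\<psi> x) = F x \<ominus>\<^bsub>P'\<^esub> S x"
    by (auto simp: hom_diff_def)
  have "\<phi> = compose (carrier K) \<psi> i"
  proof (rule Hom_eqI[OF \<phi> Hom_compose[OF K i \<psi>(1)]])
    fix x assume x: "x \<in> carrier K"
    have ix: "i x \<in> carrier P" "p (i x) = \<zero>\<^sub>M" using x im by blast+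
    have "S (i x) = \<zero>\<^sub>P'" using Sx[OF ix(1)] ix Hom_zero[OF M LQ Q(3)] Hom_zero[OF LQ P' l(1)] by simp
    then have "i' (\<psi> (i x)) = i' (\<phi> x)"
      using \<psi>(2)[OF ix(1)] \<phi>F[OF x] Hom_closed[OF F ix(1)] by (simp add: a_minus_def)
    then show "\<phi> x = compose (carrier K) \<psi> i x"
      using inj_onD[OF inj', of "\<psi> (i x)" "\<phi> x"] x ix Hom_closed[OF \<psi>(1)] Hom_closed[OF \<phi>] by (simp add: compose_def)
  qed
  then show ?thesis using pP i \<psi>(1) unfolding stably_zero_def by blast
qed

lemma syzygy_stably_iso:
  fixes M M' :: "'r fmodule"
  assumes M: "left_module R M" and M': "left_module R M'" and "stably_iso R M M'"
    and "is_syzygy R M K" "is_syzygy R M' K'"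
  shows "stably_iso R K K'"
proof -
  obtain P i p where s: "syz_seq R M K P i p" using assms is_syzygy_seq by blast
  obtain P' i' p' where s': "syz_seq R M' K' P' i' p'" using assms is_syzygy_seq by blast
  obtain f g where f: "f \<in> Hom R M M'" and g: "g \<in> Hom R M' M"
    and gf: "hom_diff M M (compose (carrier M) g f) (hom_id M) \<in> stably_zero R M M"
    and fg: "hom_diff M' M' (compose (carrier M') f g) (hom_id M') \<in> stably_zero R M' M'"
    using assms(3) unfolding stably_iso_def by blast
  \<comment> \<open>The stably zero map \<open>g f - 1\<close> is covered by \<open>G F - 1\<close>,
    which restricts to \<open>\<gamma> \<phi> - 1\<close> on the syzygy, so \<open>syz_null\<close>
    applies. Stated for arbitrary data to be used in both directions.\<close>
  have *: "hom_diff K K (compose (carrier K) \<gamma> \<phi>) (hom_id K) \<in> stably_zero R K K"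
    if M: "left_module R M" and M': "left_module R M'" and s: "syz_seq R M K P i p" and s': "syz_seq R M' K' P' i' p'"
      and f: "f \<in> Hom R M M'" and g: "g \<in> Hom R M' M"
      and gf: "hom_diff M M (compose (carrier M) g f) (hom_id M) \<in> stably_zero R M M"
      and F: "F \<in> Hom R P P'" "\<phi> \<in> Hom R K K'" "\<forall>x\<in>carrier P. p' (F x) = f (p x)" "\<forall>x\<in>carrier K. i' (\<phi> x) = F (i x)"
      and G: "G \<in> Hom R P' P" "\<gamma> \<in> Hom R K' K" "\<forall>x\<in>carrier P'. p (G x) = g (p' x)" "\<forall>x\<in>carrier K'. i (\<gamma> x) = G (i' x)"
    for M M' :: "'r fmodule" and K P i p K' P' i' p' f g F \<phi> G \<gamma>
  proof -
    have P: "left_module R P" and K: "left_module R K" and i: "i \<in> Hom R K P" and p: "p \<in> Hom R P M"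
      using s by (auto simp: syz_seq_def CM_def)
    have GF: "compose (carrier P) G F \<in> Hom R P P" "compose (carrier K) \<gamma> \<phi> \<in> Hom R K K"
      using Hom_compose P K F G by blast+
    have d: "hom_diff P P (compose (carrier P) G F) (hom_id P) \<in> Hom R P P"
      "hom_diff K K (compose (carrier K) \<gamma> \<phi>) (hom_id K) \<in> Hom R K K"
      using hom_diff_closed Hom_id P K GF by blast+
    show ?thesis
    proof (rule syz_null[OF M M s s gf d])
      fix x assume x: "x \<in> carrier P"
      have c: "F x \<in> carrier P'" "G (F x) \<in> carrier P" "p x \<in> carrier M"
        using x Hom_closed F(1) G(1) p by metis+
      show "p (hom_diff P P (compose (carrier P) G F) (hom_id P) x) =
          hom_diff M M (compose (carrier M) g f) (hom_id M) (p x)"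
        using x c F(3) G(3) by (simp add: hom_diff_def compose_def hom_id_def Hom_diff[OF P M p])
    next
      fix x assume x: "x \<in> carrier K"
      have c: "\<phi> x \<in> carrier K'" "\<gamma> (\<phi> x) \<in> carrier K" "i x \<in> carrier P"
        using x Hom_closed F(2) G(2) i by metis+
      show "i (hom_diff K K (compose (carrier K) \<gamma> \<phi>) (hom_id K) x) =
          hom_diff P P (compose (carrier P) G F) (hom_id P) (i x)"
        using x c F(4) G(4) by (simp add: hom_diff_def compose_def hom_id_def Hom_diff[OF K P i])
    qed
  qed
  obtain F \<phi> where F: "F \<in> Hom R P P'" "\<phi> \<in> Hom R K K'" "\<forall>x\<in>carrier P. p' (F x) = f (p x)" "\<forall>x\<in>carrier K. i' (\<phi> x) = F (i x)"
    using syz_map[OF M M' s s' f] by blast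
  obtain G \<gamma> where G: "G \<in> Hom R P' P" "\<gamma> \<in> Hom R K' K" "\<forall>x\<in>carrier P'. p (G x) = g (p' x)" "\<forall>x\<in>carrier K'. i (\<gamma> x) = G (i' x)"
    using syz_map[OF M' M s' s g] by blast
  show ?thesis unfolding stably_iso_def
    using *[OF M M' s s' f g gf F G] *[OF M' M s' s g f fg G F] F(2) G(2) by blast
qed

definition serre_dual ::
  "'r ring \<Rightarrow> (complex \<Rightarrow> 'r) \<Rightarrow> ('r, 'm) module \<Rightarrow> 'r fmodule \<Rightarrow>
    ('r fmodule \<Rightarrow> ((nat \<Rightarrow> 'r) \<Rightarrow> (nat \<Rightarrow> 'r)) \<Rightarrow> ('m \<Rightarrow> (nat \<Rightarrow> 'r)) \<Rightarrow> complex) \<Rightarrow> bool" where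
  "serre_dual R \<iota> M S \<eta> \<longleftrightarrow>
        (\<forall>Y\<in>CM R.
           (\<forall>g\<in>Hom R Y S. \<eta> Y g \<in> stable_dual R \<iota> M Y) \<and>
           (\<forall>g\<in>Hom R Y S. \<forall>g'\<in>Hom R Y S. \<forall>f\<in>Hom R M Y.
              \<eta> Y (hom_add Y S g g') f = \<eta> Y g f + \<eta> Y g' f) \<and>
           (\<forall>c. \<forall>g\<in>Hom R Y S. \<forall>f\<in>Hom R M Y.
              \<eta> Y (hom_scale Y S (\<iota> c) g) f = c * \<eta> Y g f) \<and>
           (\<forall>g\<in>Hom R Y S. (\<forall>f\<in>Hom R M Y. \<eta> Y g f = 0) \<longleftrightarrow> g \<in> stably_zero R Y S) \<and>
           (\<forall>\<phi>\<in>stable_dual R \<iota> M Y. \<exists>g\<in>Hom R Y S. \<forall>f\<in>Hom R M Y. \<eta> Y g f = \<phi> f)) \<and>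
        (\<forall>Y\<in>CM R. \<forall>Y'\<in>CM R. \<forall>h\<in>Hom R Y Y'. \<forall>g\<in>Hom R Y' S. \<forall>f\<in>Hom R M Y.
           \<eta> Y (compose (carrier Y) g h) f = \<eta> Y' g (compose (carrier M) h f))"

lemma is_serre_dual: "is_serre R \<iota> M S \<longleftrightarrow> S \<in> CM R \<and> (\<exists>\<eta>. serre_dual R \<iota> M S \<eta>)"
  unfolding is_serre_def serre_dual_def ..

lemma
  assumes "serre_dual R \<iota> M S \<eta>" "Y \<in> CM R"
  shows serre_dual_dual: "g \<in> Hom R Y S ==> \<eta> Y g \<in> stable_dual R \<iota> M Y"
    and serre_dual_add: "[|g \<in> Hom R Y S; g' \<in> Hom R Y S; f \<in> Hom R M Y|] ==>
      \<eta> Y (hom_add Y S g g') f = \<eta> Y g f + \<eta> Y g' f"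
    and serre_dual_zero: "[|g \<in> Hom R Y S; \<And>f. f \<in> Hom R M Y ==> \<eta> Y g f = 0|] ==> g \<in> stably_zero R Y S"
    and serre_dual_surj: "\<phi> \<in> stable_dual R \<iota> M Y ==> \<exists>g\<in>Hom R Y S. \<forall>f\<in>Hom R M Y. \<eta> Y g f = \<phi> f"
    and serre_dual_nat: "[|Y' \<in> CM R; h \<in> Hom R Y Y'; g \<in> Hom R Y' S; f \<in> Hom R M Y|] ==>
      \<eta> Y (compose (carrier Y) g h) f = \<eta> Y' g (compose (carrier M) h f)"
  using bspec[OF conjunct1[OF assms(1)[unfolded serre_dual_def]] assms(2)]
    bspec[OF conjunct2[OF assms(1)[unfolded serre_dual_def]] assms(2)]
  by (elim conjE; (simp; fail | blast))+

lemma
  assumes "\<phi> \<in> stable_dual R \<iota> M Y"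
  shows stable_dual_add: "[|f \<in> Hom R M Y; g \<in> Hom R M Y|] ==> \<phi> (hom_add M Y f g) = \<phi> f + \<phi> g"
    and stable_dual_scale: "f \<in> Hom R M Y ==> \<phi> (hom_scale M Y (\<iota> c) f) = c * \<phi> f"
    and stable_dual_zero: "f \<in> stably_zero R M Y ==> \<phi> f = 0"
  using assms by (simp_all add: stable_dual_def)

text \<open>Functoriality by the Yoneda argument: composition with \<open>a\<close> turns the form
  \<open>\<eta> S (hom_id S)\<close> into a form on \<open>Hom R K' S\<close>, and the duality of
  \<open>K'\<close> represents it by some \<open>u\<close>.\<close>

lemma serre_map:
  assumes K: "left_module R K" and K': "left_module R K'" and S: "S \<in> CM R"
    and \<eta>: "serre_dual R \<iota> K S \<eta>" and \<eta>': "serre_dual R \<iota> K' S' \<eta>'" and a: "a \<in> Hom R K K'"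
  shows "\<exists>u\<in>Hom R S S'. \<forall>f\<in>Hom R K' S. \<eta>' S u f = \<eta> S (hom_id S) (compose (carrier K) f a)"
proof -
  have LS: "left_module R S" using S by (simp add: CM_def)
  have \<eta>1: "\<eta> S (hom_id S) \<in> stable_dual R \<iota> K S" by (rule serre_dual_dual[OF \<eta> S Hom_id[OF LS]])
  define \<phi> where "\<phi> f = \<eta> S (hom_id S) (compose (carrier K) f a)" for f
  have "\<phi> \<in> stable_dual R \<iota> K' S"
    unfolding stable_dual_def mem_Collect_eq
  proof (intro conjI ballI allI)
    fix f g assume fg: "f \<in> Hom R K' S" "g \<in> Hom R K' S"
    have "compose (carrier K) (hom_add K' S f g) a = hom_add K S (compose (carrier K) f a) (compose (carrier K) g a)"
      using Hom_closed[OF a] by (auto simp: compose_def hom_add_def fun_eq_iff)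
    then show "\<phi> (hom_add K' S f g) = \<phi> f + \<phi> g"
      using stable_dual_add[OF \<eta>1 Hom_compose[OF K a fg(1)] Hom_compose[OF K a fg(2)]] unfolding \<phi>_def by simp
  next
    fix c f assume f: "f \<in> Hom R K' S"
    have "compose (carrier K) (hom_scale K' S (\<iota> c) f) a = hom_scale K S (\<iota> c) (compose (carrier K) f a)"
      using Hom_closed[OF a] by (auto simp: compose_def hom_scale_def fun_eq_iff)
    then show "\<phi> (hom_scale K' S (\<iota> c) f) = c * \<phi> f"
      using stable_dual_scale[OF \<eta>1 Hom_compose[OF K a f]] unfolding \<phi>_def by simp
  next
    fix f assume "f \<in> stably_zero R K' S"
    then show "\<phi> f = 0" unfolding \<phi>_def by (rule stable_dual_zero[OF \<eta>1 stably_zero_compose_r[OF K _ a]])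
  qed
  from serre_dual_surj[OF \<eta>' S this] show ?thesis unfolding \<phi>_def .
qed

text \<open>Naturality gives \<open>\<eta>(v u)(f) = \<eta>(v)(u f) = \<eta>'(1)(u f b) =
  \<eta>'(u)(f b) = \<eta>(1)(f b a)\<close>, which is \<open>\<eta>(1)(f)\<close> since
  \<open>b a - 1\<close> is stably zero. Thus \<open>v u - 1\<close> pairs to 0 with
  everything.\<close>

lemma serre_stably_iso_half:
  fixes R (structure)
  assumes K: "left_module R K" and K': "left_module R K'" and S: "S \<in> CM R" and S': "S' \<in> CM R"
    and \<eta>: "serre_dual R \<iota> K S \<eta>" and \<eta>': "serre_dual R \<iota> K' S' \<eta>'" and a: "a \<in> Hom R K K'" and b: "b \<in> Hom R K' K"
    and ba: "hom_diff K K (compose (carrier K) b a) (hom_id K) \<in> stably_zero R K K"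
    and u: "u \<in> Hom R S S'" "\<forall>f\<in>Hom R K' S. \<eta>' S u f = \<eta> S (hom_id S) (compose (carrier K) f a)"
    and v: "v \<in> Hom R S' S" "\<forall>f\<in>Hom R K S'. \<eta> S' v f = \<eta>' S' (hom_id S') (compose (carrier K') f b)"
  shows "hom_diff S S (compose (carrier S) v u) (hom_id S) \<in> stably_zero R S S"
proof -
  have LS: "left_module R S" and LS': "left_module R S'" using S S' by (auto simp: CM_def)
  interpret S: abelian_group S by (rule lm_grp[OF LS])
  interpret K: abelian_group K by (rule lm_grp[OF K])
  have idS: "hom_id S \<in> Hom R S S" "hom_id S' \<in> Hom R S' S'" using Hom_id LS LS' by blast+
  let ?d = "hom_diff S S (compose (carrier S) v u) (hom_id S)"
  have vu: "compose (carrier S) v u \<in> Hom R S S" using Hom_compose[OF LS u(1) v(1)] .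
  have d: "?d \<in> Hom R S S" using hom_diff_closed[OF LS LS vu idS(1)] .
  have nat: "\<eta> Y (compose (carrier Y) g h) f = \<eta> Y' g (compose (carrier K) h f)"
    if "Y \<in> CM R" "Y' \<in> CM R" "h \<in> Hom R Y Y'" "g \<in> Hom R Y' S" "f \<in> Hom R K Y" for Y Y' h g f
    using serre_dual_nat[OF \<eta>] that by blast
  have nat': "\<eta>' Y (compose (carrier Y) g h) f = \<eta>' Y' g (compose (carrier K') h f)"
    if "Y \<in> CM R" "Y' \<in> CM R" "h \<in> Hom R Y Y'" "g \<in> Hom R Y' S'" "f \<in> Hom R K' Y" for Y Y' h g f
    using serre_dual_nat[OF \<eta>'] that by blast
  have \<eta>1: "\<eta> S (hom_id S) \<in> stable_dual R \<iota> K S" by (rule serre_dual_dual[OF \<eta> S idS(1)])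
  have "\<eta> S ?d f = 0" if f: "f \<in> Hom R K S" for f
  proof -
    have uf: "compose (carrier K) u f \<in> Hom R K S'" and fb: "compose (carrier K') f b \<in> Hom R K' S"
      using Hom_compose K K' f u b by blast+
    have "\<eta> S (compose (carrier S) v u) f = \<eta> S' v (compose (carrier K) u f)"
      using nat[OF S S' u(1) v(1) f] .
    also have "... = \<eta>' S' (hom_id S') (compose (carrier K') (compose (carrier K) u f) b)"
      using v(2) uf by blast
    also have "compose (carrier K') (compose (carrier K) u f) b = compose (carrier K') u (compose (carrier K') f b)"
      using compose_assoc'[OF b] by metis
    also have "\<eta>' S' (hom_id S') (compose (carrier K') u (compose (carrier K') f b)) =
        \<eta>' S (compose (carrier S) (hom_id S') u) (compose (carrier K') f b)"
      using nat'[OF S S' u(1) idS(2) fb] by simp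
    also have "compose (carrier S) (hom_id S') u = u" using compose_id[OF u(1)] by simp
    also have "\<eta>' S u (compose (carrier K') f b) = \<eta> S (hom_id S) (compose (carrier K) (compose (carrier K') f b) a)"
      using u(2) fb by blast
    also have "compose (carrier K) (compose (carrier K') f b) a = compose (carrier K) f (compose (carrier K) b a)"
      using compose_assoc'[OF a] by metis
    also have "... = hom_add K S (compose (carrier K) f (hom_diff K K (compose (carrier K) b a) (hom_id K))) f"
    proof
      fix x show "compose (carrier K) f (compose (carrier K) b a) x =
        hom_add K S (compose (carrier K) f (hom_diff K K (compose (carrier K) b a) (hom_id K))) f x"
      proof (cases "x \<in> carrier K")
        case True
        have c: "b (a x) \<in> carrier K" using True Hom_closed[OF a] Hom_closed[OF b] by blast
        show ?thesis using True c Hom_closed[OF f]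
          by (simp add: compose_def hom_add_def hom_diff_def hom_id_def Hom_diff[OF K LS f])
             (simp add: a_minus_def S.a_assoc S.l_neg)
      qed (simp add: compose_def hom_add_def)
    qed
    also have "\<eta> S (hom_id S) ... = \<eta> S (hom_id S) (compose (carrier K) f (hom_diff K K (compose (carrier K) b a) (hom_id K)))
        + \<eta> S (hom_id S) f"
      using stable_dual_add[OF \<eta>1 stably_zero_Hom[OF K stably_zero_compose_l[OF K ba f]] f] .
    also have "\<eta> S (hom_id S) (compose (carrier K) f (hom_diff K K (compose (carrier K) b a) (hom_id K))) = 0"
      using stable_dual_zero[OF \<eta>1 stably_zero_compose_l[OF K ba f]] .
    finally have 1: "\<eta> S (compose (carrier S) v u) f = \<eta> S (hom_id S) f" by simp
    have "compose (carrier S) v u = hom_add S S ?d (hom_id S)"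
    proof
      fix x show "compose (carrier S) v u x = hom_add S S ?d (hom_id S) x"
        using Hom_closed[OF u(1), of x] Hom_closed[OF v(1), of "u x"]
        by (cases "x \<in> carrier S")
          (simp_all add: compose_def hom_add_def hom_diff_def hom_id_def a_minus_def S.a_assoc S.l_neg)
    qed
    then have "\<eta> S (compose (carrier S) v u) f = \<eta> S ?d f + \<eta> S (hom_id S) f"
      using serre_dual_add[OF \<eta> S d idS(1) f] by simp
    then show ?thesis using 1 by simp
  qed
  then show ?thesis by (rule serre_dual_zero[OF \<eta> S d])
qed

lemma serre_stably_iso:
  assumes K: "left_module R K" and K': "left_module R K'" and "stably_iso R K K'"
    and "is_serre R \<iota> K S" "is_serre R \<iota> K' S'"
  shows "stably_iso R S S'"
proof -
  obtain \<eta> where S: "S \<in> CM R" and \<eta>: "serre_dual R \<iota> K S \<eta>" using assms(4) is_serre_dual by blast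
  obtain \<eta>' where S': "S' \<in> CM R" and \<eta>': "serre_dual R \<iota> K' S' \<eta>'" using assms(5) is_serre_dual by blast
  obtain a b where a: "a \<in> Hom R K K'" and b: "b \<in> Hom R K' K"
    and ba: "hom_diff K K (compose (carrier K) b a) (hom_id K) \<in> stably_zero R K K"
    and ab: "hom_diff K' K' (compose (carrier K') a b) (hom_id K') \<in> stably_zero R K' K'"
    using assms(3) unfolding stably_iso_def by blast
  obtain u where u: "u \<in> Hom R S S'" "\<forall>f\<in>Hom R K' S. \<eta>' S u f = \<eta> S (hom_id S) (compose (carrier K) f a)"
    using serre_map[OF K K' S \<eta> \<eta>' a] by blast
  obtain v where v: "v \<in> Hom R S' S" "\<forall>f\<in>Hom R K S'. \<eta> S' v f = \<eta>' S' (hom_id S') (compose (carrier K') f b)"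
    using serre_map[OF K' K S' \<eta>' \<eta> b] by blast
  have 1: "hom_diff S S (compose (carrier S) v u) (hom_id S) \<in> stably_zero R S S"
    by (rule serre_stably_iso_half[where K = K and K' = K' and S' = S' and \<eta> = \<eta> and \<eta>' = \<eta>' and a = a and b = b])
      (fact K K' S S' \<eta> \<eta>' a b ba u v)+
  have 2: "hom_diff S' S' (compose (carrier S') u v) (hom_id S') \<in> stably_zero R S' S'"
    by (rule serre_stably_iso_half[where K = K' and K' = K and S' = S and \<eta> = \<eta>' and \<eta>' = \<eta> and a = b and b = a])
      (fact K K' S S' \<eta> \<eta>' a b ab u v)+
  show ?thesis unfolding stably_iso_def
  proof (intro bexI conjI)
    show "hom_diff S S (compose (carrier S) v u) (hom_id S) \<in> stably_zero R S S" by (rule 1)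
    show "hom_diff S' S' (compose (carrier S') u v) (hom_id S') \<in> stably_zero R S' S'" by (rule 2)
  qed (rule v(1), rule u(1))
qed

section \<open>Powers of \<open>\<tau>\<close> and divisibility of the period\<close>

context free_cm
begin

lemma tau_stably_iso:
  fixes L L' :: "'r fmodule"
  assumes "left_module R L" "left_module R L'" "stably_iso R L L'" "is_tau R \<iota> L N" "is_tau R \<iota> L' N'"
  shows "stably_iso R N N'"
proof -
  obtain K where K: "is_syzygy R L K" "is_serre R \<iota> K N" using assms(4) by (auto simp: is_tau_def)
  obtain K' where K': "is_syzygy R L' K'" "is_serre R \<iota> K' N'" using assms(5) by (auto simp: is_tau_def)
  have m: "left_module R K" "left_module R K'" using K K' by (auto simp: is_syzygy_def CM_def)
  show ?thesis
    using serre_stably_iso[OF m syzygy_stably_iso[OF assms(1-3) K(1) K'(1)] K(2) K'(2)] .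
qed

lemma tau_pow_CM: "is_tau_pow R \<iota> M d N ==> N \<in> CM R"
  by (cases d) (auto simp: is_tau_def is_serre_def)

lemma tau_pow_stably_iso:
  assumes M: "left_module R M" and M': "left_module R M'" and "stably_iso R M M'"
    and "is_tau_pow R \<iota> M d N" "is_tau_pow R \<iota> M' d N'"
  shows "stably_iso R N N'"
  using assms(4,5)
proof (induction d arbitrary: N N')
  case 0
  have "left_module R N" "left_module R N'" "stably_iso R N M" "stably_iso R M' N'"
    using 0 stably_iso_sym by (auto simp: CM_def)
  then show ?case using stably_iso_trans M M' assms(3) by metis
next
  case (Suc d)
  then obtain L L' where "is_tau_pow R \<iota> M d L" "is_tau R \<iota> L N" "is_tau_pow R \<iota> M' d L'" "is_tau R \<iota> L' N'" by auto
  then show ?case using Suc.IH tau_stably_iso tau_pow_CM CM_def by (metis (mono_tags, lifting) mem_Collect_eq)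
qed

lemma tau_pow_shift:
  assumes M: "left_module R M" and N1: "is_tau_pow R \<iota> M a N1" "stably_iso R N1 M"
    and "is_tau_pow R \<iota> M (a + b) N" "is_tau_pow R \<iota> M b N'"
  shows "stably_iso R N N'"
  using assms(4,5)
proof (induction b arbitrary: N N')
  case 0
  have m: "left_module R N" "left_module R N'" "left_module R N1"
    using 0 N1 tau_pow_CM CM_def by fastforce+
  have "stably_iso R N N1" using tau_pow_stably_iso[OF M M _ _ N1(1)] 0 stably_iso_trans M
      stably_iso_sym N1 m by (metis Nat.add_0_right is_tau_pow.simps(1))
  then show ?case using 0 stably_iso_trans m M N1(2) by (metis is_tau_pow.simps(1))
next
  case (Suc b)
  then obtain L L' where *: "is_tau_pow R \<iota> M (a + b) L" "is_tau R \<iota> L N" "is_tau_pow R \<iota> M b L'" "is_tau R \<iota> L' N'" by auto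
  then have "left_module R L" "left_module R L'" using tau_pow_CM CM_def by fastforce+
  then show ?case using Suc.IH[OF *(1,3)] tau_stably_iso * by blast
qed

lemma tau_pow_ex:
  assumes "M \<in> CM R" and ex: "\<And>L :: 'r fmodule. L \<in> CM R ==> \<exists>N. is_tau R \<iota> L N"
  shows "\<exists>N. is_tau_pow R \<iota> M d N"
proof (induction d)
  case 0
  obtain N :: "'r fmodule" and f g where N: "N \<in> CM R" "lm_iso R M N f g" using fmodule_copy[OF assms(1)] by blast
  then have "stably_iso R M N" using stably_iso_lm_iso[OF _ _ N(2)] assms(1) by (simp add: CM_def)
  then show ?case using N by auto
next
  case (Suc d)
  then obtain L where L: "is_tau_pow R \<iota> M d L" by blast
  obtain N where "is_tau R \<iota> L N" using ex[OF tau_pow_CM[OF L]] by blast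
  then show ?case using L by auto
qed

text \<open>All values of \<open>\<tau>^(a + b) M\<close> and \<open>\<tau>^b M\<close> are stably
  isomorphic by \<open>tau_pow_shift\<close>; that values exist at all is needed to pass from one
  exponent to the other.\<close>

lemma tau_pow_fixes_shift:
  assumes M: "M \<in> CM R" and ex: "\<And>L :: 'r fmodule. L \<in> CM R ==> \<exists>N. is_tau R \<iota> L N"
    and a: "tau_pow_fixes R \<iota> M a"
  shows "tau_pow_fixes R \<iota> M (a + b) \<longleftrightarrow> tau_pow_fixes R \<iota> M b"
proof -
  have LM: "left_module R M" using M by (simp add: CM_def)
  obtain N1 where N1: "is_tau_pow R \<iota> M a N1" "stably_iso R N1 M" using a by (auto simp: tau_pow_fixes_def)
  have iff: "stably_iso R N M \<longleftrightarrow> stably_iso R N' M"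
    if "is_tau_pow R \<iota> M (a + b) N" "is_tau_pow R \<iota> M b N'" for N N'
  proof -
    have m: "left_module R N" "left_module R N'" using that tau_pow_CM CM_def by fastforce+
    have "stably_iso R N N'" using tau_pow_shift[OF LM N1 that] .
    then show ?thesis using stably_iso_trans stably_iso_sym m LM by metis
  qed
  show ?thesis unfolding tau_pow_fixes_def using iff tau_pow_ex[OF M ex] by metis
qed

text \<open>Division with remainder: \<open>e mod d\<close> also fixes \<open>M\<close>, so it
  cannot be positive when \<open>d\<close> is the least positive exponent.\<close>

lemma tau_periodicI:
  assumes M: "M \<in> CM R" and ex: "\<And>L :: 'r fmodule. L \<in> CM R ==> \<exists>N. is_tau R \<iota> L N"
    and e: "1 \<le> e" "tau_pow_fixes R \<iota> M e"
  shows "\<exists>d. tau_periodic R \<iota> M d \<and> d dvd e"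
proof -
  define d where "d = (LEAST d. 1 \<le> d \<and> tau_pow_fixes R \<iota> M d)"
  have d: "1 \<le> d \<and> tau_pow_fixes R \<iota> M d" unfolding d_def by (rule LeastI[of _ e]) (use e in simp)
  have min: "\<not> tau_pow_fixes R \<iota> M d'" if "1 \<le> d'" "d' < d" for d'
    using not_less_Least[of d'] that unfolding d_def by blast
  have mult: "tau_pow_fixes R \<iota> M (q * d + r) \<longleftrightarrow> tau_pow_fixes R \<iota> M r" for q r
    by (induction q) (use tau_pow_fixes_shift[OF M ex] d in \<open>auto simp: add.assoc\<close>)
  have "tau_pow_fixes R \<iota> M (e mod d)" using e mult[of "e div d" "e mod d"] by simp
  then have "e mod d = 0" using min[of "e mod d"] d by fastforce
  then show ?thesis using d min unfolding tau_periodic_def by auto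
qed

end

lemma fps_X_power_dvd_iff: "fps_X ^ c dvd (f :: 'a::comm_ring_1 fps) \<longleftrightarrow> (\<forall>m<c. fps_nth f m = 0)"
proof
  assume "\<forall>m<c. fps_nth f m = 0"
  then have "f = fps_X ^ c * fps_shift c f"
    by (intro fps_ext) (auto simp: fps_X_power_mult_nth)
  then show "fps_X ^ c dvd f" by (metis dvd_triv_left)
qed (auto simp: dvd_def fps_X_power_mult_nth)

lemma sum_eq_single:
  assumes "finite A" "a \<in> A" "\<And>i. i \<in> A ==> i \<noteq> a ==> f i = 0"
  shows "sum f A = f a"
  using assms by (subst sum.remove[of A a]) (auto intro!: sum.neutral)

text \<open>The loop \<open>x\<close> followed by \<open>y\<close> costs exactly 1 at every vertex,
  so the costs of walks between two vertices form an upward closed set.\<close>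

lemma wset_loop:
  assumes "j < n" "1 < k" "2 * k \<le> n" "wset n k i j m \<noteq> {}"
  shows "wset n k i j (m + d) \<noteq> {}"
proof (induction d)
  case (Suc d)
  then obtain w where w: "wend n w j = i" "wcost n k w j = m + d" by (auto simp: wset_def)
  have i: "i < n" using w wend_less assms by blast
  have e: "wend n [True, False] i = i" using stp_stp[OF i, of False] by simp
  have "n * wcost n k [True, False] i = n * 1"
    using wcost_pot[OF i assms(2,3), of "[True, False]"] e assms(3) by simp
  then have "wcost n k [True, False] i = 1" using assms by (simp del: wcost.simps)
  then have "w @ [True, False] \<in> wset n k i j (m + Suc d)"
    using w e by (simp add: wset_def del: wcost.simps wend.simps)
  then show ?case by blast
qed (use assms in simp)

lemma wset_ex:
  assumes "i < n" "j < n"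
  shows "\<exists>m. wset n k i j m \<noteq> {}"
proof -
  let ?w = "replicate (i + n - j) True"
  have "int (wend n ?w j) = (int i + int n) mod int n"
    using assms by (subst wend_count) (auto simp: count_list_replicate of_nat_diff)
  also have "... = int i" using assms by simp
  finally have "?w \<in> wset n k i j (wcost n k ?w j)" by (simp add: wset_def)
  then show ?thesis by blast
qed

section \<open>Elements of the order, its center and the exponent matrix\<close>

context tiled
begin

lemma n_pos: "0 < n" and k_pos: "0 < k" and k_less: "k < n"
  using k1 nk by auto

sublocale R: ring R by (rule R_ring)

text \<open>The exponent matrix of the order: by \<open>wset_iff_C\<close> the entries at
  \<open>(i, j)\<close> are the multiples of \<open>t^(C i j)\<close>.\<close>

definition C :: "nat \<Rightarrow> nat \<Rightarrow> nat" where "C i j = (LEAST m. wset n k i j m \<noteq> {})"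

lemma wset_iff_C: "i < n ==> j < n ==> wset n k i j m \<noteq> {} \<longleftrightarrow> C i j \<le> m"
proof
  assume ij: "i < n" "j < n"
  show "wset n k i j m \<noteq> {} ==> C i j \<le> m" unfolding C_def by (rule Least_le)
  assume "C i j \<le> m"
  moreover have "wset n k i j (C i j) \<noteq> {}" unfolding C_def using wset_ex[OF ij] by (rule LeastI_ex)
  ultimately show "wset n k i j m \<noteq> {}" using wset_loop[OF ij(2) k1 nk, of i "C i j" "m - C i j"] by simp
qed

lemma C_le: "j < n ==> wend n w j = i ==> C i j \<le> wcost n k w j"
  using wset_iff_C[of i j "wcost n k w j"] wend_less by (auto simp: wset_def)

lemma C_word:
  assumes "i < n" "j < n"
  obtains w where "wend n w j = i" "wcost n k w j = C i j"
  using wset_iff_C[OF assms, of "C i j"] by (auto simp: wset_def)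

lemma C_refl: "i < n ==> C i i = 0"
  using C_le[of i "[]" i] by simp

lemma C_triangle:
  assumes "i < n" "j < n" "l < n"
  shows "C i l \<le> C i j + C j l"
proof -
  obtain v where v: "wend n v j = i" "wcost n k v j = C i j" using C_word assms by blast
  obtain w where w: "wend n w l = j" "wcost n k w l = C j l" using C_word assms by blast
  show ?thesis using C_le[OF assms(3), of "w @ v" i] v w by simp
qed

lemma mat_dvd: "a \<in> carrier R ==> i < n ==> j < n ==> fps_X ^ C i j dvd mat a i j"
  unfolding fps_X_power_dvd_iff using mat_valid wset_iff_C by (meson not_le)

definition el :: "(nat \<Rightarrow> nat \<Rightarrow> complex fps) \<Rightarrow> 'r" where
  "el \<beta> = (SOME a. a \<in> carrier R \<and> (\<forall>i<n. \<forall>j<n. mat a i j = \<beta> i j))"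

lemma
  assumes "\<And>i j. i < n ==> j < n ==> fps_X ^ C i j dvd \<beta> i j"
  shows el_closed: "el \<beta> \<in> carrier R" and mat_el: "i < n ==> j < n ==> mat (el \<beta>) i j = \<beta> i j"
proof -
  have "\<exists>a\<in>carrier R. \<forall>i<n. \<forall>j<n. mat a i j = \<beta> i j"
    using assms wset_iff_C unfolding fps_X_power_dvd_iff by (intro mat_surj) (meson not_le)
  then have "\<exists>a. a \<in> carrier R \<and> (\<forall>i<n. \<forall>j<n. mat a i j = \<beta> i j)" by blast
  from someI_ex[OF this] show "el \<beta> \<in> carrier R" "i < n ==> j < n ==> mat (el \<beta>) i j = \<beta> i j"
    unfolding el_def by blast+
qed

lemma mat_zero: "i < n ==> j < n ==> mat \<zero> i j = 0"
  using mat_add[of \<zero> \<zero> i j] by simp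


lemma mat_finsum:
  assumes "finite A" "\<And>a. a \<in> A ==> f a \<in> carrier R" "i < n" "j < n"
  shows "mat (\<Oplus>a\<in>A. f a) i j = (\<Sum>a\<in>A. mat (f a) i j)"
  using assms(1,2)
proof (induction A rule: finite_induct)
  case empty then show ?case using assms by (simp add: mat_zero)
next
  case (insert a A)
  then show ?case using assms by (simp add: R.finsum_insert mat_add Pi_def R.finsum_closed)
qed

text \<open>The word started at all vertices at once, that is, the monomial in \<open>x\<close> and
  \<open>y\<close> that it spells.\<close>

definition wel :: "bool list \<Rightarrow> 'r" where
  "wel w = el (\<lambda>i j. if i = wend n w j then fps_X ^ wcost n k w j else 0)"

lemma wel_dvd: "i < n ==> j < n ==> fps_X ^ C i j dvd (if i = wend n w j then fps_X ^ wcost n k w j else (0 :: complex fps))"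
  using C_le[of j w i] by (auto intro: le_imp_power_dvd)

lemma wel_closed [simp]: "wel w \<in> carrier R"
  unfolding wel_def by (rule el_closed) (rule wel_dvd)

lemma mat_wel: "i < n ==> j < n ==> mat (wel w) i j = (if i = wend n w j then fps_X ^ wcost n k w j else 0)"
  unfolding wel_def by (rule mat_el) (rule wel_dvd)

lemma wel_append: "wel v \<otimes> wel w = wel (w @ v)"
proof (rule mat_inj)
  fix i j assume ij: "i < n" "j < n"
  have "mat (wel v \<otimes> wel w) i j = (\<Sum>l<n. mat (wel v) i l * mat (wel w) l j)"
    using ij by (simp add: mat_mult)
  also have "... = mat (wel v) i (wend n w j) * mat (wel w) (wend n w j) j"
    using ij wend_less[OF ij(2)] by (intro sum_eq_single) (auto simp: mat_wel)
  also have "... = mat (wel (w @ v)) i j"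
    using ij wend_less[OF ij(2)] by (auto simp: mat_wel power_add mult.commute)
  finally show "mat (wel v \<otimes> wel w) i j = mat (wel (w @ v)) i j" .
qed auto

lemma wel_Nil: "wel [] = \<one>"
  by (rule mat_inj) (auto simp: mat_wel mat_one)

lemma wel_eqI: "(\<And>j. j < n ==> wend n v j = wend n w j \<and> wcost n k v j = wcost n k w j) ==> wel v = wel w"
  by (rule mat_inj) (auto simp: mat_wel)

definition x :: 'r where "x = wel [True]"
definition y :: 'r where "y = wel [False]"

lemma x_closed [simp]: "x \<in> carrier R" and y_closed [simp]: "y \<in> carrier R"
  by (simp_all add: x_def y_def)

lemma x_pow: "x [^] (a::nat) = wel (replicate a True)"
  by (induction a) (simp_all add: wel_Nil wel_append x_def replicate_append_same)

lemma y_pow: "y [^] (a::nat) = wel (replicate a False)"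
  by (induction a) (simp_all add: wel_Nil wel_append y_def replicate_append_same)

lemma xy_commute: "x \<otimes> y = y \<otimes> x"
  unfolding x_def y_def wel_append
  by (rule wel_eqI, subst wend_wcost_eq_iff[OF _ k1 nk]) (auto intro!: exI[of _ 0])

lemma x_pow_k: "x [^] k = y [^] (n - k)"
  unfolding x_pow y_pow
  by (rule wel_eqI, subst wend_wcost_eq_iff[OF _ k1 nk]) (auto simp: count_list_replicate intro!: exI[of _ 1])

definition E :: "nat \<Rightarrow> 'r" where "E l = el (\<lambda>i j. if i = l \<and> j = l then 1 else 0)"

lemma E_closed [simp]: "E l \<in> carrier R"
  unfolding E_def by (rule el_closed) (auto simp: C_refl)

lemma mat_E: "i < n ==> j < n ==> mat (E l) i j = (if i = l \<and> j = l then 1 else 0)"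
  unfolding E_def by (rule mat_el) (auto simp: C_refl)

lemma mat_E_left: "a \<in> carrier R ==> i < n ==> j < n ==> l < n ==> mat (E l \<otimes> a) i j = (if i = l then mat a l j else 0)"
proof -
  assume a: "a \<in> carrier R" "i < n" "j < n" "l < n"
  have "mat (E l \<otimes> a) i j = (\<Sum>h<n. mat (E l) i h * mat a h j)"
    using a by (simp add: mat_mult)
  also have "... = mat (E l) i l * mat a l j"
    using a by (intro sum_eq_single) (auto simp: mat_E)
  finally have "mat (E l \<otimes> a) i j = mat (E l) i l * mat a l j" .
  then show ?thesis using a by (simp add: mat_E)
qed

lemma mat_E_right: "a \<in> carrier R ==> i < n ==> j < n ==> l < n ==> mat (a \<otimes> E l) i j = (if j = l then mat a i l else 0)"
proof -
  assume a: "a \<in> carrier R" "i < n" "j < n" "l < n"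
  have "mat (a \<otimes> E l) i j = (\<Sum>h<n. mat a i h * mat (E l) h j)"
    using a by (simp add: mat_mult)
  also have "... = mat a i l * mat (E l) l j"
    using a by (intro sum_eq_single) (auto simp: mat_E)
  finally have "mat (a \<otimes> E l) i j = mat a i l * mat (E l) l j" .
  then show ?thesis using a by (simp add: mat_E)
qed

lemma E_idem: "l < n ==> l' < n ==> E l \<otimes> E l' = (if l = l' then E l else \<zero>)"
  by (rule mat_inj) (auto simp: mat_E_left mat_E mat_zero)

lemma E_sum: "(\<Oplus>l\<in>{..<n}. E l) = \<one>"
proof (rule mat_inj)
  fix i j assume ij: "i < n" "j < n"
  have "mat (\<Oplus>l\<in>{..<n}. E l) i j = (\<Sum>l<n. mat (E l) i j)" using ij by (intro mat_finsum) auto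
  also have "... = mat (E i) i j" using ij by (intro sum_eq_single) (auto simp: mat_E)
  finally show "mat (\<Oplus>l\<in>{..<n}. E l) i j = mat \<one> i j" using ij by (auto simp: mat_E mat_one)
qed (auto intro!: R.finsum_closed)

lemma wel_E:
  assumes "j < n"
  shows "E (wend n w j) \<otimes> wel w = wel w \<otimes> E j"
proof (rule mat_inj)
  have inj: "l = j" if "wend n w l = wend n w j" "l < n" for l
  proof -
    have "(int l + int (count_list w True) - int (count_list w False)) mod int n =
        (int j + int (count_list w True) - int (count_list w False)) mod int n"
      using that assms wend_count by metis
    then have "int n dvd int l - int j" by (simp add: mod_eq_dvd_iff algebra_simps)
    moreover have "\<bar>int l - int j\<bar> < int n" using that assms by linarith
    ultimately have "int l - int j = 0" using dvd_imp_le_int[of "int l - int j" "int n"] by auto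
    then show ?thesis by simp
  qed
  fix i l assume "i < n" "l < n"
  then show "mat (E (wend n w j) \<otimes> wel w) i l = mat (wel w \<otimes> E j) i l"
    using assms inj by (auto simp: mat_E_left mat_E_right mat_wel wend_less)
qed auto

text \<open>The value of \<open>p\<close> at the central element \<open>t\<close>; these scalar
  matrices turn out to be the whole center (\<open>ring_center_eq\<close>).\<close>

definition \<zeta> :: "complex fps \<Rightarrow> 'r" where "\<zeta> p = el (\<lambda>i j. if i = j then p else 0)"

lemma zeta_closed [simp]: "\<zeta> p \<in> carrier R"
  unfolding \<zeta>_def by (rule el_closed) (auto simp: C_refl)

lemma mat_zeta: "i < n ==> j < n ==> mat (\<zeta> p) i j = (if i = j then p else 0)"
  unfolding \<zeta>_def by (rule mat_el) (auto simp: C_refl)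

lemma mat_zeta_left: "a \<in> carrier R ==> i < n ==> j < n ==> mat (\<zeta> p \<otimes> a) i j = p * mat a i j"
proof -
  assume a: "a \<in> carrier R" "i < n" "j < n"
  have "mat (\<zeta> p \<otimes> a) i j = (\<Sum>h<n. mat (\<zeta> p) i h * mat a h j)"
    using a by (simp add: mat_mult)
  also have "... = mat (\<zeta> p) i i * mat a i j"
    using a by (intro sum_eq_single) (auto simp: mat_zeta)
  finally have "mat (\<zeta> p \<otimes> a) i j = mat (\<zeta> p) i i * mat a i j" .
  then show ?thesis using a by (simp add: mat_zeta)
qed

lemma mat_zeta_right: "a \<in> carrier R ==> i < n ==> j < n ==> mat (a \<otimes> \<zeta> p) i j = p * mat a i j"
proof -
  assume a: "a \<in> carrier R" "i < n" "j < n"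
  have "mat (a \<otimes> \<zeta> p) i j = (\<Sum>h<n. mat a i h * mat (\<zeta> p) h j)"
    using a by (simp add: mat_mult)
  also have "... = mat a i j * mat (\<zeta> p) j j"
    using a by (intro sum_eq_single) (auto simp: mat_zeta)
  finally have "mat (a \<otimes> \<zeta> p) i j = mat a i j * mat (\<zeta> p) j j" .
  then show ?thesis using a by (simp add: mat_zeta mult.commute)
qed

lemma zeta_commute: "a \<in> carrier R ==> \<zeta> p \<otimes> a = a \<otimes> \<zeta> p"
  by (rule mat_inj) (auto simp: mat_zeta_left mat_zeta_right)

lemma zeta_add: "\<zeta> (p + q) = \<zeta> p \<oplus> \<zeta> q"
  by (rule mat_inj) (auto simp: mat_zeta mat_add)

lemma zeta_mult: "\<zeta> (p * q) = \<zeta> p \<otimes> \<zeta> q"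
  by (rule mat_inj) (auto simp: mat_zeta mat_zeta_left)

lemma zeta_one: "\<zeta> 1 = \<one>"
  by (rule mat_inj) (auto simp: mat_zeta mat_one)

lemma zeta_inj: "\<zeta> p = \<zeta> q ==> p = q"
  using mat_zeta[of 0 0] n_pos by metis

lemma iota_zeta: "\<iota> c = \<zeta> (fps_const c)"
  by (rule mat_inj) (auto simp: mat_zeta mat_iota iota_closed)

lemma zeta_X: "\<zeta> fps_X = x \<otimes> y"
proof -
  have "wend n [False, True] j = j \<and> wcost n k [False, True] j = 1" if j: "j < n" for j
  proof -
    have e: "wend n [False, True] j = j" using stp_stp[OF j, of True] by simp
    then have "n * wcost n k [False, True] j = n * 1"
      using wcost_pot[OF j k1 nk, of "[False, True]"] nk by simp
    then show ?thesis using e n_pos by (simp del: wcost.simps wend.simps)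
  qed
  then show ?thesis unfolding x_def y_def wel_append
    by (intro mat_inj) (auto simp: mat_wel mat_zeta simp del: wcost.simps wend.simps)
qed

text \<open>Going once around the cycle has weight \<open>n (n - k)\<close> and closes up, so it
  costs \<open>n - k\<close> at every vertex. That this power of \<open>x\<close> is central is why
  \<open>sig\<close> has an order dividing \<open>n\<close>.\<close>

lemma x_pow_n: "x [^] n = \<zeta> (fps_X ^ (n - k))"
proof -
  have "wend n (replicate n True) j = j \<and> wcost n k (replicate n True) j = n - k" if j: "j < n" for j
  proof -
    have "int (wend n (replicate n True) j) = (int j + int n) mod int n"
      by (subst wend_count[OF j]) (simp add: count_list_replicate)
    then have e: "wend n (replicate n True) j = j" using j by simp
    then have "n * wcost n k (replicate n True) j = n * (n - k)"
      using wcost_pot[OF j k1 nk, of "replicate n True"] by (auto simp: count_list_replicate)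
    then have "wcost n k (replicate n True) j = n - k" using n_pos by (metis mult_left_cancel not_gr0)
    then show ?thesis using e by blast
  qed
  then show ?thesis unfolding x_pow by (intro mat_inj) (auto simp: mat_wel mat_zeta)
qed

text \<open>Commuting with the idempotents makes \<open>z\<close> diagonal, and commuting with
  \<open>x\<close> makes the diagonal constant.\<close>

lemma ring_center_eq: "ring_center R = range \<zeta>"
proof (intro equalityI subsetI)
  fix z assume z: "z \<in> ring_center R"
  then have zc: "z \<in> carrier R" and com: "\<And>r. r \<in> carrier R ==> z \<otimes> r = r \<otimes> z" by (auto simp: ring_center_def)
  have diag: "mat z i j = 0" if "i < n" "j < n" "i \<noteq> j" for i j
    using arg_cong[OF com[of "E j"], of "\<lambda>r. mat r i j"] that zc by (simp add: mat_E_left mat_E_right)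
  have step: "mat z (Suc i) (Suc i) = mat z i i" if "Suc i < n" for i
  proof -
    have i: "i < n" "Suc i < n" "stp n True i = Suc i" using that by (auto simp: stp_True)
    have "mat (z \<otimes> x) (Suc i) i = mat z (Suc i) (Suc i) * mat x (Suc i) i"
      using i zc diag by (subst mat_mult) (auto intro!: sum_eq_single)
    moreover have "mat (x \<otimes> z) (Suc i) i = mat x (Suc i) i * mat z i i"
      using i zc diag by (subst mat_mult) (auto intro!: sum_eq_single)
    moreover have "mat x (Suc i) i \<noteq> 0" using i by (simp add: x_def mat_wel)
    ultimately show ?thesis using com[of x] by (simp add: mult.commute)
  qed
  have eq0: "mat z i i = mat z 0 0" if "i < n" for i
    using that by (induction i) (use step in auto)
  have "z = \<zeta> (mat z 0 0)"
  proof (rule mat_inj)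
    fix i j assume "i < n" "j < n"
    then show "mat z i j = mat (\<zeta> (mat z 0 0)) i j"
      using diag[of i j] eq0[of i] by (cases "i = j") (simp_all add: mat_zeta)
  qed (use zc in auto)
  then show "z \<in> range \<zeta>" by blast
qed (auto simp: ring_center_def zeta_commute)

text \<open>Neither word contains \<open>x\<close>, so no exchange is possible. Hence the sum in
  \<open>mat_ups\<close> has at most one term.\<close>

lemma y_replicate_inj:
  assumes "j < n" "replicate b False \<in> wset n k i j m" "replicate b' False \<in> wset n k i j m"
  shows "b = b'"
proof -
  have "wend n (replicate b False) j = wend n (replicate b' False) j \<and>
    wcost n k (replicate b False) j = wcost n k (replicate b' False) j" using assms(2,3) by (auto simp: wset_def)
  then show ?thesis unfolding wend_wcost_eq_iff[OF assms(1) k1 nk] using k_pos by (auto simp: count_list_replicate)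
qed

lemma mat_ups_y:
  assumes "i < n" "j < n" "replicate b False \<in> wset n k i j m"
  shows "fps_nth (mat (\<upsilon> p) i j) m = fps_nth p b"
proof -
  have "{b. replicate b False \<in> wset n k i j m} = {b}" using y_replicate_inj[OF assms(2)] assms(3) by blast
  then show ?thesis using assms by (simp add: mat_ups)
qed

lemma mat_ups_0:
  assumes "i < n" "j < n" "\<And>b. replicate b False \<notin> wset n k i j m"
  shows "fps_nth (mat (\<upsilon> p) i j) m = 0"
  using assms by (simp add: mat_ups)

lemma ups_X_pow: "\<upsilon> (fps_X ^ b) = y [^] (b :: nat)"
  unfolding y_pow
proof (rule mat_inj)
  fix i j assume ij: "i < n" "j < n"
  show "mat (\<upsilon> (fps_X ^ b)) i j = mat (wel (replicate b False)) i j"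
  proof (rule fps_ext)
    fix m
    have w: "fps_nth (mat (wel (replicate b False)) i j) m = (if replicate b False \<in> wset n k i j m then 1 else 0)"
      using ij by (auto simp: mat_wel wset_def fps_X_power_iff)
    show "fps_nth (mat (\<upsilon> (fps_X ^ b)) i j) m = fps_nth (mat (wel (replicate b False)) i j) m"
    proof (cases "\<exists>b'. replicate b' False \<in> wset n k i j m")
      case True
      then obtain b' where b': "replicate b' False \<in> wset n k i j m" by blast
      then have "replicate b False \<in> wset n k i j m \<longleftrightarrow> b' = b" using y_replicate_inj[OF ij(2) b'] by blast
      then show ?thesis unfolding w using mat_ups_y[OF ij b'] by (simp add: fps_X_power_iff)
    next
      case False
      then show ?thesis unfolding w using mat_ups_0[OF ij, of m] by auto
    qed
  qed
qed (auto simp: ups_closed)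

lemma ups_one: "\<upsilon> 1 = \<one>" and ups_X: "\<upsilon> fps_X = y"
  using ups_X_pow[of 0] ups_X_pow[of 1] by simp_all

lemma ups_const: "\<upsilon> (fps_const c) = \<iota> c"
proof -
  have "\<upsilon> (fps_const c * 1) = \<iota> c \<otimes> \<upsilon> 1"
  proof (rule mat_inj)
    fix i j assume ij: "i < n" "j < n"
    show "mat (\<upsilon> (fps_const c * 1)) i j = mat (\<iota> c \<otimes> \<upsilon> 1) i j"
      unfolding iota_zeta mat_zeta_left[OF ups_closed ij]
      by (rule fps_ext) (simp only: fps_mult_left_const_nth mat_ups[OF ij] sum_distrib_left)
  qed (auto simp: ups_closed iota_closed)
  then show ?thesis by (simp add: ups_one iota_closed)
qed

end

section \<open>Bases over power series rings\<close>

definition lincomb :: "(complex fps \<Rightarrow> 'r) \<Rightarrow> ('r, 'm) module \<Rightarrow> 'i set \<Rightarrow> ('i \<Rightarrow> 'm) \<Rightarrow> ('i \<Rightarrow> complex fps) \<Rightarrow> 'm" where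
  "lincomb \<chi> M I e p = (\<Oplus>\<^bsub>M\<^esub> i\<in>I. \<chi> (p i) \<odot>\<^sub>M e i)"

text \<open>The basis is one of a subset \<open>D\<close>, which may be a vertex space
  \<open>E 0 M\<close> and need not be an \<open>R\<close>-submodule; \<open>\<chi>\<close> will be
  \<open>\<zeta>\<close> for bases over \<open>t\<close> and \<open>\<upsilon>\<close> for bases
  over \<open>y\<close>.\<close>

definition basis_of :: "(complex fps \<Rightarrow> 'r) \<Rightarrow> ('r, 'm) module \<Rightarrow> 'm set \<Rightarrow> 'i set \<Rightarrow> ('i \<Rightarrow> 'm) \<Rightarrow> bool" where
  "basis_of \<chi> M D I e \<longleftrightarrow> finite I \<and> e ` I \<subseteq> D \<and> (\<forall>d\<in>D. \<exists>p. d = lincomb \<chi> M I e p) \<and>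
     (\<forall>p. lincomb \<chi> M I e p = \<zero>\<^sub>M \<longrightarrow> (\<forall>i\<in>I. p i = 0))"

definition cspan :: "(complex fps \<Rightarrow> 'r) \<Rightarrow> ('r, 'm) module \<Rightarrow> 'm set \<Rightarrow> 'm set" where
  "cspan \<chi> M G = range (\<lambda>c. lincomb \<chi> M G id (\<lambda>g. fps_const (c g)))"

text \<open>Generation modulo the variable with constant coefficients: the hypothesis of a Nakayama
  argument, which successive approximation turns into generation by power series.\<close>

definition cgen :: "(complex fps \<Rightarrow> 'r) \<Rightarrow> ('r, 'm) module \<Rightarrow> 'm set \<Rightarrow> 'm set \<Rightarrow> bool" where
  "cgen \<chi> M D G \<longleftrightarrow> finite G \<and> G \<subseteq> D \<and> (\<forall>d\<in>D. \<exists>a\<in>cspan \<chi> M G. \<exists>d'\<in>D. d = a \<oplus>\<^sub>M \<chi> fps_X \<odot>\<^sub>M d')"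

locale fps_module =
  fixes R :: "'r ring" (structure) and M :: "('r, 'm) module" and \<chi> :: "complex fps \<Rightarrow> 'r"
  assumes M: "left_module R M" and chi_closed: "\<chi> p \<in> carrier R"
    and chi_add: "\<chi> (p + q) = \<chi> p \<oplus> \<chi> q" and chi_mult: "\<chi> (p * q) = \<chi> p \<otimes> \<chi> q" and chi_one: "\<chi> 1 = \<one>"
begin

sublocale R: ring R by (rule lm_ring[OF M])
sublocale M: abelian_group M by (rule lm_grp[OF M])

lemma smult_closed: "m \<in> carrier M ==> \<chi> p \<odot>\<^sub>M m \<in> carrier M"
  by (rule lm_closed[OF M chi_closed])

lemma chi_zero: "\<chi> 0 = \<zero>"
  using chi_add[of 0 0] chi_closed[of 0] by (simp add: R.add.r_cancel_one)

lemma chi_zero_smult: "m \<in> carrier M ==> \<chi> 0 \<odot>\<^sub>M m = \<zero>\<^sub>M"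
  by (simp add: chi_zero lm_zero_l[OF M])

lemma chi_neg_smult: "m \<in> carrier M ==> \<chi> (- p) \<odot>\<^sub>M m = \<ominus>\<^bsub>M\<^esub> (\<chi> p \<odot>\<^sub>M m)"
  using lm_l_distr[OF M chi_closed[of "- p"] chi_closed[of p]] chi_add[of "- p" p] chi_zero_smult smult_closed
  by (intro M.minus_equality[symmetric]) auto

lemma smult_smult: "m \<in> carrier M ==> \<chi> p \<odot>\<^sub>M (\<chi> q \<odot>\<^sub>M m) = \<chi> (p * q) \<odot>\<^sub>M m"
  by (simp add: chi_mult lm_assoc[OF M chi_closed chi_closed])

lemma smult_add: "m \<in> carrier M ==> \<chi> (p + q) \<odot>\<^sub>M m = \<chi> p \<odot>\<^sub>M m \<oplus>\<^sub>M \<chi> q \<odot>\<^sub>M m"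
  by (simp add: chi_add lm_l_distr[OF M chi_closed chi_closed])

lemma lincomb_closed: "e ` I \<subseteq> carrier M ==> lincomb \<chi> M I e p \<in> carrier M"
  unfolding lincomb_def by (intro M.finsum_closed) (auto intro!: smult_closed)

lemma lincomb_cong: "e ` I \<subseteq> carrier M ==> (\<And>i. i \<in> I ==> p i = q i) ==> lincomb \<chi> M I e p = lincomb \<chi> M I e q"
  unfolding lincomb_def by (intro M.finsum_cong') (auto intro!: smult_closed)

lemma lincomb_add:
  assumes "e ` I \<subseteq> carrier M"
  shows "lincomb \<chi> M I e (\<lambda>i. p i + q i) = lincomb \<chi> M I e p \<oplus>\<^sub>M lincomb \<chi> M I e q"
proof -
  have "lincomb \<chi> M I e (\<lambda>i. p i + q i) = (\<Oplus>\<^bsub>M\<^esub> i\<in>I. \<chi> (p i) \<odot>\<^sub>M e i \<oplus>\<^sub>M \<chi> (q i) \<odot>\<^sub>M e i)"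
    unfolding lincomb_def using assms by (intro M.finsum_cong') (auto simp: smult_add smult_closed image_subset_iff)
  also have "... = lincomb \<chi> M I e p \<oplus>\<^sub>M lincomb \<chi> M I e q"
    unfolding lincomb_def using assms by (intro M.finsum_addf) (auto simp: smult_closed image_subset_iff)
  finally show ?thesis .
qed

lemma lincomb_scale:
  assumes "finite I" "e ` I \<subseteq> carrier M"
  shows "lincomb \<chi> M I e (\<lambda>i. q * p i) = \<chi> q \<odot>\<^sub>M lincomb \<chi> M I e p"
proof -
  have "lincomb \<chi> M I e (\<lambda>i. q * p i) = (\<Oplus>\<^bsub>M\<^esub> i\<in>I. \<chi> q \<odot>\<^sub>M (\<chi> (p i) \<odot>\<^sub>M e i))"
    unfolding lincomb_def using assms by (intro M.finsum_cong') (auto simp: smult_smult smult_closed image_subset_iff)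
  also have "... = \<chi> q \<odot>\<^sub>M lincomb \<chi> M I e p"
    unfolding lincomb_def using assms by (intro lm_finsum_r[OF M, symmetric] chi_closed) (auto simp: smult_closed image_subset_iff)
  finally show ?thesis .
qed

lemma lincomb_neg:
  assumes "finite I" "e ` I \<subseteq> carrier M"
  shows "lincomb \<chi> M I e (\<lambda>i. - p i) = \<ominus>\<^bsub>M\<^esub> lincomb \<chi> M I e p"
  using lincomb_scale[OF assms, of "- 1" p] chi_neg_smult[OF lincomb_closed[OF assms(2)], of 1 p]
    lm_one[OF M lincomb_closed[OF assms(2)]] by (simp add: chi_one)

lemma lincomb_single:
  assumes "finite I" "e ` I \<subseteq> carrier M" "i \<in> I"
  shows "lincomb \<chi> M I e (\<lambda>j. if j = i then q else 0) = \<chi> q \<odot>\<^sub>M e i"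
proof -
  have "lincomb \<chi> M I e (\<lambda>j. if j = i then q else 0) = \<chi> (if i = i then q else 0) \<odot>\<^sub>M e i"
    unfolding lincomb_def using assms
    by (intro M.finsum_single) (auto simp: smult_closed image_subset_iff chi_zero_smult)
  then show ?thesis by simp
qed

lemma lincomb_mem:
  assumes "finite I" "e ` I \<subseteq> D" "D \<subseteq> carrier M" "\<zero>\<^sub>M \<in> D" "\<And>a b. a \<in> D ==> b \<in> D ==> a \<oplus>\<^sub>M b \<in> D"
    "\<And>q a. a \<in> D ==> \<chi> q \<odot>\<^sub>M a \<in> D"
  shows "lincomb \<chi> M I e p \<in> D"
  using assms(1,2)
proof (induction I rule: finite_induct)
  case empty then show ?case using assms by (simp add: lincomb_def)
next
  case (insert i I)
  then show ?case using assms
    unfolding lincomb_def by (subst M.finsum_insert) (auto simp: smult_closed image_subset_iff subset_iff)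
qed

context
  fixes G :: "'m set"
  assumes G: "finite G" "G \<subseteq> carrier M"
begin

lemma cspan_closed: "a \<in> cspan \<chi> M G ==> a \<in> carrier M"
  using lincomb_closed[of id G] G by (auto simp: cspan_def)

lemma cspan_add: "a \<in> cspan \<chi> M G ==> b \<in> cspan \<chi> M G ==> a \<oplus>\<^sub>M b \<in> cspan \<chi> M G"
proof -
  assume "a \<in> cspan \<chi> M G" "b \<in> cspan \<chi> M G"
  then obtain c c' where *: "a = lincomb \<chi> M G id (\<lambda>g. fps_const (c g))" "b = lincomb \<chi> M G id (\<lambda>g. fps_const (c' g))"
    by (auto simp: cspan_def)
  have "a \<oplus>\<^sub>M b = lincomb \<chi> M G id (\<lambda>g. fps_const (c g + c' g))"
    using lincomb_add[of id G "\<lambda>g. fps_const (c g)" "\<lambda>g. fps_const (c' g)"] G by (simp add: *)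
  then show ?thesis unfolding cspan_def by (auto intro!: exI[of _ "\<lambda>g. c g + c' g"])
qed

lemma cspan_mem: "g \<in> G ==> \<chi> (fps_const a) \<odot>\<^sub>M g \<in> cspan \<chi> M G"
proof -
  assume "g \<in> G"
  then have "\<chi> (fps_const a) \<odot>\<^sub>M g = lincomb \<chi> M G id (\<lambda>h. fps_const (if h = g then a else 0))"
    using lincomb_single[of G id g "fps_const a"] G by (simp add: if_distrib cong: if_cong)
  then show ?thesis
    unfolding cspan_def by (intro image_eqI[where x = "\<lambda>h. if h = g then a else 0"]) simp_all
qed

lemma cspan_zero: "\<zero>\<^sub>M \<in> cspan \<chi> M G"
proof -
  have "lincomb \<chi> M G id (\<lambda>g. fps_const 0) = \<zero>\<^sub>M"
    using lincomb_scale[of G id 0 "\<lambda>_. 0"] G lincomb_closed[of id G] by (simp add: chi_zero_smult)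
  then show ?thesis unfolding cspan_def by (intro image_eqI[where x = "\<lambda>_. 0"]) simp_all
qed

end

lemma basis_exD: "basis_of \<chi> M D I e ==> d \<in> D ==> \<exists>p. d = lincomb \<chi> M I e p"
  and basis_indD: "basis_of \<chi> M D I e ==> lincomb \<chi> M I e p = \<zero>\<^sub>M ==> i \<in> I ==> p i = 0"
  unfolding basis_of_def by simp_all

lemma basis_eqD:
  assumes "basis_of \<chi> M D I e" "D \<subseteq> carrier M" "lincomb \<chi> M I e p = lincomb \<chi> M I e q" "i \<in> I"
  shows "p i = q i"
proof -
  have b: "finite I" "e ` I \<subseteq> carrier M" using assms by (auto simp: basis_of_def)
  have "lincomb \<chi> M I e (\<lambda>i. p i + - q i) = \<zero>\<^sub>M"
    using lincomb_add[OF b(2), of p "\<lambda>i. - q i"] lincomb_neg[OF b, of q] assms(3) lincomb_closed[OF b(2), of q]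
    by (simp add: M.r_neg)
  then show ?thesis using assms(1,4) unfolding basis_of_def by fastforce
qed

text \<open>A generating set of minimal size is a basis: a relation can be divided by the variable until one
  of its coefficients is a unit, and then a generator is superfluous.\<close>

lemma minimal_generators_basis:
  assumes D: "D \<subseteq> carrier M" "\<zero>\<^sub>M \<in> D" "\<And>a b. a \<in> D ==> b \<in> D ==> a \<oplus>\<^sub>M b \<in> D" "\<And>q a. a \<in> D ==> \<chi> q \<odot>\<^sub>M a \<in> D"
    and inj: "\<And>d. d \<in> D ==> \<chi> fps_X \<odot>\<^sub>M d = \<zero>\<^sub>M ==> d = \<zero>\<^sub>M"
    and sep: "\<And>d. d \<in> D ==> (\<And>N. \<exists>d'\<in>D. d = \<chi> (fps_X ^ N) \<odot>\<^sub>M d') ==> d = \<zero>\<^sub>M"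
    and cg: "cgen \<chi> M D G"
  shows "\<exists>G'\<subseteq>G. basis_of \<chi> M D G' id"
proof -
  have G: "finite G" "G \<subseteq> D"
    and gen: "\<And>d. d \<in> D ==> \<exists>c. \<exists>d'\<in>D. d = lincomb \<chi> M G id (\<lambda>g. fps_const (c g)) \<oplus>\<^sub>M \<chi> fps_X \<odot>\<^sub>M d'"
    using cg by (auto simp: cgen_def cspan_def)
  define gn where "gn S \<longleftrightarrow> (\<forall>d\<in>D. \<exists>c. \<exists>d'\<in>D. d = lincomb \<chi> M S id (\<lambda>g. fps_const (c g)) \<oplus>\<^sub>M \<chi> fps_X \<odot>\<^sub>M d')" for S
  have minus: "\<ominus>\<^bsub>M\<^esub> a \<in> D" if "a \<in> D" for a
    using D(4)[OF that, of "- 1"] chi_neg_smult[of a 1] lm_one[OF M, of a] that D(1) by (auto simp: chi_one)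
  have "\<exists>S. (S \<subseteq> G \<and> gn S) \<and> (\<forall>S'. S' \<subseteq> G \<and> gn S' \<longrightarrow> card S \<le> card S')"
    by (rule ex_has_least_nat[of _ G]) (use gen in \<open>auto simp: gn_def\<close>)
  then obtain S where S: "S \<subseteq> G" "gn S" and min: "\<And>S'. S' \<subseteq> G ==> gn S' ==> card S \<le> card S'" by blast
  have fS: "finite S" using S G finite_subset by blast
  have SD: "id ` S \<subseteq> D" using S G by auto
  have SM: "id ` S \<subseteq> carrier M" using SD D by auto
  have lcD: "lincomb \<chi> M S id p \<in> D" for p by (rule lincomb_mem[OF fS SD D])
  have ex: "\<exists>p. d = lincomb \<chi> M S id p" if d: "d \<in> D" for d
  proof -
    have "\<exists>c nx. \<forall>d\<in>D. nx d \<in> D \<and> d = lincomb \<chi> M S id (\<lambda>g. fps_const (c d g)) \<oplus>\<^sub>M \<chi> fps_X \<odot>\<^sub>M nx d"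
      using S(2) unfolding gn_def by metis
    then obtain c nx where nx: "\<And>d. d \<in> D ==> nx d \<in> D"
      and eq: "\<And>d. d \<in> D ==> d = lincomb \<chi> M S id (\<lambda>g. fps_const (c d g)) \<oplus>\<^sub>M \<chi> fps_X \<odot>\<^sub>M nx d" by blast
    define s where "s b = (nx ^^ b) d" for b
    have sD: "s b \<in> D" for b by (induction b) (auto simp: s_def d nx)
    define p where "p g = Abs_fps (\<lambda>b. c (s b) g)" for g
    \<comment> \<open>The error after the constants found in the first \<open>N\<close> steps are
      taken as coefficients of \<open>p\<close>. Each error is the variable times the next one, so
      \<open>r 0\<close> is divisible by all powers and vanishes by \<open>sep\<close>.\<close>
    define r where "r N = s N \<ominus>\<^bsub>M\<^esub> lincomb \<chi> M S id (\<lambda>g. fps_shift N (p g))" for N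
    have rD: "r N \<in> D" for N unfolding r_def a_minus_def using D(3) sD minus lcD by blast
    have step: "r N = \<chi> fps_X \<odot>\<^sub>M r (Suc N)" for N
    proof -
      have sh: "fps_shift N (p g) = fps_const (c (s N) g) + fps_X * fps_shift (Suc N) (p g)" for g
        by (rule fps_ext) (auto simp: p_def fps_X_mult_nth)
      let ?L = "lincomb \<chi> M S id (\<lambda>g. fps_const (c (s N) g))" and ?T = "lincomb \<chi> M S id (\<lambda>g. fps_shift (Suc N) (p g))"
      have l: "lincomb \<chi> M S id (\<lambda>g. fps_shift N (p g)) = ?L \<oplus>\<^sub>M \<chi> fps_X \<odot>\<^sub>M ?T"
        unfolding sh by (simp add: lincomb_add[OF SM] lincomb_scale[OF fS SM])
      have c: "?L \<in> carrier M" "?T \<in> carrier M" "s (Suc N) \<in> carrier M" using lincomb_closed[OF SM] sD D by auto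
      have "s N = ?L \<oplus>\<^sub>M \<chi> fps_X \<odot>\<^sub>M s (Suc N)" using eq[OF sD[of N]] by (simp add: s_def)
      then have "r N = (?L \<oplus>\<^sub>M \<chi> fps_X \<odot>\<^sub>M s (Suc N)) \<ominus>\<^bsub>M\<^esub> (?L \<oplus>\<^sub>M \<chi> fps_X \<odot>\<^sub>M ?T)"
        unfolding r_def l by simp
      also have "... = \<chi> fps_X \<odot>\<^sub>M s (Suc N) \<ominus>\<^bsub>M\<^esub> \<chi> fps_X \<odot>\<^sub>M ?T"
        using c smult_closed[OF c(2)] smult_closed[OF c(3)]
        by (simp add: a_minus_def M.minus_add M.a_ac M.r_neg1)
           (metis M.a_comm M.a_lcomm M.add.inv_closed M.a_closed M.r_neg2)
      also have "... = \<chi> fps_X \<odot>\<^sub>M r (Suc N)"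
        unfolding r_def using c chi_closed by (simp add: lm_diff_r[OF M])
      finally show ?thesis .
    qed
    have "r 0 = \<chi> (fps_X ^ N) \<odot>\<^sub>M r N" for N
    proof (induction N)
      case 0 show ?case using subsetD[OF D(1) rD[of 0]] by (simp add: chi_one lm_one[OF M])
    next
      case (Suc N)
      have "r (Suc N) \<in> carrier M" using rD D by auto
      then show ?case using Suc step[of N] smult_smult[of "r (Suc N)" "fps_X ^ N" fps_X] by (simp add: mult.commute)
    qed
    then have "r 0 = \<zero>\<^sub>M" using rD by (intro sep) auto
    then have "s 0 = lincomb \<chi> M S id (\<lambda>g. fps_shift 0 (p g))"
      unfolding r_def using M.diff_eq_zero_iff lincomb_closed[OF SM] sD D by blast
    then show ?thesis by (auto simp: s_def)
  qed
  have nounit: "fps_nth (p g) 0 = 0" if p: "lincomb \<chi> M S id p = \<zero>\<^sub>M" and g: "g \<in> S" for p g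
  proof (rule ccontr)
    assume nz: "fps_nth (p g) 0 \<noteq> 0"
    define d0 where "d0 = lincomb \<chi> M S id (\<lambda>h. fps_shift 1 (p h))"
    have d0: "d0 \<in> D" unfolding d0_def by (rule lcD)
    have "p h = fps_const (fps_nth (p h) 0) + fps_X * fps_shift 1 (p h)" for h
      by (rule fps_ext) (auto simp: fps_X_mult_nth)
    then have rel: "lincomb \<chi> M S id (\<lambda>h. fps_const (fps_nth (p h) 0)) \<oplus>\<^sub>M \<chi> fps_X \<odot>\<^sub>M d0 = \<zero>\<^sub>M"
      unfolding d0_def lincomb_scale[OF fS SM, symmetric] lincomb_add[OF SM, symmetric] using p by simp
    have "gn (S - {g})"
      unfolding gn_def
    proof
      fix d assume "d \<in> D"
      then obtain c d' where d': "d' \<in> D" and d: "d = lincomb \<chi> M S id (\<lambda>h. fps_const (c h)) \<oplus>\<^sub>M \<chi> fps_X \<odot>\<^sub>M d'"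
        using S(2) unfolding gn_def by blast
      \<comment> \<open>Chosen so that adding \<open>a\<close> times the relation cancels the
        coefficient of \<open>g\<close>; the rest of the relation is a multiple of the variable and
        is absorbed in \<open>d'\<close>.\<close>
      define a where "a = - (c g / fps_nth (p g) 0)"
      define c' where "c' h = c h + a * fps_nth (p h) 0" for h
      have cg: "c' g = 0" using nz by (simp add: c'_def a_def)
      have cc: "fps_const (c' h) = fps_const (c h) + fps_const a * fps_const (fps_nth (p h) 0)" for h
        by (simp add: c'_def)
      let ?L = "lincomb \<chi> M S id (\<lambda>h. fps_const (c h))" and ?P = "lincomb \<chi> M S id (\<lambda>h. fps_const (fps_nth (p h) 0))"
      have car: "?L \<in> carrier M" "?P \<in> carrier M" "d' \<in> carrier M" "d0 \<in> carrier M"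
        using lincomb_closed[OF SM] d' d0 D by auto
      have z: "\<chi> (fps_const a) \<odot>\<^sub>M ?P \<oplus>\<^sub>M \<chi> fps_X \<odot>\<^sub>M (\<chi> (fps_const a) \<odot>\<^sub>M d0) = \<zero>\<^sub>M"
      proof -
        have "\<chi> (fps_const a) \<odot>\<^sub>M (?P \<oplus>\<^sub>M \<chi> fps_X \<odot>\<^sub>M d0) = \<zero>\<^sub>M"
          unfolding rel by (rule lm_zero_r[OF M chi_closed])
        then show ?thesis using car smult_closed
          by (simp add: lm_r_distr[OF M chi_closed] smult_smult mult.commute)
      qed
      have "lincomb \<chi> M S id (\<lambda>h. fps_const (c' h)) = ?L \<oplus>\<^sub>M \<chi> (fps_const a) \<odot>\<^sub>M ?P"
        unfolding cc lincomb_add[OF SM] lincomb_scale[OF fS SM] ..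
      moreover have "lincomb \<chi> M S id (\<lambda>h. fps_const (c' h)) = lincomb \<chi> M (S - {g}) id (\<lambda>h. fps_const (c' h))"
      proof -
        have "S = insert g (S - {g})" using g by blast
        then have "lincomb \<chi> M S id (\<lambda>h. fps_const (c' h)) =
            lincomb \<chi> M (insert g (S - {g})) id (\<lambda>h. fps_const (c' h))" by simp
        also have "... = \<chi> 0 \<odot>\<^sub>M g \<oplus>\<^sub>M lincomb \<chi> M (S - {g}) id (\<lambda>h. fps_const (c' h))"
          unfolding lincomb_def using fS SM g cg
          by (subst M.finsum_insert) (auto simp: smult_closed subset_iff)
        also have "... = lincomb \<chi> M (S - {g}) id (\<lambda>h. fps_const (c' h))"
        proof -
          have "id ` (S - {g}) \<subseteq> carrier M" and gM: "g \<in> carrier M" using SM g by auto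
          then have "lincomb \<chi> M (S - {g}) id (\<lambda>h. fps_const (c' h)) \<in> carrier M" by (intro lincomb_closed)
          then show ?thesis by (simp add: chi_zero_smult[OF gM])
        qed
        finally show ?thesis .
      qed
      moreover have "d = (?L \<oplus>\<^sub>M \<chi> (fps_const a) \<odot>\<^sub>M ?P) \<oplus>\<^sub>M \<chi> fps_X \<odot>\<^sub>M (d' \<oplus>\<^sub>M \<chi> (fps_const a) \<odot>\<^sub>M d0)"
      proof -
        have c2: "\<chi> (fps_const a) \<odot>\<^sub>M ?P \<in> carrier M" "\<chi> fps_X \<odot>\<^sub>M d' \<in> carrier M"
          "\<chi> (fps_const a) \<odot>\<^sub>M d0 \<in> carrier M" "\<chi> fps_X \<odot>\<^sub>M (\<chi> (fps_const a) \<odot>\<^sub>M d0) \<in> carrier M"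
          using smult_closed car by auto
        have "d = (?L \<oplus>\<^sub>M \<chi> fps_X \<odot>\<^sub>M d') \<oplus>\<^sub>M (\<chi> (fps_const a) \<odot>\<^sub>M ?P \<oplus>\<^sub>M \<chi> fps_X \<odot>\<^sub>M (\<chi> (fps_const a) \<odot>\<^sub>M d0))"
          unfolding z using d car c2 by simp
        then show ?thesis using car c2 by (simp add: lm_r_distr[OF M chi_closed] M.a_ac)
      qed
      moreover have "d' \<oplus>\<^sub>M \<chi> (fps_const a) \<odot>\<^sub>M d0 \<in> D" using d' d0 D by blast
      ultimately show "\<exists>c. \<exists>d'\<in>D. d = lincomb \<chi> M (S - {g}) id (\<lambda>g. fps_const (c g)) \<oplus>\<^sub>M \<chi> fps_X \<odot>\<^sub>M d'"
        by (intro exI[of _ c'] bexI[of _ "d' \<oplus>\<^sub>M \<chi> (fps_const a) \<odot>\<^sub>M d0"]) auto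
    qed
    then have "card S \<le> card (S - {g})" using S by (intro min) auto
    then show False using g fS by (metis card_Diff1_less not_le)
  qed
  have "\<forall>p. lincomb \<chi> M S id p = \<zero>\<^sub>M \<longrightarrow> (\<forall>g\<in>S. fps_nth (p g) N = 0)" for N
  proof (induction N)
    case (Suc N)
    show ?case
    proof (intro allI impI ballI)
      fix p g assume p: "lincomb \<chi> M S id p = \<zero>\<^sub>M" and g: "g \<in> S"
      have "p h = fps_X * fps_shift 1 (p h)" if "h \<in> S" for h
        by (rule fps_ext) (use nounit[OF p that] in \<open>auto simp: fps_X_mult_nth\<close>)
      then have "lincomb \<chi> M S id p = lincomb \<chi> M S id (\<lambda>h. fps_X * fps_shift 1 (p h))"
        by (intro lincomb_cong[OF SM])
      then have "\<chi> fps_X \<odot>\<^sub>M lincomb \<chi> M S id (\<lambda>h. fps_shift 1 (p h)) = \<zero>\<^sub>M"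
        using p by (simp add: lincomb_scale[OF fS SM])
      then have "lincomb \<chi> M S id (\<lambda>h. fps_shift 1 (p h)) = \<zero>\<^sub>M" by (rule inj[OF lcD])
      then have "fps_nth (fps_shift 1 (p g)) N = 0" using Suc g by blast
      then show "fps_nth (p g) (Suc N) = 0" by simp
    qed
  qed (use nounit in blast)
  then have "\<forall>p. lincomb \<chi> M S id p = \<zero>\<^sub>M \<longrightarrow> (\<forall>g\<in>S. p g = 0)" by (auto simp: fps_eq_iff)
  then have "basis_of \<chi> M D S id" unfolding basis_of_def using fS SD ex by blast
  then show ?thesis using S by blast
qed

lemma basis_reindex:
  assumes "basis_of \<chi> M D G id" "D \<subseteq> carrier M"
  shows "\<exists>(m::nat) e. e ` {..<m} = G \<and> basis_of \<chi> M D {..<m} e"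
proof -
  have G: "finite G" "id ` G \<subseteq> D" using assms by (auto simp: basis_of_def)
  obtain e where e: "bij_betw e {..<card G} G" using ex_bij_betw_nat_finite[OF G(1)] by (auto simp: atLeast0LessThan)
  let ?I = "{..<card G}"
  have im: "e ` ?I = G" and inj: "inj_on e ?I" using e by (auto simp: bij_betw_def)
  have re: "lincomb \<chi> M G id p = lincomb \<chi> M ?I e (\<lambda>i. p (e i))" for p
  proof -
    have "lincomb \<chi> M G id p = (\<Oplus>\<^bsub>M\<^esub> g\<in>e ` ?I. \<chi> (p g) \<odot>\<^sub>M g)" by (simp add: lincomb_def im)
    also have "... = (\<Oplus>\<^bsub>M\<^esub> i\<in>?I. \<chi> (p (e i)) \<odot>\<^sub>M e i)"
      using G assms(2) im by (intro M.finsum_reindex inj) (auto intro!: smult_closed)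
    finally show ?thesis by (simp add: lincomb_def)
  qed
  have eM: "e ` ?I \<subseteq> carrier M" using G assms(2) im by auto
  have ind: "\<forall>i\<in>?I. p i = 0" if z: "lincomb \<chi> M ?I e p = \<zero>\<^sub>M" for p
  proof -
    let ?q = "\<lambda>g. p (the_inv_into ?I e g)"
    have inv: "the_inv_into ?I e (e i) = i" if "i \<in> ?I" for i using the_inv_into_f_f[OF inj that] .
    have "lincomb \<chi> M ?I e (\<lambda>i. ?q (e i)) = lincomb \<chi> M ?I e p"
      by (rule lincomb_cong[OF eM]) (simp only: inv)
    then have "lincomb \<chi> M G id ?q = \<zero>\<^sub>M" using re[of ?q] z by simp
    then have "\<forall>g\<in>G. ?q g = 0" using assms(1) unfolding basis_of_def by blast
    then show ?thesis using inv im by (metis imageI)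
  qed
  have "basis_of \<chi> M D ?I e"
    unfolding basis_of_def
  proof (intro conjI ballI allI impI)
    show "e ` ?I \<subseteq> D" using im G by auto
    show "\<exists>p. d = lincomb \<chi> M ?I e p" if "d \<in> D" for d
      using assms(1) that re unfolding basis_of_def by metis
  qed (use ind in auto)
  then show ?thesis using im by blast
qed

end

context tiled
begin

section \<open>The twist\<close>

lemma wend_inj: "l < n ==> j < n ==> wend n w l = wend n w j ==> l = j"
proof -
  assume lj: "l < n" "j < n" "wend n w l = wend n w j"
  have "mat (E (wend n w j) \<otimes> wel w) (wend n w j) l = mat (wel w \<otimes> E j) (wend n w j) l"
    by (simp add: wel_E[OF lj(2)])
  then show ?thesis using lj by (auto simp: mat_E_left mat_E_right mat_wel wend_less split: if_splits)
qed

lemma wend_surj: "i < n ==> \<exists>j<n. wend n w j = i"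
proof -
  assume i: "i < n"
  have "wend n w ` {..<n} = {..<n}"
    by (rule endo_inj_surj) (auto simp: wend_less inj_on_def intro: wend_inj)
  then show ?thesis using i by (metis imageE lessThan_iff)
qed

lemma mat_wel_right:
  assumes "a \<in> carrier R" "i < n" "j < n"
  shows "mat (a \<otimes> wel w) i j = mat a i (wend n w j) * fps_X ^ wcost n k w j"
proof -
  have "mat (a \<otimes> wel w) i j = (\<Sum>l<n. mat a i l * mat (wel w) l j)" using assms by (simp add: mat_mult)
  also have "... = mat a i (wend n w j) * mat (wel w) (wend n w j) j"
    using assms wend_less by (intro sum_eq_single) (auto simp: mat_wel)
  finally show ?thesis using assms wend_less by (simp add: mat_wel)
qed

lemma mat_wel_left:
  assumes "a \<in> carrier R" "i < n" "j < n"
  shows "mat (wel w \<otimes> a) (wend n w i) j = fps_X ^ wcost n k w i * mat a i j"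
proof -
  have ne: "wend n w i \<noteq> wend n w l" if "l < n" "l \<noteq> i" for l using wend_inj that assms by metis
  have "mat (wel w \<otimes> a) (wend n w i) j = (\<Sum>l<n. mat (wel w) (wend n w i) l * mat a l j)"
    using assms wend_less by (simp add: mat_mult)
  also have "... = mat (wel w) (wend n w i) i * mat a i j"
    using assms wend_less ne by (intro sum_eq_single) (auto simp: mat_wel)
  finally show ?thesis using assms wend_less by (simp add: mat_wel)
qed

lemma wel_cancel_right: "a \<in> carrier R ==> b \<in> carrier R ==> a \<otimes> wel w = b \<otimes> wel w ==> a = b"
proof (rule mat_inj)
  fix i j assume ab: "a \<in> carrier R" "b \<in> carrier R" "a \<otimes> wel w = b \<otimes> wel w" and ij: "i < n" "j < n"
  obtain j' where j': "j' < n" "wend n w j' = j" using wend_surj[OF ij(2)] by blast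
  have "mat (a \<otimes> wel w) i j' = mat (b \<otimes> wel w) i j'" by (simp only: ab(3))
  then show "mat a i j = mat b i j" using ab(1,2) ij j' by (simp add: mat_wel_right)
qed auto

text \<open>The matrix of \<open>x r x^(-1)\<close> has the entry \<open>t^(c i - c j) r_ij\<close>
  at \<open>(T i, T j)\<close>. By \<open>wcost_shift\<close> the exponents occurring there are
  costs of walks from \<open>T j\<close> to \<open>T i\<close>, so this matrix lies in the order
  again.\<close>

lemma sig_ex:
  assumes r: "r \<in> carrier R"
  shows "\<exists>s\<in>carrier R. s \<otimes> x = x \<otimes> r"
proof -
  define c where "c j = scost n k True j" for j
  define T where "T j = stp n True j" for j
  define T' where "T' j = stp n False j" for j
  have T: "T j < n" "T' j < n" "T' (T j) = j" "T (T' j) = j" if "j < n" for j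
    using that stp_stp[OF that, of False] stp_stp[OF that, of True] by (auto simp: T_def T'_def stp_less)
  \<comment> \<open>Multiplication by \<open>t^(c (T' i) - c (T' j))\<close>, an exponent that may
    be negative.\<close>
  define \<beta> where "\<beta> i j = Abs_fps (\<lambda>m. if m + c (T' j) < c (T' i) then 0 else fps_nth (mat r (T' i) (T' j)) (m + c (T' j) - c (T' i)))" for i j
  have "\<exists>s\<in>carrier R. \<forall>i<n. \<forall>j<n. mat s i j = \<beta> i j"
  proof (rule mat_surj)
    fix i j m assume ij: "i < n" "j < n" "fps_nth (\<beta> i j) m \<noteq> 0"
    then have ge: "c (T' i) \<le> m + c (T' j)" and nz: "fps_nth (mat r (T' i) (T' j)) (m + c (T' j) - c (T' i)) \<noteq> 0"
      by (auto simp: \<beta>_def split: if_splits)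
    obtain w where w: "w \<in> wset n k (T' i) (T' j) (m + c (T' j) - c (T' i))"
      using mat_valid[OF r _ _ nz] T ij by blast
    have "wend n w (T (T' j)) = T (wend n w (T' j))"
      "wcost n k w (T (T' j)) + c (T' j) = wcost n k w (T' j) + c (wend n w (T' j))"
      using wcost_shift[OF T(2)[OF ij(2)] k1 nk, of w] by (auto simp: T_def c_def)
    then have "w \<in> wset n k i j m" using w ge T ij by (auto simp: wset_def)
    then show "wset n k i j m \<noteq> {}" by blast
  qed
  then obtain s where s: "s \<in> carrier R" "\<And>i j. i < n ==> j < n ==> mat s i j = \<beta> i j" by blast
  have "s \<otimes> x = x \<otimes> r"
  proof (rule mat_inj)
    fix i' j assume ij': "i' < n" "j < n"
    define i where "i = T' i'"
    have ij: "i < n" "j < n" "i' = T i" using ij' T by (auto simp: i_def)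
    \<comment> \<open>Where the exponent is negative, the shift must not cut off coefficients: those
      below it vanish, since no walk is that cheap.\<close>
    have z: "fps_nth (mat r i j) m = 0" if "m + c i < c j" for m
    proof (rule ccontr)
      assume "fps_nth (mat r i j) m \<noteq> 0"
      then obtain w where "w \<in> wset n k i j m" using mat_valid[OF r ij(1,2)] by blast
      then show False using wcost_shift(2)[OF ij(2) k1 nk, of w] that by (auto simp: wset_def c_def)
    qed
    have "mat (s \<otimes> x) i' j = \<beta> (T i) (T j) * fps_X ^ c j"
      unfolding x_def ij(3) using s ij T mat_wel_right[OF s(1) T(1)[OF ij(1)] ij(2), of "[True]"]
      by (simp add: c_def T_def)
    also have "... = fps_X ^ c i * mat r i j"
      using z T ij by (intro fps_ext) (auto simp: \<beta>_def fps_X_power_mult_nth fps_X_power_mult_right_nth)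
    also have "... = mat (x \<otimes> r) i' j"
      unfolding x_def ij(3) using mat_wel_left[OF r ij(1,2), of "[True]"] by (simp add: c_def T_def)
    finally show "mat (s \<otimes> x) i' j = mat (x \<otimes> r) i' j" .
  qed (use s r in auto)
  then show ?thesis using s by blast
qed

definition sig :: "'r \<Rightarrow> 'r" where "sig r = (SOME s. s \<in> carrier R \<and> s \<otimes> x = x \<otimes> r)"

lemma sig_closed: "r \<in> carrier R ==> sig r \<in> carrier R" and sig_x: "r \<in> carrier R ==> sig r \<otimes> x = x \<otimes> r"
proof -
  assume "r \<in> carrier R"
  then have "\<exists>s. s \<in> carrier R \<and> s \<otimes> x = x \<otimes> r" using sig_ex by blast
  from someI_ex[OF this] show "sig r \<in> carrier R" "sig r \<otimes> x = x \<otimes> r" by (auto simp: sig_def)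
qed

lemma sig_eqI: "r \<in> carrier R ==> s \<in> carrier R ==> s \<otimes> x = x \<otimes> r ==> sig r = s"
  using wel_cancel_right[of "sig r" s "[True]"] sig_closed sig_x by (simp add: x_def)

lemma sig_add: "r \<in> carrier R ==> s \<in> carrier R ==> sig (r \<oplus> s) = sig r \<oplus> sig s"
  by (rule sig_eqI) (simp_all add: sig_closed sig_x R.l_distr R.r_distr)

lemma sig_mult: "r \<in> carrier R ==> s \<in> carrier R ==> sig (r \<otimes> s) = sig r \<otimes> sig s"
proof (rule sig_eqI)
  assume r: "r \<in> carrier R" "s \<in> carrier R"
  have "sig r \<otimes> sig s \<otimes> x = sig r \<otimes> (x \<otimes> s)" using r by (simp add: R.m_assoc sig_closed sig_x)
  also have "... = x \<otimes> (r \<otimes> s)" using r by (simp add: R.m_assoc[symmetric] sig_closed sig_x)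
  finally show "sig r \<otimes> sig s \<otimes> x = x \<otimes> (r \<otimes> s)" .
qed (auto simp: sig_closed)

lemma sig_gens: "sig \<one> = \<one>" "sig x = x" "sig y = y" "sig (\<zeta> p) = \<zeta> p"
  by (rule sig_eqI; simp add: xy_commute zeta_commute)+

lemma sig_E: "j < n ==> sig (E j) = E (stp n True j)"
  using wel_E[of j "[True]"] by (intro sig_eqI) (auto simp: x_def)

lemma sig_pow_closed: "r \<in> carrier R ==> (sig ^^ a) r \<in> carrier R"
  by (induction a) (auto simp: sig_closed)

lemma sig_pow_x: "r \<in> carrier R ==> (sig ^^ a) r \<otimes> x [^] a = x [^] a \<otimes> r"
proof (induction a)
  case (Suc a)
  have "(sig ^^ Suc a) r \<otimes> x [^] Suc a = sig ((sig ^^ a) r) \<otimes> (x \<otimes> x [^] a)"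
    using R.nat_pow_Suc2[OF x_closed, of a] by simp
  also have "... = x \<otimes> ((sig ^^ a) r \<otimes> x [^] a)"
    using Suc.prems sig_pow_closed by (simp add: R.m_assoc[symmetric] sig_closed sig_x)
  also have "... = x [^] Suc a \<otimes> r"
    using Suc by (simp only: R.nat_pow_Suc2 x_closed) (simp add: R.m_assoc)
  finally show ?case .
qed simp

lemma sig_pow_add: "r \<in> carrier R ==> s \<in> carrier R ==> (sig ^^ a) (r \<oplus> s) = (sig ^^ a) r \<oplus> (sig ^^ a) s"
  and sig_pow_mult: "r \<in> carrier R ==> s \<in> carrier R ==> (sig ^^ a) (r \<otimes> s) = (sig ^^ a) r \<otimes> (sig ^^ a) s"
  and sig_pow_gens: "(sig ^^ a) \<one> = \<one>" "(sig ^^ a) x = x" "(sig ^^ a) y = y" "(sig ^^ a) (\<zeta> p) = \<zeta> p"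
  by (induction a) (auto simp: sig_add sig_mult sig_pow_closed sig_gens)

text \<open>\<open>x^n\<close> is central and can be cancelled on the right.\<close>

lemma sig_pow_n:
  assumes r: "r \<in> carrier R"
  shows "(sig ^^ (n * q)) r = r"
proof (induction q)
  case (Suc q)
  have n: "(sig ^^ n) r = r" if "r \<in> carrier R" for r
  proof -
    have "(sig ^^ n) r \<otimes> x [^] n = r \<otimes> x [^] n"
      using sig_pow_x[OF that, of n] zeta_commute[OF that] by (simp add: x_pow_n)
    then show ?thesis using wel_cancel_right sig_pow_closed that by (metis x_pow)
  qed
  have "(sig ^^ (n * Suc q)) r = (sig ^^ n) ((sig ^^ (n * q)) r)" by (simp add: funpow_add)
  then show ?case using Suc n[OF r] by simp
qed simp

definition tw :: "nat \<Rightarrow> ('r, 'm) module \<Rightarrow> ('r, 'm) module" where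
  "tw a M = M\<lparr>smult := (\<lambda>r m. (sig ^^ a) r \<odot>\<^sub>M m)\<rparr>"

lemma tw_simps [simp]: "carrier (tw a M) = carrier M" "\<zero>\<^bsub>tw a M\<^esub> = \<zero>\<^sub>M" "add (tw a M) = add M"
  "r \<odot>\<^bsub>tw a M\<^esub> m = (sig ^^ a) r \<odot>\<^sub>M m"
  by (simp_all add: tw_def)

lemma tw_tw: "tw a (tw b M) = tw (a + b) M"
  by (simp add: tw_def add.commute[of a b] funpow_add)

lemma tw_module:
  assumes M: "left_module R M"
  shows "left_module R (tw a M)"
proof (rule left_moduleI[OF R_ring])
  interpret M: abelian_group M by (rule lm_grp[OF M])
  show "abelian_group (tw a M)"
    by (rule abelian_groupI) (auto simp: M.a_ac intro: M.l_neg M.a_inv_closed)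
qed (auto simp: sig_pow_add sig_pow_mult sig_pow_gens sig_pow_closed lm_closed[OF M] lm_l_distr[OF M] lm_r_distr[OF M]
    lm_assoc[OF M] lm_one[OF M])

lemma Hom_tw_sub: "f \<in> Hom R M N ==> f \<in> Hom R (tw a M) (tw a N)"
  by (auto simp: Hom_def sig_pow_closed)

lemma Hom_cong:
  assumes "carrier M = carrier M'" "add M = add M'" "\<And>r m. r \<in> carrier R ==> m \<in> carrier M ==> r \<odot>\<^sub>M m = r \<odot>\<^sub>M' m"
    and "carrier N = carrier N'" "add N = add N'" "\<And>r m. r \<in> carrier R ==> m \<in> carrier N ==> r \<odot>\<^sub>N m = r \<odot>\<^sub>N' m"
  shows "Hom R M N = Hom R M' N'"
  using assms by (auto simp: Hom_def PiE_iff)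

lemma Hom_tw_n: "Hom R (tw (n * q) M) N = Hom R M N" "Hom R M (tw (n * q) N) = Hom R M N"
  by (rule Hom_cong; simp add: sig_pow_n)+

text \<open>Twisting by \<open>(n - 1) a\<close> more gives a twist by \<open>n a\<close>, which is
  trivial; so the inclusion \<open>Hom_tw_sub\<close> can be reversed.\<close>

lemma Hom_tw: "Hom R (tw a M) (tw a N) = Hom R M N"
proof (intro equalityI subsetI)
  fix f assume "f \<in> Hom R (tw a M) (tw a N)"
  then have "f \<in> Hom R (tw (n * a) M) (tw (n * a) N)"
    using Hom_tw_sub[of f "tw a M" "tw a N" "(n - 1) * a"] n_pos
    by (simp add: tw_tw algebra_simps)
  then show "f \<in> Hom R M N" by (simp add: Hom_tw_n)
qed (rule Hom_tw_sub)

lemma projective_tw: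
  assumes "projective R P"
  shows "projective R (tw a P)"
  unfolding projective_def
proof (intro conjI allI ballI impI)
  have P: "left_module R P" using assms by (simp add: projective_def)
  then show "left_module R (tw a P)" by (rule tw_module)
  fix X Y :: "'r fmodule" and g h
  assume g: "g \<in> Hom R X Y" and h: "h \<in> Hom R (tw a P) Y" and X: "left_module R X" and Y: "left_module R Y"
    and onto: "g ` carrier X = carrier Y"
  \<comment> \<open>\<open>b\<close> completes \<open>a\<close> to a multiple of \<open>n\<close>,
    so \<open>tw b\<close> moves the lifting problem for \<open>tw a P\<close> to one for
    \<open>P\<close>.\<close>
  define b where "b = (n - 1) * a"
  have ab: "b + a = n * a" using n_pos by (cases n) (auto simp: b_def)
  have h': "h \<in> Hom R P (tw b Y)"
    using Hom_tw_sub[OF h, of b] by (simp add: tw_tw ab Hom_tw_n)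
  have gb: "g \<in> Hom R (tw b X) (tw b Y)" using g by (rule Hom_tw_sub)
  have "g ` carrier (tw b X) = carrier (tw b Y)" using onto by simp
  from assms[unfolded projective_def, THEN conjunct2, rule_format, OF gb h' tw_module[OF X] tw_module[OF Y] this]
  obtain l where l: "l \<in> Hom R P (tw b X)" "compose (carrier P) g l = h" by blast
  have "l \<in> Hom R (tw a P) (tw (a + b) X)" using Hom_tw_sub[OF l(1), of a] by (simp add: tw_tw)
  then have "l \<in> Hom R (tw a P) X" by (simp add: ab add.commute[of a] Hom_tw_n)
  then show "\<exists>l\<in>Hom R (tw a P) X. compose (carrier (tw a P)) g l = h" using l(2) by auto
qed

section \<open>Lattices over the tiled order\<close>

lemma fps_module_zeta: "left_module R M ==> fps_module R M \<zeta>"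
  by (rule fps_module.intro) (auto simp: zeta_add zeta_mult zeta_one)

text \<open>Torsion free and separated for \<open>t\<close>. Both pass to submodules, and together
  with finite generation they give membership in CM (\<open>CM_I\<close>).\<close>

definition torsion_sep :: "('r, 'm) module \<Rightarrow> bool" where
  "torsion_sep M \<longleftrightarrow> (\<forall>m\<in>carrier M. \<zeta> fps_X \<odot>\<^sub>M m = \<zero>\<^sub>M \<longrightarrow> m = \<zero>\<^sub>M) \<and>
     (\<forall>m\<in>carrier M. (\<forall>N. \<exists>m'\<in>carrier M. m = \<zeta> (fps_X ^ N) \<odot>\<^sub>M m') \<longrightarrow> m = \<zero>\<^sub>M)"

text \<open>The center is the injective image of \<open>\<zeta>\<close>, so unique coefficients in
  the center are unique power series.\<close>

lemma CM_basis:
  "M \<in> CM R \<longleftrightarrow> left_module R M \<and> (\<exists>(m::nat) e. basis_of \<zeta> M (carrier M) {..<m} e)"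
proof
  assume "M \<in> CM R"
  then have M: "left_module R M" and "free_over_center R M" by (auto simp: CM_def)
  interpret fps_module R M \<zeta> by (rule fps_module_zeta[OF M])
  obtain m e where e: "e \<in> {..<m::nat} \<rightarrow> carrier M"
    and ex: "\<forall>x\<in>carrier M. \<exists>!a. a \<in> {..<m} \<rightarrow>\<^sub>E range \<zeta> \<and> x = (\<Oplus>\<^bsub>M\<^esub> i\<in>{..<m}. a i \<odot>\<^sub>M e i)"
    using \<open>free_over_center R M\<close> by (auto simp: free_over_center_def ring_center_eq)
  have eM: "e ` {..<m} \<subseteq> carrier M" using e by auto
  have r: "lincomb \<zeta> M {..<m} e p = (\<Oplus>\<^bsub>M\<^esub> i\<in>{..<m}. (\<lambda>i\<in>{..<m}. \<zeta> (p i)) i \<odot>\<^sub>M e i)" for p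
    unfolding lincomb_def using e by (intro M.finsum_cong') (auto intro!: lm_closed[OF M] simp: Pi_iff)
  have z: "lincomb \<zeta> M {..<m} e (\<lambda>_. 0) = \<zero>\<^sub>M"
    using lincomb_scale[of "{..<m}" e 0 "\<lambda>_. 0"] eM lincomb_closed[OF eM] by (simp add: chi_zero_smult)
  have "basis_of \<zeta> M (carrier M) {..<m} e"
    unfolding basis_of_def
  proof (intro conjI ballI allI impI)
    fix d assume "d \<in> carrier M"
    then obtain a where a: "a \<in> {..<m} \<rightarrow>\<^sub>E range \<zeta>" "d = (\<Oplus>\<^bsub>M\<^esub> i\<in>{..<m}. a i \<odot>\<^sub>M e i)" using ex by blast
    have "\<forall>i\<in>{..<m}. \<exists>p. a i = \<zeta> p" using a(1) by (auto simp: PiE_iff)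
    then obtain p where p: "\<forall>i\<in>{..<m}. a i = \<zeta> (p i)" by metis
    have aa: "(\<lambda>i\<in>{..<m}. \<zeta> (p i)) = a" using p a(1) by (auto simp: PiE_iff extensional_def fun_eq_iff)
    show "\<exists>p. d = lincomb \<zeta> M {..<m} e p" using a(2) r[of p] unfolding aa by metis
  next
    fix p i assume p: "lincomb \<zeta> M {..<m} e p = \<zero>\<^sub>M" and i: "i \<in> {..<m}"
    have ex0: "\<exists>!a. a \<in> {..<m} \<rightarrow>\<^sub>E range \<zeta> \<and> \<zero>\<^sub>M = (\<Oplus>\<^bsub>M\<^esub> i\<in>{..<m}. a i \<odot>\<^sub>M e i)"
      using ex M.zero_closed by (rule bspec)
    have 1: "(\<lambda>i\<in>{..<m}. \<zeta> (p i)) \<in> {..<m} \<rightarrow>\<^sub>E range \<zeta> \<and> \<zero>\<^sub>M = (\<Oplus>\<^bsub>M\<^esub> i\<in>{..<m}. (\<lambda>i\<in>{..<m}. \<zeta> (p i)) i \<odot>\<^sub>M e i)"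
      unfolding r[symmetric] using p by simp
    have 2: "(\<lambda>i\<in>{..<m}. \<zeta> 0) \<in> {..<m} \<rightarrow>\<^sub>E range \<zeta> \<and> \<zero>\<^sub>M = (\<Oplus>\<^bsub>M\<^esub> i\<in>{..<m}. (\<lambda>i\<in>{..<m}. \<zeta> 0) i \<odot>\<^sub>M e i)"
      unfolding r[of "\<lambda>_. 0", symmetric] using z by simp
    have "(\<lambda>i\<in>{..<m}. \<zeta> (p i)) = (\<lambda>i\<in>{..<m}. \<zeta> 0)"
      using the1_equality[OF ex0, OF 1] the1_equality[OF ex0, OF 2] by (rule trans[OF sym])
    then have "\<zeta> (p i) = \<zeta> 0" using i by (metis restrict_apply')
    then show "p i = 0" by (rule zeta_inj)
  qed (use eM in auto)
  then show "left_module R M \<and> (\<exists>(m::nat) e. basis_of \<zeta> M (carrier M) {..<m} e)" using M by blast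
next
  assume "left_module R M \<and> (\<exists>(m::nat) e. basis_of \<zeta> M (carrier M) {..<m} e)"
  then obtain m e where M: "left_module R M" and b: "basis_of \<zeta> M (carrier M) {..<m::nat} e" by blast
  interpret fps_module R M \<zeta> by (rule fps_module_zeta[OF M])
  have eM: "e ` {..<m} \<subseteq> carrier M" using b by (simp add: basis_of_def)
  have r: "lincomb \<zeta> M {..<m} e p = (\<Oplus>\<^bsub>M\<^esub> i\<in>{..<m}. (\<lambda>i\<in>{..<m}. \<zeta> (p i)) i \<odot>\<^sub>M e i)" for p
    unfolding lincomb_def using eM by (intro M.finsum_cong') (auto intro!: lm_closed[OF M])
  have ex1: "\<exists>!a. a \<in> {..<m} \<rightarrow>\<^sub>E ring_center R \<and> d = (\<Oplus>\<^bsub>M\<^esub> i\<in>{..<m}. a i \<odot>\<^sub>M e i)" if d: "d \<in> carrier M" for d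
  proof -
    obtain p where p: "d = lincomb \<zeta> M {..<m} e p" using b d unfolding basis_of_def by blast
    show ?thesis
    proof (rule ex1I[of _ "\<lambda>i\<in>{..<m}. \<zeta> (p i)"])
      show "(\<lambda>i\<in>{..<m}. \<zeta> (p i)) \<in> {..<m} \<rightarrow>\<^sub>E ring_center R \<and> d = (\<Oplus>\<^bsub>M\<^esub> i\<in>{..<m}. (\<lambda>i\<in>{..<m}. \<zeta> (p i)) i \<odot>\<^sub>M e i)"
        using p r[of p] by (auto simp: ring_center_eq)
    next
      fix a assume a: "a \<in> {..<m} \<rightarrow>\<^sub>E ring_center R \<and> d = (\<Oplus>\<^bsub>M\<^esub> i\<in>{..<m}. a i \<odot>\<^sub>M e i)"
      have "\<forall>i\<in>{..<m}. \<exists>p. a i = \<zeta> p" using a by (auto simp: PiE_iff ring_center_eq)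
      then obtain q where q: "\<forall>i\<in>{..<m}. a i = \<zeta> (q i)" by metis
      have aq: "a = (\<lambda>i\<in>{..<m}. \<zeta> (q i))" using q a by (auto simp: PiE_iff extensional_def fun_eq_iff)
      have "lincomb \<zeta> M {..<m} e q = lincomb \<zeta> M {..<m} e p" using a r[of q] p aq by simp
      then have "q i = p i" if "i \<in> {..<m}" for i using basis_eqD[OF b _ _ that] by blast
      then show "a = (\<lambda>i\<in>{..<m}. \<zeta> (p i))" unfolding aq by (auto simp: fun_eq_iff)
    qed
  qed
  have "e \<in> {..<m} \<rightarrow> carrier M" using eM by auto
  then have "free_over_center R M"
    unfolding free_over_center_def by (intro exI[of _ m] exI[of _ e] conjI ballI ex1)
  then show "M \<in> CM R" using M by (simp add: CM_def)
qed

lemma CM_I: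
  assumes M: "left_module R M" and ts: "torsion_sep M" and "cgen \<zeta> M (carrier M) G"
  shows "M \<in> CM R"
proof -
  interpret fps_module R M \<zeta> by (rule fps_module_zeta[OF M])
  have "\<exists>G'\<subseteq>G. basis_of \<zeta> M (carrier M) G' id"
    using ts assms(3) smult_closed by (intro minimal_generators_basis) (auto simp: torsion_sep_def)
  then obtain G' where "basis_of \<zeta> M (carrier M) G' id" by blast
  from basis_reindex[OF this subset_refl] have "\<exists>(m::nat) e. basis_of \<zeta> M (carrier M) {..<m} e" by blast
  with M show ?thesis unfolding CM_basis by (rule conjI)
qed

lemma basis_torsion_sep:
  assumes M: "left_module R M" and b: "basis_of \<zeta> M (carrier M) I e"
  shows "torsion_sep M"
proof -
  interpret fps_module R M \<zeta> by (rule fps_module_zeta[OF M])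
  have I: "finite I" "e ` I \<subseteq> carrier M" using b by (auto simp: basis_of_def)
  note sc = lincomb_scale[OF I]
  show ?thesis unfolding torsion_sep_def
  proof (intro conjI ballI impI)
    fix m assume m: "m \<in> carrier M" "\<zeta> fps_X \<odot>\<^sub>M m = \<zero>\<^sub>M"
    obtain p where p: "m = lincomb \<zeta> M I e p" using basis_exD[OF b m(1)] by blast
    have "\<forall>i\<in>I. fps_X * p i = 0" using basis_indD[OF b] m(2) unfolding p sc[symmetric] by blast
    then have "lincomb \<zeta> M I e p = lincomb \<zeta> M I e (\<lambda>i. 0 * p i)" by (intro lincomb_cong I) auto
    then show "m = \<zero>\<^sub>M" unfolding sc using p m lincomb_closed[OF I(2), of p] by (simp add: chi_zero_smult)
  next
    fix m assume m: "m \<in> carrier M" "\<forall>N. \<exists>m'\<in>carrier M. m = \<zeta> (fps_X ^ N) \<odot>\<^sub>M m'"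
    obtain p where p: "m = lincomb \<zeta> M I e p" using basis_exD[OF b m(1)] by blast
    have "p i = 0" if i: "i \<in> I" for i
    proof (rule fps_ext)
      fix N
      obtain m' where m': "m' \<in> carrier M" "m = \<zeta> (fps_X ^ Suc N) \<odot>\<^sub>M m'" using m by blast
      obtain q where q: "m' = lincomb \<zeta> M I e q" using basis_exD[OF b m'(1)] by blast
      have "lincomb \<zeta> M I e p = lincomb \<zeta> M I e (\<lambda>i. fps_X ^ Suc N * q i)" using m'(2) unfolding p q sc .
      then have "p i = fps_X ^ Suc N * q i" by (rule basis_eqD[OF b subset_refl _ i])
      then show "fps_nth (p i) N = fps_nth 0 N" by (simp only: fps_X_power_mult_nth) simp
    qed
    then have "lincomb \<zeta> M I e p = lincomb \<zeta> M I e (\<lambda>i. 0 * p i)" by (intro lincomb_cong I) auto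
    then show "m = \<zero>\<^sub>M" unfolding sc using p m lincomb_closed[OF I(2), of p] by (simp add: chi_zero_smult)
  qed
qed

lemma CM_torsion_sep: "M \<in> CM R ==> torsion_sep M"
  using CM_basis basis_torsion_sep by blast

lemma CM_module: "M \<in> CM R ==> left_module R M"
  by (simp add: CM_def)

lemma CM_tw: "M \<in> CM R ==> tw a M \<in> CM R"
proof -
  assume "M \<in> CM R"
  then obtain m e where M: "left_module R M" and b: "basis_of \<zeta> M (carrier M) {..<m::nat} e" using CM_basis by blast
  have "lincomb \<zeta> (tw a M) {..<m} e = lincomb \<zeta> M {..<m} e"
    unfolding lincomb_def finsum_def finprod_def by (simp add: sig_pow_gens fun_eq_iff)
  then have "basis_of \<zeta> (tw a M) (carrier (tw a M)) {..<m} e" using b by (simp add: basis_of_def)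
  then show ?thesis using CM_basis tw_module[OF M] by blast
qed

text \<open>The cheapest path from \<open>j\<close> to \<open>i\<close>, which generates the entries
  at \<open>(i, j)\<close> over the center.\<close>

definition ent :: "nat \<Rightarrow> nat \<Rightarrow> 'r" where
  "ent i j = el (\<lambda>a b. if a = i \<and> b = j then fps_X ^ C i j else 0)"

lemma ent_closed [simp]: "ent i j \<in> carrier R"
  unfolding ent_def by (rule el_closed) auto

lemma mat_ent: "a < n ==> b < n ==> mat (ent i j) a b = (if a = i \<and> b = j then fps_X ^ C i j else 0)"
  unfolding ent_def by (rule mat_el) auto

lemma ent_wel:
  assumes "i < n" "j < n"
  shows "\<exists>w. ent i j = wel w \<otimes> E j"
proof -
  obtain w where w: "wend n w j = i" "wcost n k w j = C i j" using C_word assms by blast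
  have "ent i j = wel w \<otimes> E j"
    by (rule mat_inj) (use assms w in \<open>auto simp: mat_ent mat_E_right mat_wel\<close>)
  then show ?thesis by blast
qed

definition cf :: "'r \<Rightarrow> nat \<Rightarrow> nat \<Rightarrow> complex fps" where "cf r i j = fps_shift (C i j) (mat r i j)"

lemma ent_expand:
  assumes r: "r \<in> carrier R"
  shows "r = (\<Oplus>ij\<in>{..<n} \<times> {..<n}. \<zeta> (cf r (fst ij) (snd ij)) \<otimes> ent (fst ij) (snd ij))"
proof (rule mat_inj)
  fix i j assume ij: "i < n" "j < n"
  have "mat (\<Oplus>ij\<in>{..<n} \<times> {..<n}. \<zeta> (cf r (fst ij) (snd ij)) \<otimes> ent (fst ij) (snd ij)) i j =
      (\<Sum>ij\<in>{..<n} \<times> {..<n}. cf r (fst ij) (snd ij) * mat (ent (fst ij) (snd ij)) i j)"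
    using ij by (subst mat_finsum) (auto simp: mat_zeta_left)
  also have "... = cf r (fst (i, j)) (snd (i, j)) * mat (ent (fst (i, j)) (snd (i, j))) i j"
    using ij by (intro sum_eq_single) (auto simp: mat_ent)
  also have "... = mat r i j"
    using mat_dvd[OF r ij] ij unfolding fps_X_power_dvd_iff
    by (intro fps_ext) (auto simp: cf_def mat_ent fps_X_power_mult_right_nth)
  finally show "mat r i j = mat (\<Oplus>ij\<in>{..<n} \<times> {..<n}. \<zeta> (cf r (fst ij) (snd ij)) \<otimes> ent (fst ij) (snd ij)) i j" ..
qed (auto simp: r intro!: R.finsum_closed)

text \<open>Every element is a finite combination of the \<open>n^2\<close> elements
  \<open>ent\<close> with central coefficients, and each \<open>ent\<close> is a word in
  \<open>x\<close> and \<open>y\<close> times an idempotent.\<close>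

lemma gen_induct:
  assumes r: "r \<in> carrier R" and z: "\<And>p. P (\<zeta> p)" and xy: "P x" "P y" and E: "\<And>j. j < n ==> P (E j)"
    and add: "\<And>a b. a \<in> carrier R ==> b \<in> carrier R ==> P a ==> P b ==> P (a \<oplus> b)"
    and mult: "\<And>a b. a \<in> carrier R ==> b \<in> carrier R ==> P a ==> P b ==> P (a \<otimes> b)"
  shows "P r"
proof -
  have w: "P (wel w)" for w
  proof (induction w)
    case Nil show ?case using z[of 1] by (simp add: wel_Nil zeta_one)
  next
    case (Cons b w)
    have "wel (b # w) = wel w \<otimes> wel [b]" by (simp add: wel_append)
    moreover have "P (wel [b])" using xy by (cases b) (auto simp: x_def y_def)
    ultimately show ?case using mult Cons by simp
  qed
  have "P (\<Oplus>ij\<in>A. \<zeta> (cf r (fst ij) (snd ij)) \<otimes> ent (fst ij) (snd ij))" if "finite A" "A \<subseteq> {..<n} \<times> {..<n}" for A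
    using that
  proof (induction A rule: finite_induct)
    case empty
    have "\<zeta> 0 = \<zero>" by (rule mat_inj) (auto simp: mat_zeta mat_zero)
    then show ?case using z[of 0] by simp
  next
    case (insert a A)
    have "P (ent (fst a) (snd a))" using ent_wel[of "fst a" "snd a"] insert.prems w E mult by (auto simp del: R.m_assoc)
    then show ?case using insert mult z add by (simp add: R.finsum_insert Pi_def R.finsum_closed)
  qed
  then have "P (\<Oplus>ij\<in>{..<n} \<times> {..<n}. \<zeta> (cf r (fst ij) (snd ij)) \<otimes> ent (fst ij) (snd ij))" by simp
  then show ?thesis unfolding ent_expand[OF r, symmetric] .
qed

text \<open>Linearity over power series in \<open>t\<close> follows from linearity over constants,
  \<open>x\<close> and \<open>y\<close>, because \<open>t = x y\<close> and the target is separated.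
  The rest is \<open>gen_induct\<close>.\<close>

lemma tiled_HomI:
  assumes M: "left_module R M" and N: "left_module R N" and ts: "torsion_sep N"
    and cl: "\<And>m. m \<in> carrier M ==> f m \<in> carrier N" "\<And>m. m \<notin> carrier M ==> f m = undefined"
    and add: "\<And>a b. a \<in> carrier M ==> b \<in> carrier M ==> f (a \<oplus>\<^sub>M b) = f a \<oplus>\<^sub>N f b"
    and io: "\<And>c m. m \<in> carrier M ==> f (\<iota> c \<odot>\<^sub>M m) = \<iota> c \<odot>\<^sub>N f m"
    and x: "\<And>m. m \<in> carrier M ==> f (x \<odot>\<^sub>M m) = x \<odot>\<^sub>N f m"
    and y: "\<And>m. m \<in> carrier M ==> f (y \<odot>\<^sub>M m) = y \<odot>\<^sub>N f m"
    and E: "\<And>j m. j < n ==> m \<in> carrier M ==> f (E j \<odot>\<^sub>M m) = E j \<odot>\<^sub>N f m"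
  shows "f \<in> Hom R M N"
proof (rule HomI[OF cl add])
  interpret FM: fps_module R M \<zeta> by (rule fps_module_zeta[OF M])
  interpret FN: fps_module R N \<zeta> by (rule fps_module_zeta[OF N])
  have X: "f (\<zeta> fps_X \<odot>\<^sub>M m) = \<zeta> fps_X \<odot>\<^sub>N f m" if "m \<in> carrier M" for m
    using that cl by (simp add: zeta_X lm_assoc[OF M] lm_assoc[OF N] x y lm_closed[OF M])
  have z: "f (\<zeta> p \<odot>\<^sub>M m) = \<zeta> p \<odot>\<^sub>N f m" if m: "m \<in> carrier M" for p m
  proof -
    \<comment> \<open>The defect of linearity at \<open>p\<close>. Splitting off the constant term
      shows that it is \<open>t\<close> times the defect at the shifted series, hence divisible by
      all powers of \<open>t\<close>.\<close>
    define d where "d p = f (\<zeta> p \<odot>\<^sub>M m) \<ominus>\<^bsub>N\<^esub> \<zeta> p \<odot>\<^sub>N f m" for p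
    have dc: "d p \<in> carrier N" for p unfolding d_def using m cl FM.smult_closed FN.smult_closed by simp
    have step: "d p = \<zeta> fps_X \<odot>\<^sub>N d (fps_shift 1 p)" for p
    proof -
      let ?c = "fps_const (fps_nth p 0)" and ?s = "fps_shift 1 p"
      have p: "p = ?c + fps_X * ?s" by (rule fps_ext) (auto simp: fps_X_mult_nth)
      have c: "\<zeta> ?c \<odot>\<^sub>N f m \<in> carrier N" "\<zeta> ?s \<odot>\<^sub>N f m \<in> carrier N" "f (\<zeta> ?s \<odot>\<^sub>M m) \<in> carrier N"
        "\<zeta> ?c \<odot>\<^sub>M m \<in> carrier M" "\<zeta> ?s \<odot>\<^sub>M m \<in> carrier M" "\<zeta> fps_X \<odot>\<^sub>M (\<zeta> ?s \<odot>\<^sub>M m) \<in> carrier M"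
        using m cl FM.smult_closed FN.smult_closed by auto
      have 1: "f (\<zeta> p \<odot>\<^sub>M m) = \<zeta> ?c \<odot>\<^sub>N f m \<oplus>\<^sub>N \<zeta> fps_X \<odot>\<^sub>N f (\<zeta> ?s \<odot>\<^sub>M m)"
      proof -
        have "\<zeta> p \<odot>\<^sub>M m = \<zeta> ?c \<odot>\<^sub>M m \<oplus>\<^sub>M \<zeta> fps_X \<odot>\<^sub>M (\<zeta> ?s \<odot>\<^sub>M m)"
          using m by (subst p) (simp add: FM.smult_add FM.smult_smult)
        then show ?thesis using add c X io[OF m, of "fps_nth p 0"] by (simp add: iota_zeta)
      qed
      have 2: "\<zeta> p \<odot>\<^sub>N f m = \<zeta> ?c \<odot>\<^sub>N f m \<oplus>\<^sub>N \<zeta> fps_X \<odot>\<^sub>N (\<zeta> ?s \<odot>\<^sub>N f m)"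
        using m cl by (subst p) (simp add: FN.smult_add FN.smult_smult)
      have c': "\<zeta> fps_X \<odot>\<^sub>N f (\<zeta> ?s \<odot>\<^sub>M m) \<in> carrier N" "\<zeta> fps_X \<odot>\<^sub>N (\<zeta> ?s \<odot>\<^sub>N f m) \<in> carrier N"
        using c FN.smult_closed by auto
      have "d p = \<zeta> fps_X \<odot>\<^sub>N f (\<zeta> ?s \<odot>\<^sub>M m) \<ominus>\<^bsub>N\<^esub> \<zeta> fps_X \<odot>\<^sub>N (\<zeta> ?s \<odot>\<^sub>N f m)"
        unfolding d_def 1 2 using c(1) c'
        by (simp add: a_minus_def FN.M.minus_add FN.M.a_ac)
           (metis FN.M.a_comm FN.M.a_lcomm FN.M.add.inv_closed FN.M.a_closed FN.M.r_neg2)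
      then show ?thesis unfolding d_def using c by (simp add: lm_diff_r[OF N])
    qed
    have "\<exists>m'\<in>carrier N. d p = \<zeta> (fps_X ^ N') \<odot>\<^sub>N m'" for N' p
    proof (induction N' arbitrary: p)
      case 0 show ?case using dc by (auto simp: zeta_one lm_one[OF N])
    next
      case (Suc N')
      obtain m' where m': "m' \<in> carrier N" "d (fps_shift 1 p) = \<zeta> (fps_X ^ N') \<odot>\<^sub>N m'" using Suc by blast
      have "d p = \<zeta> (fps_X ^ Suc N') \<odot>\<^sub>N m'" using step[of p] m' by (simp add: FN.smult_smult)
      then show ?case using m' by blast
    qed
    then have "d p = \<zero>\<^sub>N" using ts dc unfolding torsion_sep_def by blast
    then show ?thesis unfolding d_def
      by (simp only: FN.M.diff_eq_zero_iff[OF cl(1)[OF FM.smult_closed[OF m]] FN.smult_closed[OF cl(1)[OF m]]])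
  qed
  fix r assume r: "r \<in> carrier R"
  have "\<forall>m\<in>carrier M. f (r \<odot>\<^sub>M m) = r \<odot>\<^sub>N f m"
    using r
  proof (rule gen_induct)
    fix a b assume ab: "a \<in> carrier R" "b \<in> carrier R" "\<forall>m\<in>carrier M. f (a \<odot>\<^sub>M m) = a \<odot>\<^sub>N f m" "\<forall>m\<in>carrier M. f (b \<odot>\<^sub>M m) = b \<odot>\<^sub>N f m"
    then show "\<forall>m\<in>carrier M. f ((a \<oplus> b) \<odot>\<^sub>M m) = (a \<oplus> b) \<odot>\<^sub>N f m"
      using add cl by (simp add: lm_l_distr[OF M] lm_l_distr[OF N] lm_closed[OF M])
    show "\<forall>m\<in>carrier M. f ((a \<otimes> b) \<odot>\<^sub>M m) = (a \<otimes> b) \<odot>\<^sub>N f m"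
      using ab add cl by (simp add: lm_assoc[OF M] lm_assoc[OF N] lm_closed[OF M])
  qed (use z x y E in auto)
  then show "m \<in> carrier M ==> f (r \<odot>\<^sub>M m) = r \<odot>\<^sub>N f m" for m by blast
qed

end

lemma (in abelian_monoid) finsum_mem:
  assumes "finite A" "S \<subseteq> carrier G" "\<zero> \<in> S" "\<And>a b. a \<in> S ==> b \<in> S ==> a \<oplus> b \<in> S" "\<And>i. i \<in> A ==> f i \<in> S"
  shows "(\<Oplus>i\<in>A. f i) \<in> S"
  using assms(1,5)
proof (induction A rule: finite_induct)
  case empty then show ?case using assms(3) by simp
next
  case (insert i A)
  then show ?case using assms(2,4) by (subst finsum_insert) auto
qed

lemma (in fps_module) lincomb_cgen:
  assumes I: "finite I" "v ` I \<subseteq> D" and D: "D \<subseteq> carrier M" "\<zero>\<^sub>M \<in> D" "\<And>a b. a \<in> D ==> b \<in> D ==> a \<oplus>\<^sub>M b \<in> D"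
    "\<And>q a. a \<in> D ==> \<chi> q \<odot>\<^sub>M a \<in> D"
    and ex: "\<And>d. d \<in> D ==> \<exists>p. d = lincomb \<chi> M I v p"
  shows "cgen \<chi> M D (v ` I)"
  unfolding cgen_def
proof (intro conjI ballI)
  fix d assume "d \<in> D"
  then obtain p where p: "d = lincomb \<chi> M I v p" using ex by blast
  have vM: "v ` I \<subseteq> carrier M" using I D by blast
  have "p i = fps_const (fps_nth (p i) 0) + fps_X * fps_shift 1 (p i)" for i
    by (rule fps_ext) (auto simp: fps_X_mult_nth)
  then have "d = lincomb \<chi> M I v (\<lambda>i. fps_const (fps_nth (p i) 0) + fps_X * fps_shift 1 (p i))"
    using p by simp
  then have d: "d = lincomb \<chi> M I v (\<lambda>i. fps_const (fps_nth (p i) 0)) \<oplus>\<^sub>M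
      \<chi> fps_X \<odot>\<^sub>M lincomb \<chi> M I v (\<lambda>i. fps_shift 1 (p i))"
    unfolding lincomb_add[OF vM] lincomb_scale[OF I(1) vM] .
  have "lincomb \<chi> M I v (\<lambda>i. fps_const (fps_nth (p i) 0)) \<in> cspan \<chi> M (v ` I)"
    unfolding lincomb_def using I vM cspan_closed[of "v ` I"] cspan_zero[of "v ` I"] cspan_add[of "v ` I"] cspan_mem[of "v ` I"]
    by (intro M.finsum_mem) auto
  moreover have "lincomb \<chi> M I v (\<lambda>i. fps_shift 1 (p i)) \<in> D" by (rule lincomb_mem[OF I D])
  ultimately show "\<exists>a\<in>cspan \<chi> M (v ` I). \<exists>d'\<in>D. d = a \<oplus>\<^sub>M \<chi> fps_X \<odot>\<^sub>M d'" using d by blast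
qed (use I in auto)

context tiled
begin

text \<open>The order is generated over its center by the finitely many \<open>ent\<close>, so the
  products of these with \<open>R\<close>-generators of \<open>M\<close> generate \<open>M\<close>
  over power series in \<open>t\<close>.\<close>

lemma fg_cgen:
  fixes v :: "nat \<Rightarrow> 'm" and N :: nat
  assumes M: "left_module R M" and v: "\<And>s. s < N ==> v s \<in> carrier M"
    and ex: "\<And>m. m \<in> carrier M ==> \<exists>r. (\<forall>s<N. r s \<in> carrier R) \<and> m = (\<Oplus>\<^bsub>M\<^esub> s\<in>{..<N}. r s \<odot>\<^sub>M v s)"
  shows "\<exists>G. cgen \<zeta> M (carrier M) G"
proof -
  interpret fps_module R M \<zeta> by (rule fps_module_zeta[OF M])
  let ?I = "({..<n} \<times> {..<n}) \<times> {..<N}"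
  define w where "w = (\<lambda>(ij, s). ent (fst ij) (snd ij) \<odot>\<^sub>M v s)"
  have wM: "w z \<in> carrier M" if "z \<in> ?I" for z using that v by (auto simp: w_def intro!: lm_closed[OF M])
  have "cgen \<zeta> M (carrier M) (w ` ?I)"
  proof (rule lincomb_cgen)
    fix m assume "m \<in> carrier M"
    then obtain r where r: "\<And>s. s < N ==> r s \<in> carrier R" and m: "m = (\<Oplus>\<^bsub>M\<^esub> s\<in>{..<N}. r s \<odot>\<^sub>M v s)" using ex by blast
    define p where "p = (\<lambda>(ij, s). cf (r s) (fst ij) (snd ij))"
    have t: "\<zeta> (p (ij, s)) \<odot>\<^sub>M w (ij, s) \<in> carrier M" if "(ij, s) \<in> ?I" for ij s
      using wM[OF that] by (rule smult_closed)
    have rs: "r s \<odot>\<^sub>M v s = (\<Oplus>\<^bsub>M\<^esub> ij\<in>{..<n} \<times> {..<n}. \<zeta> (p (ij, s)) \<odot>\<^sub>M w (ij, s))" if s: "s < N" for s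
    proof -
      have "r s \<odot>\<^sub>M v s = (\<Oplus>ij\<in>{..<n} \<times> {..<n}. \<zeta> (cf (r s) (fst ij) (snd ij)) \<otimes> ent (fst ij) (snd ij)) \<odot>\<^sub>M v s"
        using ent_expand[OF r[OF s]] by simp
      also have "... = (\<Oplus>\<^bsub>M\<^esub> ij\<in>{..<n} \<times> {..<n}. (\<zeta> (cf (r s) (fst ij) (snd ij)) \<otimes> ent (fst ij) (snd ij)) \<odot>\<^sub>M v s)"
        using v[OF s] by (intro lm_finsum_l[OF M]) auto
      also have "... = (\<Oplus>\<^bsub>M\<^esub> ij\<in>{..<n} \<times> {..<n}. \<zeta> (p (ij, s)) \<odot>\<^sub>M w (ij, s))"
        using v[OF s] t s by (intro M.finsum_cong') (auto simp: p_def w_def lm_assoc[OF M])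
      finally show ?thesis .
    qed
    have "m = (\<Oplus>\<^bsub>M\<^esub> s\<in>{..<N}. \<Oplus>\<^bsub>M\<^esub> ij\<in>{..<n} \<times> {..<n}. \<zeta> (p (ij, s)) \<odot>\<^sub>M w (ij, s))"
      unfolding m using rs t by (intro M.finsum_cong') (auto intro!: M.finsum_closed)
    also have "... = (\<Oplus>\<^bsub>M\<^esub> z\<in>?I. \<zeta> (p z) \<odot>\<^sub>M w z)"
    proof -
      have "(\<Oplus>\<^bsub>M\<^esub> s\<in>S. \<Oplus>\<^bsub>M\<^esub> ij\<in>{..<n} \<times> {..<n}. \<zeta> (p (ij, s)) \<odot>\<^sub>M w (ij, s)) =
          (\<Oplus>\<^bsub>M\<^esub> z\<in>({..<n} \<times> {..<n}) \<times> S. \<zeta> (p z) \<odot>\<^sub>M w z)" if "finite S" "S \<subseteq> {..<N}" for S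
        using that
      proof (induction S rule: finite_induct)
        case (insert s S)
        have "({..<n} \<times> {..<n}) \<times> insert s S = (\<lambda>ij. (ij, s)) ` ({..<n} \<times> {..<n}) \<union> ({..<n} \<times> {..<n}) \<times> S" by auto
        then have "(\<Oplus>\<^bsub>M\<^esub> z\<in>({..<n} \<times> {..<n}) \<times> insert s S. \<zeta> (p z) \<odot>\<^sub>M w z) =
            (\<Oplus>\<^bsub>M\<^esub> z\<in>(\<lambda>ij. (ij, s)) ` ({..<n} \<times> {..<n}). \<zeta> (p z) \<odot>\<^sub>M w z) \<oplus>\<^sub>M (\<Oplus>\<^bsub>M\<^esub> z\<in>({..<n} \<times> {..<n}) \<times> S. \<zeta> (p z) \<odot>\<^sub>M w z)"
          using insert t by (simp only:, intro M.finsum_Un_disjoint) auto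
        also have "(\<Oplus>\<^bsub>M\<^esub> z\<in>(\<lambda>ij. (ij, s)) ` ({..<n} \<times> {..<n}). \<zeta> (p z) \<odot>\<^sub>M w z) =
            (\<Oplus>\<^bsub>M\<^esub> ij\<in>{..<n} \<times> {..<n}. \<zeta> (p (ij, s)) \<odot>\<^sub>M w (ij, s))"
          using insert t by (intro M.finsum_reindex) (auto simp: inj_on_def)
        finally show ?case using insert t by (subst M.finsum_insert) (auto intro!: M.finsum_closed)
      qed simp
      then show ?thesis by simp
    qed
    finally show "\<exists>p. m = lincomb \<zeta> M ?I w p" unfolding lincomb_def by blast
  qed (use wM in \<open>auto simp: smult_closed\<close>)
  then show ?thesis by blast
qed

lemma torsion_sep_inj:
  assumes K: "left_module R K" and P: "left_module R P" and ts: "torsion_sep P" and f: "f \<in> Hom R K P" and inj: "inj_on f (carrier K)"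
  shows "torsion_sep K"
proof -
  interpret K: abelian_group K by (rule lm_grp[OF K])
  have z: "m = \<zero>\<^sub>K" if "m \<in> carrier K" "f m = \<zero>\<^sub>P" for m
    using inj_onD[OF inj, of m "\<zero>\<^sub>K"] that Hom_zero[OF K P f] by simp
  show ?thesis unfolding torsion_sep_def
  proof (intro conjI ballI impI)
    fix m assume m: "m \<in> carrier K" "\<zeta> fps_X \<odot>\<^sub>K m = \<zero>\<^sub>K"
    then have "\<zeta> fps_X \<odot>\<^sub>P f m = \<zero>\<^sub>P" using Hom_smult[OF f, of "\<zeta> fps_X" m] Hom_zero[OF K P f] by simp
    then show "m = \<zero>\<^sub>K" using ts Hom_closed[OF f m(1)] z[OF m(1)] unfolding torsion_sep_def by simp
  next
    fix m assume m: "m \<in> carrier K" "\<forall>N. \<exists>m'\<in>carrier K. m = \<zeta> (fps_X ^ N) \<odot>\<^sub>K m'"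
    have "\<exists>m'\<in>carrier P. f m = \<zeta> (fps_X ^ N) \<odot>\<^sub>P m'" for N
    proof -
      obtain m' where "m' \<in> carrier K" "m = \<zeta> (fps_X ^ N) \<odot>\<^sub>K m'" using m(2) by blast
      then show ?thesis using Hom_smult[OF f, of "\<zeta> (fps_X ^ N)" m'] Hom_closed[OF f, of m'] by auto
    qed
    then show "m = \<zero>\<^sub>K" using ts Hom_closed[OF f m(1)] z[OF m(1)] unfolding torsion_sep_def by simp
  qed
qed

text \<open>Images of generators generate. This supplies finite generation of the kernel in
  \<open>koszul\<close>, which is exhibited there as an image.\<close>

lemma CM_quotient:
  assumes P: "P \<in> CM R" and K: "left_module R K" and ts: "torsion_sep K" and f: "f \<in> Hom R P K" and onto: "f ` carrier P = carrier K"
  shows "K \<in> CM R"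
proof -
  have LP: "left_module R P" using P by (rule CM_module)
  obtain m e where b: "basis_of \<zeta> P (carrier P) {..<m::nat} e" using P CM_basis by blast
  interpret P: fps_module R P \<zeta> by (rule fps_module_zeta[OF LP])
  interpret K: fps_module R K \<zeta> by (rule fps_module_zeta[OF K])
  have eP: "e i \<in> carrier P" if "i < m" for i using b that by (auto simp: basis_of_def)
  have "\<exists>G. cgen \<zeta> K (carrier K) G"
  proof (rule fg_cgen[OF K, where N = m and v = "\<lambda>i. f (e i)"])
    fix y assume "y \<in> carrier K"
    then obtain d where d: "d \<in> carrier P" "y = f d" using onto by blast
    obtain p where p: "d = lincomb \<zeta> P {..<m} e p" using P.basis_exD[OF b d(1)] by blast
    have "y = (\<Oplus>\<^bsub>K\<^esub> i\<in>{..<m}. f (\<zeta> (p i) \<odot>\<^sub>P e i))"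
      unfolding d(2) p lincomb_def using eP by (intro Hom_finsum[OF LP K f]) (auto intro!: P.smult_closed)
    also have "... = (\<Oplus>\<^bsub>K\<^esub> i\<in>{..<m}. \<zeta> (p i) \<odot>\<^sub>K f (e i))"
      using eP Hom_closed[OF f] by (intro K.M.finsum_cong') (auto simp: Hom_smult[OF f] intro!: K.smult_closed)
    finally show "\<exists>r. (\<forall>s<m. r s \<in> carrier R) \<and> y = (\<Oplus>\<^bsub>K\<^esub> s\<in>{..<m}. r s \<odot>\<^sub>K f (e s))"
      by (intro exI[of _ "\<lambda>i. \<zeta> (p i)"]) auto
  qed (use eP Hom_closed[OF f] in auto)
  then show ?thesis using CM_I[OF K ts] by blast
qed

lemma fmod_CM:
  assumes u: "\<And>s. s < N ==> u s \<in> carrier R" "\<And>s. s < N ==> u s \<otimes> u s = u s"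
  shows "fmod R N u \<in> CM R"
proof -
  have F: "left_module R (fmod R N u)" by (rule fmod_module[OF R_ring u])
  have "torsion_sep (fmod R N u)"
    unfolding torsion_sep_def
  proof (intro conjI ballI impI)
    fix p assume p: "p \<in> carrier (fmod R N u)" "\<zeta> fps_X \<odot>\<^bsub>fmod R N u\<^esub> p = \<zero>\<^bsub>fmod R N u\<^esub>"
    have "p s = \<zero>" for s
    proof (rule mat_inj)
      fix i j assume ij: "i < n" "j < n"
      have "\<zeta> fps_X \<otimes> p s = \<zero>" using fun_cong[OF p(2), of s] by (simp add: fmod_smult[OF R_ring u] fmod_zero[OF R_ring u])
      then have "fps_X * mat (p s) i j = 0"
        using mat_zeta_left[of "p s" i j fps_X] fmod_closed[OF R_ring u p(1)] mat_zero[OF ij] ij by simp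
      then show "mat (p s) i j = mat \<zero> i j" using mat_zero[OF ij] by simp
    qed (auto simp: fmod_closed[OF R_ring u p(1)])
    then show "p = \<zero>\<^bsub>fmod R N u\<^esub>" by (simp add: fmod_zero[OF R_ring u] fun_eq_iff)
  next
    fix p assume p: "p \<in> carrier (fmod R N u)" "\<forall>N'. \<exists>m'\<in>carrier (fmod R N u). p = \<zeta> (fps_X ^ N') \<odot>\<^bsub>fmod R N u\<^esub> m'"
    have "p s = \<zero>" for s
    proof (rule mat_inj)
      fix i j assume ij: "i < n" "j < n"
      show "mat (p s) i j = mat \<zero> i j"
      proof (rule fps_ext)
        fix N'
        obtain q where q: "q \<in> carrier (fmod R N u)" "p = \<zeta> (fps_X ^ Suc N') \<odot>\<^bsub>fmod R N u\<^esub> q" using p(2) by blast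
        have qs: "q s \<in> carrier R" using fmod_closed[OF R_ring u q(1)] by simp
        have "mat (p s) i j = fps_X ^ Suc N' * mat (q s) i j"
          using mat_zeta_left[OF qs ij, of "fps_X ^ Suc N'"] by (simp only: q(2) fmod_smult[OF R_ring u])
        then have "fps_nth (mat (p s) i j) N' = 0" by (simp only: fps_X_power_mult_nth) simp
        then show "fps_nth (mat (p s) i j) N' = fps_nth (mat \<zero> i j) N'" by (simp add: mat_zero[OF ij])
      qed
    qed (auto simp: fmod_closed[OF R_ring u p(1)])
    then show "p = \<zero>\<^bsub>fmod R N u\<^esub>" by (simp add: fmod_zero[OF R_ring u] fun_eq_iff)
  qed
  moreover have "\<exists>G. cgen \<zeta> (fmod R N u) (carrier (fmod R N u)) G"
  proof (rule fg_cgen[OF F, where N = N and v = "fvec R u"])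
    fix p assume p: "p \<in> carrier (fmod R N u)"
    show "\<exists>r. (\<forall>s<N. r s \<in> carrier R) \<and> p = (\<Oplus>\<^bsub>fmod R N u\<^esub> s\<in>{..<N}. r s \<odot>\<^bsub>fmod R N u\<^esub> fvec R u s)"
      using fmod_expand[OF R_ring u p] fmod_closed[OF R_ring u p] by blast
  qed (rule fvec_closed[OF R_ring u])
  ultimately show ?thesis using CM_I[OF F] by blast
qed

sublocale free_cm R
  by unfold_locales (auto intro: fmod_CM)

lemma is_syzygy_tw:
  assumes "is_syzygy R M K"
  shows "is_syzygy R (tw a M) (tw a K)"
proof -
  obtain P f g where "syz_seq R M K P f g" using assms is_syzygy_seq by blast
  then have "syz_seq R (tw a M) (tw a K) (tw a P) f g"
    by (simp add: syz_seq_def CM_tw projective_tw Hom_tw)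
  then show ?thesis using is_syzygy_seq by blast
qed

lemma stably_iso_tw_n:
  assumes "left_module R M"
  shows "stably_iso R (tw (n * q) M) M"
  by (rule stably_iso_lm_iso[OF tw_module[OF assms] assms, where f = "hom_id M" and g = "hom_id M"])
     (simp add: lm_iso_def Hom_tw_n Hom_id[OF assms], simp add: hom_id_def)

section \<open>Frames\<close>

text \<open>From a vertex up to \<open>n - k\<close> walk down by \<open>y\<close>, from a later one
  walk up by \<open>x\<close>: all steps on the way to 0 are free.\<close>

lemma C_0: "j < n ==> C 0 j = 0"
proof -
  assume j: "j < n"
  have "\<exists>w. wend n w j = 0 \<and> wcost n k w j = 0"
  proof (cases "j \<le> n - k")
    case True
    let ?w = "replicate j False"
    have "int (wend n ?w j) = 0" by (subst wend_count[OF j]) (simp add: count_list_replicate)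
    then have e: "wend n ?w j = 0" by simp
    then have "n * wcost n k ?w j = 0"
      using wcost_pot[OF j k1 nk, of ?w] True by (simp add: count_list_replicate pot_def)
    then show ?thesis using e n_pos by auto
  next
    case False
    let ?w = "replicate (n - j) True"
    have "int (wend n ?w j) = 0" by (subst wend_count[OF j]) (use j in \<open>simp add: count_list_replicate of_nat_diff\<close>)
    then have e: "wend n ?w j = 0" by simp
    then have "n * wcost n k ?w j = 0"
      using wcost_pot[OF j k1 nk, of ?w] False by (simp add: count_list_replicate pot_def)
    then show ?thesis using e n_pos by auto
  qed
  then obtain w where "wend n w j = 0" "wcost n k w j = 0" by blast
  then show ?thesis using C_le[OF j, of w 0] by simp
qed

text \<open>A frame embeds the vertex spaces \<open>E\<^sub>i M\<close> into one \<open>\<complex>[[t]]\<^sup>r\<close>; it is normalised if \<open>E\<^sub>0 M\<close> fills it.\<close>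

definition frame :: "('r, 'm) module \<Rightarrow> nat \<Rightarrow> ('m \<Rightarrow> nat \<Rightarrow> nat \<Rightarrow> complex fps) \<Rightarrow> bool" where
  "frame M r \<epsilon> \<longleftrightarrow> left_module R M \<and>
     (\<forall>m\<in>carrier M. \<forall>m'\<in>carrier M. \<forall>i<n. \<forall>q<r. \<epsilon> (m \<oplus>\<^sub>M m') i q = \<epsilon> m i q + \<epsilon> m' i q) \<and>
     (\<forall>a\<in>carrier R. \<forall>m\<in>carrier M. \<forall>i<n. \<forall>q<r. \<epsilon> (a \<odot>\<^sub>M m) i q = (\<Sum>j<n. mat a i j * \<epsilon> m j q)) \<and>
     (\<forall>m\<in>carrier M. \<forall>m'\<in>carrier M. (\<forall>i<n. \<forall>q<r. \<epsilon> m i q = \<epsilon> m' i q) \<longrightarrow> m = m')"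

definition nframe :: "('r, 'm) module \<Rightarrow> nat \<Rightarrow> ('m \<Rightarrow> nat \<Rightarrow> nat \<Rightarrow> complex fps) \<Rightarrow> bool" where
  "nframe M r \<epsilon> \<longleftrightarrow> frame M r \<epsilon> \<and> (\<forall>v. \<exists>m\<in>carrier M. \<forall>i<n. \<forall>q<r. \<epsilon> m i q = (if i = 0 then v q else 0))"

lemma
  assumes "frame M r \<epsilon>"
  shows frame_module: "left_module R M"
    and frame_add: "[|m \<in> carrier M; m' \<in> carrier M; i < n; q < r|] ==> \<epsilon> (m \<oplus>\<^sub>M m') i q = \<epsilon> m i q + \<epsilon> m' i q"
    and frame_smult: "[|a \<in> carrier R; m \<in> carrier M; i < n; q < r|] ==> \<epsilon> (a \<odot>\<^sub>M m) i q = (\<Sum>j<n. mat a i j * \<epsilon> m j q)"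
    and frame_inj: "[|m \<in> carrier M; m' \<in> carrier M; \<And>i q. i < n ==> q < r ==> \<epsilon> m i q = \<epsilon> m' i q|] ==> m = m'"
  using assms unfolding frame_def by blast+

lemma nframe_frame: "nframe M r \<epsilon> ==> frame M r \<epsilon>"
  by (simp add: nframe_def)

lemma frame_zero:
  assumes f: "frame M r \<epsilon>" and "i < n" "q < r"
  shows "\<epsilon> \<zero>\<^sub>M i q = 0"
proof -
  interpret M: abelian_group M by (rule lm_grp[OF frame_module[OF f]])
  show ?thesis using frame_add[OF f, of "\<zero>\<^sub>M" "\<zero>\<^sub>M" i q] assms by simp
qed

lemma frame_zeta:
  assumes f: "frame M r \<epsilon>" and "m \<in> carrier M" "i < n" "q < r"
  shows "\<epsilon> (\<zeta> p \<odot>\<^sub>M m) i q = p * \<epsilon> m i q"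
proof -
  have "\<epsilon> (\<zeta> p \<odot>\<^sub>M m) i q = (\<Sum>j<n. mat (\<zeta> p) i j * \<epsilon> m j q)" using assms by (simp add: frame_smult[OF f])
  also have "... = mat (\<zeta> p) i i * \<epsilon> m i q" using assms by (intro sum_eq_single) (auto simp: mat_zeta)
  finally show ?thesis using assms by (simp add: mat_zeta)
qed

lemma frame_ent:
  assumes f: "frame M r \<epsilon>" and "m \<in> carrier M" "i < n" "q < r" "a < n" "b < n"
  shows "\<epsilon> (ent a b \<odot>\<^sub>M m) i q = (if i = a then fps_X ^ C a b * \<epsilon> m b q else 0)"
proof -
  have "\<epsilon> (ent a b \<odot>\<^sub>M m) i q = (\<Sum>j<n. mat (ent a b) i j * \<epsilon> m j q)" using assms by (simp add: frame_smult[OF f])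
  also have "... = mat (ent a b) i b * \<epsilon> m b q" using assms by (intro sum_eq_single) (auto simp: mat_ent)
  finally show ?thesis using assms by (simp add: mat_ent)
qed

lemma frame_finsum:
  assumes f: "frame M r \<epsilon>" and "finite A" "\<And>a. a \<in> A ==> g a \<in> carrier M" "i < n" "q < r"
  shows "\<epsilon> (\<Oplus>\<^bsub>M\<^esub> a\<in>A. g a) i q = (\<Sum>a\<in>A. \<epsilon> (g a) i q)"
proof -
  interpret M: abelian_group M by (rule lm_grp[OF frame_module[OF f]])
  show ?thesis using assms(2,3)
  proof (induction A rule: finite_induct)
    case empty then show ?case using frame_zero[OF f] assms by simp
  next
    case (insert a A)
    then show ?case using assms by (simp add: M.finsum_insert frame_add[OF f] Pi_def M.finsum_closed)
  qed
qed

text \<open>\<open>E 0 M\<close> is free over the power series, and \<open>ent 0 i\<close> maps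
  \<open>E i M\<close> into it injectively; the components are the coordinates of the image.
  Normalisation holds because at vertex 0 all coordinate vectors occur.\<close>

lemma nframe_ex:
  assumes "M \<in> CM R"
  shows "\<exists>r \<epsilon>. nframe M r \<epsilon>"
proof -
  have M: "left_module R M" and ts: "torsion_sep M" using assms CM_module CM_torsion_sep by blast+
  interpret fps_module R M \<zeta> by (rule fps_module_zeta[OF M])
  obtain m e where b: "basis_of \<zeta> M (carrier M) {..<m::nat} e" using assms CM_basis by blast
  have eM: "e ` {..<m} \<subseteq> carrier M" using b by (simp add: basis_of_def)
  define D where "D = {d \<in> carrier M. E 0 \<odot>\<^sub>M d = d}"
  have DM: "D \<subseteq> carrier M" by (auto simp: D_def)
  have E0: "E 0 \<odot>\<^sub>M m \<in> D" if "m \<in> carrier M" for m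
    using that lm_assoc[OF M, of "E 0" "E 0" m] n_pos by (auto simp: D_def lm_closed[OF M] E_idem)
  have D: "D \<subseteq> carrier M" "\<zero>\<^sub>M \<in> D" "\<And>a b. a \<in> D ==> b \<in> D ==> a \<oplus>\<^sub>M b \<in> D" "\<And>q a. a \<in> D ==> \<zeta> q \<odot>\<^sub>M a \<in> D"
  proof -
    fix q a assume a: "a \<in> D"
    then have "E 0 \<odot>\<^sub>M (\<zeta> q \<odot>\<^sub>M a) = \<zeta> q \<odot>\<^sub>M (E 0 \<odot>\<^sub>M a)"
      using DM zeta_commute[of "E 0" q] by (auto simp: lm_assoc[OF M, symmetric])
    then show "\<zeta> q \<odot>\<^sub>M a \<in> D" using a smult_closed by (auto simp: D_def)
  qed (auto simp: D_def lm_zero_r[OF M] lm_r_distr[OF M])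
  have cg: "cgen \<zeta> M D ((\<lambda>i. E 0 \<odot>\<^sub>M e i) ` {..<m})"
  proof (rule lincomb_cgen[OF _ _ D])
    fix d assume d: "d \<in> D"
    obtain p where p: "d = lincomb \<zeta> M {..<m} e p" using basis_exD[OF b] d DM by blast
    have "d = E 0 \<odot>\<^sub>M (\<Oplus>\<^bsub>M\<^esub> i\<in>{..<m}. \<zeta> (p i) \<odot>\<^sub>M e i)" using d p by (simp add: D_def lincomb_def)
    also have "... = (\<Oplus>\<^bsub>M\<^esub> i\<in>{..<m}. E 0 \<odot>\<^sub>M (\<zeta> (p i) \<odot>\<^sub>M e i))"
      using eM by (intro lm_finsum_r[OF M]) (auto intro!: smult_closed)
    also have "... = (\<Oplus>\<^bsub>M\<^esub> i\<in>{..<m}. \<zeta> (p i) \<odot>\<^sub>M (E 0 \<odot>\<^sub>M e i))"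
      using eM zeta_commute[of "E 0"]
      by (intro M.finsum_cong') (auto simp: lm_assoc[OF M, symmetric] intro!: lm_closed[OF M])
    finally show "\<exists>p. d = lincomb \<zeta> M {..<m} (\<lambda>i. E 0 \<odot>\<^sub>M e i) p" unfolding lincomb_def by blast
  qed (use E0 eM in auto)
  have "\<exists>G'\<subseteq>(\<lambda>i. E 0 \<odot>\<^sub>M e i) ` {..<m}. basis_of \<zeta> M D G' id"
  proof (rule minimal_generators_basis[OF D _ _ cg])
    fix d assume d: "d \<in> D"
    show "\<zeta> fps_X \<odot>\<^sub>M d = \<zero>\<^sub>M ==> d = \<zero>\<^sub>M" using ts d DM unfolding torsion_sep_def by auto
    assume "\<And>N. \<exists>d'\<in>D. d = \<zeta> (fps_X ^ N) \<odot>\<^sub>M d'"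
    then have "\<forall>N. \<exists>d'\<in>carrier M. d = \<zeta> (fps_X ^ N) \<odot>\<^sub>M d'" using DM by (metis subsetD)
    then show "d = \<zero>\<^sub>M" using ts d DM unfolding torsion_sep_def by (auto dest: subsetD)
  qed
  then obtain G' where "basis_of \<zeta> M D G' id" by blast
  then obtain r bb where bb: "basis_of \<zeta> M D {..<r::nat} bb" using basis_reindex DM by blast
  have fb: "bb ` {..<r} \<subseteq> carrier M" using bb DM by (auto simp: basis_of_def)
  define \<kappa> where "\<kappa> d = (SOME p. d = lincomb \<zeta> M {..<r} bb p)" for d
  have \<kappa>: "d = lincomb \<zeta> M {..<r} bb (\<kappa> d)" if "d \<in> D" for d
    unfolding \<kappa>_def using basis_exD[OF bb that] by (rule someI_ex)
  have \<kappa>I: "\<kappa> (lincomb \<zeta> M {..<r} bb p) q = p q" if "q < r" for p q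
  proof (rule basis_eqD[OF bb DM])
    have "lincomb \<zeta> M {..<r} bb p \<in> D" using bb D by (intro lincomb_mem) (auto simp: basis_of_def)
    then show "lincomb \<zeta> M {..<r} bb (\<kappa> (lincomb \<zeta> M {..<r} bb p)) = lincomb \<zeta> M {..<r} bb p"
      by (rule \<kappa>[symmetric])
  qed (use that in simp)
  define \<epsilon> where "\<epsilon> m i q = \<kappa> (ent 0 i \<odot>\<^sub>M m) q" for m i q
  have entD: "ent 0 i \<odot>\<^sub>M m \<in> D" if "i < n" "m \<in> carrier M" for i m
  proof -
    have "E 0 \<otimes> ent 0 i = ent 0 i" by (rule mat_inj) (use n_pos in \<open>auto simp: mat_E_left mat_ent\<close>)
    then show ?thesis using that lm_assoc[OF M, of "E 0" "ent 0 i" m] by (auto simp: D_def lm_closed[OF M])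
  qed
  have \<epsilon>\<kappa>: "ent 0 i \<odot>\<^sub>M m = lincomb \<zeta> M {..<r} bb (\<epsilon> m i)" if "i < n" "m \<in> carrier M" for i m
    using \<kappa>[OF entD[OF that]] by (simp add: \<epsilon>_def[abs_def])
  have "frame M r \<epsilon>" unfolding frame_def
  proof (intro conjI ballI allI impI)
    fix m m' i q assume m: "m \<in> carrier M" "m' \<in> carrier M" and i: "i < n" and q: "q < r"
    have "ent 0 i \<odot>\<^sub>M (m \<oplus>\<^sub>M m') = lincomb \<zeta> M {..<r} bb (\<lambda>q. \<epsilon> m i q + \<epsilon> m' i q)"
      using m i by (simp add: lm_r_distr[OF M] \<epsilon>\<kappa> lincomb_add[OF fb])
    then show "\<epsilon> (m \<oplus>\<^sub>M m') i q = \<epsilon> m i q + \<epsilon> m' i q" unfolding \<epsilon>_def[of "m \<oplus>\<^sub>M m'"] using \<kappa>I[OF q] by simp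
  next
    fix a m i q assume a: "a \<in> carrier R" and m: "m \<in> carrier M" and i: "i < n" and q: "q < r"
    \<comment> \<open>Since \<open>C 0 j = 0\<close>, the elements \<open>ent 0 j\<close> are plain
      matrix units, and row \<open>i\<close> of \<open>a\<close> moves to row 0 with its entries as
      central coefficients.\<close>
    have ea: "ent 0 i \<otimes> a = (\<Oplus>j\<in>{..<n}. \<zeta> (mat a i j) \<otimes> ent 0 j)"
    proof (rule mat_inj)
      fix s t assume st: "s < n" "t < n"
      have "mat (ent 0 i \<otimes> a) s t = (\<Sum>l<n. mat (ent 0 i) s l * mat a l t)" using st a by (simp add: mat_mult)
      also have "... = mat (ent 0 i) s i * mat a i t" using st i by (intro sum_eq_single) (auto simp: mat_ent)
      also have "... = mat a i t * mat (ent 0 t) s t" using st i by (simp add: mat_ent C_0)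
      also have "... = (\<Sum>j<n. mat a i j * mat (ent 0 j) s t)"
        using st by (intro sum_eq_single[symmetric]) (auto simp: mat_ent)
      also have "... = mat (\<Oplus>j\<in>{..<n}. \<zeta> (mat a i j) \<otimes> ent 0 j) s t"
        using st by (subst mat_finsum) (auto simp: mat_zeta_left)
      finally show "mat (ent 0 i \<otimes> a) s t = mat (\<Oplus>j\<in>{..<n}. \<zeta> (mat a i j) \<otimes> ent 0 j) s t" .
    qed (use a in \<open>auto intro!: R.finsum_closed\<close>)
    have "ent 0 i \<odot>\<^sub>M (a \<odot>\<^sub>M m) = (\<Oplus>\<^bsub>M\<^esub> j\<in>{..<n}. (\<zeta> (mat a i j) \<otimes> ent 0 j) \<odot>\<^sub>M m)"
      using a m ea lm_finsum_l[OF M, of "{..<n}" m "\<lambda>j. \<zeta> (mat a i j) \<otimes> ent 0 j"] by (simp add: lm_assoc[OF M, symmetric])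
    also have "... = (\<Oplus>\<^bsub>M\<^esub> j\<in>{..<n}. lincomb \<zeta> M {..<r} bb (\<lambda>q. mat a i j * \<epsilon> m j q))"
      using m by (intro M.finsum_cong') (auto simp: lm_assoc[OF M] \<epsilon>\<kappa> lincomb_scale[OF _ fb] intro!: lincomb_closed fb smult_closed)
    also have "... = lincomb \<zeta> M {..<r} bb (\<lambda>q. \<Sum>j<n. mat a i j * \<epsilon> m j q)"
    proof -
      have L: "(\<Oplus>\<^bsub>M\<^esub> j\<in>A. lincomb \<zeta> M {..<r} bb (f j)) = lincomb \<zeta> M {..<r} bb (\<lambda>q. \<Sum>j\<in>A. f j q)" if "finite A" for A :: "nat set" and f
        using that
      proof (induction A rule: finite_induct)
        case empty
        have "lincomb \<zeta> M {..<r} bb (\<lambda>q. 0 * 0) = \<zero>\<^sub>M"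
          unfolding lincomb_scale[OF finite_lessThan fb] using lincomb_closed[OF fb] by (simp add: chi_zero_smult)
        then show ?case by simp
      next
        case (insert j A)
        then show ?case by (subst M.finsum_insert) (auto simp: lincomb_closed[OF fb] lincomb_add[OF fb])
      qed
      from L[of "{..<n}" "\<lambda>j q. mat a i j * \<epsilon> m j q"] show ?thesis by simp
    qed
    finally show "\<epsilon> (a \<odot>\<^sub>M m) i q = (\<Sum>j<n. mat a i j * \<epsilon> m j q)"
      unfolding \<epsilon>_def[of "a \<odot>\<^sub>M m"] using \<kappa>I[OF q] by simp
  next
    fix m m' assume m: "m \<in> carrier M" "m' \<in> carrier M" and eq: "\<forall>i<n. \<forall>q<r. \<epsilon> m i q = \<epsilon> m' i q"
    have Ei: "E i \<odot>\<^sub>M m = E i \<odot>\<^sub>M m'" if i: "i < n" for i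
    proof -
      have e0: "ent 0 i \<odot>\<^sub>M m = ent 0 i \<odot>\<^sub>M m'"
        using \<epsilon>\<kappa>[OF i m(1)] \<epsilon>\<kappa>[OF i m(2)] lincomb_cong[OF fb, of "\<epsilon> m i" "\<epsilon> m' i"] eq i by simp
      \<comment> \<open>Going to vertex 0 and back multiplies \<open>E i m\<close> by
        \<open>t^(C i 0)\<close>, which may be cancelled in a torsion free module; this is where
        injectivity comes from.\<close>
      have ee: "ent i 0 \<otimes> ent 0 i = \<zeta> (fps_X ^ C i 0) \<otimes> E i"
      proof (rule mat_inj)
        fix s t assume st: "s < n" "t < n"
        have "mat (ent i 0 \<otimes> ent 0 i) s t = (\<Sum>l<n. mat (ent i 0) s l * mat (ent 0 i) l t)" using st by (simp add: mat_mult)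
        also have "... = mat (ent i 0) s 0 * mat (ent 0 i) 0 t" using st n_pos by (intro sum_eq_single) (auto simp: mat_ent)
        also have "... = mat (\<zeta> (fps_X ^ C i 0) \<otimes> E i) s t" using st i n_pos by (auto simp: mat_ent C_0 mat_zeta_left mat_E)
        finally show "mat (ent i 0 \<otimes> ent 0 i) s t = mat (\<zeta> (fps_X ^ C i 0) \<otimes> E i) s t" .
      qed auto
      have eq0: "\<zeta> (fps_X ^ C i 0) \<odot>\<^sub>M (E i \<odot>\<^sub>M m) = \<zeta> (fps_X ^ C i 0) \<odot>\<^sub>M (E i \<odot>\<^sub>M m')"
        using arg_cong[OF e0, of "\<lambda>z. ent i 0 \<odot>\<^sub>M z"] m ee by (simp add: lm_assoc[OF M, symmetric])
      have cancel: "a = b" if "\<zeta> (fps_X ^ c) \<odot>\<^sub>M a = \<zeta> (fps_X ^ c) \<odot>\<^sub>M b" "a \<in> carrier M" "b \<in> carrier M" for a b c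
        using that
      proof (induction c)
        case 0 then show ?case by (simp add: zeta_one lm_one[OF M])
      next
        case (Suc c)
        have c: "\<zeta> (fps_X ^ c) \<odot>\<^sub>M a \<in> carrier M" "\<zeta> (fps_X ^ c) \<odot>\<^sub>M b \<in> carrier M" using Suc smult_closed by auto
        have "\<zeta> fps_X \<odot>\<^sub>M (\<zeta> (fps_X ^ c) \<odot>\<^sub>M a \<ominus>\<^bsub>M\<^esub> \<zeta> (fps_X ^ c) \<odot>\<^sub>M b) = \<zero>\<^sub>M"
          using Suc c smult_closed by (simp add: lm_diff_r[OF M] smult_smult M.diff_eq_zero_iff)
        then have "\<zeta> (fps_X ^ c) \<odot>\<^sub>M a \<ominus>\<^bsub>M\<^esub> \<zeta> (fps_X ^ c) \<odot>\<^sub>M b = \<zero>\<^sub>M"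
          using ts c unfolding torsion_sep_def by simp
        then show ?case using Suc c M.diff_eq_zero_iff by simp
      qed
      show ?thesis by (rule cancel[OF eq0 lm_closed[OF M E_closed m(1)] lm_closed[OF M E_closed m(2)]])
    qed
    have ex: "m = (\<Oplus>\<^bsub>M\<^esub> i\<in>{..<n}. E i \<odot>\<^sub>M m)" if "m \<in> carrier M" for m
      using lm_finsum_l[OF M, of "{..<n}" m E] E_sum that by (simp add: lm_one[OF M])
    have "(\<Oplus>\<^bsub>M\<^esub> i\<in>{..<n}. E i \<odot>\<^sub>M m) = (\<Oplus>\<^bsub>M\<^esub> i\<in>{..<n}. E i \<odot>\<^sub>M m')"
      using Ei m by (intro M.finsum_cong') (auto intro!: lm_closed[OF M])
    then show "m = m'" using ex m by simp
  qed (rule M)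
  moreover have "\<exists>m\<in>carrier M. \<forall>i<n. \<forall>q<r. \<epsilon> m i q = (if i = 0 then v q else 0)" for v
  proof (intro bexI[of _ "lincomb \<zeta> M {..<r} bb v"] allI impI)
    fix i q assume i: "i < n" and q: "q < r"
    let ?m = "lincomb \<zeta> M {..<r} bb v"
    have mD: "?m \<in> D" using bb D by (intro lincomb_mem) (auto simp: basis_of_def)
    then have m: "?m \<in> carrier M" "E 0 \<odot>\<^sub>M ?m = ?m" by (auto simp: D_def)
    have "ent 0 i \<otimes> E 0 = (if i = 0 then E 0 else \<zero>)"
      by (rule mat_inj) (use n_pos i in \<open>auto simp: mat_E_right mat_ent mat_E mat_zero C_0\<close>)
    then have "ent 0 i \<odot>\<^sub>M ?m = (if i = 0 then ?m else \<zero>\<^sub>M)"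
      using lm_assoc[OF M, of "ent 0 i" "E 0" ?m] m lm_zero_l[OF M m(1)] by (auto split: if_splits)
    moreover have "\<kappa> \<zero>\<^sub>M q = 0"
    proof -
      have "lincomb \<zeta> M {..<r} bb (\<lambda>q. 0 * 0) = \<zero>\<^sub>M"
        unfolding lincomb_scale[OF finite_lessThan fb] using lincomb_closed[OF fb] by (simp add: chi_zero_smult)
      then show ?thesis using \<kappa>I[OF q, of "\<lambda>q. 0 * 0"] by simp
    qed
    ultimately show "\<epsilon> ?m i q = (if i = 0 then v q else 0)" using \<kappa>I[OF q, of v] by (simp add: \<epsilon>_def)
  qed (rule lincomb_closed[OF fb])
  ultimately have "nframe M r \<epsilon>" unfolding nframe_def by simp
  then show ?thesis by blast
qed

end

section \<open>Residue functionals\<close>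

text \<open>A functional that vanishes on the common kernel of finitely many functionals is a
  combination of them. \<open>F\<close> carries no vector space structure here, only sums and
  multiples as seen by \<open>\<phi>\<close> and \<open>T\<close>, which suits sets of
  homomorphisms.\<close>

lemma functional_extension:
  fixes T :: "'f \<Rightarrow> 'j \<Rightarrow> complex" and \<phi> :: "'f \<Rightarrow> complex"
  assumes "finite J"
    and "\<And>f g. f \<in> F ==> g \<in> F ==> \<exists>h\<in>F. \<phi> h = \<phi> f + \<phi> g \<and> (\<forall>j\<in>J. T h j = T f j + T g j)"
    and "\<And>a f. f \<in> F ==> \<exists>h\<in>F. \<phi> h = a * \<phi> f \<and> (\<forall>j\<in>J. T h j = a * T f j)"
    and "\<And>f. f \<in> F ==> (\<forall>j\<in>J. T f j = 0) ==> \<phi> f = 0"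
  shows "\<exists>c. \<forall>f\<in>F. \<phi> f = (\<Sum>j\<in>J. c j * T f j)"
  using assms
proof (induction J arbitrary: F rule: finite_induct)
  case (insert a J)
  define F0 where "F0 = {f \<in> F. T f a = 0}"
  have "\<exists>c. \<forall>f\<in>F0. \<phi> f = (\<Sum>j\<in>J. c j * T f j)"
  proof (rule insert.IH)
    fix f g assume "f \<in> F0" "g \<in> F0"
    then have fg: "f \<in> F" "g \<in> F" "T f a = 0" "T g a = 0" by (auto simp: F0_def)
    obtain h where "h \<in> F" "\<phi> h = \<phi> f + \<phi> g" "\<forall>j\<in>insert a J. T h j = T f j + T g j"
      using insert.prems(1)[OF fg(1,2)] by blast
    then show "\<exists>h\<in>F0. \<phi> h = \<phi> f + \<phi> g \<and> (\<forall>j\<in>J. T h j = T f j + T g j)"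
      using fg by (intro bexI[of _ h]) (auto simp: F0_def)
  next
    fix s f assume "f \<in> F0"
    then have f: "f \<in> F" "T f a = 0" by (auto simp: F0_def)
    obtain h where "h \<in> F" "\<phi> h = s * \<phi> f" "\<forall>j\<in>insert a J. T h j = s * T f j"
      using insert.prems(2)[OF f(1)] by blast
    then show "\<exists>h\<in>F0. \<phi> h = s * \<phi> f \<and> (\<forall>j\<in>J. T h j = s * T f j)"
      using f by (intro bexI[of _ h]) (auto simp: F0_def)
  qed (use insert.prems(3) in \<open>auto simp: F0_def\<close>)
  then obtain c where c: "\<And>f. f \<in> F0 ==> \<phi> f = (\<Sum>j\<in>J. c j * T f j)" by blast
  show ?case
  proof (cases "\<forall>f\<in>F. T f a = 0")
    case True
    then have "\<phi> f = (\<Sum>j\<in>insert a J. c j * T f j)" if "f \<in> F" for f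
      using c[of f] that insert.hyps by (simp add: F0_def)
    then show ?thesis by blast
  next
    case False
    then obtain u where u: "u \<in> F" "T u a \<noteq> 0" by blast
    \<comment> \<open>The new coefficient is forced by the value at one \<open>u\<close> on which
      the functional \<open>a\<close> does not vanish; subtracting a multiple of \<open>u\<close>
      moves any \<open>f\<close> into \<open>F0\<close>.\<close>
    define c' where "c' = c(a := (\<phi> u - (\<Sum>j\<in>J. c j * T u j)) / T u a)"
    have cJ: "(\<Sum>j\<in>J. c' j * T f j) = (\<Sum>j\<in>J. c j * T f j)" for f
      using insert.hyps by (intro sum.cong) (auto simp: c'_def)
    have "\<phi> f = (\<Sum>j\<in>insert a J. c' j * T f j)" if f: "f \<in> F" for f
    proof -
      define s where "s = - (T f a / T u a)"
      obtain u' where u': "u' \<in> F" "\<phi> u' = s * \<phi> u" "\<forall>j\<in>insert a J. T u' j = s * T u j"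
        using insert.prems(2)[OF u(1)] by blast
      obtain h where h: "h \<in> F" "\<phi> h = \<phi> f + \<phi> u'" "\<forall>j\<in>insert a J. T h j = T f j + T u' j"
        using insert.prems(1)[OF f u'(1)] by blast
      have "h \<in> F0" using h u' u by (simp add: F0_def s_def)
      then have "\<phi> f + s * \<phi> u = (\<Sum>j\<in>J. c j * T h j)" using c h u' by simp
      also have "... = (\<Sum>j\<in>J. c j * T f j + s * (c j * T u j))"
        using h u' by (intro sum.cong) (auto simp: algebra_simps)
      finally have "\<phi> f = (\<Sum>j\<in>J. c j * T f j) - s * (\<phi> u - (\<Sum>j\<in>J. c j * T u j))"
        by (simp add: sum.distrib sum_distrib_left algebra_simps)
      then show ?thesis using insert.hyps u by (simp add: cJ) (simp add: c'_def s_def)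
    qed
    then show ?thesis by blast
  qed
qed auto

text \<open>A functional depending only on \<open>T\<close> modulo \<open>t^c\<close> is a
  combination of the coefficients below \<open>c\<close>, and such a combination is one coefficient
  of a product of series.\<close>

lemma residue_functional:
  fixes T :: "'f \<Rightarrow> 'i \<Rightarrow> complex fps" and \<phi> :: "'f \<Rightarrow> complex"
  assumes I: "finite I" and c: "1 \<le> c"
    and add: "\<And>f g. f \<in> F ==> g \<in> F ==> \<exists>h\<in>F. \<phi> h = \<phi> f + \<phi> g \<and> (\<forall>i\<in>I. T h i = T f i + T g i)"
    and scale: "\<And>a f. f \<in> F ==> \<exists>h\<in>F. \<phi> h = a * \<phi> f \<and> (\<forall>i\<in>I. T h i = fps_const a * T f i)"
    and wd: "\<And>f. f \<in> F ==> (\<forall>i\<in>I. fps_X ^ c dvd T f i) ==> \<phi> f = 0"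
  shows "\<exists>h. \<forall>f\<in>F. \<phi> f = fps_nth (\<Sum>i\<in>I. h i * T f i) (c - 1)"
proof -
  define T' where "T' f = (\<lambda>(i, m). fps_nth (T f i) m)" for f
  have "\<exists>d. \<forall>f\<in>F. \<phi> f = (\<Sum>j\<in>I \<times> {..<c}. d j * T' f j)"
  proof (rule functional_extension)
    fix f g assume "f \<in> F" "g \<in> F"
    from add[OF this] show "\<exists>h\<in>F. \<phi> h = \<phi> f + \<phi> g \<and> (\<forall>j\<in>I \<times> {..<c}. T' h j = T' f j + T' g j)"
      by (auto simp: T'_def)
  next
    fix a f assume "f \<in> F"
    then obtain h where "h \<in> F" "\<phi> h = a * \<phi> f" "\<forall>i\<in>I. T h i = fps_const a * T f i" using scale by blast
    then show "\<exists>h\<in>F. \<phi> h = a * \<phi> f \<and> (\<forall>j\<in>I \<times> {..<c}. T' h j = a * T' f j)"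
      by (intro bexI[of _ h]) (auto simp: T'_def)
  next
    fix f assume "f \<in> F" "\<forall>j\<in>I \<times> {..<c}. T' f j = 0"
    then show "\<phi> f = 0" by (intro wd) (auto simp: T'_def fps_X_power_dvd_iff)
  qed (use I in auto)
  then obtain d where d: "\<And>f. f \<in> F ==> \<phi> f = (\<Sum>j\<in>I \<times> {..<c}. d j * T' f j)" by blast
  \<comment> \<open>The coefficients are reversed so that the Cauchy product at index
    \<open>c - 1\<close> pairs \<open>d (i, m)\<close> with the coefficient
    \<open>m\<close>.\<close>
  define h where "h i = Abs_fps (\<lambda>l. d (i, c - 1 - l))" for i
  have "\<phi> f = fps_nth (\<Sum>i\<in>I. h i * T f i) (c - 1)" if "f \<in> F" for f
  proof -
    have "fps_nth (h i * T f i) (c - 1) = (\<Sum>m<c. d (i, m) * fps_nth (T f i) m)" for i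
    proof -
      have "fps_nth (h i * T f i) (c - 1) = (\<Sum>l=0..c - 1. d (i, c - 1 - l) * fps_nth (T f i) (c - 1 - l))"
        by (simp add: fps_mult_nth h_def)
      also have "... = (\<Sum>m<c. d (i, m) * fps_nth (T f i) m)"
        using c by (intro sum.reindex_bij_witness[where i = "\<lambda>m. c - 1 - m" and j = "\<lambda>l. c - 1 - l"]) auto
      finally show ?thesis .
    qed
    then show ?thesis using d[OF that] by (simp add: fps_sum_nth T'_def sum.cartesian_product case_prod_unfold)
  qed
  then show ?thesis by blast
qed

text \<open>Multiplication by \<open>t^e\<close> brings every lower coefficient to the position
  \<open>c - 1\<close>.\<close>

lemma fps_X_power_dvdI:
  fixes f :: "complex fps"
  assumes "1 \<le> c" "\<And>e. fps_nth (fps_X ^ e * f) (c - 1) = 0"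
  shows "fps_X ^ c dvd f"
  unfolding fps_X_power_dvd_iff
proof (intro allI impI)
  fix m assume "m < c"
  then have "c - 1 - (c - 1 - m) = m" "\<not> c - 1 < c - 1 - m" by auto
  then show "fps_nth f m = 0" using assms(2)[of "c - 1 - m"] by (simp only: fps_X_power_mult_nth if_False)
qed

lemma fps_X_power_dvd_cancel:
  "fps_X ^ (a + b) dvd fps_X ^ a * (f :: complex fps) \<longleftrightarrow> fps_X ^ b dvd f"
  by (simp add: power_add dvd_times_left_cancel_iff)

context tiled
begin

section \<open>The Nakayama permutation\<close>

definition nu :: "nat \<Rightarrow> nat" where "nu i = wend n (replicate k True) i"
definition gam :: "nat \<Rightarrow> nat" where "gam i = wcost n k (replicate k True) i"

lemma nu_less: "i < n ==> nu i < n"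
  by (simp add: nu_def wend_less)

lemma nu_surj: "i < n ==> \<exists>j<n. nu j = i"
  unfolding nu_def by (rule wend_surj)

lemma nu_bij: "bij_betw nu {..<n} {..<n}"
proof -
  have "inj_on nu {..<n}" by (auto simp: inj_on_def nu_def intro: wend_inj)
  moreover have "nu ` {..<n} = {..<n}" using nu_surj nu_less by (force simp: image_iff)
  ultimately show ?thesis by (simp add: bij_betw_def)
qed

text \<open>The walk \<open>x\<^sup>k = y\<^sup>n\<^sup>-\<^sup>k\<close> is a cheapest one and passes, in one of its two forms, through every vertex.\<close>

lemma gam_minimal:
  assumes j: "j < n"
  shows "gam j \<le> C (nu j) j"
proof -
  obtain w where w: "wend n w j = nu j" "wcost n k w j = C (nu j) j" using C_word[OF nu_less[OF j] j] by blast
  define a b where ab: "a = int (count_list w True)" "b = int (count_list w False)"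
  have "(int j + a - b) mod int n = (int j + int k) mod int n"
    using w(1) wend_count[OF j, of w] wend_count[OF j, of "replicate k True"]
    by (simp add: nu_def ab count_list_replicate)
  then have "int n dvd (int j + a - b) - (int j + int k)" by (simp add: mod_eq_dvd_iff)
  \<comment> \<open>\<open>q\<close> is the number of extra turns around the cycle compared with
    \<open>x^k\<close>. Further turns need more letters \<open>x\<close>, backward turns more
    letters \<open>y\<close>, and neither lowers the weight.\<close>
  then obtain q where q: "a - b = int k + int n * q" by (auto simp: dvd_def algebra_simps)
  have nonneg: "0 \<le> a" "0 \<le> b" by (simp_all add: ab)
  have nk': "int (n - k) = int n - int k" using nk by simp
  have eq: "(int n - int k) * a + int k * b = int n * a - int k * int k - int k * int n * q"
  proof -
    have "(int n - int k) * a + int k * b = int n * a - int k * (a - b)" by (simp add: algebra_simps)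
    then show ?thesis unfolding q by (simp add: algebra_simps)
  qed
  have wt: "(int n - int k) * int k \<le> (int n - int k) * a + int k * b"
  proof (cases "q \<ge> 0")
    case True
    have "int k + int n * q \<le> a" using q nonneg by linarith
    then have "int n * (int k + int n * q) \<le> int n * a" by (intro mult_left_mono) auto
    moreover have "int k * int n * q \<le> int n * int n * q" using True nk by (intro mult_right_mono) auto
    ultimately show ?thesis unfolding eq by (simp add: algebra_simps)
  next
    case False
    then have "q \<le> - 1" by linarith
    then have "int k * int n * q \<le> int k * int n * (- 1)" by (intro mult_left_mono) auto
    moreover have "0 \<le> int n * a" using nonneg by simp
    ultimately show ?thesis unfolding eq by (simp add: algebra_simps)
  qed
  have "int n * int (wcost n k w j) + int (pot n k j) = (int n - int k) * a + int k * b + int (pot n k (nu j))"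
    using arg_cong[OF wcost_pot[OF j k1 nk, of w], of int] w(1) nk' by (simp add: ab)
  moreover have "int n * int (gam j) + int (pot n k j) = (int n - int k) * int k + int (pot n k (nu j))"
    using arg_cong[OF wcost_pot[OF j k1 nk, of "replicate k True"], of int] nk'
    by (simp add: gam_def nu_def count_list_replicate)
  ultimately have "int n * int (gam j) \<le> int n * int (wcost n k w j)" using wt by linarith
  then show ?thesis using n_pos w(2) by simp
qed

text \<open>If \<open>i\<close> is at most \<open>k\<close> steps of \<open>x\<close> ahead of
  \<open>j\<close>, then \<open>x^k\<close> passes through it, otherwise \<open>y^(n - k)\<close>
  does; minimality and the triangle inequality give the converse bound. This Gorenstein property of
  the exponent matrix is the source of Serre duality.\<close>

lemma gam_split:
  assumes i: "i < n" and j: "j < n"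
  shows "C (nu j) i + C i j = gam j"
proof -
  have le: "C (nu j) i + C i j \<le> gam j"
  proof -
    define c where "c = (i + n - j) mod n"
    have cn: "c < n" using n_pos by (simp add: c_def)
    have cc: "(int j + int c) mod int n = int i"
    proof -
      have "int c = (int i + int n - int j) mod int n" using j by (simp add: c_def zmod_int of_nat_diff)
      then have "(int j + int c) mod int n = (int i + int n) mod int n" by (simp add: mod_simps)
      then show ?thesis using i by simp
    qed
    obtain v w where vw: "wend n v j = i" "wend n (v @ w) j = nu j" "wcost n k (v @ w) j = gam j"
    proof (cases "c \<le> k")
      case True
      have "int (wend n (replicate c True) j) = int i"
        using cc by (subst wend_count[OF j]) (simp add: count_list_replicate)
      moreover have "replicate c True @ replicate (k - c) True = replicate k True"
        using True by (simp add: replicate_add[symmetric])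
      ultimately show ?thesis by (intro that[of "replicate c True" "replicate (k - c) True"]) (simp_all add: nu_def gam_def del: wend_append wcost_append)
    next
      case False
      have "int (wend n (replicate (n - c) False) j) = (int j - int (n - c)) mod int n"
        by (subst wend_count[OF j]) (simp add: count_list_replicate)
      also have "int j - int (n - c) = int j + int c - int n" using cn by (simp add: of_nat_diff)
      also have "... mod int n = int i" using cc by simp
      finally have "wend n (replicate (n - c) False) j = i" by simp
      moreover have "replicate (n - c) False @ replicate (c - k) False = replicate (n - k) False"
        using False cn by (simp add: replicate_add[symmetric])
      moreover have "wend n (replicate k True) j = wend n (replicate (n - k) False) j \<and>
          wcost n k (replicate k True) j = wcost n k (replicate (n - k) False) j"
        by (subst wend_wcost_eq_iff[OF j k1 nk]) (auto simp: count_list_replicate intro!: exI[of _ 1])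
      ultimately show ?thesis
        by (intro that[of "replicate (n - c) False" "replicate (c - k) False"]) (simp_all add: nu_def gam_def del: wend_append wcost_append)
    qed
    show ?thesis using C_le[OF j vw(1)] C_le[OF i, of w "nu j"] vw by simp
  qed
  then show ?thesis using gam_minimal[OF j] C_triangle[OF nu_less[OF j] i j] by linarith
qed

lemma gam_C: "j < n ==> C (nu j) j = gam j"
  using gam_split[of j j] C_refl by simp

lemma gam_C0: "j < n ==> C (nu j) 0 = gam j"
  using gam_split[of 0 j] C_0 n_pos by simp

lemma gam_le: "j < n ==> gam j \<le> gam 0"
  using gam_split[of "nu j" 0] gam_C0[of j] nu_less n_pos by simp

text \<open>Moving along \<open>x^k\<close> multiplies the component at \<open>i\<close> by
  \<open>t^(gam i)\<close>; \<open>del\<close> complements this to the constant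
  \<open>gam 0\<close>, the largest value, so that no negative exponents arise.\<close>

definition del :: "nat \<Rightarrow> nat" where "del i = gam 0 - gam i"

lemma del_gam: "i < n ==> del i + gam i = gam 0"
  using gam_le by (simp add: del_def)

lemma C0_le_gam: "i < n ==> C i 0 \<le> gam 0"
  using gam_split[of i 0] n_pos by simp

text \<open>The walk ends at \<open>k\<close>, which lies on the rising branch of
  \<open>pot\<close>, so \<open>n * gam 0 = (n - k) * k + k * k\<close>. Positivity makes
  \<open>gam 0 - 1\<close> a meaningful residue index.\<close>

lemma gam_0_pos: "1 \<le> gam 0"
proof -
  have "int (nu 0) = int k mod int n" unfolding nu_def
    by (subst wend_count[OF n_pos]) (simp add: count_list_replicate)
  then have "nu 0 = k" using k_less by simp
  moreover have "k \<le> n - k" using nk by simp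
  ultimately have "n * gam 0 = (n - k) * k + k * k"
    using wcost_pot[OF n_pos k1 nk, of "replicate k True"]
    by (simp add: gam_def nu_def count_list_replicate pot_def)
  then have "0 < n * gam 0" using k_pos by simp
  then show ?thesis by (cases "gam 0") auto
qed

section \<open>Homomorphisms as matrices\<close>

definition bas :: "('r, 'm) module \<Rightarrow> nat \<Rightarrow> ('m \<Rightarrow> nat \<Rightarrow> nat \<Rightarrow> complex fps) \<Rightarrow> nat \<Rightarrow> 'm" where
  "bas M r \<epsilon> q = (SOME m. m \<in> carrier M \<and> (\<forall>i<n. \<forall>q'<r. \<epsilon> m i q' = (if i = 0 \<and> q' = q then 1 else 0)))"

lemma
  assumes "nframe M r \<epsilon>"
  shows bas_closed: "bas M r \<epsilon> q \<in> carrier M"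
    and bas_frame: "i < n ==> q' < r ==> \<epsilon> (bas M r \<epsilon> q) i q' = (if i = 0 \<and> q' = q then 1 else 0)"
proof -
  have "\<exists>m\<in>carrier M. \<forall>i<n. \<forall>q'<r. \<epsilon> m i q' = (if i = 0 then (\<lambda>q'. if q' = q then 1 else 0) q' else 0)"
    using assms unfolding nframe_def by (elim conjE) (erule spec)
  then obtain m where "m \<in> carrier M" "\<forall>i<n. \<forall>q'<r. \<epsilon> m i q' = (if i = 0 then (\<lambda>q'. if q' = q then 1 else 0) q' else 0)"
    by blast
  then have "\<exists>m. m \<in> carrier M \<and> (\<forall>i<n. \<forall>q'<r. \<epsilon> m i q' = (if i = 0 \<and> q' = q then 1 else 0))"
    by (intro exI[of _ m]) auto
  from someI_ex[OF this] show "bas M r \<epsilon> q \<in> carrier M"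
    "i < n ==> q' < r ==> \<epsilon> (bas M r \<epsilon> q) i q' = (if i = 0 \<and> q' = q then 1 else 0)"
    unfolding bas_def by blast+
qed

text \<open>\<open>ent 0 i\<close> carries the component at \<open>i\<close> unchanged to vertex 0,
  where it expands in the basis \<open>bas\<close>. Hence one matrix describes \<open>f\<close> at
  all vertices.\<close>

lemma hom_matrix:
  assumes M: "nframe M r \<epsilon>" and N: "frame N r' \<epsilon>'" and f: "f \<in> Hom R M N"
    and m: "m \<in> carrier M" and i: "i < n" and p: "p < r'"
  shows "\<epsilon>' (f m) i p = (\<Sum>q<r. \<epsilon>' (f (bas M r \<epsilon> q)) 0 p * \<epsilon> m i q)"
proof -
  note FM = nframe_frame[OF M]
  note LM = frame_module[OF FM] and LN = frame_module[OF N]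
  interpret M: abelian_group M by (rule lm_grp[OF LM])
  let ?s = "\<Oplus>\<^bsub>M\<^esub> q\<in>{..<r}. \<zeta> (\<epsilon> m i q) \<odot>\<^sub>M bas M r \<epsilon> q"
  have b: "\<zeta> (\<epsilon> m i q) \<odot>\<^sub>M bas M r \<epsilon> q \<in> carrier M" for q
    using bas_closed[OF M] by (intro lm_closed[OF LM]) auto
  have e: "ent 0 i \<odot>\<^sub>M m \<in> carrier M" using m by (intro lm_closed[OF LM]) auto
  have "ent 0 i \<odot>\<^sub>M m = ?s"
  proof (rule frame_inj[OF FM e])
    fix a q assume a: "a < n" and q: "q < r"
    have "\<epsilon> ?s a q = (\<Sum>q'<r. \<epsilon> (\<zeta> (\<epsilon> m i q') \<odot>\<^sub>M bas M r \<epsilon> q') a q)"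
      using b a q by (intro frame_finsum[OF FM]) auto
    also have "... = (\<Sum>q'<r. \<epsilon> m i q' * (if a = 0 \<and> q = q' then 1 else 0))"
      using a q by (intro sum.cong refl) (simp add: frame_zeta[OF FM bas_closed[OF M]] bas_frame[OF M])
    also have "... = \<epsilon> m i q * (if a = 0 \<and> q = q then 1 else 0)"
      using q by (intro sum_eq_single) auto
    finally show "\<epsilon> (ent 0 i \<odot>\<^sub>M m) a q = \<epsilon> ?s a q"
      using a q i m n_pos by (simp add: frame_ent[OF FM] C_0)
  qed (use b in \<open>auto intro!: M.finsum_closed\<close>)
  then have "f (ent 0 i \<odot>\<^sub>M m) = (\<Oplus>\<^bsub>N\<^esub> q\<in>{..<r}. f (\<zeta> (\<epsilon> m i q) \<odot>\<^sub>M bas M r \<epsilon> q))"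
    using Hom_finsum[OF LM LN f, of "{..<r}"] b by simp
  then have "\<epsilon>' (f (ent 0 i \<odot>\<^sub>M m)) 0 p = (\<Sum>q<r. \<epsilon>' (f (\<zeta> (\<epsilon> m i q) \<odot>\<^sub>M bas M r \<epsilon> q)) 0 p)"
    using frame_finsum[OF N, of "{..<r}" "\<lambda>q. f (\<zeta> (\<epsilon> m i q) \<odot>\<^sub>M bas M r \<epsilon> q)" 0 p] b Hom_closed[OF f] n_pos p by simp
  also have "... = (\<Sum>q<r. \<epsilon>' (f (bas M r \<epsilon> q)) 0 p * \<epsilon> m i q)"
    using bas_closed[OF M] Hom_closed[OF f] n_pos p
    by (intro sum.cong refl) (simp add: Hom_smult[OF f] frame_zeta[OF N])
  also have "\<epsilon>' (f (ent 0 i \<odot>\<^sub>M m)) 0 p = \<epsilon>' (f m) i p"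
    using m i p Hom_closed[OF f m] n_pos by (simp add: Hom_smult[OF f] frame_ent[OF N] C_0)
  finally show ?thesis .
qed

lemma Hom_of_matrix:
  assumes M: "frame M r \<epsilon>" and N: "frame N r' \<epsilon>'"
    and ex: "\<And>m i. m \<in> carrier M ==> i < n ==> \<exists>m'\<in>carrier N. \<forall>p<r'. \<epsilon>' m' i p = (\<Sum>q<r. \<Phi> p q * \<epsilon> m i q)"
  shows "\<exists>f\<in>Hom R M N. \<forall>m\<in>carrier M. \<forall>i<n. \<forall>p<r'. \<epsilon>' (f m) i p = (\<Sum>q<r. \<Phi> p q * \<epsilon> m i q)"
proof -
  note LM = frame_module[OF M] and LN = frame_module[OF N]
  interpret M: abelian_group M by (rule lm_grp[OF LM])
  interpret N: abelian_group N by (rule lm_grp[OF LN])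
  have ex': "\<exists>m'. m' \<in> carrier N \<and> (\<forall>i<n. \<forall>p<r'. \<epsilon>' m' i p = (\<Sum>q<r. \<Phi> p q * \<epsilon> m i q))" if m: "m \<in> carrier M" for m
  proof -
    \<comment> \<open>The witnesses for different vertices may differ; the idempotents select one
      component from each, and the sum has all of them.\<close>
    obtain g where g: "\<And>i. i < n ==> g i \<in> carrier N" "\<And>i p. i < n ==> p < r' ==> \<epsilon>' (g i) i p = (\<Sum>q<r. \<Phi> p q * \<epsilon> m i q)"
      using ex[OF m] by metis
    have Eg: "E i \<odot>\<^sub>N g i \<in> carrier N" if "i < n" for i using g(1)[OF that] by (intro lm_closed[OF LN]) auto
    have Ee: "E l = ent l l" if "l < n" for l
      by (rule mat_inj) (use that in \<open>auto simp: mat_E mat_ent C_refl\<close>)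
    have "\<epsilon>' (\<Oplus>\<^bsub>N\<^esub> i\<in>{..<n}. E i \<odot>\<^sub>N g i) i p = (\<Sum>q<r. \<Phi> p q * \<epsilon> m i q)" if i: "i < n" and p: "p < r'" for i p
    proof -
      have "\<epsilon>' (\<Oplus>\<^bsub>N\<^esub> i\<in>{..<n}. E i \<odot>\<^sub>N g i) i p = (\<Sum>l<n. \<epsilon>' (E l \<odot>\<^sub>N g l) i p)"
        using Eg i p by (intro frame_finsum[OF N]) auto
      also have "... = \<epsilon>' (E i \<odot>\<^sub>N g i) i p"
        using i p g(1) by (intro sum_eq_single) (auto simp: Ee frame_ent[OF N])
      also have "... = \<epsilon>' (g i) i p" using i p g(1) by (simp add: Ee frame_ent[OF N] C_refl)
      finally show ?thesis using g(2)[OF i p] by simp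
    qed
    moreover have "(\<Oplus>\<^bsub>N\<^esub> i\<in>{..<n}. E i \<odot>\<^sub>N g i) \<in> carrier N" using Eg by (intro N.finsum_closed) auto
    ultimately show ?thesis by blast
  qed
  define f where "f = (\<lambda>m\<in>carrier M. SOME m'. m' \<in> carrier N \<and> (\<forall>i<n. \<forall>p<r'. \<epsilon>' m' i p = (\<Sum>q<r. \<Phi> p q * \<epsilon> m i q)))"
  have f: "f m \<in> carrier N" "\<And>i p. i < n ==> p < r' ==> \<epsilon>' (f m) i p = (\<Sum>q<r. \<Phi> p q * \<epsilon> m i q)"
    if m: "m \<in> carrier M" for m
    using someI_ex[OF ex'[OF m]] m by (auto simp: f_def)
  have "f \<in> Hom R M N"
  proof (rule HomI)
    fix m m' assume m: "m \<in> carrier M" "m' \<in> carrier M"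
    show "f (m \<oplus>\<^sub>M m') = f m \<oplus>\<^sub>N f m'"
    proof (rule frame_inj[OF N])
      fix i p assume "i < n" "p < r'"
      then show "\<epsilon>' (f (m \<oplus>\<^sub>M m')) i p = \<epsilon>' (f m \<oplus>\<^sub>N f m') i p"
        using m f by (simp add: frame_add[OF N] frame_add[OF M] sum.distrib algebra_simps)
    qed (use m f in auto)
  next
    fix a m assume a: "a \<in> carrier R" and m: "m \<in> carrier M"
    have am: "a \<odot>\<^sub>M m \<in> carrier M" "a \<odot>\<^sub>N f m \<in> carrier N"
      using a m f lm_closed[OF LM] lm_closed[OF LN] by auto
    show "f (a \<odot>\<^sub>M m) = a \<odot>\<^sub>N f m"
    proof (rule frame_inj[OF N])
      fix i p assume ip: "i < n" "p < r'"
      have "\<epsilon>' (f (a \<odot>\<^sub>M m)) i p = (\<Sum>q<r. \<Phi> p q * (\<Sum>j<n. mat a i j * \<epsilon> m j q))"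
        using f(2)[OF am(1) ip] a m ip by (simp add: frame_smult[OF M])
      also have "... = (\<Sum>j<n. mat a i j * (\<Sum>q<r. \<Phi> p q * \<epsilon> m j q))"
        unfolding sum_distrib_left by (subst sum.swap) (simp add: mult.left_commute)
      also have "... = \<epsilon>' (a \<odot>\<^sub>N f m) i p"
        using f m a ip by (simp add: frame_smult[OF N])
      finally show "\<epsilon>' (f (a \<odot>\<^sub>M m)) i p = \<epsilon>' (a \<odot>\<^sub>N f m) i p" .
    qed (use am f in auto)
  qed (use f in \<open>auto simp: f_def\<close>)
  then show ?thesis using f by blast
qed

lemma frame_regm: "frame (regm R) n mat"
  unfolding frame_def
  using regm_module[OF R_ring] mat_inj by (auto simp: regm_simps mat_add mat_mult)

text \<open>On the twisted module \<open>E i\<close> acts as \<open>E (nu i)\<close>, so the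
  component at \<open>i\<close> is the old one at \<open>nu i\<close>. The factor
  \<open>t^(del i)\<close> restores the untwisted matrix entries.\<close>

lemma frame_tw:
  assumes M: "frame M r \<epsilon>"
  shows "frame (tw k M) r (\<lambda>m i q. fps_X ^ del i * \<epsilon> m (nu i) q)"
  unfolding frame_def
proof (intro conjI ballI allI impI)
  show "left_module R (tw k M)" by (rule tw_module[OF frame_module[OF M]])
next
  fix m m' i q assume "m \<in> carrier (tw k M)" "m' \<in> carrier (tw k M)" "i < n" "q < r"
  then show "fps_X ^ del i * \<epsilon> (m \<oplus>\<^bsub>tw k M\<^esub> m') (nu i) q = fps_X ^ del i * \<epsilon> m (nu i) q + fps_X ^ del i * \<epsilon> m' (nu i) q"
    by (simp add: frame_add[OF M] nu_less algebra_simps)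
next
  fix a m i q assume a: "a \<in> carrier R" and m: "m \<in> carrier (tw k M)" and i: "i < n" and q: "q < r"
  let ?s = "(sig ^^ k) a"
  have s: "?s \<in> carrier R" by (rule sig_pow_closed[OF a])
  \<comment> \<open>The entry at \<open>(nu i, j)\<close> of \<open>sig^k(a) x^k = x^k a\<close>,
    multiplied by \<open>t^(del i)\<close>; then \<open>t^(gam j)\<close> is cancelled.\<close>
  have key: "fps_X ^ del i * mat ?s (nu i) (nu j) = mat a i j * fps_X ^ del j" if j: "j < n" for j
  proof -
    have "mat ?s (nu i) (nu j) * fps_X ^ gam j = fps_X ^ gam i * mat a i j"
      using mat_wel_right[OF s nu_less[OF i] j, of "replicate k True"] mat_wel_left[OF a i j, of "replicate k True"]
        sig_pow_x[OF a, of k] by (simp add: x_pow nu_def gam_def)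
    then have "fps_X ^ del i * mat ?s (nu i) (nu j) * fps_X ^ gam j = fps_X ^ (del i + gam i) * mat a i j"
      by (simp add: power_add mult.assoc)
    also have "... = mat a i j * fps_X ^ del j * fps_X ^ gam j"
      using del_gam[OF i] del_gam[OF j] by (simp add: power_add[symmetric] mult.assoc mult.commute)
    finally show ?thesis by simp
  qed
  have "fps_X ^ del i * \<epsilon> (?s \<odot>\<^sub>M m) (nu i) q = (\<Sum>l<n. fps_X ^ del i * (mat ?s (nu i) l * \<epsilon> m l q))"
    using m i q s by (simp add: frame_smult[OF M] nu_less sum_distrib_left)
  also have "... = (\<Sum>j<n. fps_X ^ del i * (mat ?s (nu i) (nu j) * \<epsilon> m (nu j) q))"
    by (rule sum.reindex_bij_betw[OF nu_bij, symmetric])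
  also have "... = (\<Sum>j<n. mat a i j * (fps_X ^ del j * \<epsilon> m (nu j) q))"
  proof (intro sum.cong refl)
    fix j assume "j \<in> {..<n}"
    then show "fps_X ^ del i * (mat ?s (nu i) (nu j) * \<epsilon> m (nu j) q) = mat a i j * (fps_X ^ del j * \<epsilon> m (nu j) q)"
      using key[of j] by (simp add: mult.assoc[symmetric])
  qed
  finally show "fps_X ^ del i * \<epsilon> (a \<odot>\<^bsub>tw k M\<^esub> m) (nu i) q = (\<Sum>j<n. mat a i j * (fps_X ^ del j * \<epsilon> m (nu j) q))"
    by simp
next
  fix m m' assume m: "m \<in> carrier (tw k M)" "m' \<in> carrier (tw k M)"
    and eq: "\<forall>i<n. \<forall>q<r. fps_X ^ del i * \<epsilon> m (nu i) q = fps_X ^ del i * \<epsilon> m' (nu i) q"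
  show "m = m'"
  proof (rule frame_inj[OF M])
    fix i q assume "i < n" "q < r"
    moreover obtain j where "j < n" "nu j = i" using nu_surj[OF \<open>i < n\<close>] by blast
    ultimately show "\<epsilon> m i q = \<epsilon> m' i q" using eq by fastforce
  qed (use m in auto)
qed

section \<open>Serre duality\<close>

text \<open>A lattice containing \<open>t^c\<close> times the full lattice equals its double dual
  modulo \<open>t^c\<close>. For a vector \<open>v\<close> outside it, a residue functional yields a
  form \<open>l'\<close> that is divisible by \<open>t^c\<close> on the lattice but not at
  \<open>v\<close>.\<close>

lemma lattice_double_dual:
  assumes M: "nframe M r \<epsilon>" and l: "l < n" and c: "C l 0 \<le> c"
    and dd: "\<And>l'. (\<And>m. m \<in> carrier M ==> fps_X ^ c dvd (\<Sum>q<r. l' q * \<epsilon> m l q)) ==> fps_X ^ c dvd (\<Sum>q<r. l' q * v q)"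
  shows "\<exists>m\<in>carrier M. \<forall>q<r. \<epsilon> m l q = v q"
proof (rule ccontr)
  assume no: "\<not> (\<exists>m\<in>carrier M. \<forall>q<r. \<epsilon> m l q = v q)"
  note F = nframe_frame[OF M]
  note LM = frame_module[OF F]
  interpret M: abelian_group M by (rule lm_grp[OF LM])
  have full: "\<exists>m\<in>carrier M. \<forall>q<r. \<epsilon> m l q = fps_X ^ c * w q" for w
  proof -
    obtain m0 where m0: "m0 \<in> carrier M" "\<forall>i<n. \<forall>q<r. \<epsilon> m0 i q = (if i = 0 then fps_X ^ (c - C l 0) * w q else 0)"
      using M unfolding nframe_def by (elim conjE allE[of _ "\<lambda>q. fps_X ^ (c - C l 0) * w q"]) blast
    have "\<epsilon> (ent l 0 \<odot>\<^sub>M m0) l q = fps_X ^ c * w q" if "q < r" for q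
      using that m0 l n_pos c by (simp add: frame_ent[OF F] mult.assoc[symmetric] power_add[symmetric])
    then show ?thesis using m0(1) by (intro bexI[of _ "ent l 0 \<odot>\<^sub>M m0"]) (auto intro!: lm_closed[OF LM])
  qed
  have c1: "1 \<le> c"
  proof (rule ccontr)
    assume "\<not> 1 \<le> c"
    then have "c = 0" by simp
    then show False using full[of v] no by (simp only: power_0 mult_1)
  qed
  \<comment> \<open>The pair \<open>(m, a)\<close> stands for \<open>m + a v\<close>. As
    \<open>v\<close> is outside the lattice, the number \<open>a\<close> is determined by this
    vector modulo \<open>t^c\<close>.\<close>
  define T where "T = (\<lambda>(m, a) q. \<epsilon> m l q + fps_const a * v q)"
  have zc: "\<zeta> p \<odot>\<^sub>M m \<in> carrier M" if "m \<in> carrier M" for p m using that by (intro lm_closed[OF LM]) auto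
  have "\<exists>h. \<forall>f\<in>carrier M \<times> (UNIV :: complex set). snd f = fps_nth (\<Sum>q<r. h q * T f q) (c - 1)"
  proof (rule residue_functional[OF _ c1])
    fix f g assume "f \<in> carrier M \<times> (UNIV :: complex set)" "g \<in> carrier M \<times> (UNIV :: complex set)"
    then show "\<exists>h\<in>carrier M \<times> UNIV. snd h = snd f + snd g \<and> (\<forall>i\<in>{..<r}. T h i = T f i + T g i)"
      using l by (intro bexI[of _ "(fst f \<oplus>\<^sub>M fst g, snd f + snd g)"])
        (auto simp: T_def frame_add[OF F] algebra_simps simp flip: fps_const_add)
  next
    fix a f assume "f \<in> carrier M \<times> (UNIV :: complex set)"
    then show "\<exists>h\<in>carrier M \<times> UNIV. snd h = a * snd f \<and> (\<forall>i\<in>{..<r}. T h i = fps_const a * T f i)"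
      using l zc by (intro bexI[of _ "(\<zeta> (fps_const a) \<odot>\<^sub>M fst f, a * snd f)"])
        (auto simp: T_def frame_zeta[OF F] algebra_simps simp flip: fps_const_mult)
  next
    fix f assume f: "f \<in> carrier M \<times> (UNIV :: complex set)" and dv: "\<forall>i\<in>{..<r}. fps_X ^ c dvd T f i"
    obtain m a where ma: "f = (m, a)" "m \<in> carrier M" using f by auto
    show "snd f = 0"
    proof (rule ccontr)
      assume "snd f \<noteq> 0"
      then have a: "a \<noteq> 0" using ma by simp
      have "\<forall>q. \<exists>w. q < r \<longrightarrow> T f q = fps_X ^ c * w" using dv by (auto simp: dvd_def)
      then obtain w where w: "\<And>q. q < r ==> T f q = fps_X ^ c * w q" by metis
      obtain m' where m': "m' \<in> carrier M" "\<forall>q<r. \<epsilon> m' l q = fps_X ^ c * w q" using full by blast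
      let ?m = "\<zeta> (fps_const (1 / a)) \<odot>\<^sub>M (m' \<oplus>\<^sub>M \<zeta> (- 1) \<odot>\<^sub>M m)"
      have "\<epsilon> ?m l q = v q" if q: "q < r" for q
      proof -
        have "\<epsilon> ?m l q = fps_const (1 / a) * (\<epsilon> m' l q - \<epsilon> m l q)"
          using q l m' ma zc by (simp add: frame_zeta[OF F] frame_add[OF F])
        also have "\<epsilon> m' l q - \<epsilon> m l q = fps_const a * v q" using m' w[OF q] q by (simp add: T_def ma diff_eq_eq add.commute)
        also have "fps_const (1 / a) * (fps_const a * v q) = v q"
          using a by (simp add: mult.assoc[symmetric])
        finally show ?thesis .
      qed
      moreover have "?m \<in> carrier M" using m' ma zc by simp
      ultimately show False using no by blast
    qed
  qed simp
  then obtain h where h: "\<And>m a. m \<in> carrier M ==> a = fps_nth (\<Sum>q<r. h q * T (m, a) q) (c - 1)" by fastforce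
  have "fps_X ^ c dvd (\<Sum>q<r. h q * \<epsilon> m l q)" if m: "m \<in> carrier M" for m
  proof (rule fps_X_power_dvdI[OF c1])
    fix e
    have "0 = fps_nth (\<Sum>q<r. h q * T (\<zeta> (fps_X ^ e) \<odot>\<^sub>M m, 0) q) (c - 1)" by (rule h[OF zc[OF m]])
    also have "(\<Sum>q<r. h q * T (\<zeta> (fps_X ^ e) \<odot>\<^sub>M m, 0) q) = fps_X ^ e * (\<Sum>q<r. h q * \<epsilon> m l q)"
      unfolding sum_distrib_left using m l by (intro sum.cong refl) (simp add: T_def frame_zeta[OF F] mult.left_commute)
    finally show "fps_nth (fps_X ^ e * (\<Sum>q<r. h q * \<epsilon> m l q)) (c - 1) = 0" ..
  qed
  then have "fps_X ^ c dvd (\<Sum>q<r. h q * v q)" by (rule dd)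
  then have "fps_nth (\<Sum>q<r. h q * v q) (c - 1) = 0" using c1 by (simp add: fps_X_power_dvd_iff)
  moreover have "(\<Sum>q<r. h q * T (\<zero>\<^sub>M, 1) q) = (\<Sum>q<r. h q * v q)"
    using l by (intro sum.cong refl) (simp add: T_def frame_zero[OF F])
  ultimately show False using h[of "\<zero>\<^sub>M" 1] by simp
qed

text \<open>The form \<open>l\<close> becomes a map into the projective module \<open>R E_j\<close>,
  viewed as column \<open>j\<close>; the divisibility says that this column belongs to the
  order.\<close>

lemma elementary_hom:
  assumes M: "frame M r \<epsilon>" and j: "j < n"
    and dv: "\<And>m i. m \<in> carrier M ==> i < n ==> fps_X ^ C i j dvd (\<Sum>q<r. l q * \<epsilon> m i q)"
  shows "\<exists>a\<in>Hom R M (regm R). \<forall>m\<in>carrier M. \<forall>i<n. \<forall>b<n. mat (a m) i b = (if b = j then \<Sum>q<r. l q * \<epsilon> m i q else 0)"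
proof -
  have "\<exists>m'\<in>carrier (regm R). \<forall>p<n. mat m' i p = (\<Sum>q<r. (if p = j then l q else 0) * \<epsilon> m i q)"
    if m: "m \<in> carrier M" and i: "i < n" for m i
  proof -
    let ?\<beta> = "\<lambda>a b. if b = j then \<Sum>q<r. l q * \<epsilon> m a q else 0"
    have d: "fps_X ^ C a b dvd ?\<beta> a b" if "a < n" "b < n" for a b using dv[OF m that(1)] by auto
    show ?thesis
      using el_closed[of ?\<beta>, OF d] mat_el[of ?\<beta>, OF d] i by (intro bexI[of _ "el ?\<beta>"]) (auto simp: regm_simps)
  qed
  then obtain a where a: "a \<in> Hom R M (regm R)"
    "\<forall>m\<in>carrier M. \<forall>i<n. \<forall>p<n. mat (a m) i p = (\<Sum>q<r. (if p = j then l q else 0) * \<epsilon> m i q)"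
    using Hom_of_matrix[OF M frame_regm, of "\<lambda>p q. if p = j then l q else 0"] by blast
  then show ?thesis by (intro bexI[of _ a]) auto
qed

lemma elementary_stably_zero:
  assumes M: "frame M r \<epsilon>" and N: "frame N r' \<epsilon>'" and j: "j < n" and z: "z \<in> carrier N"
    and dv: "\<And>m i. m \<in> carrier M ==> i < n ==> fps_X ^ C i j dvd (\<Sum>q<r. l q * \<epsilon> m i q)"
  shows "\<exists>f\<in>stably_zero R M N. \<forall>m\<in>carrier M. \<forall>i<n. \<forall>p<r'. \<epsilon>' (f m) i p = (\<Sum>q<r. l q * \<epsilon> m i q) * \<epsilon>' z j p"
proof -
  note LM = frame_module[OF M] and LN = frame_module[OF N]
  interpret N: abelian_group N by (rule lm_grp[OF LN])
  obtain a where a: "a \<in> Hom R M (regm R)"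
    "\<forall>m\<in>carrier M. \<forall>i<n. \<forall>b<n. mat (a m) i b = (if b = j then \<Sum>q<r. l q * \<epsilon> m i q else 0)"
    using elementary_hom[OF M j dv] by blast
  have ac: "a m \<in> carrier R" if "m \<in> carrier M" for m using Hom_closed[OF a(1) that] by (simp add: regm_simps)
  let ?f = "\<lambda>x\<in>carrier M. \<Oplus>\<^bsub>N\<^esub> s\<in>{..<1::nat}. a x \<odot>\<^sub>N z"
  have f: "?f \<in> stably_zero R M N" using a(1) z by (intro stably_zeroI[OF LM LN]) auto
  have fm: "?f m = a m \<odot>\<^sub>N z" if m: "m \<in> carrier M" for m
  proof -
    have "(\<Oplus>\<^bsub>N\<^esub> s\<in>{0::nat}. a m \<odot>\<^sub>N z) = a m \<odot>\<^sub>N z \<oplus>\<^sub>N \<zero>\<^sub>N"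
      using lm_closed[OF LN ac[OF m] z] by (subst N.finsum_insert) auto
    then show ?thesis using m lm_closed[OF LN ac[OF m] z] by (simp add: lessThan_Suc)
  qed
  have "\<epsilon>' (?f m) i p = (\<Sum>q<r. l q * \<epsilon> m i q) * \<epsilon>' z j p" if m: "m \<in> carrier M" and i: "i < n" and p: "p < r'" for m i p
  proof -
    have "\<epsilon>' (?f m) i p = (\<Sum>b<n. mat (a m) i b * \<epsilon>' z b p)"
      using fm[OF m] ac[OF m] z i p by (simp add: frame_smult[OF N])
    also have "... = mat (a m) i j * \<epsilon>' z j p" using a(2) m i j by (intro sum_eq_single) auto
    finally show ?thesis using a(2) m i j by simp
  qed
  then show ?thesis using f by blast
qed

text \<open>The walk from \<open>i\<close> to \<open>nu j\<close> multiplies the value at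
  \<open>i\<close> by \<open>t^(C (nu j) i)\<close>, and by \<open>gam_split\<close> exactly
  \<open>t^(C i j)\<close> of the divisor \<open>t^(gam j)\<close> is left. So the conditions for a
  map into \<open>R E_j\<close> reduce to one at the vertex \<open>nu j\<close>.\<close>

lemma dual_condition:
  assumes M: "frame M r \<epsilon>" and j: "j < n"
    and dv: "\<And>m. m \<in> carrier M ==> fps_X ^ gam j dvd (\<Sum>q<r. l q * \<epsilon> m (nu j) q)"
    and m: "m \<in> carrier M" and i: "i < n"
  shows "fps_X ^ C i j dvd (\<Sum>q<r. l q * \<epsilon> m i q)"
proof -
  have e: "ent (nu j) i \<odot>\<^sub>M m \<in> carrier M" using m by (intro lm_closed[OF frame_module[OF M]]) auto
  have "(\<Sum>q<r. l q * \<epsilon> (ent (nu j) i \<odot>\<^sub>M m) (nu j) q) = fps_X ^ C (nu j) i * (\<Sum>q<r. l q * \<epsilon> m i q)"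
    unfolding sum_distrib_left using m i j
    by (intro sum.cong refl) (simp add: frame_ent[OF M] nu_less mult.left_commute)
  then have "fps_X ^ (C (nu j) i + C i j) dvd fps_X ^ C (nu j) i * (\<Sum>q<r. l q * \<epsilon> m i q)"
    using dv[OF e] gam_split[OF i j] by simp
  then show ?thesis by (simp add: fps_X_power_dvd_cancel)
qed

text \<open>Since \<open>C i 0 \<le> gam 0\<close>, the coordinate forms multiplied by
  \<open>t^(gam 0)\<close> are maps from \<open>M\<close> into \<open>R E_0\<close>. A map whose
  matrix is divisible by this power factors through them, provided that the quotients
  \<open>L q\<close> lie in \<open>N\<close>.\<close>

lemma stably_zero_of_divisible:
  assumes M: "nframe M r \<epsilon>" and N: "frame N r' \<epsilon>'" and u: "u \<in> Hom R M N"
    and L: "\<And>q. q < r ==> L q \<in> carrier N"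
    and div: "\<And>q j p. q < r ==> j < n ==> p < r' ==>
      fps_X ^ gam 0 * \<epsilon>' (L q) j p = (if j = 0 then \<epsilon>' (u (bas M r \<epsilon> q)) 0 p else 0)"
  shows "u \<in> stably_zero R M N"
proof -
  note F = nframe_frame[OF M]
  note LM = frame_module[OF F] and LN = frame_module[OF N]
  interpret N: abelian_group N by (rule lm_grp[OF LN])
  have "\<exists>a. a \<in> Hom R M (regm R) \<and> (\<forall>m\<in>carrier M. \<forall>i<n. \<forall>b<n. mat (a m) i b = (if b = 0 then fps_X ^ gam 0 * \<epsilon> m i q else 0))"
    if q: "q < r" for q
  proof -
    have s: "(\<Sum>q'<r. (if q' = q then fps_X ^ gam 0 else 0) * \<epsilon> m i q') = fps_X ^ gam 0 * \<epsilon> m i q" for m i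
      using q by (subst sum_eq_single[of _ q]) auto
    have "\<exists>a\<in>Hom R M (regm R). \<forall>m\<in>carrier M. \<forall>i<n. \<forall>b<n. mat (a m) i b =
        (if b = 0 then \<Sum>q'<r. (if q' = q then fps_X ^ gam 0 else 0) * \<epsilon> m i q' else 0)"
      using C0_le_gam by (intro elementary_hom[OF F n_pos]) (auto simp: s intro!: dvd_mult2 le_imp_power_dvd)
    then show ?thesis unfolding s by blast
  qed
  then obtain a where a: "\<And>q. q < r ==> a q \<in> Hom R M (regm R)"
    and am: "\<And>q m i b. q < r ==> m \<in> carrier M ==> i < n ==> b < n ==> mat (a q m) i b = (if b = 0 then fps_X ^ gam 0 * \<epsilon> m i q else 0)"
    by metis
  have ac: "a q m \<in> carrier R" if "q < r" "m \<in> carrier M" for q m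
    using Hom_closed[OF a[OF that(1)] that(2)] by (simp add: regm_simps)
  let ?f = "\<lambda>x\<in>carrier M. \<Oplus>\<^bsub>N\<^esub> q\<in>{..<r}. a q x \<odot>\<^sub>N L q"
  have f: "?f \<in> stably_zero R M N" using a L by (intro stably_zeroI[OF LM LN]) auto
  have "u = ?f"
  proof (rule Hom_eqI[OF u stably_zero_Hom[OF LM f]])
    fix m assume m: "m \<in> carrier M"
    have t: "a q m \<odot>\<^sub>N L q \<in> carrier N" if "q < r" for q using that ac m L by (intro lm_closed[OF LN]) auto
    have "u m = (\<Oplus>\<^bsub>N\<^esub> q\<in>{..<r}. a q m \<odot>\<^sub>N L q)"
    proof (rule frame_inj[OF N])
      fix i p assume i: "i < n" and p: "p < r'"
      have "\<epsilon>' (\<Oplus>\<^bsub>N\<^esub> q\<in>{..<r}. a q m \<odot>\<^sub>N L q) i p = (\<Sum>q<r. \<epsilon>' (a q m \<odot>\<^sub>N L q) i p)"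
        using t i p by (intro frame_finsum[OF N]) auto
      also have "... = (\<Sum>q<r. \<epsilon>' (u (bas M r \<epsilon> q)) 0 p * \<epsilon> m i q)"
      proof (intro sum.cong refl)
        fix q assume "q \<in> {..<r}"
        then have q: "q < r" by simp
        have "\<epsilon>' (a q m \<odot>\<^sub>N L q) i p = (\<Sum>b<n. mat (a q m) i b * \<epsilon>' (L q) b p)"
          using ac[OF q m] L[OF q] i p by (simp add: frame_smult[OF N])
        also have "... = mat (a q m) i 0 * \<epsilon>' (L q) 0 p"
          using am[OF q m i] n_pos by (intro sum_eq_single) auto
        also have "... = \<epsilon> m i q * (fps_X ^ gam 0 * \<epsilon>' (L q) 0 p)"
          using am[OF q m i n_pos] by (simp add: mult_ac)
        also have "... = \<epsilon>' (u (bas M r \<epsilon> q)) 0 p * \<epsilon> m i q" using div[OF q n_pos p] by simp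
        finally show "\<epsilon>' (a q m \<odot>\<^sub>N L q) i p = \<epsilon>' (u (bas M r \<epsilon> q)) 0 p * \<epsilon> m i q" .
      qed
      also have "... = \<epsilon>' (u m) i p" by (rule hom_matrix[OF M N u m i p, symmetric])
      finally show "\<epsilon>' (u m) i p = \<epsilon>' (\<Oplus>\<^bsub>N\<^esub> q\<in>{..<r}. a q m \<odot>\<^sub>N L q) i p" ..
    qed (use t Hom_closed[OF u m] in \<open>auto intro!: N.finsum_closed\<close>)
    then show "u m = ?f m" using m by simp
  qed
  then show ?thesis using f by simp
qed

end

section \<open>The residue pairing and its perfection\<close>

context tiled
begin

definition twf :: "('m \<Rightarrow> nat \<Rightarrow> nat \<Rightarrow> complex fps) \<Rightarrow> 'm \<Rightarrow> nat \<Rightarrow> nat \<Rightarrow> complex fps" where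
  "twf \<epsilon> m i q = fps_X ^ del i * \<epsilon> m (nu i) q"

lemma frame_twf: "frame M r \<epsilon> ==> frame (tw k M) r (twf \<epsilon>)"
  using frame_tw[of M r \<epsilon>] by (simp add: twf_def[abs_def])

text \<open>The trace form of the Serre duality between \<open>M\<close> and \<open>tw k M\<close>.\<close>

definition rho :: "('r, 'm) module \<Rightarrow> nat \<Rightarrow> ('m \<Rightarrow> nat \<Rightarrow> nat \<Rightarrow> complex fps) \<Rightarrow> ('m \<Rightarrow> 'm) \<Rightarrow> complex" where
  "rho M r \<epsilon> u = fps_nth (\<Sum>q<r. twf \<epsilon> (u (bas M r \<epsilon> q)) 0 q) (gam 0 - 1)"

lemma rho_compose:
  assumes "nframe M r \<epsilon>"
  shows "rho M r \<epsilon> (compose (carrier M) g f) = fps_nth (\<Sum>q<r. twf \<epsilon> (g (f (bas M r \<epsilon> q))) 0 q) (gam 0 - 1)"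
  using bas_closed[OF assms] by (simp add: rho_def compose_def)

text \<open>For \<open>u\<close> the sum of the \<open>a s\<close> times \<open>l s\<close>, the
  trace is the sum of \<open>t^(del j)\<close> times the entry \<open>(nu j, j)\<close> of
  \<open>a s (l s)\<close>. Such an entry is divisible by \<open>t^(gam j)\<close>, so the trace is
  divisible by \<open>t^(gam 0)\<close> and has no coefficient at \<open>gam 0 - 1\<close>.\<close>

lemma rho_stably_zero:
  assumes M: "nframe M r \<epsilon>" and u: "u \<in> stably_zero R M (tw k M)"
  shows "rho M r \<epsilon> u = 0"
proof -
  note F = nframe_frame[OF M]
  note LM = frame_module[OF F]
  define S where "S = tw k M"
  have FS: "frame S r (twf \<epsilon>)" unfolding S_def by (rule frame_twf[OF F])
  note LS = frame_module[OF FS]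
  have cS: "carrier S = carrier M" by (simp add: S_def)
  obtain m :: nat and a l where a: "\<And>s. s < m ==> a s \<in> Hom R M (regm R)" and l: "\<And>s. s < m ==> l s \<in> carrier S"
    and ueq: "u = (\<lambda>x\<in>carrier M. \<Oplus>\<^bsub>S\<^esub> s\<in>{..<m}. a s x \<odot>\<^sub>S l s)"
    using stably_zeroD[OF LM LS] u unfolding S_def[symmetric] by blast
  have ac: "a s m' \<in> carrier R" if "s < m" "m' \<in> carrier M" for s m'
    using Hom_closed[OF a[OF that(1)] that(2)] by (simp add: regm_simps)
  have b: "bas M r \<epsilon> q \<in> carrier M" for q by (rule bas_closed[OF M])
  have "twf \<epsilon> (u (bas M r \<epsilon> q)) 0 q = (\<Sum>s<m. \<Sum>j<n. fps_X ^ del j * (mat (a s (bas M r \<epsilon> q)) 0 j * \<epsilon> (l s) (nu j) q))"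
    if q: "q < r" for q
  proof -
    have "twf \<epsilon> (u (bas M r \<epsilon> q)) 0 q = (\<Sum>s<m. twf \<epsilon> (a s (bas M r \<epsilon> q) \<odot>\<^sub>S l s) 0 q)"
      using frame_finsum[OF FS, of "{..<m}" "\<lambda>s. a s (bas M r \<epsilon> q) \<odot>\<^sub>S l s" 0 q] b ac l q n_pos
      by (simp add: ueq lm_closed[OF LS])
    also have "... = (\<Sum>s<m. \<Sum>j<n. mat (a s (bas M r \<epsilon> q)) 0 j * twf \<epsilon> (l s) j q)"
      using b ac l q n_pos by (intro sum.cong refl) (simp add: frame_smult[OF FS])
    finally show ?thesis by (simp add: twf_def mult.left_commute)
  qed
  then have "(\<Sum>q<r. twf \<epsilon> (u (bas M r \<epsilon> q)) 0 q) =
      (\<Sum>q<r. \<Sum>s<m. \<Sum>j<n. fps_X ^ del j * (mat (a s (bas M r \<epsilon> q)) 0 j * \<epsilon> (l s) (nu j) q))" by simp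
  also have "... = (\<Sum>s<m. \<Sum>q<r. \<Sum>j<n. fps_X ^ del j * (mat (a s (bas M r \<epsilon> q)) 0 j * \<epsilon> (l s) (nu j) q))"
    by (rule sum.swap)
  also have "... = (\<Sum>s<m. \<Sum>j<n. fps_X ^ del j * mat (a s (l s)) (nu j) j)"
  proof (rule sum.cong[OF refl])
    fix s assume "s \<in> {..<m}"
    then have s: "s < m" by simp
    have "(\<Sum>q<r. \<Sum>j<n. fps_X ^ del j * (mat (a s (bas M r \<epsilon> q)) 0 j * \<epsilon> (l s) (nu j) q)) =
        (\<Sum>j<n. \<Sum>q<r. fps_X ^ del j * (mat (a s (bas M r \<epsilon> q)) 0 j * \<epsilon> (l s) (nu j) q))" by (rule sum.swap)
    also have "... = (\<Sum>j<n. fps_X ^ del j * mat (a s (l s)) (nu j) j)"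
      unfolding sum_distrib_left[symmetric]
    proof (intro sum.cong refl)
      fix j assume "j \<in> {..<n}"
      then show "fps_X ^ del j * (\<Sum>q<r. mat (a s (bas M r \<epsilon> q)) 0 j * \<epsilon> (l s) (nu j) q) = fps_X ^ del j * mat (a s (l s)) (nu j) j"
        using hom_matrix[OF M frame_regm a[OF s], of "l s" "nu j" j] l[OF s] nu_less by (simp add: cS)
    qed
    finally show "(\<Sum>q<r. \<Sum>j<n. fps_X ^ del j * (mat (a s (bas M r \<epsilon> q)) 0 j * \<epsilon> (l s) (nu j) q)) =
        (\<Sum>j<n. fps_X ^ del j * mat (a s (l s)) (nu j) j)" .
  qed
  finally have eq: "(\<Sum>q<r. twf \<epsilon> (u (bas M r \<epsilon> q)) 0 q) = (\<Sum>s<m. \<Sum>j<n. fps_X ^ del j * mat (a s (l s)) (nu j) j)" .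
  have "fps_X ^ gam 0 dvd (\<Sum>q<r. twf \<epsilon> (u (bas M r \<epsilon> q)) 0 q)"
    unfolding eq
  proof (intro dvd_sum)
    fix s j assume "s \<in> {..<m}" "j \<in> {..<n}"
    then have s: "s < m" and j: "j < n" by auto
    have "fps_X ^ gam j dvd mat (a s (l s)) (nu j) j"
      using mat_dvd[OF ac[OF s] nu_less[OF j] j, of "l s"] l[OF s] gam_C[OF j] by (simp add: cS)
    then show "fps_X ^ gam 0 dvd fps_X ^ del j * mat (a s (l s)) (nu j) j"
      unfolding del_gam[OF j, symmetric] by (simp only: fps_X_power_dvd_cancel)
  qed
  then show ?thesis using gam_0_pos by (simp add: rho_def fps_X_power_dvd_iff)
qed

lemma hom_scale_zeta:
  assumes M: "left_module R M" and N: "left_module R N" and f: "f \<in> Hom R M N"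
  shows "hom_scale M N (\<zeta> p) f \<in> Hom R M N"
proof (rule HomI)
  interpret M: abelian_group M by (rule lm_grp[OF M])
  fix m m' assume "m \<in> carrier M" "m' \<in> carrier M"
  then show "hom_scale M N (\<zeta> p) f (m \<oplus>\<^sub>M m') = hom_scale M N (\<zeta> p) f m \<oplus>\<^sub>N hom_scale M N (\<zeta> p) f m'"
    using Hom_closed[OF f] by (simp add: hom_scale_def Hom_add[OF f] lm_r_distr[OF N])
next
  fix c m assume c: "c \<in> carrier R" "m \<in> carrier M"
  then have "\<zeta> p \<odot>\<^sub>N (c \<odot>\<^sub>N f m) = c \<odot>\<^sub>N (\<zeta> p \<odot>\<^sub>N f m)"
    using zeta_commute[of c p] Hom_closed[OF f] by (simp add: lm_assoc[OF N, symmetric])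
  then show "hom_scale M N (\<zeta> p) f (c \<odot>\<^sub>M m) = c \<odot>\<^sub>N hom_scale M N (\<zeta> p) f m"
    using c by (simp add: hom_scale_def Hom_smult[OF f] lm_closed[OF M])
qed (use Hom_closed[OF f] in \<open>auto simp: hom_scale_def lm_closed[OF N]\<close>)

lemma stably_zero_zeta:
  assumes M: "left_module R M" and N: "left_module R N" and u: "u \<in> stably_zero R M N"
  shows "hom_scale M N (\<zeta> p) u \<in> stably_zero R M N"
proof -
  have "compose (carrier M) (hom_scale N N (\<zeta> p) (hom_id N)) u \<in> stably_zero R M N"
    by (rule stably_zero_compose_l[OF M u hom_scale_zeta[OF N N Hom_id[OF N]]])
  moreover have "compose (carrier M) (hom_scale N N (\<zeta> p) (hom_id N)) u = hom_scale M N (\<zeta> p) u"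
    using Hom_closed[OF stably_zero_Hom[OF M u]] by (auto simp: fun_eq_iff compose_def hom_scale_def hom_id_def)
  ultimately show ?thesis by simp
qed

lemma elt_single:
  assumes M: "nframe M r \<epsilon>" and l: "l < n"
  shows "\<exists>m\<in>carrier M. \<forall>i<n. \<forall>q<r. \<epsilon> m i q = (if i = l then fps_X ^ C l 0 * v q else 0)"
proof -
  note F = nframe_frame[OF M]
  have "\<exists>m0\<in>carrier M. \<forall>i<n. \<forall>q<r. \<epsilon> m0 i q = (if i = 0 then v q else 0)"
    using M unfolding nframe_def by (elim conjE) (erule spec)
  then obtain m0 where m0: "m0 \<in> carrier M" "\<forall>i<n. \<forall>q<r. \<epsilon> m0 i q = (if i = 0 then v q else 0)" by blast
  show ?thesis
    using m0 l n_pos by (intro bexI[of _ "ent l 0 \<odot>\<^sub>M m0"]) (auto simp: frame_ent[OF F] intro!: lm_closed[OF frame_module[OF F]])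
qed

text \<open>\<open>\<phi>\<close> is a residue functional of the matrix of \<open>f\<close>, with
  some matrix \<open>h\<close>. That \<open>\<phi>\<close> kills rank one maps through
  \<open>R E_j\<close> says, by double duality, that \<open>h\<close> maps \<open>Y\<close> into the
  twisted lattice; so \<open>h\<close> is the matrix of the required \<open>g\<close>.\<close>

lemma serre_surj:
  assumes M: "nframe M r \<epsilon>" and Y: "nframe Y rY \<epsilon>Y" and \<phi>: "\<phi> \<in> stable_dual R \<iota> M Y"
  shows "\<exists>g\<in>Hom R Y (tw k M). \<forall>f\<in>Hom R M Y. rho M r \<epsilon> (compose (carrier M) g f) = \<phi> f"
proof -
  note F = nframe_frame[OF M] and FY = nframe_frame[OF Y]
  note LM = frame_module[OF F] and LY = frame_module[OF FY]
  interpret Y: abelian_group Y by (rule lm_grp[OF LY])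
  define S where "S = tw k M"
  have FS: "frame S r (twf \<epsilon>)" unfolding S_def by (rule frame_twf[OF F])
  have cS: "carrier S = carrier M" by (simp add: S_def)
  have b: "bas M r \<epsilon> q \<in> carrier M" for q by (rule bas_closed[OF M])
  define T where "T f = (\<lambda>(p, q). \<epsilon>Y (f (bas M r \<epsilon> p)) 0 q)" for f
  have zY: "\<zeta> p \<odot>\<^sub>Y y \<in> carrier Y" if "y \<in> carrier Y" for p y using that by (intro lm_closed[OF LY]) auto
  note zs = hom_scale_zeta[OF LM LY]
  have "\<exists>h. \<forall>f\<in>Hom R M Y. \<phi> f = fps_nth (\<Sum>i\<in>{..<r} \<times> {..<rY}. h i * T f i) (gam 0 - 1)"
  proof (rule residue_functional[OF _ gam_0_pos])
    fix f g assume fg: "f \<in> Hom R M Y" "g \<in> Hom R M Y"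
    then have "\<phi> (hom_add M Y f g) = \<phi> f + \<phi> g" using \<phi> unfolding stable_dual_def by blast
    then show "\<exists>h\<in>Hom R M Y. \<phi> h = \<phi> f + \<phi> g \<and> (\<forall>i\<in>{..<r} \<times> {..<rY}. T h i = T f i + T g i)"
      using hom_add_closed[OF LM LY fg] b n_pos Hom_closed[OF fg(1)] Hom_closed[OF fg(2)]
      by (intro bexI[of _ "hom_add M Y f g"]) (auto simp: T_def hom_add_def frame_add[OF FY])
  next
    fix a f assume f: "f \<in> Hom R M Y"
    then have "\<phi> (hom_scale M Y (\<iota> a) f) = a * \<phi> f" using \<phi> unfolding stable_dual_def by blast
    then show "\<exists>h\<in>Hom R M Y. \<phi> h = a * \<phi> f \<and> (\<forall>i\<in>{..<r} \<times> {..<rY}. T h i = fps_const a * T f i)"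
      using zs[OF f, of "fps_const a"] b n_pos Hom_closed[OF f]
      by (intro bexI[of _ "hom_scale M Y (\<iota> a) f"]) (auto simp: iota_zeta T_def hom_scale_def frame_zeta[OF FY])
  next
    fix f assume f: "f \<in> Hom R M Y" and dv: "\<forall>i\<in>{..<r} \<times> {..<rY}. fps_X ^ gam 0 dvd T f i"
    have "\<forall>p q. \<exists>w. p < r \<longrightarrow> q < rY \<longrightarrow> T f (p, q) = fps_X ^ gam 0 * w" using dv by (fastforce simp: dvd_def)
    then obtain w where w: "\<And>p q. p < r ==> q < rY ==> T f (p, q) = fps_X ^ gam 0 * w p q" by metis
    have "\<exists>y\<in>carrier Y. \<forall>i<n. \<forall>q<rY. \<epsilon>Y y i q = (if i = 0 then fps_X ^ C 0 0 * w p q else 0)" for p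
      by (rule elt_single[OF Y n_pos])
    then obtain L where L: "\<And>p. L p \<in> carrier Y" "\<And>p i q. i < n ==> q < rY ==> \<epsilon>Y (L p) i q = (if i = 0 then fps_X ^ C 0 0 * w p q else 0)"
      by metis
    have "f \<in> stably_zero R M Y"
    proof (rule stably_zero_of_divisible[OF M FY f])
      fix p j q assume "p < r" "j < n" "q < rY"
      then show "fps_X ^ gam 0 * \<epsilon>Y (L p) j q = (if j = 0 then \<epsilon>Y (f (bas M r \<epsilon> p)) 0 q else 0)"
        using w[of p q] L(2)[of j q p] n_pos by (simp add: C_refl T_def)
    qed (rule L(1))
    then show "\<phi> f = 0" using \<phi> unfolding stable_dual_def by blast
  qed simp
  then obtain h where h: "\<And>f. f \<in> Hom R M Y ==> \<phi> f = fps_nth (\<Sum>i\<in>{..<r} \<times> {..<rY}. h i * T f i) (gam 0 - 1)" by blast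
  then have h: "\<phi> f = fps_nth (\<Sum>p<r. \<Sum>q<rY. h (p, q) * \<epsilon>Y (f (bas M r \<epsilon> p)) 0 q) (gam 0 - 1)" if "f \<in> Hom R M Y" for f
    using that by (simp add: sum.cartesian_product T_def case_prod_unfold)
  define w where "w y j p = (\<Sum>q<rY. h (p, q) * \<epsilon>Y y j q)" for y j p
  \<comment> \<open>The maps sending \<open>m\<close> to \<open>l(m)\<close> times
    \<open>t^e y\<close> are stably zero, so \<open>\<phi>\<close> vanishes on them; in the residue
    representation this is the divisibility.\<close>
  have key: "fps_X ^ gam 0 dvd (\<Sum>p<r. l p * w y j p)"
    if y: "y \<in> carrier Y" and j: "j < n" and dv: "\<And>m. m \<in> carrier M ==> fps_X ^ gam j dvd (\<Sum>p<r. l p * \<epsilon> m (nu j) p)" for l y j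
  proof (rule fps_X_power_dvdI[OF gam_0_pos])
    fix e
    obtain f where f: "f \<in> stably_zero R M Y"
      "\<forall>m\<in>carrier M. \<forall>i<n. \<forall>q<rY. \<epsilon>Y (f m) i q = (\<Sum>p<r. l p * \<epsilon> m i p) * \<epsilon>Y (\<zeta> (fps_X ^ e) \<odot>\<^sub>Y y) j q"
      using elementary_stably_zero[OF F FY j zY[OF y] dual_condition[OF F j dv]] by blast
    have "(\<Sum>p<r. \<Sum>q<rY. h (p, q) * \<epsilon>Y (f (bas M r \<epsilon> p)) 0 q) = fps_X ^ e * (\<Sum>p<r. l p * w y j p)"
      unfolding sum_distrib_left
    proof (intro sum.cong refl)
      fix p assume "p \<in> {..<r}"
      then have p: "p < r" by simp
      have s: "(\<Sum>p'<r. l p' * \<epsilon> (bas M r \<epsilon> p) 0 p') = l p"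
        using p n_pos by (subst sum_eq_single[of _ p]) (auto simp: bas_frame[OF M])
      have "(\<Sum>q<rY. h (p, q) * \<epsilon>Y (f (bas M r \<epsilon> p)) 0 q) = (\<Sum>q<rY. fps_X ^ e * (l p * (h (p, q) * \<epsilon>Y y j q)))"
        using f(2) b n_pos s y j by (intro sum.cong refl) (simp add: frame_zeta[OF FY] mult_ac)
      then show "(\<Sum>q<rY. h (p, q) * \<epsilon>Y (f (bas M r \<epsilon> p)) 0 q) = fps_X ^ e * (l p * w y j p)"
        by (simp add: w_def sum_distrib_left)
    qed
    moreover have "\<phi> f = 0" using \<phi> f(1) unfolding stable_dual_def by blast
    ultimately show "fps_nth (fps_X ^ e * (\<Sum>p<r. l p * w y j p)) (gam 0 - 1) = 0"
      using h[OF stably_zero_Hom[OF LM f(1)]] by simp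
  qed
  have "\<exists>m'\<in>carrier S. \<forall>p<r. twf \<epsilon> m' j p = (\<Sum>q<rY. h (p, q) * \<epsilon>Y y j q)" if y: "y \<in> carrier Y" and j: "j < n" for y j
  proof -
    \<comment> \<open>Test with \<open>t^(gam j)\<close> times a coordinate form, which satisfies
      the hypothesis of \<open>key\<close> trivially.\<close>
    have "fps_X ^ del j dvd w y j p" if p: "p < r" for p
    proof -
      have "fps_X ^ gam 0 dvd (\<Sum>p'<r. (if p' = p then fps_X ^ gam j else 0) * w y j p')"
        using p by (intro key[OF y j], subst sum_eq_single[of _ p]) auto
      also have "(\<Sum>p'<r. (if p' = p then fps_X ^ gam j else 0) * w y j p') = fps_X ^ gam j * w y j p"
        using p by (subst sum_eq_single[of _ p]) auto
      finally show ?thesis unfolding del_gam[OF j, symmetric] add.commute[of "del j"] by (simp only: fps_X_power_dvd_cancel)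
    qed
    then obtain v where v: "\<And>p. p < r ==> w y j p = fps_X ^ del j * v p" unfolding dvd_def by metis
    have "\<exists>m\<in>carrier M. \<forall>p<r. \<epsilon> m (nu j) p = v p"
    proof (rule lattice_double_dual[OF M nu_less[OF j], of "gam j"])
      fix l' assume "\<And>m. m \<in> carrier M ==> fps_X ^ gam j dvd (\<Sum>q<r. l' q * \<epsilon> m (nu j) q)"
      then have "fps_X ^ gam 0 dvd (\<Sum>p<r. l' p * w y j p)" by (rule key[OF y j])
      also have "(\<Sum>p<r. l' p * w y j p) = fps_X ^ del j * (\<Sum>p<r. l' p * v p)"
        unfolding sum_distrib_left using v by (intro sum.cong refl) (simp add: mult.left_commute)
      finally show "fps_X ^ gam j dvd (\<Sum>q<r. l' q * v q)"
        unfolding del_gam[OF j, symmetric] by (simp only: fps_X_power_dvd_cancel)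
    qed (simp add: gam_C0[OF j])
    then show ?thesis using v by (auto simp: cS twf_def w_def)
  qed
  from Hom_of_matrix[OF FY FS, of "\<lambda>p q. h (p, q)", OF this] obtain g where g: "g \<in> Hom R Y S"
    "\<And>y i p. y \<in> carrier Y ==> i < n ==> p < r ==> twf \<epsilon> (g y) i p = (\<Sum>q<rY. h (p, q) * \<epsilon>Y y i q)" by blast
  have "rho M r \<epsilon> (compose (carrier M) g f) = \<phi> f" if f: "f \<in> Hom R M Y" for f
    using g(2) n_pos Hom_closed[OF f b] by (simp add: rho_compose[OF M] h[OF f])
  then show ?thesis using g(1) unfolding S_def by blast
qed

text \<open>If \<open>g\<close> is not stably zero, then \<open>a\<close> can be read off from
  \<open>u + a g\<close> with \<open>u\<close> stably zero, as a residue with some matrix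
  \<open>h\<close>. Testing on rank one maps shows that \<open>h / t^(gam 0)\<close> is the matrix
  of a map \<open>f\<close> from \<open>M\<close> to \<open>Y\<close>, and the pairing of
  \<open>g\<close> with \<open>f\<close> is 1.\<close>

lemma serre_nondegenerate:
  assumes M: "nframe M r \<epsilon>" and Y: "nframe Y rY \<epsilon>Y" and g: "g \<in> Hom R Y (tw k M)"
    and zero: "\<And>f. f \<in> Hom R M Y ==> rho M r \<epsilon> (compose (carrier M) g f) = 0"
  shows "g \<in> stably_zero R Y (tw k M)"
proof (rule ccontr)
  note F = nframe_frame[OF M] and FY = nframe_frame[OF Y]
  note LM = frame_module[OF F] and LY = frame_module[OF FY]
  define S where "S = tw k M"
  assume "g \<notin> stably_zero R Y (tw k M)"
  then have no: "g \<notin> stably_zero R Y S" and g: "g \<in> Hom R Y S" using g by (auto simp: S_def)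
  have FS: "frame S r (twf \<epsilon>)" unfolding S_def by (rule frame_twf[OF F])
  note LS = frame_module[OF FS]
  interpret S: abelian_group S by (rule lm_grp[OF LS])
  interpret Y: abelian_group Y by (rule lm_grp[OF LY])
  have cS: "carrier S = carrier M" by (simp add: S_def)
  have b: "bas Y rY \<epsilon>Y q \<in> carrier Y" for q by (rule bas_closed[OF Y])
  have zS: "\<zeta> p \<odot>\<^sub>S y \<in> carrier S" if "y \<in> carrier S" for p y using that by (intro lm_closed[OF LS]) auto
  define G where "G q p = twf \<epsilon> (g (bas Y rY \<epsilon>Y q)) 0 p" for q p
  define T where "T = (\<lambda>(u, a) (q, p). twf \<epsilon> (u (bas Y rY \<epsilon>Y q)) 0 p + fps_const a * G q p)"
  let ?F = "stably_zero R Y S \<times> (UNIV :: complex set)"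
  let ?I = "{..<rY} \<times> {..<r}"
  have uc: "u y \<in> carrier S" if "u \<in> stably_zero R Y S" "y \<in> carrier Y" for u y
    using Hom_closed[OF stably_zero_Hom[OF LY that(1)] that(2)] .
  have gc: "g y \<in> carrier S" if "y \<in> carrier Y" for y using Hom_closed[OF g that] .
  \<comment> \<open>One factor \<open>t^(gam 0)\<close> is what
    \<open>stably_zero_of_divisible\<close> asks for. The other is due to the frame of
    \<open>S\<close>, which is not normalised: its component 0 is the one of \<open>M\<close> at
    \<open>nu 0\<close>, where only multiples of \<open>t^(gam 0)\<close> are prescribed by
    \<open>elt_single\<close>.\<close>
  have c: "1 \<le> 2 * gam 0" using gam_0_pos by simp
  have "\<exists>h. \<forall>f\<in>?F. snd f = fps_nth (\<Sum>i\<in>?I. h i * T f i) (2 * gam 0 - 1)"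
  proof (rule residue_functional[OF _ c])
    fix f f' assume "f \<in> ?F" "f' \<in> ?F"
    then obtain u a u' a' where ua: "f = (u, a)" "u \<in> stably_zero R Y S" "f' = (u', a')" "u' \<in> stably_zero R Y S" by auto
    have "(hom_add Y S u u', a + a') \<in> ?F" using stably_zero_add[OF LY LS ua(2,4)] by simp
    moreover have "\<forall>i\<in>?I. T (hom_add Y S u u', a + a') i = T f i + T f' i"
      using b uc[OF ua(2)] uc[OF ua(4)] n_pos
      by (auto simp: T_def ua hom_add_def frame_add[OF FS] algebra_simps simp flip: fps_const_add)
    ultimately show "\<exists>h\<in>?F. snd h = snd f + snd f' \<and> (\<forall>i\<in>?I. T h i = T f i + T f' i)"
      by (intro bexI[of _ "(hom_add Y S u u', a + a')"]) (auto simp: ua)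
  next
    fix s f assume "f \<in> ?F"
    then obtain u a where ua: "f = (u, a)" "u \<in> stably_zero R Y S" by auto
    have "(hom_scale Y S (\<zeta> (fps_const s)) u, s * a) \<in> ?F" using stably_zero_zeta[OF LY LS ua(2)] by simp
    moreover have "\<forall>i\<in>?I. T (hom_scale Y S (\<zeta> (fps_const s)) u, s * a) i = fps_const s * T f i"
      using b uc[OF ua(2)] n_pos
      by (auto simp: T_def ua hom_scale_def frame_zeta[OF FS] algebra_simps simp flip: fps_const_mult)
    ultimately show "\<exists>h\<in>?F. snd h = s * snd f \<and> (\<forall>i\<in>?I. T h i = fps_const s * T f i)"
      by (intro bexI[of _ "(hom_scale Y S (\<zeta> (fps_const s)) u, s * a)"]) (auto simp: ua)
  next
    fix f assume "f \<in> ?F" and dv: "\<forall>i\<in>?I. fps_X ^ (2 * gam 0) dvd T f i"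
    then obtain u a where ua: "f = (u, a)" "u \<in> stably_zero R Y S" by auto
    show "snd f = 0"
    proof (rule ccontr)
      assume "snd f \<noteq> 0"
      then have a: "a \<noteq> 0" using ua by simp
      have "\<forall>q p. \<exists>w. q < rY \<longrightarrow> p < r \<longrightarrow> T f (q, p) = fps_X ^ (2 * gam 0) * w" using dv by (fastforce simp: dvd_def)
      then obtain w where w: "\<And>q p. q < rY ==> p < r ==> T f (q, p) = fps_X ^ (2 * gam 0) * w q p" by metis
      have "\<exists>z\<in>carrier M. \<forall>i<n. \<forall>p<r. \<epsilon> z i p = (if i = nu 0 then fps_X ^ C (nu 0) 0 * w q p else 0)" for q
        by (rule elt_single[OF M nu_less[OF n_pos]])
      then obtain L where L: "\<And>q. L q \<in> carrier M"
        "\<And>q i p. i < n ==> p < r ==> \<epsilon> (L q) i p = (if i = nu 0 then fps_X ^ C (nu 0) 0 * w q p else 0)" by metis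
      note sc = hom_scale_zeta[OF LY LS g]
      let ?w = "hom_add Y S u (hom_scale Y S (\<zeta> (fps_const a)) g)"
      have wH: "?w \<in> Hom R Y S" by (rule hom_add_closed[OF LY LS stably_zero_Hom[OF LY ua(2)] sc])
      have wz: "?w \<in> stably_zero R Y S"
      proof (rule stably_zero_of_divisible[OF Y FS wH])
        fix q show "L q \<in> carrier S" using L(1) by (simp add: cS)
      next
        fix q j p assume qjp: "q < rY" "j < n" "p < r"
        have e: "twf \<epsilon> (?w (bas Y rY \<epsilon>Y q)) 0 p = fps_X ^ (2 * gam 0) * w q p"
          using w[of q p] qjp b n_pos uc[OF ua(2)] gc zS
          by (simp add: hom_add_def hom_scale_def frame_add[OF FS] frame_zeta[OF FS] T_def ua G_def)
        have "nu j = nu 0 \<longleftrightarrow> j = 0" using qjp n_pos nu_bij by (auto simp: bij_betw_def dest: inj_onD)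
        then show "fps_X ^ gam 0 * twf \<epsilon> (L q) j p = (if j = 0 then twf \<epsilon> (?w (bas Y rY \<epsilon>Y q)) 0 p else 0)"
          using L(2)[of "nu j" p q] qjp nu_less gam_C0[OF n_pos]
          unfolding e by (simp add: twf_def del_def mult.assoc[symmetric] power_add[symmetric] mult_2)
      qed
      define u' where "u' = hom_scale Y S (\<zeta> (- 1)) u"
      have u': "u' \<in> stably_zero R Y S" unfolding u'_def by (rule stably_zero_zeta[OF LY LS ua(2)])
      have "hom_scale Y S (\<zeta> (fps_const (1 / a))) (hom_add Y S ?w u') \<in> stably_zero R Y S"
        by (intro stably_zero_zeta LY LS stably_zero_add wz u')
      moreover have "hom_scale Y S (\<zeta> (fps_const (1 / a))) (hom_add Y S ?w u') = g"
      proof (rule Hom_eqI[OF stably_zero_Hom[OF LY calculation] g])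
        fix y assume y: "y \<in> carrier Y"
        have uy: "u y \<in> carrier S" "u' y \<in> carrier S" using uc[OF ua(2) y] uc[OF u' y] by auto
        show "hom_scale Y S (\<zeta> (fps_const (1 / a))) (hom_add Y S ?w u') y = g y"
        proof (rule frame_inj[OF FS])
          fix i p assume "i < n" "p < r"
          then show "twf \<epsilon> (hom_scale Y S (\<zeta> (fps_const (1 / a))) (hom_add Y S ?w u') y) i p = twf \<epsilon> (g y) i p"
            using y uy gc[OF y] zS a
            by (simp add: hom_scale_def hom_add_def frame_zeta[OF FS] frame_add[OF FS] u'_def mult.assoc[symmetric])
        qed (use y uy gc[OF y] zS in \<open>auto simp: hom_scale_def hom_add_def\<close>)
      qed
      ultimately show False using no by simp
    qed
  qed simp
  then obtain h0 where h0: "\<And>f. f \<in> ?F ==> snd f = fps_nth (\<Sum>i\<in>?I. h0 i * T f i) (2 * gam 0 - 1)" by blast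
  define h where "h q p = h0 (q, p)" for q p
  have h: "a = fps_nth (\<Sum>q<rY. \<Sum>p<r. h q p * (twf \<epsilon> (u (bas Y rY \<epsilon>Y q)) 0 p + fps_const a * G q p)) (2 * gam 0 - 1)"
    if "u \<in> stably_zero R Y S" for u a
    using h0[of "(u, a)"] that by (simp add: sum.cartesian_product T_def case_prod_unfold h_def)
  have key: "fps_X ^ (2 * gam 0) dvd (\<Sum>q<rY. \<Sum>p<r. h q p * (l q * twf \<epsilon> z j p))"
    if z: "z \<in> carrier S" and j: "j < n" and dv: "\<And>y i. y \<in> carrier Y ==> i < n ==> fps_X ^ C i j dvd (\<Sum>q<rY. l q * \<epsilon>Y y i q)" for l z j
  proof (rule fps_X_power_dvdI[OF c])
    fix e
    obtain u where u: "u \<in> stably_zero R Y S"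
      "\<forall>y\<in>carrier Y. \<forall>i<n. \<forall>p<r. twf \<epsilon> (u y) i p = (\<Sum>q<rY. l q * \<epsilon>Y y i q) * twf \<epsilon> (\<zeta> (fps_X ^ e) \<odot>\<^sub>S z) j p"
      using elementary_stably_zero[OF FY FS j zS[OF z] dv] by blast
    have "(\<Sum>q<rY. \<Sum>p<r. h q p * (twf \<epsilon> (u (bas Y rY \<epsilon>Y q)) 0 p + fps_const 0 * G q p)) = fps_X ^ e * (\<Sum>q<rY. \<Sum>p<r. h q p * (l q * twf \<epsilon> z j p))"
      unfolding sum_distrib_left
    proof (intro sum.cong refl)
      fix q p assume "q \<in> {..<rY}" "p \<in> {..<r}"
      then have q: "q < rY" and p: "p < r" by auto
      have s: "(\<Sum>q'<rY. l q' * \<epsilon>Y (bas Y rY \<epsilon>Y q) 0 q') = l q"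
        using q n_pos by (subst sum_eq_single[of _ q]) (auto simp: bas_frame[OF Y])
      show "h q p * (twf \<epsilon> (u (bas Y rY \<epsilon>Y q)) 0 p + fps_const 0 * G q p) = fps_X ^ e * (h q p * (l q * twf \<epsilon> z j p))"
        using u(2) b n_pos s z j p by (simp add: frame_zeta[OF FS] mult_ac)
    qed
    then show "fps_nth (fps_X ^ e * (\<Sum>q<rY. \<Sum>p<r. h q p * (l q * twf \<epsilon> z j p))) (2 * gam 0 - 1) = 0"
      using h[OF u(1), of 0] by simp
  qed
  \<comment> \<open>Here \<open>gam\<close> vanishes, so \<open>C i j0 = 0\<close> for all
    \<open>i\<close> and every row \<open>l\<close> may be used in \<open>key\<close>; moreover
    \<open>del j0 = gam 0\<close>.\<close>
  obtain j0 where j0: "j0 < n" "nu j0 = 0" using nu_surj[OF n_pos] by blast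
  have g0: "gam j0 = 0" using gam_C0[OF j0(1)] j0 C_refl n_pos by simp
  have "fps_X ^ gam 0 dvd h q p" if q: "q < rY" and p: "p < r" for q p
  proof -
    obtain z where z: "z \<in> carrier M" "\<forall>i<n. \<forall>p'<r. \<epsilon> z i p' = (if i = 0 then fps_X ^ C 0 0 * (if p' = p then 1 else 0) else 0)"
      using elt_single[OF M n_pos, of "\<lambda>p'. if p' = p then 1 else 0"] by blast
    have zt: "twf \<epsilon> z j0 p' = (if p' = p then fps_X ^ gam 0 else 0)" if "p' < r" for p'
      using z(2) that j0 n_pos g0 by (simp add: twf_def del_def C_refl)
    have "fps_X ^ (2 * gam 0) dvd (\<Sum>q'<rY. \<Sum>p'<r. h q' p' * ((if q' = q then 1 else 0) * twf \<epsilon> z j0 p'))"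
    proof (rule key[OF _ j0(1)])
      fix y i assume "i < n"
      then have "C i j0 = 0" using gam_split[of i j0] j0 g0 by simp
      then show "fps_X ^ C i j0 dvd (\<Sum>q'<rY. (if q' = q then 1 else 0) * \<epsilon>Y y i q')" by simp
    qed (use z in \<open>simp add: cS\<close>)
    also have "(\<Sum>q'<rY. \<Sum>p'<r. h q' p' * ((if q' = q then 1 else 0) * twf \<epsilon> z j0 p')) = (\<Sum>p'<r. h q p' * (1 * twf \<epsilon> z j0 p'))"
      using q by (subst sum_eq_single[of _ q]) auto
    also have "... = fps_X ^ gam 0 * h q p" using p by (subst sum_eq_single[of _ p]) (auto simp: zt)
    finally show ?thesis unfolding mult_2 by (simp only: fps_X_power_dvd_cancel)
  qed
  then have "\<forall>q p. \<exists>w. q < rY \<longrightarrow> p < r \<longrightarrow> h q p = fps_X ^ gam 0 * w" by (fastforce simp: dvd_def)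
  then obtain \<Phi> where \<Phi>: "\<And>q p. q < rY ==> p < r ==> h q p = fps_X ^ gam 0 * \<Phi> q p" by metis
  have "\<exists>y\<in>carrier Y. \<forall>q<rY. \<epsilon>Y y i q = (\<Sum>p<r. \<Phi> q p * \<epsilon> m i p)" if m: "m \<in> carrier M" and i: "i < n" for m i
  proof -
    obtain j where j: "j < n" "nu j = i" using nu_surj[OF i] by blast
    show ?thesis
    proof (rule lattice_double_dual[OF Y i, of "gam j"])
      show "C i 0 \<le> gam j" using gam_C0[OF j(1)] j(2) by simp
      fix l assume l: "\<And>y. y \<in> carrier Y ==> fps_X ^ gam j dvd (\<Sum>q<rY. l q * \<epsilon>Y y i q)"
      have "fps_X ^ (2 * gam 0) dvd (\<Sum>q<rY. \<Sum>p<r. h q p * (l q * twf \<epsilon> m j p))"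
        using m l dual_condition[OF FY j(1), of l] by (intro key[OF _ j(1)]) (auto simp: cS j(2))
      also have "... = fps_X ^ (gam 0 + del j) * (\<Sum>q<rY. l q * (\<Sum>p<r. \<Phi> q p * \<epsilon> m i p))"
        unfolding sum_distrib_left
        by (intro sum.cong refl) (simp add: \<Phi> twf_def j(2) power_add mult_ac)
      finally have "fps_X ^ ((gam 0 + del j) + gam j) dvd fps_X ^ (gam 0 + del j) * (\<Sum>q<rY. l q * (\<Sum>p<r. \<Phi> q p * \<epsilon> m i p))"
        using del_gam[OF j(1)] by (simp add: mult_2 add.assoc)
      then show "fps_X ^ gam j dvd (\<Sum>q<rY. l q * (\<Sum>p<r. \<Phi> q p * \<epsilon> m i p))" by (simp only: fps_X_power_dvd_cancel)
    qed
  qed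
  from Hom_of_matrix[OF F FY, of \<Phi>, OF this] obtain f where f: "f \<in> Hom R M Y"
    "\<And>m i q. m \<in> carrier M ==> i < n ==> q < rY ==> \<epsilon>Y (f m) i q = (\<Sum>p<r. \<Phi> q p * \<epsilon> m i p)" by blast
  have fb: "\<epsilon>Y (f (bas M r \<epsilon> p)) 0 q = \<Phi> q p" if "p < r" "q < rY" for p q
  proof -
    have "\<epsilon>Y (f (bas M r \<epsilon> p)) 0 q = (\<Sum>p'<r. \<Phi> q p' * \<epsilon> (bas M r \<epsilon> p) 0 p')"
      by (rule f(2)[OF bas_closed[OF M] n_pos that(2)])
    also have "... = \<Phi> q p * \<epsilon> (bas M r \<epsilon> p) 0 p"
      using that n_pos by (intro sum_eq_single) (auto simp: bas_frame[OF M])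
    finally show ?thesis using that n_pos by (simp add: bas_frame[OF M])
  qed
  have "(\<Sum>p<r. twf \<epsilon> (g (f (bas M r \<epsilon> p))) 0 p) = (\<Sum>p<r. \<Sum>q<rY. \<Phi> q p * G q p)"
  proof (intro sum.cong refl)
    fix p assume "p \<in> {..<r}"
    then have p: "p < r" by simp
    show "twf \<epsilon> (g (f (bas M r \<epsilon> p))) 0 p = (\<Sum>q<rY. \<Phi> q p * G q p)"
      using hom_matrix[OF Y FS g Hom_closed[OF f(1) bas_closed[OF M]] n_pos p] fb[OF p] by (simp add: G_def mult.commute)
  qed
  also have "... = (\<Sum>q<rY. \<Sum>p<r. \<Phi> q p * G q p)" by (rule sum.swap)
  finally have "fps_nth (\<Sum>q<rY. \<Sum>p<r. \<Phi> q p * G q p) (gam 0 - 1) = 0"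
    using zero[OF f(1)] by (simp add: rho_compose[OF M])
  \<comment> \<open>The residue representation at the pair with \<open>u = 0\<close> and
    \<open>a = 1\<close>; dividing \<open>h\<close> by \<open>t^(gam 0)\<close> moves the index from
    \<open>2 * gam 0 - 1\<close> to \<open>gam 0 - 1\<close>.\<close>
  moreover have "fps_nth (\<Sum>q<rY. \<Sum>p<r. \<Phi> q p * G q p) (gam 0 - 1) = 1"
  proof -
    let ?z = "\<lambda>x\<in>carrier Y. \<zero>\<^sub>S"
    have zz: "?z \<in> stably_zero R Y S" by (rule stably_zero_zero[OF LY LS])
    have "(\<Sum>q<rY. \<Sum>p<r. h q p * (twf \<epsilon> (?z (bas Y rY \<epsilon>Y q)) 0 p + fps_const 1 * G q p)) = fps_X ^ gam 0 * (\<Sum>q<rY. \<Sum>p<r. \<Phi> q p * G q p)"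
      unfolding sum_distrib_left using b n_pos by (intro sum.cong refl) (simp add: frame_zero[OF FS] \<Phi> mult_ac)
    then have "fps_nth (fps_X ^ gam 0 * (\<Sum>q<rY. \<Sum>p<r. \<Phi> q p * G q p)) (2 * gam 0 - 1) = 1" using h[OF zz, of 1] by simp
    moreover have "2 * gam 0 - 1 - gam 0 = gam 0 - 1" "\<not> 2 * gam 0 - 1 < gam 0" using gam_0_pos by auto
    ultimately show ?thesis by (simp only: fps_X_power_mult_nth if_False)
  qed
  ultimately show False by simp
qed

lemma is_serre_tw:
  fixes M :: "'r fmodule"
  assumes M: "M \<in> CM R"
  shows "is_serre R \<iota> M (tw k M)"
proof -
  obtain r \<epsilon> where N: "nframe M r \<epsilon>" using nframe_ex[OF M] by blast
  note F = nframe_frame[OF N]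
  note LM = frame_module[OF F]
  define S where "S = tw k M"
  have FS: "frame S r (twf \<epsilon>)" unfolding S_def by (rule frame_twf[OF F])
  note LS = frame_module[OF FS]
  have S: "S \<in> CM R" unfolding S_def by (rule CM_tw[OF M])
  have b: "bas M r \<epsilon> q \<in> carrier M" for q by (rule bas_closed[OF N])
  define \<eta> where "\<eta> = (\<lambda>(Y :: 'r fmodule) (g :: (nat \<Rightarrow> 'r) \<Rightarrow> nat \<Rightarrow> 'r) f. rho M r \<epsilon> (compose (carrier M) g f))"
  have \<eta>: "\<eta> Y g f = fps_nth (\<Sum>q<r. twf \<epsilon> (g (f (bas M r \<epsilon> q))) 0 q) (gam 0 - 1)" for Y g f
    unfolding \<eta>_def by (rule rho_compose[OF N])
  have gc: "g (f (bas M r \<epsilon> q)) \<in> carrier S" if "g \<in> Hom R Y S" "f \<in> Hom R M Y" for Y :: "'r fmodule" and g f q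
    by (rule Hom_closed[OF that(1) Hom_closed[OF that(2) b]])
  have "is_serre R \<iota> M S" unfolding is_serre_def
  proof (intro conjI exI[of _ \<eta>] ballI allI)
    fix Y :: "'r fmodule" and g assume Y: "Y \<in> CM R" and g: "g \<in> Hom R Y S"
    have LY: "left_module R Y" using Y by (rule CM_module)
    show "\<eta> Y g \<in> stable_dual R \<iota> M Y" unfolding stable_dual_def mem_Collect_eq
    proof (intro conjI ballI allI)
      fix f f' assume f: "f \<in> Hom R M Y" "f' \<in> Hom R M Y"
      show "\<eta> Y g (hom_add M Y f f') = \<eta> Y g f + \<eta> Y g f'"
        using b gc[OF g f(1)] gc[OF g f(2)] n_pos Hom_closed[OF f(1) b] Hom_closed[OF f(2) b]
        by (simp add: \<eta> hom_add_def Hom_add[OF g] frame_add[OF FS] sum.distrib)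
    next
      fix c f assume f: "f \<in> Hom R M Y"
      show "\<eta> Y g (hom_scale M Y (\<iota> c) f) = c * \<eta> Y g f"
        using b gc[OF g f] n_pos Hom_closed[OF f b]
        by (simp add: \<eta> hom_scale_def Hom_smult[OF g] iota_zeta frame_zeta[OF FS] flip: sum_distrib_left)
    next
      fix f assume "f \<in> stably_zero R M Y"
      then have "compose (carrier M) g f \<in> stably_zero R M S" using g by (rule stably_zero_compose_l[OF LM])
      then show "\<eta> Y g f = 0" unfolding \<eta>_def S_def by (rule rho_stably_zero[OF N])
    qed
    show "\<eta> Y (hom_add Y S g g') f = \<eta> Y g f + \<eta> Y g' f" if g': "g' \<in> Hom R Y S" and f: "f \<in> Hom R M Y" for g' f
      using gc[OF g f] gc[OF g' f] n_pos Hom_closed[OF f b] by (simp add: \<eta> hom_add_def frame_add[OF FS] sum.distrib)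
    show "\<eta> Y (hom_scale Y S (\<iota> c) g) f = c * \<eta> Y g f" if f: "f \<in> Hom R M Y" for c f
      using gc[OF g f] n_pos Hom_closed[OF f b] by (simp add: \<eta> hom_scale_def iota_zeta frame_zeta[OF FS] flip: sum_distrib_left)
    obtain rY \<epsilon>Y where NY: "nframe Y rY \<epsilon>Y" using nframe_ex[OF Y] by blast
    show "(\<forall>f\<in>Hom R M Y. \<eta> Y g f = 0) = (g \<in> stably_zero R Y S)"
    proof
      assume "\<forall>f\<in>Hom R M Y. \<eta> Y g f = 0"
      then show "g \<in> stably_zero R Y S"
        using g unfolding S_def \<eta>_def by (intro serre_nondegenerate[OF N NY]) auto
    next
      assume gz: "g \<in> stably_zero R Y S"
      show "\<forall>f\<in>Hom R M Y. \<eta> Y g f = 0"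
      proof
        fix f assume "f \<in> Hom R M Y"
        then have "compose (carrier M) g f \<in> stably_zero R M S" by (rule stably_zero_compose_r[OF LM gz])
        then show "\<eta> Y g f = 0" unfolding \<eta>_def S_def by (rule rho_stably_zero[OF N])
      qed
    qed
  next
    fix Y :: "'r fmodule" and \<phi> assume Y: "Y \<in> CM R" and \<phi>: "\<phi> \<in> stable_dual R \<iota> M Y"
    obtain rY \<epsilon>Y where NY: "nframe Y rY \<epsilon>Y" using nframe_ex[OF Y] by blast
    show "\<exists>g\<in>Hom R Y S. \<forall>f\<in>Hom R M Y. \<eta> Y g f = \<phi> f" unfolding S_def \<eta>_def by (rule serre_surj[OF N NY \<phi>])
  next
    fix Y Y' :: "'r fmodule" and h g f assume h: "h \<in> Hom R Y Y'" and f: "f \<in> Hom R M Y"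
    show "\<eta> Y (compose (carrier Y) g h) f = \<eta> Y' g (compose (carrier M) h f)"
      unfolding \<eta>_def using compose_assoc'[OF f] by metis
  qed (rule S)
  then show ?thesis unfolding S_def .
qed

end

context tiled
begin

section \<open>Matrix factorisations\<close>

lemma sig_pow_E: "j < n ==> (sig ^^ a) (E j) = E (wend n (replicate a True) j)"
proof (induction a)
  case (Suc a)
  have "stp n True (wend n (replicate a True) j) = wend n (replicate a True) (stp n True j)"
    using wcost_shift(1)[OF Suc.prems k1 nk] by simp
  then show ?case using Suc sig_E wend_less by simp
qed simp

lemma x_pow_E: "j < n ==> E (wend n (replicate a True) j) \<otimes> x [^] a = x [^] a \<otimes> E j"
  unfolding x_pow by (rule wel_E)

lemma fps_module_ups: "left_module R M ==> fps_module R M \<upsilon>"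
  by (rule fps_module.intro) (auto simp: ups_closed ups_add ups_mult ups_one)

text \<open>The idempotents do not commute with \<open>y\<close>: in \<open>E i y^b E j\<close> only
  those powers survive that lead from \<open>j\<close> to \<open>i\<close>.\<close>

lemma ups_E:
  assumes i: "i < n" and j: "j < n"
  shows "E i \<otimes> (\<upsilon> q \<otimes> E j) = \<upsilon> (Abs_fps (\<lambda>b. if wend n (replicate b False) j = i then fps_nth q b else 0)) \<otimes> E j"
    (is "_ = \<upsilon> ?q \<otimes> _")
proof (rule mat_inj)
  fix a l assume al: "a < n" "l < n"
  have "mat (\<upsilon> ?q) a j = (if a = i then mat (\<upsilon> q) i j else 0)"
  proof (rule fps_ext)
    fix m
    show "fps_nth (mat (\<upsilon> ?q) a j) m = fps_nth (if a = i then mat (\<upsilon> q) i j else 0) m"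
    proof (cases "\<exists>b. replicate b False \<in> wset n k a j m")
      case True
      then obtain b where b: "replicate b False \<in> wset n k a j m" by blast
      then have "wend n (replicate b False) j = a" by (simp add: wset_def)
      then show ?thesis using mat_ups_y[OF al(1) j b] by auto
    next
      case False
      then show ?thesis using mat_ups_0[OF al(1) j, of m] by auto
    qed
  qed
  then show "mat (E i \<otimes> (\<upsilon> q \<otimes> E j)) a l = mat (\<upsilon> ?q \<otimes> E j) a l"
    using al i j by (simp add: mat_E_left mat_E_right ups_closed)
qed (simp_all add: ups_closed)

text \<open>\<open>R E\<^sub>j\<close> is free over \<open>\<complex>[[y]]\<close> on \<open>1, x, \<dots>, x\<^sup>k\<^sup>-\<^sup>1\<close>; \<open>kap c j\<close> is the coefficient of \<open>x\<^sup>c\<close>.\<close>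

abbreviation yx :: "nat \<Rightarrow> nat \<Rightarrow> bool list" where "yx b c \<equiv> replicate b False @ replicate c True"

definition kap :: "nat \<Rightarrow> nat \<Rightarrow> 'r \<Rightarrow> complex fps" where
  "kap c j r = Abs_fps (\<lambda>b. fps_nth (mat r (wend n (yx b c) j) j) (wcost n k (yx b c) j))"

lemma kap_nth: "fps_nth (kap c j r) b = fps_nth (mat r (wend n (yx b c) j) j) (wcost n k (yx b c) j)"
  by (simp add: kap_def)

lemma kap_add: "j < n ==> r \<in> carrier R ==> s \<in> carrier R ==> kap c j (r \<oplus> s) = kap c j r + kap c j s"
  by (rule fps_ext) (simp add: kap_nth mat_add wend_less)

lemma kap_iota: "j < n ==> r \<in> carrier R ==> kap c j (\<iota> a \<otimes> r) = fps_const a * kap c j r"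
  by (rule fps_ext) (simp add: kap_nth iota_zeta mat_zeta_left wend_less)

lemma kap_zero: "j < n ==> kap c j \<zero> = 0"
  by (rule fps_ext) (simp add: kap_nth mat_zero wend_less)

lemma kap_finsum:
  assumes "finite A" "\<And>a. a \<in> A ==> f a \<in> carrier R" "j < n"
  shows "kap c j (\<Oplus>a\<in>A. f a) = (\<Sum>a\<in>A. kap c j (f a))"
  using assms
  by (induction A rule: finite_induct) (simp_all add: kap_zero kap_add R.finsum_insert Pi_def R.finsum_closed)

lemma mat_gen_shift:
  assumes "r \<in> carrier R" "i < n" "j < n"
  shows "fps_nth (mat (wel [g] \<otimes> r) (stp n g i) j) (m + scost n k g i) = fps_nth (mat r i j) m"
  using mat_wel_left[OF assms, of "[g]"] by (simp add: fps_X_power_mult_nth)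

text \<open>A nonzero coefficient of \<open>wel [g] \<otimes> r\<close> comes from a walk
  contributing to \<open>r\<close> with the letter \<open>g\<close> appended.\<close>

lemma mat_gen_zero:
  assumes r: "r \<in> carrier R" and i: "i < n" and j: "j < n"
    and no: "\<And>w. wend n (w @ [g]) j = i ==> wcost n k (w @ [g]) j = m ==> False"
  shows "fps_nth (mat (wel [g] \<otimes> r) i j) m = 0"
proof (rule ccontr)
  assume nz: "fps_nth (mat (wel [g] \<otimes> r) i j) m \<noteq> 0"
  obtain i' where i': "i' < n" "wend n [g] i' = i" using wend_surj[OF i] by blast
  have e: "mat (wel [g] \<otimes> r) i j = fps_X ^ scost n k g i' * mat r i' j"
    using mat_wel_left[OF r i'(1) j, of "[g]"] i'(2) by simp
  then have ge: "scost n k g i' \<le> m" and "fps_nth (mat r i' j) (m - scost n k g i') \<noteq> 0"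
    using nz by (auto simp: fps_X_power_mult_nth split: if_splits)
  then obtain w where "w \<in> wset n k i' j (m - scost n k g i')" using mat_valid[OF r i'(1) j] by blast
  then show False using no[of w] i'(2) ge by (simp add: wset_def)
qed

lemma kap_x_Suc:
  assumes "r \<in> carrier R" "j < n"
  shows "kap (Suc c) j (x \<otimes> r) = kap c j r"
proof (rule fps_ext)
  fix b
  have "yx b (Suc c) = yx b c @ [True]" by (simp add: replicate_append_same)
  then have "wend n (yx b (Suc c)) j = stp n True (wend n (yx b c) j)"
    "wcost n k (yx b (Suc c)) j = wcost n k (yx b c) j + scost n k True (wend n (yx b c) j)"
    by (simp_all only: wend_append wcost_append wend.simps wcost.simps add_0_right)
  then show "fps_nth (kap (Suc c) j (x \<otimes> r)) b = fps_nth (kap c j r) b"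
    unfolding kap_nth x_def using mat_gen_shift[OF assms(1) wend_less[OF assms(2)] assms(2)] by (simp only:)
qed

text \<open>The term \<open>x^(k - 1)\<close> wraps around to \<open>x^k = y^(n - k)\<close>. Powers
  of \<open>y\<close> below \<open>n - k\<close> do not occur, since no walk equivalent to them ends
  with \<open>x\<close>.\<close>

lemma kap_x_0:
  assumes r: "r \<in> carrier R" and j: "j < n"
  shows "kap 0 j (x \<otimes> r) = fps_X ^ (n - k) * kap (k - 1) j r"
proof (rule fps_ext)
  fix b
  show "fps_nth (kap 0 j (x \<otimes> r)) b = fps_nth (fps_X ^ (n - k) * kap (k - 1) j r) b"
  proof (cases "b < n - k")
    case True
    have "fps_nth (mat (wel [True] \<otimes> r) (wend n (yx b 0) j) j) (wcost n k (yx b 0) j) = 0"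
    proof (rule mat_gen_zero[OF r wend_less[OF j] j])
      fix w assume "wend n (w @ [True]) j = wend n (yx b 0) j" "wcost n k (w @ [True]) j = wcost n k (yx b 0) j"
      then have "\<exists>q. int (count_list (w @ [True]) True) = int (count_list (yx b 0) True) + int k * q \<and>
          int (count_list (yx b 0) False) = int (count_list (w @ [True]) False) + int (n - k) * q"
        using wend_wcost_eq_iff[OF j k1 nk] by blast
      then obtain q where "int (count_list (w @ [True]) True) = int (count_list (yx b 0) True) + int k * q"
          "int (count_list (yx b 0) False) = int (count_list (w @ [True]) False) + int (n - k) * q" by blast
      then have q: "int (count_list w True) + 1 = int k * q" "int b = int (count_list w False) + int (n - k) * q"
        by (simp_all add: count_list_replicate)
      have "0 < int k * q" using q(1) by linarith
      then have "1 \<le> q" using k_pos by (simp add: zero_less_mult_iff)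
      then have "int (n - k) * 1 \<le> int (n - k) * q" by (intro mult_left_mono) auto
      then show False using q(2) True by linarith
    qed
    then show ?thesis using True by (simp only: kap_nth x_def fps_X_power_mult_nth if_True)
  next
    case False
    then obtain b' where b: "b = b' + (n - k)" by (metis add.commute le_Suc_ex not_less)
    have "wend n (yx b 0) j = wend n (yx b' (k - 1) @ [True]) j \<and> wcost n k (yx b 0) j = wcost n k (yx b' (k - 1) @ [True]) j"
      using k_pos by (subst wend_wcost_eq_iff[OF j k1 nk]) (auto simp: count_list_replicate b intro!: exI[of _ "- 1"])
    then have "wend n (yx b 0) j = stp n True (wend n (yx b' (k - 1)) j)"
      "wcost n k (yx b 0) j = wcost n k (yx b' (k - 1)) j + scost n k True (wend n (yx b' (k - 1)) j)"
      by (simp_all only: wend_append wcost_append wend.simps wcost.simps add_0_right)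
    then have "fps_nth (kap 0 j (x \<otimes> r)) b = fps_nth (kap (k - 1) j r) b'"
      unfolding kap_nth x_def using mat_gen_shift[OF r wend_less[OF j] j] by (simp only:)
    then show ?thesis using b by (simp add: fps_X_power_mult_nth)
  qed
qed

text \<open>The constant coefficient vanishes: to end with \<open>y\<close>, a word equivalent to
  \<open>x^c\<close> would have to exchange \<open>k\<close> letters \<open>x\<close>, and
  \<open>c < k\<close>.\<close>

lemma kap_y:
  assumes r: "r \<in> carrier R" and j: "j < n" and c: "c < k"
  shows "kap c j (y \<otimes> r) = fps_X * kap c j r"
proof (rule fps_ext)
  fix b
  show "fps_nth (kap c j (y \<otimes> r)) b = fps_nth (fps_X * kap c j r) b"
  proof (cases b)
    case 0
    have "fps_nth (mat (wel [False] \<otimes> r) (wend n (yx 0 c) j) j) (wcost n k (yx 0 c) j) = 0"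
    proof (rule mat_gen_zero[OF r wend_less[OF j] j])
      fix w assume "wend n (w @ [False]) j = wend n (yx 0 c) j" "wcost n k (w @ [False]) j = wcost n k (yx 0 c) j"
      then have *: "\<exists>q. int (count_list (w @ [False]) True) = int (count_list (yx 0 c) True) + int k * q \<and>
          int (count_list (yx 0 c) False) = int (count_list (w @ [False]) False) + int (n - k) * q"
        using wend_wcost_eq_iff[OF j k1 nk] by blast
      define e where "e = int (n - k)"
      obtain q where "int (count_list (w @ [False]) True) = int (count_list (yx 0 c) True) + int k * q"
          "int (count_list (yx 0 c) False) = int (count_list (w @ [False]) False) + e * q" using *[folded e_def] by blast
      then have q: "int (count_list w True) = int c + int k * q" "1 + int (count_list w False) + e * q = 0"
        by (simp_all add: count_list_replicate)
      have "e * q < 0" using q(2) by linarith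
      then have "q \<le> - 1" using k_less by (simp add: mult_less_0_iff e_def)
      then have "int k * q \<le> int k * (- 1)" by (intro mult_left_mono) auto
      then show False using q(1) c by linarith
    qed
    then show ?thesis using 0 by (simp only: kap_nth y_def) simp
  next
    case (Suc b')
    have "wend n (yx b c) j = wend n (yx b' c @ [False]) j \<and> wcost n k (yx b c) j = wcost n k (yx b' c @ [False]) j"
      by (subst wend_wcost_eq_iff[OF j k1 nk]) (auto simp: count_list_replicate Suc intro!: exI[of _ 0])
    then have "wend n (yx b c) j = stp n False (wend n (yx b' c) j)"
      "wcost n k (yx b c) j = wcost n k (yx b' c) j + scost n k False (wend n (yx b' c) j)"
      by (simp_all only: wend_append wcost_append wend.simps wcost.simps add_0_right)
    then have "fps_nth (kap c j (y \<otimes> r)) b = fps_nth (kap c j r) b'"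
      unfolding kap_nth y_def using mat_gen_shift[OF r wend_less[OF j] j] by (simp only:)
    then show ?thesis using Suc by simp
  qed
qed

lemma kap_E:
  assumes "r \<in> carrier R" "j < n" "i < n"
  shows "kap c j (E (wend n (replicate c True) i) \<otimes> r) =
    Abs_fps (\<lambda>b. if wend n (replicate b False) j = i then fps_nth (kap c j r) b else 0)"
proof (rule fps_ext)
  fix b
  have "wend n (yx b c) j = wend n (replicate c True) i \<longleftrightarrow> wend n (replicate b False) j = i"
    using wend_inj assms wend_less by auto
  then show "fps_nth (kap c j (E (wend n (replicate c True) i) \<otimes> r)) b =
      fps_nth (Abs_fps (\<lambda>b. if wend n (replicate b False) j = i then fps_nth (kap c j r) b else 0)) b"
    using assms by (cases "wend n (replicate b False) j = i") (simp_all add: kap_nth mat_E_left wend_less del: wend_append wcost_append)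
qed

lemma kap_inj:
  assumes r: "r \<in> carrier R" "r \<otimes> E j = r" "r' \<in> carrier R" "r' \<otimes> E j = r'" and j: "j < n"
    and eq: "\<And>c. c < k ==> kap c j r = kap c j r'"
  shows "r = r'"
proof (rule mat_inj[OF r(1,3)])
  fix i l assume il: "i < n" "l < n"
  show "mat r i l = mat r' i l"
  proof (cases "l = j")
    case False
    have "mat (r \<otimes> E j) i l = mat (r' \<otimes> E j) i l" using il j r(1,3) False by (simp add: mat_E_right)
    then show ?thesis using r by simp
  next
    case l: True
    show ?thesis
    proof (rule fps_ext)
      fix m
      show "fps_nth (mat r i l) m = fps_nth (mat r' i l) m"
      proof (cases "wset n k i j m = {}")
        case True
        then show ?thesis using mat_valid[OF r(1) il] mat_valid[OF r(3) il] l by metis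
      next
        case False
        then obtain w where w: "wend n w j = i" "wcost n k w j = m" by (auto simp: wset_def)
        \<comment> \<open>Normal form of a walk: \<open>k\<close> letters \<open>x\<close> at a time
          are traded for \<open>n - k\<close> letters \<open>y\<close> until fewer than
          \<open>k\<close> are left. So the coefficients \<open>kap\<close> for \<open>c < k\<close>
          see every entry of column \<open>j\<close>.\<close>
        define c b where "c = count_list w True mod k" and "b = count_list w False + (n - k) * (count_list w True div k)"
        have "wend n w j = wend n (yx b c) j \<and> wcost n k w j = wcost n k (yx b c) j"
        proof (subst wend_wcost_eq_iff[OF j k1 nk], intro exI conjI)
          have "count_list w True = c + k * (count_list w True div k)" unfolding c_def by simp
          then show "int (count_list w True) = int (count_list (yx b c) True) + int k * int (count_list w True div k)"
            by (simp add: count_list_replicate flip: of_nat_mult of_nat_add)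
          show "int (count_list (yx b c) False) = int (count_list w False) + int (n - k) * int (count_list w True div k)"
            by (simp add: count_list_replicate b_def)
        qed
        then have wbc: "wend n (yx b c) j = i" "wcost n k (yx b c) j = m" using w by simp_all
        have "c < k" using k_pos by (simp add: c_def)
        from arg_cong[OF eq[OF this], of "\<lambda>p. fps_nth p b"] show ?thesis unfolding kap_nth wbc l .
      qed
    qed
  qed
qed

lemma kap_ups:
  assumes j: "j < n"
  shows "c < k ==> d < k ==> kap c j (x [^] d \<otimes> (\<upsilon> q \<otimes> E j)) = (if c = d then q else 0)"
proof (induction d arbitrary: c)
  case 0
  show ?case
  proof (rule fps_ext)
    fix b
    have "fps_nth (kap c j (\<upsilon> q \<otimes> E j)) b = fps_nth (mat (\<upsilon> q) (wend n (yx b c) j) j) (wcost n k (yx b c) j)"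
      unfolding kap_nth using j wend_less by (simp add: mat_E_right ups_closed del: wend_append wcost_append)
    also have "... = (if c = 0 then fps_nth q b else 0)"
    proof (cases "c = 0")
      case True
      then show ?thesis using mat_ups_y[OF wend_less[OF j] j, of b "replicate b False"] by (simp add: wset_def)
    next
      case False
      have "replicate b' False \<notin> wset n k (wend n (yx b c) j) j (wcost n k (yx b c) j)" for b'
      proof
        assume "replicate b' False \<in> wset n k (wend n (yx b c) j) j (wcost n k (yx b c) j)"
        then have "wend n (yx b c) j = wend n (replicate b' False) j \<and> wcost n k (yx b c) j = wcost n k (replicate b' False) j"
          by (simp add: wset_def)
        then obtain q where "int c = int k * q" unfolding wend_wcost_eq_iff[OF j k1 nk] by (auto simp: count_list_replicate)
        then have "int k dvd int c" by simp
        then have "k dvd c" by (simp only: int_dvd_int_iff)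
        then show False using False 0 by (auto dest: dvd_imp_le)
      qed
      from mat_ups_0[OF wend_less[OF j] j this] show ?thesis using False by simp
    qed
    finally show "fps_nth (kap c j (x [^] (0::nat) \<otimes> (\<upsilon> q \<otimes> E j))) b = fps_nth (if c = 0 then q else 0) b"
      by (simp add: ups_closed)
  qed
next
  case (Suc d)
  let ?r = "x [^] d \<otimes> (\<upsilon> q \<otimes> E j)"
  have r: "?r \<in> carrier R" by (simp add: ups_closed)
  have "x [^] Suc d \<otimes> (\<upsilon> q \<otimes> E j) = x \<otimes> ?r"
    using R.nat_pow_Suc2[OF x_closed, of d] by (simp add: R.m_assoc ups_closed)
  moreover have "kap c j (x \<otimes> ?r) = (if c = Suc d then q else 0)"
  proof (cases c)
    case 0
    have "k - 1 < k" "d < k" "k - 1 \<noteq> d" using Suc.prems by auto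
    then show ?thesis using Suc.IH[of "k - 1"] kap_x_0[OF r j] 0 by simp
  next
    case (Suc c')
    then show ?thesis using Suc.IH[of c'] kap_x_Suc[OF r j] Suc.prems \<open>Suc d < k\<close> by simp
  qed
  ultimately show ?case by simp
qed

end

section \<open>Modules induced from the subalgebra generated by \<open>y\<close> and the
  idempotents\<close>

context tiled
begin

lemma zeta_X_pow: "\<zeta> (fps_X ^ m) = (x \<otimes> y) [^] (m :: nat)"
  by (induction m) (simp_all add: zeta_one zeta_mult zeta_X mult.commute[of fps_X])

lemma y_pow_n: "y [^] n = \<zeta> (fps_X ^ k)"
proof -
  have "y [^] n = y [^] (n - k) \<otimes> y [^] k" using k_less by (simp add: R.nat_pow_mult)
  then show ?thesis by (simp add: x_pow_k[symmetric] zeta_X_pow R.pow_mult_distrib[OF xy_commute])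
qed

text \<open>Generators over \<open>t\<close> also generate over \<open>y\<close>, because multiples
  of \<open>t\<close> are multiples of \<open>y\<close>. Splitting them by the idempotents first
  makes them homogeneous, and a minimal generating subset is a basis.\<close>

lemma homogeneous_basis:
  assumes M: "M \<in> CM R"
  shows "\<exists>(N::nat) \<beta> js. basis_of \<upsilon> M (carrier M) {..<N} \<beta> \<and> (\<forall>s<N. js s < n \<and> E (js s) \<odot>\<^sub>M \<beta> s = \<beta> s)"
proof -
  have LM: "left_module R M" and ts: "torsion_sep M" using M CM_module CM_torsion_sep by blast+
  obtain m e where b: "basis_of \<zeta> M (carrier M) {..<m::nat} e" using M CM_basis by blast
  interpret Z: fps_module R M \<zeta> by (rule fps_module_zeta[OF LM])
  interpret U: fps_module R M \<upsilon> by (rule fps_module_ups[OF LM])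
  have eM: "e q \<in> carrier M" if "q < m" for q using b that by (auto simp: basis_of_def)
  let ?G = "(\<lambda>(i, q). E i \<odot>\<^sub>M e q) ` ({..<n} \<times> {..<m})"
  have Gf: "finite ?G" and GM: "?G \<subseteq> carrier M" using eM by (auto intro!: lm_closed[OF LM])
  have Gm: "\<zeta> (fps_const a) \<odot>\<^sub>M (E i \<odot>\<^sub>M e q) \<in> cspan \<upsilon> M ?G" if "i < n" "q < m" for a i q
  proof -
    have "E i \<odot>\<^sub>M e q \<in> ?G" using that by (intro image_eqI[of _ _ "(i, q)"]) auto
    from U.cspan_mem[OF Gf GM this, of a] show ?thesis by (simp only: ups_const iota_zeta)
  qed
  have cs: "\<zeta> (fps_const a) \<odot>\<^sub>M e q \<in> cspan \<upsilon> M ?G" if q: "q < m" for a q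
  proof -
    have "e q = (\<Oplus>\<^bsub>M\<^esub> i\<in>{..<n}. E i \<odot>\<^sub>M e q)"
      using lm_finsum_l[OF LM, of "{..<n}" "e q" E] E_sum eM[OF q] by (simp add: lm_one[OF LM])
    then have "\<zeta> (fps_const a) \<odot>\<^sub>M e q = \<zeta> (fps_const a) \<odot>\<^sub>M (\<Oplus>\<^bsub>M\<^esub> i\<in>{..<n}. E i \<odot>\<^sub>M e q)" by simp
    also have "... = (\<Oplus>\<^bsub>M\<^esub> i\<in>{..<n}. \<zeta> (fps_const a) \<odot>\<^sub>M (E i \<odot>\<^sub>M e q))"
      using eM[OF q] by (intro lm_finsum_r[OF LM]) (auto intro!: lm_closed[OF LM])
    also have "... \<in> cspan \<upsilon> M ?G"
      using U.cspan_closed[OF Gf GM] U.cspan_zero[OF Gf GM] U.cspan_add[OF Gf GM] Gm[OF _ q]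
      by (intro Z.M.finsum_mem) auto
    finally show ?thesis .
  qed
  have cg: "cgen \<upsilon> M (carrier M) ?G"
    unfolding cgen_def
  proof (intro conjI ballI)
    fix d assume "d \<in> carrier M"
    then obtain p where p: "d = lincomb \<zeta> M {..<m} e p" using Z.basis_exD[OF b] by blast
    have ei: "e ` {..<m} \<subseteq> carrier M" using eM by auto
    have "p i = fps_const (fps_nth (p i) 0) + fps_X * fps_shift 1 (p i)" for i
      by (rule fps_ext) (auto simp: fps_X_mult_nth)
    then have "d = lincomb \<zeta> M {..<m} e (\<lambda>i. fps_const (fps_nth (p i) 0) + fps_X * fps_shift 1 (p i))"
      using p by simp
    then have d: "d = lincomb \<zeta> M {..<m} e (\<lambda>i. fps_const (fps_nth (p i) 0)) \<oplus>\<^sub>M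
        \<zeta> fps_X \<odot>\<^sub>M lincomb \<zeta> M {..<m} e (\<lambda>i. fps_shift 1 (p i))"
      unfolding Z.lincomb_add[OF ei] Z.lincomb_scale[OF finite_lessThan ei] .
    let ?d = "lincomb \<zeta> M {..<m} e (\<lambda>i. fps_shift 1 (p i))"
    have dc: "?d \<in> carrier M" by (rule Z.lincomb_closed[OF ei])
    have "lincomb \<zeta> M {..<m} e (\<lambda>i. fps_const (fps_nth (p i) 0)) \<in> cspan \<upsilon> M ?G"
      unfolding lincomb_def
      using U.cspan_closed[OF Gf GM] U.cspan_zero[OF Gf GM] U.cspan_add[OF Gf GM] cs
      by (intro Z.M.finsum_mem) auto
    \<comment> \<open>\<open>t d = y (x d)\<close>: the remainder modulo \<open>t\<close> is a
      remainder modulo \<open>y\<close>.\<close>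
    moreover have "\<zeta> fps_X \<odot>\<^sub>M ?d = \<upsilon> fps_X \<odot>\<^sub>M (x \<odot>\<^sub>M ?d)"
      using dc by (simp add: zeta_X ups_X xy_commute lm_assoc[OF LM])
    moreover have "x \<odot>\<^sub>M ?d \<in> carrier M" using dc by (intro lm_closed[OF LM]) auto
    ultimately show "\<exists>a\<in>cspan \<upsilon> M ?G. \<exists>d'\<in>carrier M. d = a \<oplus>\<^sub>M \<upsilon> fps_X \<odot>\<^sub>M d'" using d by metis
  qed (use Gf GM in auto)
  have "\<exists>G'\<subseteq>?G. basis_of \<upsilon> M (carrier M) G' id"
  proof (rule U.minimal_generators_basis[OF _ _ _ _ _ _ cg])
    fix d assume d: "d \<in> carrier M"
    assume "\<upsilon> fps_X \<odot>\<^sub>M d = \<zero>\<^sub>M"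
    then have "\<zeta> fps_X \<odot>\<^sub>M d = \<zero>\<^sub>M" using d by (simp add: zeta_X ups_X lm_assoc[OF LM] lm_zero_r[OF LM])
    then show "d = \<zero>\<^sub>M" using ts d unfolding torsion_sep_def by blast
  next
    fix d assume d: "d \<in> carrier M" and all: "\<And>N. \<exists>d'\<in>carrier M. d = \<upsilon> (fps_X ^ N) \<odot>\<^sub>M d'"
    have "\<exists>m'\<in>carrier M. d = \<zeta> (fps_X ^ N) \<odot>\<^sub>M m'" for N
    proof -
      obtain d' where d': "d' \<in> carrier M" "d = \<upsilon> (fps_X ^ (n * N)) \<odot>\<^sub>M d'" using all by blast
      \<comment> \<open>As \<open>y^n = t^k\<close>, divisibility by \<open>y^(n N)\<close> gives
        divisibility by \<open>t^(k N)\<close>, hence by \<open>t^N\<close>; so \<open>M\<close> is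
        separated for \<open>y\<close>.\<close>
      have "\<upsilon> (fps_X ^ (n * N)) = (y [^] n) [^] N" unfolding ups_X_pow by (simp add: R.nat_pow_pow)
      also have "... = ((x \<otimes> y) [^] N) \<otimes> ((x \<otimes> y) [^] ((k - 1) * N))"
      proof -
        have "N + (k - 1) * N = k * N" using k_pos by (simp add: mult_eq_if)
        then show ?thesis unfolding y_pow_n zeta_X_pow by (simp add: R.nat_pow_pow R.nat_pow_mult)
      qed
      finally have "d = \<zeta> (fps_X ^ N) \<odot>\<^sub>M ((x \<otimes> y) [^] ((k - 1) * N) \<odot>\<^sub>M d')"
        using d' by (simp add: zeta_X_pow lm_assoc[OF LM])
      moreover have "(x \<otimes> y) [^] ((k - 1) * N) \<odot>\<^sub>M d' \<in> carrier M" using d' by (intro lm_closed[OF LM]) auto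
      ultimately show ?thesis by blast
    qed
    then show "d = \<zero>\<^sub>M" using ts d unfolding torsion_sep_def by blast
  qed (auto intro: U.smult_closed)
  then obtain G' where G': "G' \<subseteq> ?G" "basis_of \<upsilon> M (carrier M) G' id" by blast
  obtain N :: nat and \<beta> where \<beta>: "\<beta> ` {..<N} = G'" "basis_of \<upsilon> M (carrier M) {..<N} \<beta>"
    using U.basis_reindex[OF G'(2) subset_refl] by blast
  have "\<exists>j. j < n \<and> E j \<odot>\<^sub>M \<beta> s = \<beta> s" if s: "s < N" for s
  proof -
    have "\<beta> s \<in> ?G" using \<beta>(1) G'(1) s by blast
    then obtain i q where iq: "i < n" "q < m" "\<beta> s = E i \<odot>\<^sub>M e q" by auto
    have "E i \<odot>\<^sub>M \<beta> s = (E i \<otimes> E i) \<odot>\<^sub>M e q" using iq eM by (simp add: lm_assoc[OF LM])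
    then show ?thesis using iq by (auto simp: E_idem)
  qed
  then show ?thesis using \<beta>(2) by metis
qed

text \<open>\<open>P\<close> is \<open>B \<otimes>\<^sub>A M\<close> for the subalgebra \<open>A\<close> generated by \<open>y\<close> and the idempotents, over which \<open>B\<close> is free
  on \<open>1, x, \<dots>, x\<^sup>k\<^sup>-\<^sup>1\<close>; an element \<open>p\<close> is the sum of the \<open>x\<^sup>k\<^sup>-\<^sup>1\<^sup>-\<^sup>e \<otimes> T p e\<close> for \<open>e < k\<close>.\<close>

definition induced :: "('r, 'm) module \<Rightarrow> ('r, 'p) module \<Rightarrow> ('p \<Rightarrow> nat \<Rightarrow> 'm) \<Rightarrow> bool" where
  "induced M P T \<longleftrightarrow>
     (\<forall>p\<in>carrier P. \<forall>e<k. T p e \<in> carrier M) \<and>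
     (\<forall>p\<in>carrier P. \<forall>q\<in>carrier P. \<forall>e<k. T (p \<oplus>\<^sub>P q) e = T p e \<oplus>\<^sub>M T q e) \<and>
     (\<forall>p\<in>carrier P. \<forall>q\<in>carrier P. (\<forall>e<k. T p e = T q e) \<longrightarrow> p = q) \<and>
     (\<forall>v. (\<forall>e<k. v e \<in> carrier M) \<longrightarrow> (\<exists>p\<in>carrier P. \<forall>e<k. T p e = v e)) \<and>
     (\<forall>p\<in>carrier P. \<forall>a. \<forall>e<k. T (\<iota> a \<odot>\<^sub>P p) e = \<iota> a \<odot>\<^sub>M T p e) \<and>
     (\<forall>p\<in>carrier P. \<forall>e. Suc e < k \<longrightarrow> T (x \<odot>\<^sub>P p) e = T p (Suc e)) \<and>
     (\<forall>p\<in>carrier P. T (x \<odot>\<^sub>P p) (k - 1) = y [^] (n - k) \<odot>\<^sub>M T p 0) \<and>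
     (\<forall>p\<in>carrier P. \<forall>e<k. T (y \<odot>\<^sub>P p) e = y \<odot>\<^sub>M T p e) \<and>
     (\<forall>p\<in>carrier P. \<forall>i<n. \<forall>e<k. T (E (wend n (replicate (k - 1 - e) True) i) \<odot>\<^sub>P p) e = E i \<odot>\<^sub>M T p e)"

text \<open>A homogeneous basis element \<open>\<beta> s\<close> spans a copy of
  \<open>A E_(js s)\<close>, so inducing gives the sum of the \<open>R E_(js s)\<close>. The
  component \<open>e\<close> of \<open>p\<close> applies the coefficients of
  \<open>x^(k - 1 - e)\<close> to the basis; with this order \<open>x\<close> shifts components
  down.\<close>

lemma induced_ex:
  fixes M :: "'r fmodule"
  assumes M: "M \<in> CM R"
  shows "\<exists>(P :: 'r fmodule) T. P \<in> CM R \<and> projective R P \<and> induced M P T"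
proof -
  have LM: "left_module R M" using M by (rule CM_module)
  obtain N :: nat and \<beta> js where b: "basis_of \<upsilon> M (carrier M) {..<N} \<beta>"
    and js: "\<And>s. s < N ==> js s < n" and jE: "\<And>s. s < N ==> E (js s) \<odot>\<^sub>M \<beta> s = \<beta> s"
    using homogeneous_basis[OF M] by blast
  interpret U: fps_module R M \<upsilon> by (rule fps_module_ups[OF LM])
  have \<beta>M: "\<beta> ` {..<N} \<subseteq> carrier M" using b by (auto simp: basis_of_def)
  define P where "P = fmod R N (\<lambda>s. E (js s))"
  have u: "\<And>s. s < N ==> E (js s) \<in> carrier R" "\<And>s. s < N ==> E (js s) \<otimes> E (js s) = E (js s)"
    using js by (auto simp: E_idem)
  let ?u = "\<lambda>s. E (js s)"
  have fm: "p \<in> carrier P \<longleftrightarrow> (\<forall>s<N. p s \<in> carrier R \<and> p s \<otimes> ?u s = p s) \<and> (\<forall>s\<ge>N. p s = \<zero>)"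
    "p \<oplus>\<^sub>P q = (\<lambda>s. p s \<oplus> q s)" "a \<odot>\<^sub>P p = (\<lambda>s. a \<otimes> p s)" for p q a
    unfolding P_def
    by (rule fmod_carrier[OF R_ring], use u in auto, rule fmod_add[OF R_ring], use u in auto, rule fmod_smult[OF R_ring], use u in auto)
  have Pcl: "p s \<in> carrier R" if "p \<in> carrier P" for p s
    using that by (cases "s < N") (auto simp: fm)
  define T where "T p e = lincomb \<upsilon> M {..<N} \<beta> (\<lambda>s. kap (k - 1 - e) (js s) (p s))" for p e
  have cong: "lincomb \<upsilon> M {..<N} \<beta> p = lincomb \<upsilon> M {..<N} \<beta> q" if "\<And>s. s < N ==> p s = q s" for p q
    using that by (intro U.lincomb_cong[OF \<beta>M]) auto
  have "induced M P T"
    unfolding induced_def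
  proof (intro conjI ballI allI impI)
    fix p e assume p: "p \<in> carrier P" and e: "e < k"
    show "T p e \<in> carrier M" unfolding T_def by (rule U.lincomb_closed[OF \<beta>M])
    show "T (\<iota> a \<odot>\<^sub>P p) e = \<iota> a \<odot>\<^sub>M T p e" for a
      unfolding T_def ups_const[symmetric] U.lincomb_scale[OF finite_lessThan \<beta>M, symmetric]
      using js Pcl[OF p] by (intro cong) (simp add: fm kap_iota ups_const)
    show "T (y \<odot>\<^sub>P p) e = y \<odot>\<^sub>M T p e"
      unfolding T_def ups_X[symmetric] U.lincomb_scale[OF finite_lessThan \<beta>M, symmetric]
      using js Pcl[OF p] e by (intro cong) (simp add: fm kap_y ups_X)
    fix i assume i: "i < n"
    let ?q = "\<lambda>s. Abs_fps (\<lambda>b. if wend n (replicate b False) (js s) = i then fps_nth (kap (k - 1 - e) (js s) (p s)) b else 0)"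
    have "E i \<odot>\<^sub>M T p e = (\<Oplus>\<^bsub>M\<^esub> s\<in>{..<N}. E i \<odot>\<^sub>M (\<upsilon> (kap (k - 1 - e) (js s) (p s)) \<odot>\<^sub>M \<beta> s))"
      unfolding T_def lincomb_def using \<beta>M by (intro lm_finsum_r[OF LM]) (auto intro!: U.smult_closed)
    also have "... = (\<Oplus>\<^bsub>M\<^esub> s\<in>{..<N}. \<upsilon> (?q s) \<odot>\<^sub>M \<beta> s)"
    proof (intro U.M.finsum_cong')
      fix s assume "s \<in> {..<N}"
      then have s: "s < N" and bs: "\<beta> s \<in> carrier M" using \<beta>M by auto
      have "E i \<odot>\<^sub>M (\<upsilon> q \<odot>\<^sub>M \<beta> s) = (E i \<otimes> (\<upsilon> q \<otimes> E (js s))) \<odot>\<^sub>M \<beta> s" for q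
        using bs jE[OF s] by (simp add: lm_assoc[OF LM] ups_closed lm_closed[OF LM])
      also have "(E i \<otimes> (\<upsilon> q \<otimes> E (js s))) \<odot>\<^sub>M \<beta> s = \<upsilon> (Abs_fps (\<lambda>b. if wend n (replicate b False) (js s) = i then fps_nth q b else 0)) \<odot>\<^sub>M \<beta> s" for q
        unfolding ups_E[OF i js[OF s]] using bs jE[OF s] by (simp add: lm_assoc[OF LM] ups_closed)
      finally show "E i \<odot>\<^sub>M (\<upsilon> (kap (k - 1 - e) (js s) (p s)) \<odot>\<^sub>M \<beta> s) = \<upsilon> (?q s) \<odot>\<^sub>M \<beta> s" .
    qed (use \<beta>M in \<open>auto intro!: U.smult_closed\<close>)
    also have "... = lincomb \<upsilon> M {..<N} \<beta> ?q" by (simp add: lincomb_def)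
    also have "... = T (E (wend n (replicate (k - 1 - e) True) i) \<odot>\<^sub>P p) e"
      unfolding T_def using kap_E[OF Pcl[OF p] js i] by (intro cong) (simp only: fm)
    finally show "T (E (wend n (replicate (k - 1 - e) True) i) \<odot>\<^sub>P p) e = E i \<odot>\<^sub>M T p e" ..
  next
    fix p q e assume p: "p \<in> carrier P" and q: "q \<in> carrier P"
    show "T (p \<oplus>\<^sub>P q) e = T p e \<oplus>\<^sub>M T q e"
      unfolding T_def U.lincomb_add[OF \<beta>M, symmetric]
      using js Pcl[OF p] Pcl[OF q] by (intro cong) (simp add: fm kap_add)
  next
    fix p q assume p: "p \<in> carrier P" and q: "q \<in> carrier P" and eq: "\<forall>e<k. T p e = T q e"
    have "p s = q s" for s
    proof (cases "s < N")
      case True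
      show ?thesis
      proof (rule kap_inj[OF _ _ _ _ js[OF True]])
        fix c assume c: "c < k"
        have "T p (k - 1 - c) = T q (k - 1 - c)" using eq c by simp
        then show "kap c (js s) (p s) = kap c (js s) (q s)"
          using U.basis_eqD[OF b subset_refl, of "\<lambda>s. kap c (js s) (p s)" "\<lambda>s. kap c (js s) (q s)" s] True c
          by (simp add: T_def)
      qed (use p q True in \<open>auto simp: fm\<close>)
    qed (use p q in \<open>auto simp: fm\<close>)
    then show "p = q" by (simp add: fun_eq_iff)
  next
    fix v assume v: "\<forall>e<k. v e \<in> carrier M"
    have "\<exists>Q. e < k \<longrightarrow> v e = lincomb \<upsilon> M {..<N} \<beta> Q" for e using v U.basis_exD[OF b] by blast
    then obtain Q where Q: "\<And>e. e < k ==> v e = lincomb \<upsilon> M {..<N} \<beta> (Q e)" by metis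
    \<comment> \<open>Component \<open>e\<close> belongs to \<open>x^(k - 1 - e)\<close>, so
      \<open>x^d\<close> carries the coefficients \<open>Q (k - 1 - d)\<close>.\<close>
    define p where "p s = (if s < N then \<Oplus>d\<in>{..<k}. x [^] d \<otimes> (\<upsilon> (Q (k - 1 - d) s) \<otimes> E (js s)) else \<zero>)" for s
    have t: "x [^] (d::nat) \<otimes> (\<upsilon> q \<otimes> E j) \<in> carrier R" for d q j by (simp add: ups_closed)
    have pP: "p \<in> carrier P"
      unfolding fm
    proof (intro conjI allI impI)
      fix s assume s: "s < N"
      show "p s \<in> carrier R" using t s by (simp add: p_def R.finsum_closed)
      have "p s \<otimes> E (js s) = (\<Oplus>d\<in>{..<k}. (x [^] d \<otimes> (\<upsilon> (Q (k - 1 - d) s) \<otimes> E (js s))) \<otimes> E (js s))"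
        using t s by (simp add: p_def R.finsum_ldistr)
      also have "... = p s"
        using t s js[OF s] by (simp add: p_def R.m_assoc ups_closed E_idem)
      finally show "p s \<otimes> E (js s) = p s" .
    qed (simp add: p_def)
    moreover have "T p e = v e" if e: "e < k" for e
      unfolding T_def Q[OF e]
    proof (rule cong)
      fix s assume s: "s < N"
      have "kap (k - 1 - e) (js s) (p s) = (\<Sum>d<k. kap (k - 1 - e) (js s) (x [^] d \<otimes> (\<upsilon> (Q (k - 1 - d) s) \<otimes> E (js s))))"
        using kap_finsum[OF finite_lessThan t js[OF s]] s by (simp add: p_def)
      also have "... = (\<Sum>d<k. if k - 1 - e = d then Q (k - 1 - d) s else 0)"
        using kap_ups[OF js[OF s]] e by (intro sum.cong) auto
      also have "... = Q e s" using e by simp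
      finally show "kap (k - 1 - e) (js s) (p s) = Q e s" .
    qed
    ultimately show "\<exists>p\<in>carrier P. \<forall>e<k. T p e = v e" by blast
  next
    fix p e assume p: "p \<in> carrier P" and e: "Suc e < k"
    have "k - 1 - e = Suc (k - 1 - Suc e)" using e by simp
    then have "T (x \<odot>\<^sub>P p) e = lincomb \<upsilon> M {..<N} \<beta> (\<lambda>s. kap (Suc (k - 1 - Suc e)) (js s) (x \<otimes> p s))"
      by (simp only: T_def fm)
    also have "... = T p (Suc e)"
      unfolding T_def using js Pcl[OF p] by (intro cong) (simp only: kap_x_Suc)
    finally show "T (x \<odot>\<^sub>P p) e = T p (Suc e)" .
  next
    fix p assume p: "p \<in> carrier P"
    show "T (x \<odot>\<^sub>P p) (k - 1) = y [^] (n - k) \<odot>\<^sub>M T p 0"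
      unfolding T_def ups_X_pow[symmetric] U.lincomb_scale[OF finite_lessThan \<beta>M, symmetric]
      using js Pcl[OF p] by (intro cong) (simp add: fm kap_x_0)
  qed
  moreover have "P \<in> CM R" unfolding P_def by (rule fmod_CM) (use u in auto)
  moreover have "projective R P" unfolding P_def by (rule fmod_projective[OF R_ring]) (use u in auto)
  ultimately show ?thesis by blast
qed

end

context tiled
begin

lemma
  assumes "induced M P T"
  shows induced_closed: "p \<in> carrier P ==> e < k ==> T p e \<in> carrier M"
    and induced_add: "p \<in> carrier P ==> q \<in> carrier P ==> e < k ==> T (p \<oplus>\<^sub>P q) e = T p e \<oplus>\<^sub>M T q e"
    and induced_inj: "p \<in> carrier P ==> q \<in> carrier P ==> (\<And>e. e < k ==> T p e = T q e) ==> p = q"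
    and induced_surj: "(\<And>e. e < k ==> v e \<in> carrier M) ==> \<exists>p. p \<in> carrier P \<and> (\<forall>e<k. T p e = v e)"
    and induced_iota: "p \<in> carrier P ==> e < k ==> T (\<iota> a \<odot>\<^sub>P p) e = \<iota> a \<odot>\<^sub>M T p e"
    and induced_x: "p \<in> carrier P ==> Suc e < k ==> T (x \<odot>\<^sub>P p) e = T p (Suc e)"
    and induced_x_top: "p \<in> carrier P ==> T (x \<odot>\<^sub>P p) (k - 1) = y [^] (n - k) \<odot>\<^sub>M T p 0"
    and induced_y: "p \<in> carrier P ==> e < k ==> T (y \<odot>\<^sub>P p) e = y \<odot>\<^sub>M T p e"
    and induced_E: "p \<in> carrier P ==> i < n ==> e < k ==>
      T (E (wend n (replicate (k - 1 - e) True) i) \<odot>\<^sub>P p) e = E i \<odot>\<^sub>M T p e"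
  using assms unfolding induced_def by (simp_all add: Bex_def)

text \<open>Horner's scheme for the sum of the \<open>x^(e - 1 - i) v_i\<close>. At
  \<open>e = k\<close> and \<open>v = T p\<close> it is the multiplication
  \<open>B \<otimes>\<^sub>A M \<rightarrow> M\<close>; the values before are the coefficients of
  the quotient by \<open>X - x\<close>.\<close>

primrec horner :: "('r, 'm) module \<Rightarrow> (nat \<Rightarrow> 'm) \<Rightarrow> nat \<Rightarrow> 'm" where
  "horner M v 0 = \<zero>\<^sub>M"
| "horner M v (Suc e) = v e \<oplus>\<^sub>M x \<odot>\<^sub>M horner M v e"

lemma x_E: "i < n ==> x \<otimes> E i = E (stp n True i) \<otimes> x"
  using wel_E[of i "[True]"] by (simp add: x_def)

lemma y_pow_x: "y [^] (m :: nat) \<otimes> x = x \<otimes> y [^] m"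
  by (rule R.group_commutes_pow) (simp_all add: xy_commute)

lemma horner_closed:
  assumes "left_module R M"
  shows "(\<And>e. e < a ==> v e \<in> carrier M) ==> horner M v a \<in> carrier M"
proof (induction a)
  interpret M: abelian_group M by (rule lm_grp[OF assms])
  case 0 show ?case by simp
next
  interpret M: abelian_group M by (rule lm_grp[OF assms])
  case (Suc a)
  then show ?case using lm_closed[OF assms x_closed] by simp
qed

text \<open>The resolution \<open>0 \<rightarrow> M \<rightarrow> B \<otimes>\<^sub>A M \<rightarrow> B \<otimes>\<^sub>A M \<rightarrow> M \<rightarrow> 0\<close> (up to twists). Its middle map is
  \<open>x \<otimes> 1 - 1 \<otimes> x\<close> and the map from \<open>M\<close> is \<open>\<Sum>\<^sub>e x\<^sup>k\<^sup>-\<^sup>1\<^sup>-\<^sup>e \<otimes> x\<^sup>e\<close>, corresponding to the factorisation of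
  \<open>X\<^sup>k - x\<^sup>k\<close> by \<open>X - x\<close>.\<close>

lemma koszul:
  fixes M :: "'r fmodule"
  assumes M: "M \<in> CM R"
  shows "\<exists>K. is_syzygy R M K \<and> is_syzygy R (tw k K) M"
proof -
  obtain P :: "'r fmodule" and T where P: "P \<in> CM R" and prj: "projective R P" and I: "induced M P T"
    using induced_ex[OF M] by blast
  have LM: "left_module R M" and LP: "left_module R P" using M P CM_module by blast+
  interpret M: abelian_group M by (rule lm_grp[OF LM])
  interpret P: abelian_group P by (rule lm_grp[OF LP])
  note TM = induced_closed[OF I] and T_inj = induced_inj[OF I] and T_add = induced_add[OF I]
    and T_x = induced_x[OF I] and T_top = induced_x_top[OF I]
  have aM: "a \<odot>\<^sub>M m \<in> carrier M" if "a \<in> carrier R" "m \<in> carrier M" for a m by (rule lm_closed[OF LM that])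
  have aP: "a \<odot>\<^sub>P m \<in> carrier P" if "a \<in> carrier R" "m \<in> carrier P" for a m by (rule lm_closed[OF LP that])
  have T0: "T \<zero>\<^sub>P e = \<zero>\<^sub>M" if e: "e < k" for e
    using T_add[of "\<zero>\<^sub>P" "\<zero>\<^sub>P" e] TM[of "\<zero>\<^sub>P" e] e by simp
  have comm: "a \<odot>\<^sub>M (x \<odot>\<^sub>M m) = x \<odot>\<^sub>M (a \<odot>\<^sub>M m)" if "a \<otimes> x = x \<otimes> a" "a \<in> carrier R" "m \<in> carrier M" for a m
    using that by (simp add: lm_assoc[OF LM, symmetric])
  have kk: "k = Suc (k - 1)" using k_pos by simp
  have last: "e = k - 1" if "e < k" "\<not> Suc e < k" for e using that by simp

  define pi where "pi = (\<lambda>p\<in>carrier P. horner M (T p) k)"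
  have hc: "horner M (T p) e \<in> carrier M" if "p \<in> carrier P" "e \<le> k" for p e
    using that TM by (intro horner_closed[OF LM]) auto
  have pi: "pi \<in> Hom R P M"
  proof (rule tiled_HomI[OF LP LM CM_torsion_sep[OF M]])
    fix p q assume pq: "p \<in> carrier P" "q \<in> carrier P"
    have "e \<le> k ==> horner M (T (p \<oplus>\<^sub>P q)) e = horner M (T p) e \<oplus>\<^sub>M horner M (T q) e" for e
    proof (induction e)
      case (Suc e)
      then show ?case
        using pq hc[of p e] hc[of q e] TM[of p e] TM[of q e] aM[OF x_closed]
        by (simp add: T_add lm_r_distr[OF LM] M.a_ac)
    qed simp
    then show "pi (p \<oplus>\<^sub>P q) = pi p \<oplus>\<^sub>M pi q" using pq by (simp add: pi_def)
  next
    fix c p assume p: "p \<in> carrier P"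
    have "e \<le> k ==> horner M (T (\<iota> c \<odot>\<^sub>P p)) e = \<iota> c \<odot>\<^sub>M horner M (T p) e" for e
    proof (induction e)
      case 0 show ?case by (simp add: lm_zero_r[OF LM] iota_closed)
    next
      case (Suc e)
      then show ?case using p hc[of p e] TM[of p e] aM[OF x_closed] zeta_commute[of x "fps_const c"]
        by (simp add: induced_iota[OF I, unfolded iota_zeta] lm_r_distr[OF LM] iota_zeta comm)
    qed
    then show "pi (\<iota> c \<odot>\<^sub>P p) = \<iota> c \<odot>\<^sub>M pi p" using p aP iota_closed by (simp add: pi_def)
    have "e \<le> k ==> horner M (T (y \<odot>\<^sub>P p)) e = y \<odot>\<^sub>M horner M (T p) e" for e
    proof (induction e)
      case 0 show ?case by (simp add: lm_zero_r[OF LM])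
    next
      case (Suc e)
      then show ?case using p hc[of p e] TM[of p e] aM[OF x_closed] xy_commute
        by (simp add: induced_y[OF I] lm_r_distr[OF LM] comm)
    qed
    then show "pi (y \<odot>\<^sub>P p) = y \<odot>\<^sub>M pi p" using p aP by (simp add: pi_def)
    \<comment> \<open>Acting by \<open>x\<close> shifts the components down by one, so the two
      schemes differ by the contribution of component 0. It reenters at the top as
      \<open>y^(n - k) = x^k\<close>.\<close>
    have "Suc e \<le> k ==> horner M (T p) (Suc e) = horner M (T (x \<odot>\<^sub>P p)) e \<oplus>\<^sub>M x [^] e \<odot>\<^sub>M T p 0" for e
    proof (induction e)
      case 0
      then show ?case using TM[OF p, of 0] by (simp add: lm_zero_r[OF LM] lm_one[OF LM])
    next
      case (Suc e)
      let ?h = "horner M (T (x \<odot>\<^sub>P p)) e" and ?t = "T p 0"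
      have cl: "?h \<in> carrier M" "?t \<in> carrier M" "T p (Suc e) \<in> carrier M" "x [^] e \<odot>\<^sub>M ?t \<in> carrier M"
        using Suc.prems hc[of "x \<odot>\<^sub>P p" e] aP[OF x_closed p] TM[OF p] aM by auto
      have "x \<odot>\<^sub>M (x [^] e \<odot>\<^sub>M ?t) = x [^] Suc e \<odot>\<^sub>M ?t"
        using cl R.nat_pow_Suc2[OF x_closed, of e] by (simp add: lm_assoc[OF LM, symmetric])
      then have "x \<odot>\<^sub>M horner M (T p) (Suc e) = x \<odot>\<^sub>M ?h \<oplus>\<^sub>M x [^] Suc e \<odot>\<^sub>M ?t"
        using Suc cl by (simp only: Suc_leD lm_r_distr[OF LM x_closed])
      then have "horner M (T p) (Suc (Suc e)) = T p (Suc e) \<oplus>\<^sub>M (x \<odot>\<^sub>M ?h \<oplus>\<^sub>M x [^] Suc e \<odot>\<^sub>M ?t)"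
        by (simp only: horner.simps)
      also have "... = (T p (Suc e) \<oplus>\<^sub>M x \<odot>\<^sub>M ?h) \<oplus>\<^sub>M x [^] Suc e \<odot>\<^sub>M ?t"
        using cl aM[OF x_closed] aM[of "x [^] Suc e" ?t] by (simp only: M.a_assoc R.nat_pow_closed x_closed)
      also have "T p (Suc e) = T (x \<odot>\<^sub>P p) e" using T_x[OF p] Suc.prems by simp
      finally show ?case by (simp only: horner.simps)
    qed
    from this[of "k - 1"] have h: "horner M (T p) k = horner M (T (x \<odot>\<^sub>P p)) (k - 1) \<oplus>\<^sub>M x [^] (k - 1) \<odot>\<^sub>M T p 0"
      using kk by simp
    let ?h = "horner M (T (x \<odot>\<^sub>P p)) (k - 1)"
    have cl: "?h \<in> carrier M" "T p 0 \<in> carrier M" using hc[of "x \<odot>\<^sub>P p" "k - 1"] aP[OF x_closed p] TM[OF p] k_pos by auto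
    have "x \<otimes> x [^] (k - 1) = y [^] (n - k)"
      using R.nat_pow_Suc2[OF x_closed, of "k - 1"] kk x_pow_k by simp
    then have "x \<odot>\<^sub>M (x [^] (k - 1) \<odot>\<^sub>M T p 0) = y [^] (n - k) \<odot>\<^sub>M T p 0"
      using cl by (simp add: lm_assoc[OF LM, symmetric])
    then have "x \<odot>\<^sub>M horner M (T p) k = x \<odot>\<^sub>M ?h \<oplus>\<^sub>M T (x \<odot>\<^sub>P p) (k - 1)"
      unfolding h T_top[OF p] using cl aM by (simp add: lm_r_distr[OF LM])
    also have "... = T (x \<odot>\<^sub>P p) (k - 1) \<oplus>\<^sub>M x \<odot>\<^sub>M ?h"
      using cl aM TM[OF aP[OF x_closed p], of "k - 1"] k_pos by (intro M.a_comm) auto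
    also have "... = horner M (T (x \<odot>\<^sub>P p)) k" by (subst (5) kk) (simp only: horner.simps)
    finally show "pi (x \<odot>\<^sub>P p) = x \<odot>\<^sub>M pi p" using p aP by (simp add: pi_def)
    fix j assume j: "j < n"
    \<comment> \<open>After \<open>e\<close> steps the partial value is still to be multiplied by
      \<open>x^(k - e)\<close>, so \<open>E j\<close> acts on it as the \<open>E i\<close> from
      which \<open>x^(k - e)\<close> leads to \<open>j\<close>.\<close>
    have "e \<le> k ==> i < n ==> wend n (replicate (k - e) True) i = j ==>
        horner M (T (E j \<odot>\<^sub>P p)) e = E i \<odot>\<^sub>M horner M (T p) e" for e i
    proof (induction e arbitrary: i)
      case 0 then show ?case by (simp add: lm_zero_r[OF LM])
    next
      case (Suc e)
      obtain i' where i': "i' < n" "stp n True i' = i" using wend_surj[OF Suc.prems(2), of "[True]"] by auto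
      have "replicate (k - e) True = True # replicate (k - Suc e) True"
        using Suc.prems(1) by (simp add: Suc_diff_Suc flip: replicate_Suc)
      then have "wend n (replicate (k - e) True) i' = j" using i' Suc.prems(3) by simp
      then have ih: "horner M (T (E j \<odot>\<^sub>P p)) e = E i' \<odot>\<^sub>M horner M (T p) e" using Suc i' by simp
      have te: "T (E j \<odot>\<^sub>P p) e = E i \<odot>\<^sub>M T p e"
        using induced_E[OF I p Suc.prems(2), of e] Suc.prems by simp
      have "x \<odot>\<^sub>M (E i' \<odot>\<^sub>M horner M (T p) e) = E i \<odot>\<^sub>M (x \<odot>\<^sub>M horner M (T p) e)"
        using hc[OF p, of e] x_E[OF i'(1)] i'(2) Suc.prems by (simp add: lm_assoc[OF LM, symmetric])
      then show ?case
        using hc[OF p, of e] TM[OF p, of e] aM Suc.prems by (simp add: ih te lm_r_distr[OF LM])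
    qed
    from this[of k j] show "pi (E j \<odot>\<^sub>P p) = E j \<odot>\<^sub>M pi p" using j p aP by (simp add: pi_def)
  qed (use hc in \<open>auto simp: pi_def\<close>)
  have pi_onto: "pi ` carrier P = carrier M"
  proof (intro equalityI subsetI)
    fix m assume m: "m \<in> carrier M"
    \<comment> \<open>The element \<open>1 \<otimes> m\<close>, as component \<open>k - 1\<close>
      belongs to \<open>x^0\<close>.\<close>
    have "\<exists>p. p \<in> carrier P \<and> (\<forall>e<k. T p e = (if e = k - 1 then m else \<zero>\<^sub>M))"
      using m by (intro induced_surj[OF I]) auto
    then obtain p where p: "p \<in> carrier P" "\<forall>e<k. T p e = (if e = k - 1 then m else \<zero>\<^sub>M)" by blast
    have z: "e \<le> k - 1 ==> horner M (T p) e = \<zero>\<^sub>M" for e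
      by (induction e) (use p(2) in \<open>auto simp: lm_zero_r[OF LM]\<close>)
    then have "horner M (T p) (Suc (k - 1)) = m" using p(2) m k_pos unfolding horner.simps z[OF order_refl] by (simp add: lm_zero_r[OF LM])
    then show "m \<in> pi ` carrier P" using p(1) kk by (intro image_eqI[of _ _ p]) (simp_all add: pi_def)
  qed (use Hom_closed[OF pi] in auto)

  \<comment> \<open>The map \<open>x \<otimes> 1 - 1 \<otimes> x\<close>: the first term is the
    action of \<open>x\<close> on \<open>P\<close>, the second acts on the components in
    \<open>M\<close>.\<close>
  have "\<exists>p. p \<in> carrier P \<and> (\<forall>e<k. T p e = T (x \<odot>\<^sub>P q) e \<ominus>\<^bsub>M\<^esub> x \<odot>\<^sub>M T q e)" if q: "q \<in> carrier P" for q
    using TM[OF q] TM[OF aP[OF x_closed q]] aM by (intro induced_surj[OF I]) auto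
  then obtain ph where ph: "\<And>q. q \<in> carrier P ==> ph q \<in> carrier P"
    "\<And>q e. q \<in> carrier P ==> e < k ==> T (ph q) e = T (x \<odot>\<^sub>P q) e \<ominus>\<^bsub>M\<^esub> x \<odot>\<^sub>M T q e" by metis
  define phi where "phi = (\<lambda>q\<in>carrier P. ph q)"
  have phP: "phi q \<in> carrier P" if "q \<in> carrier P" for q using ph(1) that by (simp add: phi_def)
  have T_phi: "T (phi q) e = T (x \<odot>\<^sub>P q) e \<ominus>\<^bsub>M\<^esub> x \<odot>\<^sub>M T q e" if "q \<in> carrier P" "e < k" for q e
    using ph(2) that by (simp add: phi_def)
  have xP: "x \<odot>\<^sub>P q \<in> carrier P" if "q \<in> carrier P" for q by (rule aP[OF x_closed that])
  \<comment> \<open>Both terms raise the vertex by one and are linear only up to \<open>sig\<close>,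
    as in \<open>x r = sig(r) x\<close>; the twist of the target absorbs this.\<close>
  have phi: "phi \<in> Hom R P (tw 1 P)"
  proof (rule tiled_HomI[OF LP tw_module[OF LP] CM_torsion_sep[OF CM_tw[OF P]]])
    fix p q assume pq: "p \<in> carrier P" "q \<in> carrier P"
    have "phi (p \<oplus>\<^sub>P q) = phi p \<oplus>\<^sub>P phi q"
    proof (rule T_inj)
      fix e assume e: "e < k"
      have "T (x \<odot>\<^sub>P (p \<oplus>\<^sub>P q)) e = T (x \<odot>\<^sub>P p) e \<oplus>\<^sub>M T (x \<odot>\<^sub>P q) e"
        using pq xP e by (simp add: lm_r_distr[OF LP] T_add)
      then show "T (phi (p \<oplus>\<^sub>P q)) e = T (phi p \<oplus>\<^sub>P phi q) e"
        using pq e phP TM xP aM[OF x_closed]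
        by (simp add: T_phi T_add lm_r_distr[OF LM] M.minus_eq M.minus_add M.a_ac)
    qed (use pq phP in auto)
    then show "phi (p \<oplus>\<^sub>P q) = phi p \<oplus>\<^bsub>tw 1 P\<^esub> phi q" by simp
  next
    fix c p assume p: "p \<in> carrier P"
    have gen: "phi (a \<odot>\<^sub>P p) = b \<odot>\<^sub>P phi p"
      if ab: "a \<in> carrier R" "b \<in> carrier R" "x \<otimes> a = b \<otimes> x" and
        Ta: "\<And>q e. q \<in> carrier P ==> e < k ==> \<exists>s\<in>carrier R. \<exists>s'\<in>carrier R. T (a \<odot>\<^sub>P q) e = s \<odot>\<^sub>M T q e \<and> x \<otimes> s = s' \<otimes> x \<and>
          (\<forall>q'\<in>carrier P. T (b \<odot>\<^sub>P q') e = s' \<odot>\<^sub>M T q' e)" for a b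
    proof (rule T_inj)
      fix e assume e: "e < k"
      obtain s s' where s: "s \<in> carrier R" "s' \<in> carrier R" "T (a \<odot>\<^sub>P p) e = s \<odot>\<^sub>M T p e" "x \<otimes> s = s' \<otimes> x"
        "\<And>q'. q' \<in> carrier P ==> T (b \<odot>\<^sub>P q') e = s' \<odot>\<^sub>M T q' e" using Ta[OF p e] by blast
      have "x \<odot>\<^sub>P (a \<odot>\<^sub>P p) = b \<odot>\<^sub>P (x \<odot>\<^sub>P p)" using ab p by (simp add: lm_assoc[OF LP, symmetric])
      moreover have "x \<odot>\<^sub>M (s \<odot>\<^sub>M T p e) = s' \<odot>\<^sub>M (x \<odot>\<^sub>M T p e)"
        using s TM[OF p e] by (simp add: lm_assoc[OF LM, symmetric])
      ultimately show "T (phi (a \<odot>\<^sub>P p)) e = T (b \<odot>\<^sub>P phi p) e"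
        using p e s phP[OF p] xP[OF p] aP[OF ab(1) p] TM aM[OF x_closed]
        by (simp add: T_phi lm_diff_r[OF LM])
    qed (use p phP aP ab in auto)
    have "phi (\<iota> c \<odot>\<^sub>P p) = \<iota> c \<odot>\<^sub>P phi p"
    proof (rule gen)
      show "x \<otimes> \<iota> c = \<iota> c \<otimes> x" using zeta_commute[of x "fps_const c"] by (simp add: iota_zeta)
      then show "\<exists>s\<in>carrier R. \<exists>s'\<in>carrier R. T (\<iota> c \<odot>\<^sub>P q) e = s \<odot>\<^sub>M T q e \<and> x \<otimes> s = s' \<otimes> x \<and>
          (\<forall>q'\<in>carrier P. T (\<iota> c \<odot>\<^sub>P q') e = s' \<odot>\<^sub>M T q' e)" if "q \<in> carrier P" "e < k" for q e
        using that iota_closed by (intro bexI[of _ "\<iota> c"]) (auto simp: induced_iota[OF I])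
    qed (auto simp: iota_closed)
    then show "phi (\<iota> c \<odot>\<^sub>P p) = \<iota> c \<odot>\<^bsub>tw 1 P\<^esub> phi p" by (simp add: iota_zeta sig_gens)
    have "phi (y \<odot>\<^sub>P p) = y \<odot>\<^sub>P phi p"
    proof (rule gen)
      show "x \<otimes> y = y \<otimes> x" by (rule xy_commute)
      then show "\<exists>s\<in>carrier R. \<exists>s'\<in>carrier R. T (y \<odot>\<^sub>P q) e = s \<odot>\<^sub>M T q e \<and> x \<otimes> s = s' \<otimes> x \<and>
          (\<forall>q'\<in>carrier P. T (y \<odot>\<^sub>P q') e = s' \<odot>\<^sub>M T q' e)" if "q \<in> carrier P" "e < k" for q e
        using that by (intro bexI[of _ y]) (auto simp: induced_y[OF I])
    qed auto
    then show "phi (y \<odot>\<^sub>P p) = y \<odot>\<^bsub>tw 1 P\<^esub> phi p" by (simp add: sig_gens)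
    have "phi (x \<odot>\<^sub>P p) = x \<odot>\<^sub>P phi p"
    proof (rule T_inj)
      fix e assume e: "e < k"
      show "T (phi (x \<odot>\<^sub>P p)) e = T (x \<odot>\<^sub>P phi p) e"
      proof (cases "Suc e < k")
        case True
        then show ?thesis using e p xP phP by (simp add: T_phi T_x)
      next
        case False
        then have ek: "e = k - 1" by (rule last[OF e])
        have "T (phi (x \<odot>\<^sub>P p)) (k - 1) = y [^] (n - k) \<odot>\<^sub>M T (x \<odot>\<^sub>P p) 0 \<ominus>\<^bsub>M\<^esub> x \<odot>\<^sub>M (y [^] (n - k) \<odot>\<^sub>M T p 0)"
          using T_phi[OF xP[OF p], of "k - 1"] T_top[OF p] T_top[OF xP[OF p]] k_pos by simp
        also have "x \<odot>\<^sub>M (y [^] (n - k) \<odot>\<^sub>M T p 0) = y [^] (n - k) \<odot>\<^sub>M (x \<odot>\<^sub>M T p 0)"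
          using TM[OF p k_pos] y_pow_x by (simp add: comm)
        also have "y [^] (n - k) \<odot>\<^sub>M T (x \<odot>\<^sub>P p) 0 \<ominus>\<^bsub>M\<^esub> y [^] (n - k) \<odot>\<^sub>M (x \<odot>\<^sub>M T p 0) = y [^] (n - k) \<odot>\<^sub>M T (phi p) 0"
          using TM[OF p k_pos] TM[OF xP[OF p] k_pos] aM[OF x_closed] p k_pos by (simp add: T_phi lm_diff_r[OF LM])
        also have "... = T (x \<odot>\<^sub>P phi p) (k - 1)" using T_top[OF phP[OF p]] by simp
        finally show ?thesis unfolding ek .
      qed
    qed (use p xP phP in auto)
    then show "phi (x \<odot>\<^sub>P p) = x \<odot>\<^bsub>tw 1 P\<^esub> phi p" by (simp add: sig_gens)
    fix j assume j: "j < n"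
    have j': "stp n True j < n" using stp_less n_pos by simp
    have "phi (E j \<odot>\<^sub>P p) = E (stp n True j) \<odot>\<^sub>P phi p"
    proof (rule gen)
      show "x \<otimes> E j = E (stp n True j) \<otimes> x" by (rule x_E[OF j])
      fix q e assume q: "q \<in> carrier P" and e: "e < k"
      obtain i where i: "i < n" "wend n (replicate (k - 1 - e) True) i = j" using wend_surj[OF j] by blast
      then have i': "wend n (replicate (k - 1 - e) True) (stp n True i) = stp n True j" "stp n True i < n"
        using wcost_shift(1)[OF i(1) k1 nk] stp_less n_pos by auto
      show "\<exists>s\<in>carrier R. \<exists>s'\<in>carrier R. T (E j \<odot>\<^sub>P q) e = s \<odot>\<^sub>M T q e \<and> x \<otimes> s = s' \<otimes> x \<and>
          (\<forall>q'\<in>carrier P. T (E (stp n True j) \<odot>\<^sub>P q') e = s' \<odot>\<^sub>M T q' e)"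
        using induced_E[OF I q i(1) e] induced_E[OF I _ i'(2) e] i i' x_E[OF i(1)]
        by (intro bexI[of _ "E i"] bexI[of _ "E (stp n True i)"]) auto
    qed auto
    then show "phi (E j \<odot>\<^sub>P p) = E j \<odot>\<^bsub>tw 1 P\<^esub> phi p" using j by (simp add: sig_E)
  qed (use phP in \<open>auto simp: phi_def\<close>)

  define K where "K = P\<lparr>carrier := {p \<in> carrier P. pi p = \<zero>\<^sub>M}\<rparr>"
  have K_simps: "carrier K = {p \<in> carrier P. pi p = \<zero>\<^sub>M}" "add K = add P" "smult K = smult P" "zero K = zero P"
    by (simp_all add: K_def)
  have LK: "left_module R K"
    unfolding K_def
    by (rule submodule_left_module[OF LP])
      (auto simp: Hom_add[OF pi] Hom_smult[OF pi] Hom_zero[OF LP LM pi] lm_zero_r[OF LM] aP)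
  have phi_K: "phi p \<in> carrier K" if p: "p \<in> carrier P" for p
  proof -
    \<comment> \<open>At \<open>e = k\<close> this says
      \<open>pi (phi p) + x pi(p) = pi (x p)\<close>, so \<open>pi (phi p) = 0\<close> by linearity
      of \<open>pi\<close>.\<close>
    have "e \<le> k ==> horner M (T (phi p)) e \<oplus>\<^sub>M x \<odot>\<^sub>M horner M (T p) e = horner M (T (x \<odot>\<^sub>P p)) e" for e
    proof (induction e)
      case 0 then show ?case by (simp add: lm_zero_r[OF LM])
    next
      case (Suc e)
      let ?a = "horner M (T (phi p)) e" and ?b = "horner M (T p) e" and ?t = "T p e" and ?s = "T (x \<odot>\<^sub>P p) e"
      have cl: "?a \<in> carrier M" "?b \<in> carrier M" "?t \<in> carrier M" "?s \<in> carrier M" "x \<odot>\<^sub>M ?t \<in> carrier M"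
          "x \<odot>\<^sub>M ?a \<in> carrier M" "x \<odot>\<^sub>M ?b \<in> carrier M" "x \<odot>\<^sub>M (x \<odot>\<^sub>M ?b) \<in> carrier M"
        using Suc.prems p phP xP hc TM aM by auto
      have ih: "?a \<oplus>\<^sub>M x \<odot>\<^sub>M ?b = horner M (T (x \<odot>\<^sub>P p)) e" using Suc by simp
      have "horner M (T (phi p)) (Suc e) \<oplus>\<^sub>M x \<odot>\<^sub>M horner M (T p) (Suc e) =
          ((?s \<ominus>\<^bsub>M\<^esub> x \<odot>\<^sub>M ?t) \<oplus>\<^sub>M x \<odot>\<^sub>M ?a) \<oplus>\<^sub>M (x \<odot>\<^sub>M ?t \<oplus>\<^sub>M x \<odot>\<^sub>M (x \<odot>\<^sub>M ?b))"
        using T_phi[OF p] Suc.prems cl by (simp add: lm_r_distr[OF LM])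
      also have "... = ?s \<oplus>\<^sub>M ((x \<odot>\<^sub>M ?a \<oplus>\<^sub>M x \<odot>\<^sub>M (x \<odot>\<^sub>M ?b)) \<oplus>\<^sub>M (x \<odot>\<^sub>M ?t \<oplus>\<^sub>M (\<ominus>\<^bsub>M\<^esub> (x \<odot>\<^sub>M ?t))))"
        using cl by (simp only: M.minus_eq M.a_ac M.a_closed M.a_inv_closed)
      also have "... = ?s \<oplus>\<^sub>M (x \<odot>\<^sub>M ?a \<oplus>\<^sub>M x \<odot>\<^sub>M (x \<odot>\<^sub>M ?b))" using cl by (simp add: M.r_neg)
      also have "... = ?s \<oplus>\<^sub>M x \<odot>\<^sub>M (?a \<oplus>\<^sub>M x \<odot>\<^sub>M ?b)" using cl by (simp add: lm_r_distr[OF LM])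
      finally show ?case unfolding ih by simp
    qed
    from this[of k] have "pi (phi p) \<oplus>\<^sub>M x \<odot>\<^sub>M pi p = x \<odot>\<^sub>M pi p"
      using p phP xP Hom_smult[OF pi, of x p] by (simp add: pi_def)
    then have "pi (phi p) = \<zero>\<^sub>M"
      using Hom_closed[OF pi] p phP aM[OF x_closed] by (simp add: M.add.r_cancel_one)
    then show ?thesis using phP[OF p] by (simp add: K_simps)
  qed
  have phi_onto: "phi ` carrier P = carrier K"
  proof (intro equalityI subsetI)
    fix q assume q: "q \<in> carrier K"
    then have qP: "q \<in> carrier P" and qz: "horner M (T q) k = \<zero>\<^sub>M" by (auto simp: K_simps pi_def)
    \<comment> \<open>Synthetic division by \<open>X - x\<close>: the partial values of Horner's
      scheme are the coefficients of the quotient, and the remainder \<open>horner M (T q) k\<close>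
      is 0 on the kernel.\<close>
    obtain p where p: "p \<in> carrier P" "\<forall>e<k. T p e = horner M (T q) e"
      using induced_surj[OF I, of "horner M (T q)"] hc[OF qP less_imp_le] by blast
    have "phi p = q"
    proof (rule T_inj)
      fix e assume e: "e < k"
      let ?h = "horner M (T q) e"
      have cl: "?h \<in> carrier M" "T q e \<in> carrier M" "x \<odot>\<^sub>M ?h \<in> carrier M" using hc[OF qP] TM[OF qP] e aM by auto
      have "T (x \<odot>\<^sub>P p) e = horner M (T q) (Suc e)"
      proof (cases "Suc e < k")
        case True then show ?thesis using T_x[OF p(1) True] p(2) by simp
      next
        case False
        have "T (x \<odot>\<^sub>P p) (k - 1) = \<zero>\<^sub>M" using T_top[OF p(1)] p(2) k_pos by (simp add: lm_zero_r[OF LM])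
        moreover have "Suc e = k" using False e by simp
        ultimately show ?thesis using qz last[OF e False] by simp
      qed
      then have "T (phi p) e = (T q e \<oplus>\<^sub>M x \<odot>\<^sub>M ?h) \<ominus>\<^bsub>M\<^esub> x \<odot>\<^sub>M ?h" using T_phi[OF p(1) e] p(2) e by simp
      also have "... = T q e" using cl by (simp add: M.minus_eq M.a_assoc M.r_neg)
      finally show "T (phi p) e = T q e" .
    qed (use p qP phP in auto)
    then show "q \<in> phi ` carrier P" using p(1) by blast
  qed (use phi_K in auto)
  have phi': "phi \<in> Hom R P (tw 1 K)"
    using phi phi_K unfolding Hom_def by (auto simp: K_simps PiE_iff)
  define inc where "inc = (\<lambda>p\<in>carrier K. p)"
  have inc: "inc \<in> Hom R K P"
  proof -
    interpret K: abelian_group K by (rule lm_grp[OF LK])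
    show ?thesis
    proof (rule HomI)
      fix a b assume "a \<in> carrier K" "b \<in> carrier K"
      then show "inc (a \<oplus>\<^sub>K b) = inc a \<oplus>\<^sub>P inc b" using K.a_closed[of a b] by (simp add: inc_def K_simps(2))
    next
      fix r a assume "r \<in> carrier R" "a \<in> carrier K"
      then show "inc (r \<odot>\<^sub>K a) = r \<odot>\<^sub>P inc a" using lm_closed[OF LK, of r a] by (simp add: inc_def K_simps(3))
    qed (auto simp: inc_def K_simps(1))
  qed
  have inj: "inj_on inc (carrier K)" by (simp add: inc_def inj_on_def)
  \<comment> \<open>Finite generation of the kernel comes from the surjection \<open>phi\<close>,
    made linear by the twist \<open>n - 1\<close>, which undoes the twist of its target.\<close>
  have K: "K \<in> CM R"
  proof (rule CM_quotient[OF CM_tw[OF P] LK])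
    show "torsion_sep K" by (rule torsion_sep_inj[OF LK LP CM_torsion_sep[OF P] inc inj])
    have "phi \<in> Hom R (tw (n - 1) P) (tw (n - 1) (tw 1 K))" using phi' by (simp only: Hom_tw)
    moreover have "tw (n - 1) (tw 1 K) = tw (n * 1) K" using n_pos by (simp add: tw_tw)
    ultimately show "phi \<in> Hom R (tw (n - 1) P) K" by (simp only: Hom_tw_n)
    show "phi ` carrier (tw (n - 1) P) = carrier K" using phi_onto by simp
  qed
  have "syz_seq R M K P inc pi"
    unfolding syz_seq_def using K P prj inc pi inj pi_onto by (auto simp: inc_def K_simps(1))
  then have syz1: "is_syzygy R M K" using is_syzygy_seq by blast

  have "\<exists>p. p \<in> carrier P \<and> (\<forall>e<k. T p e = x [^] e \<odot>\<^sub>M m)" if m: "m \<in> carrier M" for m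
    using aM m by (intro induced_surj[OF I]) auto
  then obtain i0 where i0: "\<And>m. m \<in> carrier M ==> i0 m \<in> carrier P"
    "\<And>m e. m \<in> carrier M ==> e < k ==> T (i0 m) e = x [^] e \<odot>\<^sub>M m" by metis
  define io where "io = (\<lambda>m\<in>carrier M. i0 m)"
  have ioP: "io m \<in> carrier P" if "m \<in> carrier M" for m using i0(1) that by (simp add: io_def)
  have T_io: "T (io m) e = x [^] e \<odot>\<^sub>M m" if "m \<in> carrier M" "e < k" for m e using i0(2) that by (simp add: io_def)
  have x_Suc: "x \<odot>\<^sub>M (x [^] (e :: nat) \<odot>\<^sub>M m) = x [^] Suc e \<odot>\<^sub>M m" if "m \<in> carrier M" for m e
    using that R.nat_pow_Suc2[OF x_closed, of e] by (simp add: lm_assoc[OF LM, symmetric])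
  \<comment> \<open>On the image of \<open>io\<close> the operators \<open>x \<otimes> 1\<close> and
    \<open>1 \<otimes> x\<close> agree; at the top component this is the relation
    \<open>x^k = y^(n - k)\<close>.\<close>
  have T_x_io: "T (x \<odot>\<^sub>P io m) e = x \<odot>\<^sub>M T (io m) e" if m: "m \<in> carrier M" and e: "e < k" for m e
  proof (cases "Suc e < k")
    case True
    then show ?thesis using T_x[OF ioP[OF m] True] T_io[OF m] e x_Suc[OF m] by simp
  next
    case False
    have ek: "e = k - 1" by (rule last[OF e False])
    have "T (x \<odot>\<^sub>P io m) (k - 1) = x [^] k \<odot>\<^sub>M m"
      using T_top[OF ioP[OF m]] T_io[OF m k_pos] m by (simp add: x_pow_k lm_one[OF LM])
    also have "... = x \<odot>\<^sub>M T (io m) (k - 1)" using T_io[OF m, of "k - 1"] k_pos x_Suc[OF m, of "k - 1"] by simp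
    finally show ?thesis unfolding ek .
  qed
  \<comment> \<open>Each term \<open>x^(k - 1 - e) \<otimes> x^e m\<close> lies \<open>k - 1\<close>
    steps ahead of \<open>m\<close>, hence the twist.\<close>
  have io: "io \<in> Hom R M (tw (k - 1) P)"
  proof (rule tiled_HomI[OF LM tw_module[OF LP] CM_torsion_sep[OF CM_tw[OF P]]])
    fix m m' assume m: "m \<in> carrier M" "m' \<in> carrier M"
    have "io (m \<oplus>\<^sub>M m') = io m \<oplus>\<^sub>P io m'"
      by (rule T_inj) (use m ioP in \<open>auto simp: T_io T_add lm_r_distr[OF LM]\<close>)
    then show "io (m \<oplus>\<^sub>M m') = io m \<oplus>\<^bsub>tw (k - 1) P\<^esub> io m'" by simp
  next
    fix c m assume m: "m \<in> carrier M"
    have lin: "io (a \<odot>\<^sub>M m) = a \<odot>\<^sub>P io m"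
      if a: "a \<in> carrier R" "\<And>e :: nat. x [^] e \<otimes> a = a \<otimes> x [^] e" and Ta: "\<And>e. e < k ==> T (a \<odot>\<^sub>P io m) e = a \<odot>\<^sub>M T (io m) e" for a
    proof (rule T_inj)
      fix e assume e: "e < k"
      have "T (io (a \<odot>\<^sub>M m)) e = (x [^] e \<otimes> a) \<odot>\<^sub>M m"
        unfolding T_io[OF aM[OF a(1) m] e] by (rule lm_assoc[OF LM _ a(1) m, symmetric]) simp
      also have "... = a \<odot>\<^sub>M (x [^] e \<odot>\<^sub>M m)" unfolding a(2) by (rule lm_assoc[OF LM a(1) _ m]) simp
      finally show "T (io (a \<odot>\<^sub>M m)) e = T (a \<odot>\<^sub>P io m) e" by (simp only: Ta[OF e] T_io[OF m e])
    qed (use ioP aP aM a(1) m in auto)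
    have "io (\<iota> c \<odot>\<^sub>M m) = \<iota> c \<odot>\<^sub>P io m"
      using zeta_commute[of "x [^] (_ :: nat)" "fps_const c"] induced_iota[OF I ioP[OF m]]
      by (intro lin) (simp_all add: iota_zeta)
    then show "io (\<iota> c \<odot>\<^sub>M m) = \<iota> c \<odot>\<^bsub>tw (k - 1) P\<^esub> io m" by (simp add: iota_zeta sig_pow_gens)
    have yx: "x [^] e \<otimes> y = y \<otimes> x [^] (e :: nat)" for e
      by (rule R.group_commutes_pow) (simp_all add: xy_commute)
    have "io (y \<odot>\<^sub>M m) = y \<odot>\<^sub>P io m"
      using yx induced_y[OF I ioP[OF m]] by (intro lin) simp_all
    then show "io (y \<odot>\<^sub>M m) = y \<odot>\<^bsub>tw (k - 1) P\<^esub> io m" by (simp add: sig_pow_gens)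
    have "io (x \<odot>\<^sub>M m) = x \<odot>\<^sub>P io m"
    proof (rule T_inj)
      fix e assume e: "e < k"
      have "T (io (x \<odot>\<^sub>M m)) e = (x [^] e \<otimes> x) \<odot>\<^sub>M m" using m e aM by (simp add: T_io lm_assoc[OF LM])
      also have "... = T (x \<odot>\<^sub>P io m) e" using T_x_io[OF m e] T_io[OF m e] x_Suc[OF m, of e] by simp
      finally show "T (io (x \<odot>\<^sub>M m)) e = T (x \<odot>\<^sub>P io m) e" .
    qed (use m ioP aP aM in auto)
    then show "io (x \<odot>\<^sub>M m) = x \<odot>\<^bsub>tw (k - 1) P\<^esub> io m" by (simp add: sig_pow_gens)
    fix j assume j: "j < n"
    have "io (E j \<odot>\<^sub>M m) = E (wend n (replicate (k - 1) True) j) \<odot>\<^sub>P io m"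
    proof (rule T_inj)
      fix e assume e: "e < k"
      let ?i = "wend n (replicate e True) j"
      have i: "?i < n" using j by (rule wend_less)
      have "replicate (k - 1) True = replicate e True @ replicate (k - 1 - e) True"
        using e by (simp flip: replicate_add)
      then have "wend n (replicate (k - 1) True) j = wend n (replicate (k - 1 - e) True) ?i" by simp
      then have "T (E (wend n (replicate (k - 1) True) j) \<odot>\<^sub>P io m) e = E ?i \<odot>\<^sub>M (x [^] e \<odot>\<^sub>M m)"
        using induced_E[OF I ioP[OF m] i e] T_io[OF m e] by simp
      also have "... = T (io (E j \<odot>\<^sub>M m)) e"
        using m e aM x_pow_E[OF j, of e] by (simp add: T_io lm_assoc[OF LM, symmetric])
      finally show "T (io (E j \<odot>\<^sub>M m)) e = T (E (wend n (replicate (k - 1) True) j) \<odot>\<^sub>P io m) e" ..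
    qed (use m ioP aP aM in auto)
    then show "io (E j \<odot>\<^sub>M m) = E j \<odot>\<^bsub>tw (k - 1) P\<^esub> io m" using j by (simp add: sig_pow_E)
  qed (use ioP in \<open>auto simp: io_def\<close>)
  have io_inj: "inj_on io (carrier M)"
  proof (rule inj_on_inverseI)
    fix m assume m: "m \<in> carrier M"
    show "T (io m) 0 = m" unfolding T_io[OF m k_pos] using m by (simp add: lm_one[OF LM])
  qed
  have ker: "io ` carrier M = {p \<in> carrier P. phi p = \<zero>\<^sub>P}"
  proof (intro equalityI subsetI)
    fix p assume "p \<in> io ` carrier M"
    then obtain m where m: "m \<in> carrier M" "p = io m" by blast
    have "phi (io m) = \<zero>\<^sub>P"
    proof (rule T_inj)
      fix e assume e: "e < k"
      have "T (phi (io m)) e = x \<odot>\<^sub>M T (io m) e \<ominus>\<^bsub>M\<^esub> x \<odot>\<^sub>M T (io m) e"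
        using T_phi[OF ioP[OF m(1)] e] T_x_io[OF m(1) e] by simp
      also have "... = \<zero>\<^sub>M" using TM[OF ioP[OF m(1)] e] aM by (simp add: M.minus_eq M.r_neg)
      finally show "T (phi (io m)) e = T \<zero>\<^sub>P e" using T0[OF e] by simp
    qed (use phP ioP m in auto)
    then show "p \<in> {p \<in> carrier P. phi p = \<zero>\<^sub>P}" using m ioP by simp
  next
    fix p assume "p \<in> {p \<in> carrier P. phi p = \<zero>\<^sub>P}"
    then have p: "p \<in> carrier P" "phi p = \<zero>\<^sub>P" by auto
    have step: "T (x \<odot>\<^sub>P p) e = x \<odot>\<^sub>M T p e" if e: "e < k" for e
      using T_phi[OF p(1) e] T0[OF e] p(2) TM[OF p(1) e] TM[OF xP[OF p(1)] e] aM[OF x_closed] M.diff_eq_zero_iff by metis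
    let ?m = "T p 0"
    have m: "?m \<in> carrier M" by (rule TM[OF p(1) k_pos])
    \<comment> \<open>On the kernel of \<open>phi\<close> each component is \<open>x\<close> times
      the preceding one, so the element is determined by component 0.\<close>
    have tp: "e < k ==> T p e = x [^] e \<odot>\<^sub>M ?m" for e
    proof (induction e)
      case 0 show ?case using m by (simp add: lm_one[OF LM])
    next
      case (Suc e)
      then show ?case using T_x[OF p(1) Suc.prems] step[of e] x_Suc[OF m, of e] by simp
    qed
    have "p = io ?m"
    proof (rule T_inj[OF p(1) ioP[OF m]])
      fix e assume e: "e < k"
      show "T p e = T (io ?m) e" unfolding T_io[OF m e] by (rule tp[OF e])
    qed
    then show "p \<in> io ` carrier M" using m by blast
  qed
  have "phi \<in> Hom R (tw (k - 1) P) (tw (k - 1) (tw 1 K))" using phi' by (simp only: Hom_tw)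
  \<comment> \<open>The twist \<open>k - 1\<close> of the source and the one of \<open>phi\<close>
    add up to \<open>k\<close>, which is the twist of \<open>K\<close> in the claim.\<close>
  then have "phi \<in> Hom R (tw (k - 1) P) (tw k K)" using kk by (simp add: tw_tw)
  then have "syz_seq R (tw k K) M (tw (k - 1) P) io phi"
    unfolding syz_seq_def using M io io_inj phi_onto ker CM_tw[OF P, of "k - 1"] projective_tw[OF prj, of "k - 1"]
    by (simp add: K_simps(4))
  then have "is_syzygy R (tw k K) M" using is_syzygy_seq by blast
  then show ?thesis using syz1 by blast
qed

lemma is_syzygy_CM: "is_syzygy R M K ==> K \<in> CM R"
  by (simp add: is_syzygy_def)

text \<open>One double step: with \<open>K\<close> a syzygy of \<open>N\<close>, the Serre dual of
  \<open>K\<close> is \<open>tw k K\<close>; a syzygy of the latter is \<open>N\<close> itself by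
  \<open>koszul\<close>, and its Serre dual is \<open>tw k N\<close>. All twists by
  \<open>q * k\<close> are carried along.\<close>

lemma tau_pow_tw:
  fixes N :: "'r fmodule"
  assumes N: "N \<in> CM R" and MN: "stably_iso R M N"
  shows "is_tau_pow R \<iota> M (2 * q) (tw (q * k) N)"
proof (induction q)
  case 0
  have "tw 0 N = N" by (simp add: tw_def)
  then show ?case using N MN by simp
next
  case (Suc q)
  obtain K where K: "is_syzygy R N K" "is_syzygy R (tw k K) N" using koszul[OF N] by blast
  have "is_serre R \<iota> (tw (q * k) K) (tw k (tw (q * k) K))"
    by (rule is_serre_tw[OF CM_tw[OF is_syzygy_CM[OF K(1)]]])
  then have t1: "is_tau R \<iota> (tw (q * k) N) (tw (q * k) (tw k K))"
    using is_syzygy_tw[OF K(1), of "q * k"] unfolding is_tau_def by (auto simp: tw_tw add.commute)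
  have "is_serre R \<iota> (tw (q * k) N) (tw k (tw (q * k) N))" by (rule is_serre_tw[OF CM_tw[OF N]])
  then have t2: "is_tau R \<iota> (tw (q * k) (tw k K)) (tw (Suc q * k) N)"
    using is_syzygy_tw[OF K(2), of "q * k"] unfolding is_tau_def by (auto simp: tw_tw)
  have "2 * Suc q = Suc (Suc (2 * q))" by simp
  then show ?case using Suc t1 t2 by auto
qed

lemma tau_periodic_dvd:
  assumes M: "M \<in> CM R"
  shows "\<exists>d. tau_periodic R \<iota> M d \<and> d dvd 2 * (lcm n k div k)"
proof (rule tau_periodicI[OF M])
  fix L :: "'r fmodule" assume L: "L \<in> CM R"
  then obtain K where K: "is_syzygy R L K" using koszul by blast
  then show "\<exists>N. is_tau R \<iota> L N" using is_serre_tw[OF is_syzygy_CM[OF K]] unfolding is_tau_def by blast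
next
  let ?q = "lcm n k div k"
  have qk: "?q * k = lcm n k" by simp
  have "0 < lcm n k" using n_pos k_pos by (simp add: lcm_pos_nat)
  then have "?q \<noteq> 0" using qk by (metis mult_0 less_irrefl)
  then show "1 \<le> 2 * ?q" by simp
  have LM: "left_module R M" by (rule CM_module[OF M])
  obtain N :: "'r fmodule" and f g where N: "N \<in> CM R" and fg: "lm_iso R M N f g" using fmodule_copy[OF M] by blast
  have LN: "left_module R N" by (rule CM_module[OF N])
  have MN: "stably_iso R M N" by (rule stably_iso_lm_iso[OF LM LN fg])
  obtain c where c: "lcm n k = n * c" using dvd_lcm1[of n k] by (auto simp: dvd_def)
  have "stably_iso R (tw (?q * k) N) N" using stably_iso_tw_n[OF LN, of c] by (simp only: trans[OF qk c])
  then have "stably_iso R (tw (?q * k) N) M"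
    by (rule stably_iso_trans[OF tw_module[OF LN] LN LM _ stably_iso_sym[OF MN]])
  then show "tau_pow_fixes R \<iota> M (2 * ?q)" using tau_pow_tw[OF N MN] unfolding tau_pow_fixes_def by blast
qed

end

theorem proposition3p15:
  fixes k n :: nat and M :: "((path \<Rightarrow> complex) set, 'm) module"
  assumes "1 < k" and "real k \<le> real n / 2"
    and "M \<in> CM (B_algebra k n)"
  shows "\<exists>d. tau_periodic (B_algebra k n) (B_scalar k n) M d \<and> d dvd 2 * (lcm n k div k)"
proof -
  have "2 * k \<le> n" using assms(2) by linarith
  then interpret tiled "B_algebra k n" n k "bmat k n" "B_scalar k n" "\<lambda>p. bcoset k n (ypath n p)"
    using assms(1) by (intro tiled_B_algebra)
  show ?thesis by (rule tau_periodic_dvd[OF assms(3)])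
qed

end
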